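(* The classifying space of $\Gamma_\tau$ has a realization as the finite square complex $$S_{\Gamma_\tau}=\Gamma_\tau\backslash(T_{q+1}\times T_{q+1})$$ with the following explicit description. (1) Vertices: there is only one vertex. (2) Edges: there is a vertical oriented edge $a_\xi$ for every $\xi\in\mathbb{F}_q[Z]$ of norm $N(\xi)=-c$, and a horizontal oriented edge $b_\lambda$ for every $\lambda\in\mathbb{F}_q[Z]$ of norm $N(\lambda)=\frac{c\tau}{1-\tau}$. The orientation reversion map is $a_\xi\mapsto a_{-\xi}$ and $b_\lambda\mapsto b_{-\lambda}$. (3) Squares: for every pair $a_\xi$, $b_\lambda$ of an oriented vertical and an oriented horizontal edge there is a square in $S_{\Gamma_\tau}$ in which the path $a_\xi$ followed by $b_{\sigma_\xi(\lambda)}$ and the path $b_\lambda$ followed by $a_{\sigma_\lambda(\xi)}$ have the same start and end corner and together form the boundary of the square. Each square is constructed in this way four times, but occurs in $S_{\Gamma_\tau}$ only once.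
   Context: $q$ is a power of an odd prime $p$, $c\in\mathbb{F}_q^\ast$ a non-square, $\tau\in\mathbb{F}_q^\ast\setminus\{1\}$, $K=\mathbb{F}_q(t)$, $D=K\{Z,F\}/(Z^2=c,\ F^2=t(t-1),\ ZF=-FZ)$. $\mathbb{F}_q[Z]\subset D$ is a field with $q^2$ elements; $\bar w=w^q$, $N(w)=w\bar w$. For $\xi\in\mathbb{F}_q[Z]$ put $\gamma_\xi=tZ+\xi F$. For $N(\xi)=-c$ let $a_\xi$, and for $N(\eta)=\frac{c\tau}{1-\tau}$ let $b_\eta$, be the image of $\gamma_\xi Z$, resp. $\gamma_\eta Z$, in $D^\ast/K^\ast$; $\Gamma_\tau\subset D^\ast/K^\ast$ is the subgroup generated by all $a_\xi,b_\eta$. $\sigma_\xi(w)=\bar w\cdot\dfrac{w-\xi}{\bar w-\bar\xi}=w^q(w-\xi)^{1-q}$. $D$ splits at $t=\tau$ and $t=\infty$; $\Gamma_\tau$ acts through the embedding $D^\ast/K^\ast\to\mathrm{PGL}_2(K_\tau)\times\mathrm{PGL}_2(K_\infty)$ on the product of the Bruhat–Tits trees at $\tau$ and $\infty$, which is $T_{q+1}\times T_{q+1}$ ($T_n$ being the infinite tree of constant valency $n$). The classifying space of a group $\Gamma$ is a $K(\Gamma,1)$. A square complex is a 2-dimensional complex consisting of a graph with squares attached along closed edge paths of length 4; a square is given by a 4-tuple $(e_1,e_2,e_3,e_4)$ of consecutive oriented edges up to cyclic permutation and simultaneous reversal. The square in (3) is $(a_\xi,b_{\sigma_\xi(\lambda)},a_{\sigma_\lambda(\xi)}^{-1},b_\lambda^{-1})$.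 *)

theory Defs
  imports
    "HOL-Analysis.Analysis"
    "HOL-Computational_Algebra.Fraction_Field"
    "HOL-Computational_Algebra.Formal_Laurent_Series"
    "HOL-Algebra.Generated_Groups"
    "HOL-Algebra.Ring"
begin

section \<open>Square complexes\<close>

text \<open>Graphs are in the sense of Serre: the edges are oriented, and \<open>sc_rev\<close> reverses the
  orientation. \<open>sc_bd X s\<close> is the set of all \<open>4\<close>-tuples that describe the attaching path of
  the square \<open>s\<close>.\<close>

record ('v, 'e, 's) sqcomplex =
  sc_verts :: "'v set"
  sc_edges :: "'e set"
  sc_src :: "'e \<Rightarrow> 'v"
  sc_tgt :: "'e \<Rightarrow> 'v"
  sc_rev :: "'e \<Rightarrow> 'e"
  sc_squares :: "'s set"
  sc_bd :: "'s \<Rightarrow> ('e \<times> 'e \<times> 'e \<times> 'e) set"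

fun dihedral_class :: "('e \<Rightarrow> 'e) \<Rightarrow> 'e \<times> 'e \<times> 'e \<times> 'e \<Rightarrow> ('e \<times> 'e \<times> 'e \<times> 'e) set" where
  "dihedral_class r (a, b, c, d) =
     {(a, b, c, d), (b, c, d, a), (c, d, a, b), (d, a, b, c),
      (r d, r c, r b, r a), (r c, r b, r a, r d), (r b, r a, r d, r c), (r a, r d, r c, r b)}"

fun map4 :: "('e \<Rightarrow> 'f) \<Rightarrow> 'e \<times> 'e \<times> 'e \<times> 'e \<Rightarrow> 'f \<times> 'f \<times> 'f \<times> 'f" where
  "map4 f (a, b, c, d) = (f a, f b, f c, f d)"

fun closed_path4 :: "('v, 'e, 's) sqcomplex \<Rightarrow> 'e \<times> 'e \<times> 'e \<times> 'e \<Rightarrow> bool" where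
  "closed_path4 X (a, b, c, d) \<longleftrightarrow> {a, b, c, d} \<subseteq> sc_edges X \<and>
     sc_tgt X a = sc_src X b \<and> sc_tgt X b = sc_src X c \<and>
     sc_tgt X c = sc_src X d \<and> sc_tgt X d = sc_src X a"

definition square_complex :: "('v, 'e, 's) sqcomplex \<Rightarrow> bool" where
  "square_complex X \<longleftrightarrow>
     (\<forall>e\<in>sc_edges X. sc_src X e \<in> sc_verts X \<and> sc_tgt X e \<in> sc_verts X \<and>
        sc_rev X e \<in> sc_edges X \<and> sc_rev X e \<noteq> e \<and> sc_rev X (sc_rev X e) = e \<and>
        sc_src X (sc_rev X e) = sc_tgt X e \<and> sc_tgt X (sc_rev X e) = sc_src X e) \<and>
     (\<forall>s\<in>sc_squares X. \<exists>p. closed_path4 X p \<and> sc_bd X s = dihedral_class (sc_rev X) p)"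

definition finite_complex :: "('v, 'e, 's) sqcomplex \<Rightarrow> bool" where
  "finite_complex X \<longleftrightarrow> finite (sc_verts X) \<and> finite (sc_edges X) \<and> finite (sc_squares X)"

definition complex_iso ::
  "('v, 'e, 's) sqcomplex \<Rightarrow> ('v', 'e', 's') sqcomplex \<Rightarrow>
   ('v \<Rightarrow> 'v') \<Rightarrow> ('e \<Rightarrow> 'e') \<Rightarrow> ('s \<Rightarrow> 's') \<Rightarrow> bool" where
  "complex_iso X Y fv fe fs \<longleftrightarrow>
     bij_betw fv (sc_verts X) (sc_verts Y) \<and>
     bij_betw fe (sc_edges X) (sc_edges Y) \<and>
     bij_betw fs (sc_squares X) (sc_squares Y) \<and>
     (\<forall>e\<in>sc_edges X. sc_src Y (fe e) = fv (sc_src X e) \<and> sc_tgt Y (fe e) = fv (sc_tgt X e) \<and>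
        sc_rev Y (fe e) = fe (sc_rev X e)) \<and>
     (\<forall>s\<in>sc_squares X. sc_bd Y (fs s) = map4 fe ` sc_bd X s)"

subsection \<open>Quotients by group actions\<close>

definition orbit :: "('g \<Rightarrow> 'x \<Rightarrow> 'x) \<Rightarrow> 'g set \<Rightarrow> 'x \<Rightarrow> 'x set" where
  "orbit act G x = (\<lambda>g. act g x) ` G"

text \<open>Cells of the quotient are orbits of cells. For an orbit \<open>O\<close> of edges the image
  \<open>sc_src X ` O\<close> is again an orbit, by equivariance; likewise for the other structure maps.\<close>

definition quotient_complex ::
  "'g set \<Rightarrow> ('g \<Rightarrow> 'v \<Rightarrow> 'v) \<Rightarrow> ('g \<Rightarrow> 'e \<Rightarrow> 'e) \<Rightarrow> ('g \<Rightarrow> 's \<Rightarrow> 's) \<Rightarrow>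
   ('v, 'e, 's) sqcomplex \<Rightarrow> ('v set, 'e set, 's set) sqcomplex" where
  "quotient_complex G av ae as X =
     \<lparr> sc_verts = orbit av G ` sc_verts X,
       sc_edges = orbit ae G ` sc_edges X,
       sc_src = image (sc_src X),
       sc_tgt = image (sc_tgt X),
       sc_rev = image (sc_rev X),
       sc_squares = orbit as G ` sc_squares X,
       sc_bd = (\<lambda>Q. map4 (orbit ae G) ` (\<Union>s\<in>Q. sc_bd X s)) \<rparr>"

text \<open>The condition under which the above is again a square complex, with the orbit space
  as its underlying space: an element that maps a cell to itself fixes it pointwise.\<close>

definition acts_without_inversion ::
  "'g set \<Rightarrow> ('g \<Rightarrow> 'e \<Rightarrow> 'e) \<Rightarrow> ('v, 'e, 's) sqcomplex \<Rightarrow> bool" where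
  "acts_without_inversion G ae X \<longleftrightarrow>
     (\<forall>g\<in>G. (\<forall>e\<in>sc_edges X. ae g e \<noteq> sc_rev X e) \<and>
        (\<forall>s\<in>sc_squares X. \<forall>p\<in>sc_bd X s. map4 (ae g) p \<in> sc_bd X s \<longrightarrow> map4 (ae g) p = p))"

subsection \<open>Geometric realization\<close>

definition quotient_topology :: "('a \<Rightarrow> 'a \<Rightarrow> bool) \<Rightarrow> 'a topology \<Rightarrow> 'a set topology" where
  "quotient_topology R Y =
     topology (\<lambda>U. U \<subseteq> (\<lambda>x. {y \<in> topspace Y. R x y}) ` topspace Y \<and> openin Y (\<Union>U))"

lemma quotient_map_quotient_topology:
  assumes "equivp R"
  shows "quotient_map Y (quotient_topology R Y) (\<lambda>x. {y \<in> topspace Y. R x y})"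
proof -
  define cl where "cl x = {y \<in> topspace Y. R x y}" for x
  have cl_eq: "cl x = cl y \<longleftrightarrow> R x y" if "y \<in> topspace Y" for x y
    using that assms unfolding cl_def equivp_def by auto
  have mem: "x \<in> cl y \<longleftrightarrow> x \<in> topspace Y \<and> cl x = cl y" if "y \<in> topspace Y" for x y
    using that cl_eq equivp_symp[OF assms] unfolding cl_def by auto
  have same: "A = B" if AB: "A \<in> cl ` topspace Y" "B \<in> cl ` topspace Y" "x \<in> A" "x \<in> B" for A B x
  proof -
    obtain a b where "a \<in> topspace Y" "b \<in> topspace Y" "A = cl a" "B = cl b"
      using AB(1,2) by blast
    then show ?thesis using mem[of a x] mem[of b x] AB(3,4) by simp
  qed
  have "istopology (\<lambda>U. U \<subseteq> cl ` topspace Y \<and> openin Y (\<Union>U))"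
    unfolding istopology_def
  proof (intro conjI allI impI)
    fix S T assume S: "S \<subseteq> cl ` topspace Y \<and> openin Y (\<Union>S)" and T: "T \<subseteq> cl ` topspace Y \<and> openin Y (\<Union>T)"
    have "A = B" if "A \<in> S" "B \<in> T" "x \<in> A" "x \<in> B" for A B x
      by (rule same[of A B x]) (use S T that in blast)+
    then have "\<Union>S \<inter> \<Union>T \<subseteq> \<Union>(S \<inter> T)" by (fast dest: sym)
    then have "\<Union>(S \<inter> T) = \<Union>S \<inter> \<Union>T" by blast
    then show "openin Y (\<Union>(S \<inter> T))"
      using S T openin_Int by metis
    show "S \<inter> T \<subseteq> cl ` topspace Y" using S by blast
  next
    fix \<K> assume K: "\<forall>K\<in>\<K>. K \<subseteq> cl ` topspace Y \<and> openin Y (\<Union>K)"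
    then show "\<Union>\<K> \<subseteq> cl ` topspace Y" by blast
    have "\<Union>(\<Union>\<K>) = (\<Union>K\<in>\<K>. \<Union>K)" by blast
    moreover have "openin Y (\<Union>K\<in>\<K>. \<Union>K)" using K by (intro openin_Union) blast
    ultimately show "openin Y (\<Union>(\<Union>\<K>))" by simp
  qed
  then have op: "openin (quotient_topology R Y) U \<longleftrightarrow> U \<subseteq> cl ` topspace Y \<and> openin Y (\<Union>U)" for U
    unfolding quotient_topology_def cl_def by simp
  have pre: "{x \<in> topspace Y. cl x \<in> U} = \<Union>U" if U: "U \<subseteq> cl ` topspace Y" for U
  proof (intro equalityI subsetI)
    fix x assume "x \<in> {x \<in> topspace Y. cl x \<in> U}"
    then show "x \<in> \<Union>U" using mem[of x x] by blast
  next
    fix x assume "x \<in> \<Union>U"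
    then obtain y where "y \<in> topspace Y" "cl y \<in> U" "x \<in> cl y" using U by blast
    then show "x \<in> {x \<in> topspace Y. cl x \<in> U}" using mem[of y x] by simp
  qed
  have "\<Union>(cl ` topspace Y) = topspace Y"
    using pre[of "cl ` topspace Y"] by auto
  then have "openin (quotient_topology R Y) (cl ` topspace Y)"
    using op by simp
  then have top: "topspace (quotient_topology R Y) = cl ` topspace Y"
    using op[of "topspace (quotient_topology R Y)"] by (simp add: openin_subset subset_antisym)
  have "quotient_map Y (quotient_topology R Y) cl"
    unfolding quotient_map_def top
  proof (intro conjI allI impI refl)
    fix U assume "U \<subseteq> cl ` topspace Y"
    then show "openin Y {x \<in> topspace Y. cl x \<in> U} = openin (quotient_topology R Y) U"
      using pre[of U] op[of U] by simp
  qed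
  then show ?thesis
    unfolding cl_def .
qed

datatype ('v, 'e, 's) cell = VCell 'v | ECell 'e | SCell 's

fun cell_space :: "('v, 'e, 's) cell \<Rightarrow> (real \<times> real) topology" where
  "cell_space (VCell v) = top_of_set {(0, 0)}"
| "cell_space (ECell e) = top_of_set ({0..1} \<times> {0})"
| "cell_space (SCell s) = top_of_set ({0..1} \<times> {0..1})"

definition cells :: "('v, 'e, 's) sqcomplex \<Rightarrow> ('v, 'e, 's) cell set" where
  "cells X = VCell ` sc_verts X \<union> ECell ` sc_edges X \<union> SCell ` sc_squares X"

text \<open>The sides of the unit square, run through counterclockwise from the origin, are glued
  to the four edges of one chosen description of the attaching path.\<close>

inductive glue :: "('v, 'e, 's) sqcomplex \<Rightarrow>
    ('v, 'e, 's) cell \<times> real \<times> real \<Rightarrow> ('v, 'e, 's) cell \<times> real \<times> real \<Rightarrow> bool"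
  for X where
  "e \<in> sc_edges X \<Longrightarrow> glue X (ECell e, 0, 0) (VCell (sc_src X e), 0, 0)"
| "e \<in> sc_edges X \<Longrightarrow> glue X (ECell e, 1, 0) (VCell (sc_tgt X e), 0, 0)"
| "e \<in> sc_edges X \<Longrightarrow> x \<in> {0..1} \<Longrightarrow> glue X (ECell e, x, 0) (ECell (sc_rev X e), 1 - x, 0)"
| "s \<in> sc_squares X \<Longrightarrow> x \<in> {0..1} \<Longrightarrow> (a, b, c, d) = (SOME p. p \<in> sc_bd X s) \<Longrightarrow>
     glue X (SCell s, x, 0) (ECell a, x, 0)"
| "s \<in> sc_squares X \<Longrightarrow> x \<in> {0..1} \<Longrightarrow> (a, b, c, d) = (SOME p. p \<in> sc_bd X s) \<Longrightarrow>
     glue X (SCell s, 1, x) (ECell b, x, 0)"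
| "s \<in> sc_squares X \<Longrightarrow> x \<in> {0..1} \<Longrightarrow> (a, b, c, d) = (SOME p. p \<in> sc_bd X s) \<Longrightarrow>
     glue X (SCell s, 1 - x, 1) (ECell c, x, 0)"
| "s \<in> sc_squares X \<Longrightarrow> x \<in> {0..1} \<Longrightarrow> (a, b, c, d) = (SOME p. p \<in> sc_bd X s) \<Longrightarrow>
     glue X (SCell s, 0, 1 - x) (ECell d, x, 0)"

definition realization ::
  "('v, 'e, 's) sqcomplex \<Rightarrow> (('v, 'e, 's) cell \<times> real \<times> real) set topology" where
  "realization X = quotient_topology (equivclp (glue X)) (sum_topology cell_space (cells X))"

section \<open>Fundamental groups and classifying spaces\<close>

definition loops :: "'a topology \<Rightarrow> 'a \<Rightarrow> (real \<Rightarrow> 'a) set" where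
  "loops X x = {p. pathin X p \<and> p 0 = x \<and> p 1 = x}"

definition loop_class :: "'a topology \<Rightarrow> 'a \<Rightarrow> (real \<Rightarrow> 'a) \<Rightarrow> (real \<Rightarrow> 'a) set" where
  "loop_class X x p =
     {q \<in> loops X x. homotopic_with (\<lambda>h. h 0 = x \<and> h 1 = x) (top_of_set {0..1}) X p q}"

definition loop_concat :: "(real \<Rightarrow> 'a) \<Rightarrow> (real \<Rightarrow> 'a) \<Rightarrow> real \<Rightarrow> 'a" where
  "loop_concat p q s = (if s \<le> 1/2 then p (2 * s) else q (2 * s - 1))"

definition fundamental_group :: "'a topology \<Rightarrow> 'a \<Rightarrow> (real \<Rightarrow> 'a) set monoid" where
  "fundamental_group X x =
     \<lparr> carrier = loop_class X x ` loops X x,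
       monoid.mult = (\<lambda>A B. \<Union>p\<in>A. \<Union>q\<in>B. loop_class X x (loop_concat p q)),
       one = loop_class X x (\<lambda>_. x) \<rparr>"

text \<open>\<open>X\<close> is a \<open>K(G,1)\<close>; the last condition is the vanishing of the higher homotopy groups.\<close>

definition classifying_space :: "('g, 'm) monoid_scheme \<Rightarrow> 'a topology \<Rightarrow> bool" where
  "classifying_space G X \<longleftrightarrow>
     topspace X \<noteq> {} \<and> path_connected_space X \<and>
     (\<forall>x\<in>topspace X. fundamental_group X x \<cong> G) \<and>
     (\<forall>n\<ge>2. \<forall>f. continuous_map (nsphere n) X f \<longrightarrow>
        (\<exists>x\<in>topspace X. homotopic_with (\<lambda>_. True) (nsphere n) X f (\<lambda>_. x)))"

section \<open>Quaternion algebras\<close>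

text \<open>\<open>Quat x0 x1 x2 x3\<close> is \<open>x0 + x1 Z + x2 F + x3 ZF\<close>, where
  \<open>Z\<^sup>2 = a\<close>, \<open>F\<^sup>2 = b\<close> and \<open>ZF = -FZ\<close>.\<close>

datatype 'k quat = Quat 'k 'k 'k 'k

fun qadd :: "'k::field quat \<Rightarrow> 'k quat \<Rightarrow> 'k quat" where
  "qadd (Quat x0 x1 x2 x3) (Quat y0 y1 y2 y3) = Quat (x0 + y0) (x1 + y1) (x2 + y2) (x3 + y3)"

fun qmul :: "'k::field \<Rightarrow> 'k \<Rightarrow> 'k quat \<Rightarrow> 'k quat \<Rightarrow> 'k quat" where
  "qmul a b (Quat x0 x1 x2 x3) (Quat y0 y1 y2 y3) =
     Quat (x0 * y0 + a * x1 * y1 + b * x2 * y2 - a * b * x3 * y3)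
          (x0 * y1 + x1 * y0 - b * x2 * y3 + b * x3 * y2)
          (x0 * y2 + x2 * y0 + a * x1 * y3 - a * x3 * y1)
          (x0 * y3 + x3 * y0 + x1 * y2 - x2 * y1)"

definition quat_algebra :: "'k::field \<Rightarrow> 'k \<Rightarrow> 'k quat ring" where
  "quat_algebra a b =
     \<lparr> carrier = UNIV, monoid.mult = qmul a b, one = Quat 1 0 0 0,
       ring.zero = Quat 0 0 0 0, ring.add = qadd \<rparr>"

abbreviation qscalar :: "'k::field \<Rightarrow> 'k quat" where
  "qscalar x \<equiv> Quat x 0 0 0"

abbreviation qZ :: "'k::field quat" where
  "qZ \<equiv> Quat 0 1 0 0"

abbreviation qF :: "'k::field quat" where
  "qF \<equiv> Quat 0 0 1 0"

lemma quat_algebra_ring: "ring (quat_algebra a b)"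
proof (rule ringI)
  show "abelian_group (quat_algebra a b)"
  proof (rule abelian_groupI)
    fix x assume "x \<in> carrier (quat_algebra a b)"
    show "\<exists>y\<in>carrier (quat_algebra a b). y \<oplus>\<^bsub>quat_algebra a b\<^esub> x = \<zero>\<^bsub>quat_algebra a b\<^esub>"
    proof (cases x)
      case (Quat x0 x1 x2 x3)
      then show ?thesis
        by (intro bexI[of _ "Quat (-x0) (-x1) (-x2) (-x3)"]) (auto simp: quat_algebra_def)
    qed
  next
    fix x y z :: "'a quat"
    show "x \<oplus>\<^bsub>quat_algebra a b\<^esub> y \<oplus>\<^bsub>quat_algebra a b\<^esub> z =
          x \<oplus>\<^bsub>quat_algebra a b\<^esub> (y \<oplus>\<^bsub>quat_algebra a b\<^esub> z)"
      by (cases x; cases y; cases z) (auto simp: quat_algebra_def)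
    show "x \<oplus>\<^bsub>quat_algebra a b\<^esub> y = y \<oplus>\<^bsub>quat_algebra a b\<^esub> x"
      by (cases x; cases y) (auto simp: quat_algebra_def)
    show "\<zero>\<^bsub>quat_algebra a b\<^esub> \<oplus>\<^bsub>quat_algebra a b\<^esub> x = x"
      by (cases x) (auto simp: quat_algebra_def)
  qed (auto simp: quat_algebra_def)
  show "monoid (quat_algebra a b)"
  proof (rule monoidI)
    fix x y z :: "'a quat"
    show "x \<otimes>\<^bsub>quat_algebra a b\<^esub> y \<otimes>\<^bsub>quat_algebra a b\<^esub> z =
          x \<otimes>\<^bsub>quat_algebra a b\<^esub> (y \<otimes>\<^bsub>quat_algebra a b\<^esub> z)"
      by (cases x; cases y; cases z) (simp add: quat_algebra_def algebra_simps)
    show "\<one>\<^bsub>quat_algebra a b\<^esub> \<otimes>\<^bsub>quat_algebra a b\<^esub> x = x"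
      by (cases x) (auto simp: quat_algebra_def)
    show "x \<otimes>\<^bsub>quat_algebra a b\<^esub> \<one>\<^bsub>quat_algebra a b\<^esub> = x"
      by (cases x) (auto simp: quat_algebra_def)
  qed (auto simp: quat_algebra_def)
next
  fix x y z :: "'a quat"
  show "(x \<oplus>\<^bsub>quat_algebra a b\<^esub> y) \<otimes>\<^bsub>quat_algebra a b\<^esub> z =
        x \<otimes>\<^bsub>quat_algebra a b\<^esub> z \<oplus>\<^bsub>quat_algebra a b\<^esub> y \<otimes>\<^bsub>quat_algebra a b\<^esub> z"
    by (cases x; cases y; cases z) (simp add: quat_algebra_def algebra_simps)
  show "z \<otimes>\<^bsub>quat_algebra a b\<^esub> (x \<oplus>\<^bsub>quat_algebra a b\<^esub> y) =
        z \<otimes>\<^bsub>quat_algebra a b\<^esub> x \<oplus>\<^bsub>quat_algebra a b\<^esub> z \<otimes>\<^bsub>quat_algebra a b\<^esub> y"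
    by (cases x; cases y; cases z) (simp add: quat_algebra_def algebra_simps)
qed

section \<open>The group\<close>

text \<open>Throughout, the finite type \<open>'a\<close> is the field with \<open>q\<close> elements.\<close>

type_synonym 'a ratfun = "'a poly fract"

definition rf_const :: "'a::field \<Rightarrow> 'a ratfun" where
  "rf_const x = Fraction_Field.Fract [:x:] 1"

definition rf_t :: "'a::field ratfun" where
  "rf_t = Fraction_Field.Fract [:0, 1:] 1"

definition D_alg :: "'a::field \<Rightarrow> 'a ratfun quat ring" where
  "D_alg c = quat_algebra (rf_const c) (rf_t * (rf_t - 1))"

definition FqZ :: "'a::field ratfun quat set" where
  "FqZ = {Quat (rf_const x) (rf_const y) 0 0 | x y. True}"

definition bar :: "'a::{field, finite} \<Rightarrow> 'a ratfun quat \<Rightarrow> 'a ratfun quat" where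
  "bar c w = w [^]\<^bsub>D_alg c\<^esub> CARD('a)"

definition Nm :: "'a::{field, finite} \<Rightarrow> 'a ratfun quat \<Rightarrow> 'a ratfun quat" where
  "Nm c w = w \<otimes>\<^bsub>D_alg c\<^esub> bar c w"

definition norm_set :: "'a::{field, finite} \<Rightarrow> 'a \<Rightarrow> 'a ratfun quat set" where
  "norm_set c n = {w \<in> FqZ. Nm c w = qscalar (rf_const n)}"

definition sigma ::
  "'a::{field, finite} \<Rightarrow> 'a ratfun quat \<Rightarrow> 'a ratfun quat \<Rightarrow> 'a ratfun quat" where
  "sigma c \<xi> w =
     bar c w \<otimes>\<^bsub>D_alg c\<^esub> (w \<ominus>\<^bsub>D_alg c\<^esub> \<xi>) \<otimes>\<^bsub>D_alg c\<^esub>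
       inv\<^bsub>D_alg c\<^esub> (bar c w \<ominus>\<^bsub>D_alg c\<^esub> bar c \<xi>)"

definition PD :: "'a::field \<Rightarrow> 'a ratfun quat set monoid" where
  "PD c = units_of (D_alg c) Mod (qscalar ` (- {0}))"

definition gamma :: "'a::field \<Rightarrow> 'a ratfun quat \<Rightarrow> 'a ratfun quat" where
  "gamma c \<xi> = (qscalar rf_t \<otimes>\<^bsub>D_alg c\<^esub> qZ) \<oplus>\<^bsub>D_alg c\<^esub> (\<xi> \<otimes>\<^bsub>D_alg c\<^esub> qF)"

text \<open>\<open>gen c \<xi>\<close> is \<open>a\<^sub>\<xi>\<close> or \<open>b\<^sub>\<xi>\<close>, depending on the norm of \<open>\<xi>\<close>.\<close>

definition gen :: "'a::field \<Rightarrow> 'a ratfun quat \<Rightarrow> 'a ratfun quat set" where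
  "gen c \<xi> = (qscalar ` (- {0})) #>\<^bsub>units_of (D_alg c)\<^esub> (gamma c \<xi> \<otimes>\<^bsub>D_alg c\<^esub> qZ)"

definition V_labels :: "'a::{field, finite} \<Rightarrow> 'a ratfun quat set" where
  "V_labels c = norm_set c (- c)"

definition H_labels :: "'a::{field, finite} \<Rightarrow> 'a \<Rightarrow> 'a ratfun quat set" where
  "H_labels c \<tau> = norm_set c (c * \<tau> / (1 - \<tau>))"

definition Gamma_tau :: "'a::{field, finite} \<Rightarrow> 'a \<Rightarrow> 'a ratfun quat set monoid" where
  "Gamma_tau c \<tau> = subgroup_generated (PD c) (gen c ` (V_labels c \<union> H_labels c \<tau>))"

section \<open>Completions and Bruhat--Tits trees\<close>

text \<open>The completions of \<open>K\<close> at \<open>t = \<tau>\<close> and \<open>t = \<infinity>\<close> are both Laurent series fields; the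
  uniformizer \<open>fls_X\<close> is \<open>t - \<tau>\<close> and \<open>1/t\<close>, respectively. \<open>eval_at s\<close> is the embedding of
  \<open>K\<close> that maps \<open>t\<close> to \<open>s\<close>, for transcendental \<open>s\<close>.\<close>

definition eval_at :: "'a::field fls \<Rightarrow> 'a ratfun \<Rightarrow> 'a fls" where
  "eval_at s r = (THE y. \<exists>n d. d \<noteq> 0 \<and> r = Fraction_Field.Fract n d \<and>
     y = poly (map_poly fls_const n) s / poly (map_poly fls_const d) s)"

definition emb_tau :: "'a::field \<Rightarrow> 'a ratfun \<Rightarrow> 'a fls" where
  "emb_tau \<tau> = eval_at (fls_const \<tau> + fls_X)"

definition emb_inf :: "'a::field ratfun \<Rightarrow> 'a fls" where
  "emb_inf = eval_at fls_X_inv"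

text \<open>Since \<open>D\<close> is central simple of dimension four, such a \<open>\<rho>\<close> extends uniquely to an isomorphism
  from the completion of \<open>D\<close> onto the matrix algebra. It is unique up to conjugation.\<close>

definition splitting ::
  "('k::field \<Rightarrow> 'l::field) \<Rightarrow> 'k quat ring \<Rightarrow> ('k quat \<Rightarrow> 'l^2^2) \<Rightarrow> bool" where
  "splitting \<iota> A \<rho> \<longleftrightarrow>
     (\<forall>x. \<rho> (qscalar x) = mat (\<iota> x)) \<and>
     (\<forall>u v. \<rho> (u \<oplus>\<^bsub>A\<^esub> v) = \<rho> u + \<rho> v) \<and>
     (\<forall>u v. \<rho> (u \<otimes>\<^bsub>A\<^esub> v) = \<rho> u ** \<rho> v)"

lemma fps_sqrt_exists:
  fixes f :: "'a::field fps"
  assumes "(2::'a) \<noteq> 0" "a \<noteq> 0" "fps_nth f 0 = a\<^sup>2"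
  shows "\<exists>g. g\<^sup>2 = f"
proof -
  have "\<exists>g. \<forall>n. g n = (if n = 0 then a else (fps_nth f n - (\<Sum>i\<in>{1..<n}. g i * g (n - i))) / (2 * a))"
  proof -
    define H where "H = (\<lambda>(g::nat\<Rightarrow>'a) n. if n = 0 then a else (fps_nth f n - (\<Sum>i\<in>{1..<n}. g i * g (n - i))) / (2 * a))"
    have "adm_wf less_than H"
      unfolding adm_wf_def H_def by (auto intro!: sum.cong)
    then have "wfrec less_than H n = H (wfrec less_than H) n" for n
      by (intro wfrec_fixpoint[THEN fun_cong]) auto
    then show ?thesis unfolding H_def by blast
  qed
  then obtain g where g: "\<And>n. g n = (if n = 0 then a else (fps_nth f n - (\<Sum>i\<in>{1..<n}. g i * g (n - i))) / (2 * a))"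
    by blast
  have "(Abs_fps g)\<^sup>2 = f"
  proof (rule fps_ext)
    fix n
    show "fps_nth ((Abs_fps g)\<^sup>2) n = fps_nth f n"
    proof (cases "n = 0")
      case True
      then show ?thesis using g[of 0] assms by (simp add: power2_eq_square)
    next
      case False
      have s: "{0..n} = insert 0 (insert n {1..<n})" using False by auto
      have "fps_nth ((Abs_fps g)\<^sup>2) n = (\<Sum>i\<in>{0..n}. g i * g (n - i))"
        by (simp add: power2_eq_square fps_mult_nth)
      also have "\<dots> = 2 * a * g n + (\<Sum>i\<in>{1..<n}. g i * g (n - i))"
        using False g[of 0] by (subst s) (simp add: algebra_simps)
      also have "2 * a * g n = fps_nth f n - (\<Sum>i\<in>{1..<n}. g i * g (n - i))"
        using False assms by (subst g) simp
      finally show ?thesis by simp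
    qed
  qed
  then show ?thesis by blast
qed

lemma two_nonzero:
  assumes "odd CARD('a::{field,finite})" shows "(2::'a) \<noteq> 0"
proof
  assume 2: "(2::'a) = 0"
  have tw: "x + x = 0" for x :: 'a using 2 by (metis mult_2 mult_zero_left)
  have "\<And>x::'a. x + 1 \<noteq> x" by simp
  have "even (card (UNIV :: 'a set))"
  proof -
    define P where "P = (\<lambda>x::'a. {x, x + 1}) ` UNIV"
    have "card (\<Union>P) = sum card P"
    proof (rule card_Union_disjoint)
      show "pairwise disjnt P"
      proof (rule pairwiseI)
        fix A B assume "A \<in> P" "B \<in> P" "A \<noteq> B"
        then obtain x y where xy: "A = {x, x+1}" "B = {y, y+1}" unfolding P_def by auto
        have a: "z + 1 + 1 = z" for z :: 'a using tw[of 1] by (simp add: add.assoc)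
        show "disjnt A B"
        proof (rule ccontr)
          assume "\<not> disjnt A B"
          then have "x = y \<or> x = y + 1 \<or> x + 1 = y \<or> x + 1 = y + 1"
            unfolding disjnt_def xy by auto
          then have "x = y \<or> x = y + 1" using a by auto
          then have "A = B" unfolding xy using a[of y] by auto
          then show False using \<open>A \<noteq> B\<close> by simp
        qed
      qed
    qed (auto simp: P_def)
    moreover have "\<Union>P = UNIV" unfolding P_def by auto
    moreover have "card A = 2" if "A \<in> P" for A using that unfolding P_def by auto
    ultimately show ?thesis by (simp)
  qed
  then show False using assms by simp
qed

lemma squares_card:
  assumes "(2::'a::{field,finite}) \<noteq> 0"
  shows "CARD('a) + 1 \<le> 2 * card (range (\<lambda>x::'a. x\<^sup>2))"
proof -
  let ?R = "range (\<lambda>x::'a. x\<^sup>2)"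
  have "CARD('a) = (\<Sum>s\<in>?R. card {x. x\<^sup>2 = s})"
  proof -
    have "CARD('a) = card (\<Union>s\<in>?R. {x. x\<^sup>2 = s})" by (rule arg_cong[where f=card]) auto
    also have "\<dots> = (\<Sum>s\<in>?R. card {x. x\<^sup>2 = s})" by (rule card_UN_disjoint) auto
    finally show ?thesis .
  qed
  also have "\<dots> = card {x::'a. x\<^sup>2 = 0} + (\<Sum>s\<in>?R - {0}. card {x. x\<^sup>2 = s})"
    by (rule sum.remove) (auto intro: image_eqI[of _ _ 0])
  also have "card {x::'a. x\<^sup>2 = 0} = 1" by simp
  also have "(\<Sum>s\<in>?R - {0}. card {x. x\<^sup>2 = s}) \<le> (\<Sum>s\<in>?R - {0}. 2)"
  proof (rule sum_mono)
    fix s assume "s \<in> ?R - {0}"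
    then obtain y where "s = y\<^sup>2" by auto
    then have "{x. x\<^sup>2 = s} \<subseteq> {y, - y}" by (auto simp: power2_eq_iff)
    then have "card {x. x\<^sup>2 = s} \<le> card {y, - y}" by (intro card_mono) auto
    also have "\<dots> \<le> 2" by (simp add: card_insert_if)
    finally show "card {x. x\<^sup>2 = s} \<le> 2" .
  qed
  also have "(\<Sum>s\<in>?R - {0}. 2) = 2 * (card ?R - 1)"
    by (simp add: card_Diff_singleton image_eqI[of _ _ 0])
  also have "1 + 2 * (card ?R - 1) = 2 * card ?R - 1"
    using card_gt_0_iff[of ?R] by auto
  finally show ?thesis using card_gt_0_iff[of ?R] by simp
qed

lemma norm_surj:
  assumes "(2::'a::{field,finite}) \<noteq> 0" "c \<noteq> 0"
  shows "\<exists>x y::'a. x\<^sup>2 - c * y\<^sup>2 = u"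
proof -
  let ?R = "range (\<lambda>x::'a. x\<^sup>2)" let ?T = "(\<lambda>s. u + c * s) ` ?R"
  have "card ?T = card ?R" using assms by (intro card_image inj_onI) auto
  then have "CARD('a) < card ?R + card ?T" using squares_card[OF assms(1)] by linarith
  then have "?R \<inter> ?T \<noteq> {}"
    by (metis card_Un_disjoint card_mono finite_class.finite_UNIV finite leD top_greatest)
  then obtain x y where "x\<^sup>2 = u + c * y\<^sup>2" by auto
  then have "x\<^sup>2 - c * y\<^sup>2 = u" by simp
  then show ?thesis by blast
qed

definition transcendental :: "'a::field fls \<Rightarrow> bool" where
  "transcendental s \<longleftrightarrow> (\<forall>d. d \<noteq> 0 \<longrightarrow> poly (map_poly fls_const d) s \<noteq> 0)"

lemma fc_add: "map_poly fls_const (p + q) = map_poly fls_const p + map_poly fls_const (q::'a::field poly)"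
  by (rule poly_eqI) (simp add: coeff_map_poly fls_plus_const)
lemma fc_mult: "map_poly fls_const (p * q) = map_poly fls_const p * map_poly fls_const (q::'a::field poly)"
proof -
  have "fls_const (sum f A) = (\<Sum>x\<in>A. fls_const (f x))" for f :: "nat \<Rightarrow> 'a" and A
    by (induction A rule: infinite_finite_induct) (simp_all flip: fls_plus_const)
  then show ?thesis
    by (intro poly_eqI) (simp add: coeff_map_poly coeff_mult)
qed

lemma eval_at_Fract:
  assumes "transcendental s" "d \<noteq> 0"
  shows "eval_at s (Fraction_Field.Fract n d) = poly (map_poly fls_const n) s / poly (map_poly fls_const d) s"
  unfolding eval_at_def
proof (rule the_equality)
  fix y assume "\<exists>n' d'. d' \<noteq> 0 \<and> Fraction_Field.Fract n d = Fraction_Field.Fract n' d' \<and>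
     y = poly (map_poly fls_const n') s / poly (map_poly fls_const d') s"
  then obtain n' d' where *: "d' \<noteq> 0" "Fraction_Field.Fract n d = Fraction_Field.Fract n' d'"
     "y = poly (map_poly fls_const n') s / poly (map_poly fls_const d') s" by blast
  then have "n * d' = n' * d" using assms by (simp add: eq_fract)
  then have "poly (map_poly fls_const n) s * poly (map_poly fls_const d') s
    = poly (map_poly fls_const n') s * poly (map_poly fls_const d) s"
    by (metis fc_mult poly_mult)
  then show "y = poly (map_poly fls_const n) s / poly (map_poly fls_const d) s"
    using assms * unfolding transcendental_def by (simp add: frac_eq_eq)
qed (use assms in blast)

lemma eval_at_hom:
  fixes s :: "'a::field fls"
  assumes "transcendental s"
  shows "eval_at s (x + y) = eval_at s x + eval_at s y"
    "eval_at s (x * y) = eval_at s x * eval_at s y"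
    "\<And>a. eval_at s (rf_const a) = fls_const a" "eval_at s rf_t = s"
    "eval_at s 1 = 1" "eval_at s 0 = 0"
proof -
  obtain a b where x: "x = Fraction_Field.Fract a b" "b \<noteq> 0" by (cases x) auto
  obtain e d where y: "y = Fraction_Field.Fract e d" "d \<noteq> 0" by (cases y) auto
  show "eval_at s (x + y) = eval_at s x + eval_at s y"
    using x y assms by (simp add: eval_at_Fract fc_add fc_mult transcendental_def field_simps)
  show "eval_at s (x * y) = eval_at s x * eval_at s y"
    using x y assms by (simp add: eval_at_Fract fc_mult)
  show "eval_at s (rf_const a) = fls_const a" for a using assms
    by (simp add: rf_const_def eval_at_Fract map_poly_pCons)
  show "eval_at s rf_t = s" "eval_at s 1 = 1" "eval_at s 0 = 0"
    using assms by (simp_all add: rf_const_def rf_t_def eval_at_Fract One_fract_def Zero_fract_def map_poly_pCons)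
qed

lemma transcendental_tau: "transcendental (fls_const \<tau> + fls_X)"
proof -
  have "poly (map_poly fls_const p) (fls_const \<tau> + fls_X) = fps_to_fls (fps_of_poly (pcompose p [:\<tau>, 1:]))" for p
    by (induction p) (simp_all add: map_poly_pCons pcompose_pCons fps_of_poly_add fps_of_poly_mult
         fps_of_poly_pCons fps_of_poly_smult fls_times_fps_to_fls fps_of_poly_const algebra_simps flip: fls_X_conv_shift_1)
  then show ?thesis unfolding transcendental_def
    by (auto simp: pcompose_eq_0_iff)
qed

lemma transcendental_inf: "transcendental fls_X_inv"
proof -
  have *: "fls_nth (poly (map_poly fls_const p) fls_X_inv) k = (if k \<le> 0 then coeff p (nat (- k)) else 0)" for p :: "'a poly" and k
  proof (induction p arbitrary: k)
    case (pCons a p)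
    have "nat (- k) = Suc (nat (- k - 1))" if "k < 0" using that by auto
    then show ?case using pCons
      by (auto simp: map_poly_pCons fls_X_inv_times_conv_shift coeff_pCons split: nat.splits)
  qed simp
  show ?thesis unfolding transcendental_def
  proof (intro allI impI)
    fix d :: "'a poly" assume "d \<noteq> 0"
    then have "fls_nth (poly (map_poly fls_const d) fls_X_inv) (- int (degree d)) \<noteq> 0"
      by (simp add: *)
    then show "poly (map_poly fls_const d) fls_X_inv \<noteq> 0" by auto
  qed
qed

lemma split_gen:
  assumes "transcendental s" and "x\<^sup>2 - fls_const c * y\<^sup>2 = s * (s - 1)"
  shows "\<exists>\<rho>. splitting (eval_at s) (D_alg c) \<rho>"
proof -
  let ?i = "eval_at s"
  let ?m = "\<lambda>a b e d. (\<chi> i j. if i = 1 then (if j = 1 then a else b) else (if j = 1 then e else d)) :: 'a fls^2^2"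
  note h = eval_at_hom[OF assms(1)]
  have hm: "?i (u - v) = ?i u - ?i v" for u v
    using h(1)[of "u - v" v] by (simp add: algebra_simps)
  let ?\<alpha> = "fls_const c"
  define r where "r q = (case q of Quat a b e d \<Rightarrow>
     ?m (?i a + ?i e * x + ?i d * (?\<alpha> * y)) (?\<alpha> * ?i b - ?i e * (?\<alpha> * y) - ?i d * (?\<alpha> * x))
        (?i b + ?i e * y + ?i d * x) (?i a - ?i e * x - ?i d * (?\<alpha> * y)))" for q
  have b: "?i (rf_t * (rf_t - 1)) = x\<^sup>2 - ?\<alpha> * y\<^sup>2" using h hm assms by simp
  have "splitting ?i (D_alg c) r"
    unfolding splitting_def
  proof (intro conjI allI)
    fix u v :: "'a ratfun quat" and k
    show "r (qscalar k) = mat (?i k)"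
      by (simp add: r_def h vec_eq_iff mat_def) (metis exhaust_2)
    show "r (u \<oplus>\<^bsub>D_alg c\<^esub> v) = r u + r v"
      by (cases u; cases v) (simp add: r_def D_alg_def quat_algebra_def h vec_eq_iff algebra_simps)
    show "r (u \<otimes>\<^bsub>D_alg c\<^esub> v) = r u ** r v"
    proof -
      obtain x1 x2 x3 x4 y1 y2 y3 y4 where uv: "u = Quat x1 x2 x3 x4" "v = Quat y1 y2 y3 y4"
        by (cases u; cases v) auto
      define \<beta> where "\<beta> = rf_t * (rf_t - 1 :: 'a ratfun)"
      have b': "?i \<beta> = x * x - ?\<alpha> * (y * y)" using b by (simp add: \<beta>_def power2_eq_square)
      show ?thesis
        unfolding uv
        by (simp add: r_def D_alg_def quat_algebra_def \<beta>_def[symmetric] h(1,2,3) hm b'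
             vec_eq_iff forall_2 matrix_matrix_mult_def sum_2)
           (simp add: algebra_simps)
    qed
  qed
  then show ?thesis by blast
qed

text \<open>Splittings at both places exist.\<close>

lemma splitting_exists:
  fixes c \<tau> :: "'a::{field,finite}"
  assumes "odd CARD('a)" "c \<noteq> 0" "\<tau> \<noteq> 0" "\<tau> \<noteq> 1"
  shows "\<exists>\<rho>. splitting (emb_tau \<tau>) (D_alg c) \<rho>" "\<exists>\<rho>. splitting emb_inf (D_alg c) \<rho>"
proof -
  note two = two_nonzero[OF assms(1)]
  let ?g = "(fps_const \<tau> + fps_X) * (fps_const \<tau> + fps_X - 1)"
  obtain x0 y0 where 0: "x0\<^sup>2 - c * y0\<^sup>2 = \<tau> * (\<tau> - 1)" using norm_surj[OF two assms(2)] by blast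
  have "\<exists>x y. x\<^sup>2 - fps_const c * y\<^sup>2 = ?g"
  proof (cases "x0 = 0")
    case False
    have "\<exists>x. x\<^sup>2 = ?g + fps_const c * fps_const (y0\<^sup>2)"
      by (rule fps_sqrt_exists[OF two False]) (use 0 in \<open>simp add: algebra_simps\<close>)
    then obtain x where "x\<^sup>2 = ?g + fps_const c * fps_const (y0\<^sup>2)" ..
    then have "x\<^sup>2 - fps_const c * (fps_const y0)\<^sup>2 = ?g" by (simp add: fps_const_power)
    then show ?thesis by blast
  next
    case True
    then have "y0 \<noteq> 0" using 0 assms by auto
    have "\<exists>y. y\<^sup>2 = fps_const (- 1 / c) * ?g"
      by (rule fps_sqrt_exists[OF two \<open>y0 \<noteq> 0\<close>]) (use 0 True assms in \<open>simp add: field_simps\<close>)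
    then obtain y where "y\<^sup>2 = fps_const (- 1 / c) * ?g" ..
    then have "0\<^sup>2 - fps_const c * y\<^sup>2 = fps_const (- (c * (- 1 / c))) * ?g"
      by (simp add: mult.assoc[symmetric] flip: fps_const_neg)
    also have "\<dots> = ?g" using assms(2) by simp
    finally show ?thesis by blast
  qed
  then obtain x y where xy: "x\<^sup>2 - fps_const c * y\<^sup>2 = ?g" by blast
  have "(fps_to_fls x)\<^sup>2 - fls_const c * (fps_to_fls y)\<^sup>2 = fps_to_fls ?g"
    unfolding xy[symmetric] by (simp add: fls_times_fps_to_fls power2_eq_square fps_to_fls_minus)
  also have "\<dots> = (fls_const \<tau> + fls_X) * (fls_const \<tau> + fls_X - 1)"
    by (simp add: fls_times_fps_to_fls fps_to_fls_minus fps_to_fls_plus)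
  finally show "\<exists>\<rho>. splitting (emb_tau \<tau>) (D_alg c) \<rho>"
    unfolding emb_tau_def by (rule split_gen[OF transcendental_tau])
  have "\<exists>z::'a fps. z\<^sup>2 = 1 - fps_X" by (rule fps_sqrt_exists[OF two, of 1]) simp_all
  then obtain z :: "'a fps" where "z\<^sup>2 = 1 - fps_X" ..
  then have z: "(fps_to_fls z)\<^sup>2 = 1 - fls_X"
    by (metis fls_times_fps_to_fls power2_eq_square fps_to_fls_minus fps_one_to_fls fps_X_to_fls)
  have "fls_X_inv * fls_X = (1::'a fls)" by (simp add: fls_X_inv_times_conv_shift)
  then have "fls_X_inv\<^sup>2 * (1 - fls_X) = fls_X_inv * (fls_X_inv - (1::'a fls))"
    by (simp add: power2_eq_square algebra_simps)
  then have "(fls_X_inv * fps_to_fls z)\<^sup>2 - fls_const c * 0\<^sup>2 = fls_X_inv * (fls_X_inv - 1)"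
    by (simp add: z power_mult_distrib)
  then show "\<exists>\<rho>. splitting emb_inf (D_alg c) \<rho>"
    unfolding emb_inf_def by (rule split_gen[OF transcendental_inf])
qed

definition is_lattice :: "('a::field fls^2) set \<Rightarrow> bool" where
  "is_lattice L \<longleftrightarrow> (\<exists>u w.
     (\<forall>x y. x *s u + y *s w = 0 \<longrightarrow> x = 0 \<and> y = 0) \<and>
     L = {x *s u + y *s w | x y. fls_subdegree x \<ge> 0 \<and> fls_subdegree y \<ge> 0})"

type_synonym 'a btvert = "('a fls^2) set set"

definition homothety_class :: "('a::field fls^2) set \<Rightarrow> 'a btvert" where
  "homothety_class L = {(\<lambda>v. x *s v) ` L | x. x \<noteq> 0}"

definition bt_verts :: "'a::field btvert set" where
  "bt_verts = {homothety_class L | L. is_lattice L}"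

definition bt_edges :: "('a::field btvert \<times> 'a btvert) set" where
  "bt_edges = {(C, C'). C \<in> bt_verts \<and> C' \<in> bt_verts \<and>
     (\<exists>L\<in>C. \<exists>L'\<in>C'. (\<lambda>v. fls_X *s v) ` L \<subset> L' \<and> L' \<subset> L)}"

text \<open>The result does not depend on the representatives of the coset \<open>g\<close> and the class \<open>C\<close>.\<close>

definition bt_act ::
  "('a::field ratfun quat \<Rightarrow> 'a fls^2^2) \<Rightarrow> 'a ratfun quat set \<Rightarrow> 'a btvert \<Rightarrow> 'a btvert" where
  "bt_act \<rho> g C = {(\<lambda>v. \<rho> x *v v) ` L | x L. x \<in> g \<and> L \<in> C}"

section \<open>The product of the trees and its quotient\<close>

text \<open>The first factor is the tree at \<open>\<tau>\<close> and is drawn horizontally, the second one is the tree at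
  \<open>\<infinity>\<close> and is drawn vertically.\<close>

type_synonym 'v dart = "'v \<times> 'v"

datatype 'v pedge = is_Hor: Hor "'v dart" 'v | is_Ver: Ver 'v "'v dart"

fun pedge_src :: "'v pedge \<Rightarrow> 'v \<times> 'v" where
  "pedge_src (Hor (x, x') y) = (x, y)"
| "pedge_src (Ver x (y, y')) = (x, y)"

fun pedge_rev :: "'v pedge \<Rightarrow> 'v pedge" where
  "pedge_rev (Hor (x, x') y) = Hor (x', x) y"
| "pedge_rev (Ver x (y, y')) = Ver x (y', y)"

definition bt_product ::
  "('a::field btvert \<times> 'a btvert, 'a btvert pedge,
    ('a btvert pedge \<times> 'a btvert pedge \<times> 'a btvert pedge \<times> 'a btvert pedge) set) sqcomplex"
  where
  "bt_product =
     \<lparr> sc_verts = bt_verts \<times> bt_verts,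
       sc_edges = {Hor e y | e y. e \<in> bt_edges \<and> y \<in> bt_verts} \<union>
               {Ver x f | x f. x \<in> bt_verts \<and> f \<in> bt_edges},
       sc_src = pedge_src,
       sc_tgt = pedge_src \<circ> pedge_rev,
       sc_rev = pedge_rev,
       sc_squares = {dihedral_class pedge_rev
           (Hor (x, x') y, Ver x' (y, y'), Hor (x', x) y', Ver x (y', y)) | x x' y y'.
           (x, x') \<in> bt_edges \<and> (y, y') \<in> bt_edges},
       sc_bd = (\<lambda>s. s) \<rparr>"

definition act_vert ::
  "('a::field ratfun quat \<Rightarrow> 'a fls^2^2) \<Rightarrow> ('a ratfun quat \<Rightarrow> 'a fls^2^2) \<Rightarrow>
   'a ratfun quat set \<Rightarrow> 'a btvert \<times> 'a btvert \<Rightarrow> 'a btvert \<times> 'a btvert" where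
  "act_vert \<rho> \<rho>' g = map_prod (bt_act \<rho> g) (bt_act \<rho>' g)"

fun act_edge ::
  "('a::field ratfun quat \<Rightarrow> 'a fls^2^2) \<Rightarrow> ('a ratfun quat \<Rightarrow> 'a fls^2^2) \<Rightarrow>
   'a ratfun quat set \<Rightarrow> 'a btvert pedge \<Rightarrow> 'a btvert pedge" where
  "act_edge \<rho> \<rho>' g (Hor (x, x') y) = Hor (bt_act \<rho> g x, bt_act \<rho> g x') (bt_act \<rho>' g y)"
| "act_edge \<rho> \<rho>' g (Ver x (y, y')) = Ver (bt_act \<rho> g x) (bt_act \<rho>' g y, bt_act \<rho>' g y')"

text \<open>\<open>\<rho>\<close> and \<open>\<rho>'\<close> are splittings of \<open>D\<close> at \<open>\<tau>\<close> and at \<open>\<infinity>\<close>.\<close>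

definition S_Gamma where
  "S_Gamma c \<tau> \<rho> \<rho>' = quotient_complex (carrier (Gamma_tau c \<tau>))
     (act_vert \<rho> \<rho>') (act_edge \<rho> \<rho>') (\<lambda>g. image (map4 (act_edge \<rho> \<rho>' g))) bt_product"

section \<open>The explicit complex\<close>

datatype 'l sedge = Aedge 'l | Bedge 'l

fun sedge_rev :: "'a::field \<Rightarrow> 'a ratfun quat sedge \<Rightarrow> 'a ratfun quat sedge" where
  "sedge_rev c (Aedge \<xi>) = Aedge (\<ominus>\<^bsub>D_alg c\<^esub> \<xi>)"
| "sedge_rev c (Bedge \<eta>) = Bedge (\<ominus>\<^bsub>D_alg c\<^esub> \<eta>)"

definition explicit_square where
  "explicit_square c \<xi> \<eta> = dihedral_class (sedge_rev c)
     (Aedge \<xi>, Bedge (sigma c \<xi> \<eta>),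
      sedge_rev c (Aedge (sigma c \<eta> \<xi>)), sedge_rev c (Bedge \<eta>))"

definition explicit_complex ::
  "'a::{field, finite} \<Rightarrow> 'a \<Rightarrow> (unit, 'a ratfun quat sedge,
     ('a ratfun quat sedge \<times> 'a ratfun quat sedge \<times>
      'a ratfun quat sedge \<times> 'a ratfun quat sedge) set) sqcomplex" where
  "explicit_complex c \<tau> =
     \<lparr> sc_verts = {()},
       sc_edges = Aedge ` V_labels c \<union> Bedge ` H_labels c \<tau>,
       sc_src = (\<lambda>_. ()),
       sc_tgt = (\<lambda>_. ()),
       sc_rev = sedge_rev c,
       sc_squares = {explicit_square c \<xi> \<eta> | \<xi> \<eta>. \<xi> \<in> V_labels c \<and> \<eta> \<in> H_labels c \<tau>},
       sc_bd = (\<lambda>s. s) \<rparr>"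

end

theory Submission
  imports Defs "HOL-Library.Sublist"
begin

text \<open>In the completion at \<open>\<tau>\<close> the generators \<open>a\<^sub>\<xi>\<close> fix a standard vertex of the tree and the
  \<open>b\<^sub>\<eta>\<close> move it to its neighbours, one \<open>\<eta>\<close> for each neighbour; at \<open>\<infinity>\<close> the roles are exchanged. The
  residue of the reduced norm of \<open>\<gamma>\<^sub>\<xi>Z\<close> decides which case occurs, and the kernel of a critical
  generator modulo the uniformizer determines \<open>\<xi>\<close>; hence reduced words in the critical generators
  are in bijection with the vertices. This shows at once that the graph of lattice classes is a tree
  and that the words act simply transitively on it. The map \<open>\<sigma>\<close> is made for the relations
  \<open>a\<^sub>\<xi> b\<^sub>\<mu> = b\<^sub>\<lambda> a\<^sub>\<nu>\<close> with \<open>\<mu> = \<sigma>\<^sub>\<xi>(\<lambda>)\<close> and \<open>\<nu> = \<sigma>\<^sub>\<lambda>(\<xi>)\<close>,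
  by which every element of \<open>\<Gamma>\<^sub>\<tau>\<close> is an \<open>a\<close>-word times a \<open>b\<close>-word; so
  \<open>\<Gamma>\<^sub>\<tau>\<close> is simply transitive on the vertices of the product, and the cells of the quotient can be read
  off at one vertex.

  The product of the realizations of the trees, whose points are encoded by distance functions, is
  uniquely geodesic with continuously varying geodesics, and short displacements are ruled out by the
  free action without inversions. Maps from paths, homotopies and spheres lift along geodesics, as in
  covering theory, and are contracted upstairs; this yields the fundamental group and the vanishing of
  the higher homotopy groups of the quotient.\<close>

section \<open>Spheres as suspensions\<close>

text \<open>For \<open>N(\<xi>) = n\<close> the reduced norm of
  \<open>\<gamma>\<^sub>\<xi> Z\<close> is \<open>c t ((c + n) t - n)\<close>. At the place
  \<open>\<tau>\<close> the factors \<open>c\<close> and \<open>t\<close> are units, so it vanishes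
  there only for \<open>n = c \<tau> / (1 - \<tau>)\<close>; at infinity its degree drops from 2 to
  1 only for \<open>n = -c\<close>. This is the origin of the two label norms, and since zero and
  drop have order one, a critical generator moves the standard vertex by exactly one edge. On the
  topological side, \<open>realization\<close> glues abstract cells along arbitrarily chosen
  boundary tuples, whereas the contractible space upstairs is metric. Characteristic maps compare
  the two: finiteness makes the disjoint union of the cells compact, and the union of the orbits
  meeting a compact set is closed, so the glued space carries the quotient topology of the orbit
  map. Suspensions enter because lifting is proved for homotopies with a compact parameter space: a
  map from a sphere is read as a homotopy of maps from the sphere one dimension lower, with both
  ends collapsed.\<close>

definition suspend :: "nat \<Rightarrow> real \<times> (nat \<Rightarrow> real) \<Rightarrow> nat \<Rightarrow> real" where
  "suspend m z i = (if i = Suc m then 2 * fst z - 1 else sqrt (1 - (2 * fst z - 1)\<^sup>2) * snd z i)"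

lemma topspace_nsphere:
  "topspace (nsphere n) = {x. (\<Sum>i\<le>n. (x i)\<^sup>2) = 1 \<and> (\<forall>i>n. x i = 0)}"
  by (simp add: nsphere)

lemma suspend_radius:
  fixes s :: real
  assumes "s \<in> {0..1}" shows "0 \<le> 1 - (2 * s - 1)\<^sup>2"
proof -
  have "1 - (2 * s - 1)\<^sup>2 = 4 * (s * (1 - s))" by (simp add: power2_eq_square algebra_simps)
  then show ?thesis using assms by simp
qed

lemma continuous_map_suspend:
  "continuous_map (prod_topology (top_of_set {0..1}) (nsphere m)) (nsphere (Suc m)) (suspend m)"
proof -
  let ?Z = "prod_topology (top_of_set {0..1::real}) (nsphere m)"
  have f: "continuous_map ?Z euclideanreal (\<lambda>z. fst z)"
    using continuous_map_fst continuous_map_in_subtopology by blast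
  have s: "continuous_map ?Z euclideanreal (\<lambda>z. snd z i)" for i
    using continuous_map_compose[OF continuous_map_snd continuous_map_nsphere_projection]
    by (simp add: o_def)
  have "continuous_map ?Z (powertop_real UNIV) (suspend m)"
    unfolding continuous_map_componentwise_UNIV
  proof
    fix i
    have "continuous_map ?Z euclideanreal (\<lambda>z. sqrt (1 - (2 * fst z - 1)\<^sup>2) * snd z i)"
      by (intro continuous_intros f s)
    moreover have "continuous_map ?Z euclideanreal (\<lambda>z. 2 * fst z - 1)"
      by (intro continuous_intros f)
    ultimately show "continuous_map ?Z euclideanreal (\<lambda>z. suspend m z i)"
      unfolding suspend_def by (cases "i = Suc m") simp_all
  qed
  moreover have "suspend m z \<in> {x. (\<Sum>i\<le>Suc m. (x i)\<^sup>2) = 1 \<and> (\<forall>i>Suc m. x i = 0)}"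
    if z: "z \<in> topspace ?Z" for z
  proof -
    obtain s y where zz: "z = (s, y)" "s \<in> {0..1}" "(\<Sum>i\<le>m. (y i)\<^sup>2) = 1" "\<forall>i>m. y i = 0"
      using z by (auto simp: topspace_nsphere)
    have "(\<Sum>i\<le>m. (suspend m z i)\<^sup>2) = (\<Sum>i\<le>m. (1 - (2 * s - 1)\<^sup>2) * (y i)\<^sup>2)"
      using suspend_radius[OF zz(2)]
      by (intro sum.cong) (auto simp: suspend_def zz(1) power_mult_distrib)
    also have "\<dots> = 1 - (2 * s - 1)\<^sup>2"
      using zz(3) by (simp flip: sum_distrib_left)
    finally show ?thesis using zz by (auto simp: suspend_def)
  qed
  ultimately show ?thesis
    unfolding nsphere by (intro continuous_map_into_subtopology) auto
qed

text \<open>Off the poles the remaining coordinates can be divided by their length \<open>r\<close>.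
  Surjectivity together with compactness makes \<open>suspend\<close> a quotient map, so a map on
  the cylinder that is constant on each end descends to the sphere.\<close>

lemma suspend_surj:
  "suspend m ` topspace (prod_topology (top_of_set {0..1}) (nsphere m)) = topspace (nsphere (Suc m))"
proof
  show "suspend m ` topspace (prod_topology (top_of_set {0..1}) (nsphere m)) \<subseteq> topspace (nsphere (Suc m))"
    by (rule continuous_map_image_subset_topspace[OF continuous_map_suspend])
  show "topspace (nsphere (Suc m)) \<subseteq> suspend m ` topspace (prod_topology (top_of_set {0..1}) (nsphere m))"
  proof
    fix x assume "x \<in> topspace (nsphere (Suc m))"
    then have x: "(\<Sum>i\<le>m. (x i)\<^sup>2) = 1 - (x (Suc m))\<^sup>2" "\<forall>i>Suc m. x i = 0"
      by (auto simp: topspace_nsphere)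
    have nn: "0 \<le> (\<Sum>i\<le>m. (x i)\<^sup>2)" by (simp add: sum_nonneg)
    then have "\<bar>x (Suc m)\<bar> \<le> 1" using x(1) abs_square_le_1[of "x (Suc m)"] by simp
    define s where "s = (x (Suc m) + 1) / 2"
    have s: "s \<in> {0..1}" "2 * s - 1 = x (Suc m)" using \<open>\<bar>x (Suc m)\<bar> \<le> 1\<close> by (auto simp: s_def field_simps)
    define r where "r = sqrt (1 - (x (Suc m))\<^sup>2)"
    have r2: "r\<^sup>2 = 1 - (x (Suc m))\<^sup>2" using nn x(1) by (simp add: r_def)
    show "x \<in> suspend m ` topspace (prod_topology (top_of_set {0..1}) (nsphere m))"
    \<comment> \<open>At a pole all points of the lower sphere have the same image, so any one of
      them serves as preimage.\<close>
    proof (cases "r = 0")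
      case True
      then have "(\<Sum>i\<le>m. (x i)\<^sup>2) = 0" using x(1) r2 by simp
      then have z: "\<forall>i\<le>m. x i = 0" by (subst (asm) sum_nonneg_eq_0_iff) auto
      have "x = suspend m (s, \<lambda>n. if n = 0 then 1 else 0)"
      proof
        fix i show "x i = suspend m (s, \<lambda>n. if n = 0 then 1 else 0) i"
          using z x(2) s True unfolding suspend_def r_def
          by (cases "i \<le> m"; cases "i = Suc m") auto
      qed
      then show ?thesis using s in_topspace_nsphere[of m] by (intro image_eqI) auto
    next
      case False
      define y where "y i = (if i \<le> m then x i / r else 0)" for i
      have "(\<Sum>i\<le>m. (y i)\<^sup>2) = (\<Sum>i\<le>m. (x i)\<^sup>2 / r\<^sup>2)"
        by (intro sum.cong) (auto simp: y_def power_divide)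
      also have "\<dots> = (\<Sum>i\<le>m. (x i)\<^sup>2) / r\<^sup>2" by (simp add: sum_divide_distrib)
      also have "\<dots> = 1" unfolding x(1) r2[symmetric] using False by simp
      finally have "y \<in> topspace (nsphere m)" by (auto simp: topspace_nsphere y_def)
      moreover have "x = suspend m (s, y)"
      proof
        fix i show "x i = suspend m (s, y) i"
          using x(2) s False unfolding suspend_def r_def[symmetric] y_def
          by (cases "i \<le> m"; cases "i = Suc m") (auto simp: r_def)
      qed
      ultimately show ?thesis using s by (intro image_eqI) auto
    qed
  qed
qed

text \<open>Compactness passes along the surjection from the cylinder over the sphere one dimension
  lower; the induction starts at the two points of the 0-sphere.\<close>

lemma compact_space_nsphere: "compact_space (nsphere n)"
proof (induction n)
  case 0
  have "x \<in> {(\<lambda>i. if i = 0 then 1 else 0), (\<lambda>i. if i = 0 then -1 else 0)}"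
    if "x \<in> topspace (nsphere 0)" for x
  proof -
    have "(x 0)\<^sup>2 = 1" "\<forall>i>0. x i = 0" using that by (auto simp: topspace_nsphere)
    then show ?thesis by (auto simp: power2_eq_1_iff fun_eq_iff)
  qed
  then have "finite (topspace (nsphere 0))" by (meson finite.emptyI finite.insertI finite_subset subsetI)
  then show ?case by (simp add: compact_space_def finite_imp_compactin)
next
  case (Suc n)
  have "compact_space (prod_topology (top_of_set {0..1::real}) (nsphere n))"
    using Suc by (simp add: compact_space_prod_topology compact_space_subtopology)
  then have "compactin (nsphere (Suc n)) (topspace (nsphere (Suc n)))"
    using image_compactin[OF _ continuous_map_suspend[of n]] suspend_surj[of n]
    by (metis compact_space_def)
  then show ?case by (simp add: compact_space_def)
qed

lemma Hausdorff_space_nsphere: "Hausdorff_space (nsphere n)"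
  unfolding nsphere by (intro Hausdorff_space_subtopology) (simp add: Hausdorff_space_product_topology)

text \<open>The 0-sphere is disconnected, so the induction starts at the circle, the image of the
  real line under cosine and sine.\<close>

lemma connected_space_nsphere: "connected_space (nsphere (Suc n))"
proof (induction n)
  case 0
  define f :: "real \<Rightarrow> nat \<Rightarrow> real"
    where "f s i = (if i = 0 then cos s else if i = 1 then sin s else 0)" for s i
  have "continuous_map euclideanreal (powertop_real UNIV) f"
    unfolding continuous_map_componentwise_UNIV
  proof
    fix k show "continuous_map euclideanreal euclideanreal (\<lambda>x. f x k)"
      by (cases "k = 0"; cases "k = 1") (simp_all add: f_def continuous_on_cos continuous_on_sin)
  qed
  then have "continuous_map euclideanreal (nsphere 1) f"
    unfolding nsphere by (intro continuous_map_into_subtopology) (auto simp: f_def)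
  moreover have "f ` topspace euclideanreal = topspace (nsphere 1)"
  proof
    show "f ` topspace euclideanreal \<subseteq> topspace (nsphere 1)" by (auto simp: topspace_nsphere f_def)
    show "topspace (nsphere 1) \<subseteq> f ` topspace euclideanreal"
    proof
      fix x assume "x \<in> topspace (nsphere 1)"
      then have x: "(x 0)\<^sup>2 + (x 1)\<^sup>2 = 1" "\<forall>i>1. x i = 0" by (auto simp: topspace_nsphere)
      obtain s where "x 0 = cos s" "x 1 = sin s" using sincos_total_2pi[OF x(1)] by metis
      then have "x = f s" using x(2) by (auto simp: f_def fun_eq_iff)
      then show "x \<in> f ` topspace euclideanreal" by simp
    qed
  qed
  ultimately have "connectedin (nsphere 1) (topspace (nsphere 1))"
    using connectedin_continuous_map_image[of euclideanreal "nsphere 1" f "topspace euclideanreal"] by simp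
  then show ?case by (simp add: connectedin_topspace)
next
  case (Suc n)
  have "connected_space (top_of_set {0..1::real})"
    using connectedin_iff_connected[of "{0..1::real}"] by (simp add: connectedin_def)
  then have "connected_space (prod_topology (top_of_set {0..1::real}) (nsphere (Suc n)))"
    using Suc by (simp add: connected_space_prod_topology)
  then have "connectedin (nsphere (Suc (Suc n))) (topspace (nsphere (Suc (Suc n))))"
    unfolding suspend_surj[of "Suc n", symmetric]
    by (intro connectedin_continuous_map_image[OF continuous_map_suspend]) (simp only: connectedin_topspace)
  then show ?case by (simp add: connectedin_topspace)
qed

section \<open>Quotients of geodesic spaces by free isometric actions\<close>

text \<open>The uniform displacement bound \<open>\<epsilon>\<close> does the work of proper
  discontinuity: it makes the action free and keeps distinct points of one orbit at distance at
  least \<open>\<epsilon>\<close>, so that no evenly covered neighbourhoods have to be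
  chosen.\<close>

locale free_isometric_action = Metric_space M d + group G
  for M :: "'a set" and d and G (structure) +
  fixes act :: "'g \<Rightarrow> 'a \<Rightarrow> 'a" and \<epsilon> :: real
  assumes act_closed: "g \<in> carrier G \<Longrightarrow> e \<in> M \<Longrightarrow> act g e \<in> M"
    and act_mult: "g \<in> carrier G \<Longrightarrow> h \<in> carrier G \<Longrightarrow> e \<in> M \<Longrightarrow> act (g \<otimes> h) e = act g (act h e)"
    and act_one: "e \<in> M \<Longrightarrow> act \<one> e = e"
    and act_dist: "g \<in> carrier G \<Longrightarrow> e \<in> M \<Longrightarrow> e' \<in> M \<Longrightarrow> d (act g e) (act g e') = d e e'"
    and displacement: "g \<in> carrier G \<Longrightarrow> e \<in> M \<Longrightarrow> d e (act g e) < \<epsilon> \<Longrightarrow> g = \<one>"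
    and eps_pos: "0 < \<epsilon>"
begin

definition same_orbit :: "'a \<Rightarrow> 'a \<Rightarrow> bool" where
  "same_orbit e e' \<longleftrightarrow> (\<exists>g\<in>carrier G. e' = act g e)"

lemma act_inv: "g \<in> carrier G \<Longrightarrow> e \<in> M \<Longrightarrow> act (inv g) (act g e) = e"
  by (metis act_mult act_one inv_closed l_inv)

lemma same_orbit_refl: "e \<in> M \<Longrightarrow> same_orbit e e"
  unfolding same_orbit_def using act_one by (metis one_closed)

lemma same_orbit_sym: "e \<in> M \<Longrightarrow> same_orbit e e' \<Longrightarrow> same_orbit e' e"
  unfolding same_orbit_def using act_inv by (metis inv_closed)

lemma same_orbit_trans: "e \<in> M \<Longrightarrow> same_orbit e e' \<Longrightarrow> same_orbit e' e'' \<Longrightarrow> same_orbit e e''"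
  unfolding same_orbit_def using act_mult by (metis m_closed)

lemma act_inj: "g \<in> carrier G \<Longrightarrow> h \<in> carrier G \<Longrightarrow> e \<in> M \<Longrightarrow> act g e = act h e \<Longrightarrow> g = h"
proof -
  assume a: "g \<in> carrier G" "h \<in> carrier G" "e \<in> M" "act g e = act h e"
  have "act (inv h \<otimes> g) e = e" using a act_mult act_inv by simp
  then have "inv h \<otimes> g = \<one>" using a displacement[of "inv h \<otimes> g" e] eps_pos by simp
  then show "g = h" using a by (metis inv_closed inv_equality inv_inv)
qed

lemma near_unique: "e \<in> M \<Longrightarrow> same_orbit e e' \<Longrightarrow> d e e' < \<epsilon> \<Longrightarrow> e = e'"
  unfolding same_orbit_def using displacement act_one by force

text \<open>Two points of one orbit that are both within \<open>\<epsilon> / 2\<close> of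
  \<open>e\<close> coincide, so at most one point of the orbit of \<open>e'\<close> lies that close,
  and its distance is positive.\<close>

lemma orbits_apart:
  assumes "e \<in> M" "e' \<in> M" "\<not> same_orbit e e'"
  shows "\<exists>r>0. \<forall>g\<in>carrier G. r \<le> d e (act g e')"
proof (cases "\<exists>g\<in>carrier G. d e (act g e') < \<epsilon> / 2")
  case True
  then obtain g where g: "g \<in> carrier G" "d e (act g e') < \<epsilon> / 2" by blast
  have "d e (act h e') = d e (act g e')" if h: "h \<in> carrier G" "d e (act h e') < \<epsilon> / 2" for h
  proof -
    have "d (act g e') (act h e') < \<epsilon>"
      using triangle''[of "act g e'" e "act h e'"] g h assms act_closed by fastforce
    moreover have "same_orbit (act g e') (act h e')"
      using g h assms by (meson act_closed same_orbit_def same_orbit_sym same_orbit_trans)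
    ultimately show ?thesis using near_unique g assms act_closed by metis
  qed
  moreover have "0 < d e (act g e')"
  proof -
    have "e \<noteq> act g e'" using assms g by (metis same_orbit_def same_orbit_sym)
    then show ?thesis using assms g act_closed by simp
  qed
  ultimately show ?thesis using eps_pos
    by (intro exI[of _ "min (\<epsilon> / 2) (d e (act g e'))"]) force
next
  case False
  then show ?thesis using eps_pos by (intro exI[of _ "\<epsilon> / 2"]) (auto simp: not_less)
qed

text \<open>The gap to a single orbit depends on the point of \<open>K\<close>. Balls of half that
  radius cover \<open>K\<close>; because the action is isometric, a finite subcover gives one radius
  that works for all of \<open>K\<close>.\<close>

lemma closed_orbit_of_compact:
  assumes K: "compactin mtopology K"
  shows "closedin mtopology {e \<in> M. \<exists>k\<in>K. same_orbit k e}"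
proof -
  have KM: "K \<subseteq> M" using K compactin_subset_topspace by fastforce
  have "\<exists>r>0. mball e r \<subseteq> M - {e \<in> M. \<exists>k\<in>K. same_orbit k e}"
    if e: "e \<in> M" "\<not> (\<exists>k\<in>K. same_orbit k e)" for e
  proof -
    have "\<exists>r>0. \<forall>g\<in>carrier G. r \<le> d e (act g k)" if "k \<in> K" for k
      using that e KM by (intro orbits_apart) (use same_orbit_sym in blast)+
    then obtain r where r: "\<And>k. k \<in> K \<Longrightarrow> 0 < r k"
      "\<And>k g. k \<in> K \<Longrightarrow> g \<in> carrier G \<Longrightarrow> r k \<le> d e (act g k)" by metis
    have "\<exists>\<F>. finite \<F> \<and> \<F> \<subseteq> (\<lambda>k. mball k (r k / 2)) ` K \<and> K \<subseteq> \<Union>\<F>"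
      using K r(1) KM by (intro compactinD[OF K]) force+
    then obtain \<F> where \<F>: "finite \<F>" "\<F> \<subseteq> (\<lambda>k. mball k (r k / 2)) ` K" "K \<subseteq> \<Union>\<F>" by blast
    obtain F where F: "finite F" "F \<subseteq> K" "K \<subseteq> (\<Union>k\<in>F. mball k (r k / 2))"
      using finite_subset_image[OF \<F>(1,2)] \<F>(3) by blast
    define r0 where "r0 = Min (insert 1 ((\<lambda>k. r k / 2) ` F))"
    have r0: "0 < r0" "\<And>k. k \<in> F \<Longrightarrow> r0 \<le> r k / 2"
    proof -
      show "0 < r0" unfolding r0_def using F r(1) by auto
      show "r0 \<le> r k / 2" if "k \<in> F" for k
        unfolding r0_def using F that by (intro Min_le) auto
    qed
    have "e' \<notin> {e \<in> M. \<exists>k\<in>K. same_orbit k e}" if e': "e' \<in> mball e r0" for e'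
    proof
      assume "e' \<in> {e \<in> M. \<exists>k\<in>K. same_orbit k e}"
      then obtain k g where k: "k \<in> K" "g \<in> carrier G" "e' = act g k" by (auto simp: same_orbit_def)
      then obtain k' where k': "k' \<in> F" "k \<in> mball k' (r k' / 2)" using F(3) by blast
      have "r k' \<le> d e (act g k')" using r(2) k' F(2) k(2) by blast
      also have "\<dots> \<le> d e e' + d e' (act g k')"
        using triangle e' k' k F(2) KM act_closed by simp
      also have "d e' (act g k') = d k' k" using k k' by (simp add: act_dist commute)
      finally show False using e' k' r0(2)[OF k'(1)] by simp
    qed
    then show ?thesis using r0(1) by (intro exI[of _ r0]) auto
  qed
  then show ?thesis
    unfolding closedin_def openin_mtopology by auto
qed

text \<open>\<open>Y\<close> is meant to be the disjoint union of the cells of the quotient and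
  \<open>\<phi>\<close> their characteristic maps, whose images meet every orbit. The map
  \<open>p\<close> sends a point to the class of any cell point that lands in its orbit.\<close>

lemma orbit_space_quotient:
  assumes "compact_space Y" and q: "quotient_map Y X q" and \<phi>: "continuous_map Y mtopology \<phi>"
    and cover: "\<And>e. e \<in> M \<Longrightarrow> \<exists>y\<in>topspace Y. same_orbit (\<phi> y) e"
    and fib: "\<And>y y'. y \<in> topspace Y \<Longrightarrow> y' \<in> topspace Y \<Longrightarrow> q y = q y' \<longleftrightarrow> same_orbit (\<phi> y) (\<phi> y')"
  shows "\<exists>p. quotient_map mtopology X p \<and> (\<forall>e\<in>M. \<forall>e'\<in>M. p e = p e' \<longleftrightarrow> same_orbit e e')"
proof -
  define s where "s e = (SOME y. y \<in> topspace Y \<and> same_orbit (\<phi> y) e)" for e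
  have s: "s e \<in> topspace Y" "same_orbit (\<phi> (s e)) e" if "e \<in> M" for e
    using someI_ex[of "\<lambda>y. y \<in> topspace Y \<and> same_orbit (\<phi> y) e"] cover[OF that]
    unfolding s_def by auto
  have \<phi>M: "\<phi> y \<in> M" if "y \<in> topspace Y" for y
    using continuous_map_image_subset_topspace[OF \<phi>] that by auto
  define p where "p e = q (s e)" for e
  have pq: "p (\<phi> y) = q y" if "y \<in> topspace Y" for y
    unfolding p_def using that fib s \<phi>M by simp
  have pp: "p e = p e' \<longleftrightarrow> same_orbit e e'" if "e \<in> M" "e' \<in> M" for e e'
  proof -
    note s1 = s[OF that(1)] and s2 = s[OF that(2)]
    note m = \<phi>M[OF s1(1)] \<phi>M[OF s2(1)]
    have "same_orbit (\<phi> (s e)) (\<phi> (s e')) \<longleftrightarrow> same_orbit e e'"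
      using same_orbit_trans[OF m(1) s1(2)] same_orbit_trans[OF that(1) same_orbit_sym[OF m(1) s1(2)]]
        same_orbit_trans[OF m(1) _ s2(2)] same_orbit_trans[OF that(1) _ same_orbit_sym[OF m(2) s2(2)]]
        same_orbit_trans[OF m(1) _ same_orbit_sym[OF m(2) s2(2)]] by blast
    then show ?thesis unfolding p_def fib[OF s1(1) s2(1)] .
  qed
  have onto: "p ` M = topspace X"
  proof
    show "p ` M \<subseteq> topspace X"
      unfolding p_def using s(1) quotient_imp_surjective_map[OF q] by blast
    show "topspace X \<subseteq> p ` M"
    proof
      fix x assume "x \<in> topspace X"
      then obtain y where "y \<in> topspace Y" "x = q y"
        using quotient_imp_surjective_map[OF q] by auto
      then show "x \<in> p ` M" using pq[of y] \<phi>M[of y] by (intro image_eqI[of _ _ "\<phi> y"]) auto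
    qed
  qed
  have "quotient_map mtopology X p"
    unfolding quotient_map_def
  proof (intro conjI allI impI)
    show "p ` topspace mtopology = topspace X" using onto by simp
    fix U assume U: "U \<subseteq> topspace X"
    let ?P = "{e \<in> topspace mtopology. p e \<in> U}" and ?Q = "{y \<in> topspace Y. q y \<in> U}"
    have Q: "?Q = {y \<in> topspace Y. \<phi> y \<in> ?P}" using pq \<phi>M by auto
    have "openin mtopology ?P \<longleftrightarrow> openin Y ?Q"
    proof
      assume "openin mtopology ?P"
      then show "openin Y ?Q" unfolding Q by (rule openin_continuous_map_preimage[OF \<phi>])
    next
      \<comment> \<open>The complement of \<open>?Q\<close> is compact, so its image is compact and
        the union of the orbits meeting that image is closed; this union is the complement of
        \<open>?P\<close>.\<close>
      assume "openin Y ?Q"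
      then have "compactin Y (topspace Y - ?Q)"
        using \<open>compact_space Y\<close> by (intro closedin_compact_space) auto
      then have K: "compactin mtopology (\<phi> ` (topspace Y - ?Q))" by (rule image_compactin[OF _ \<phi>])
      have "{e \<in> M. \<exists>k\<in>\<phi> ` (topspace Y - ?Q). same_orbit k e} = M - ?P"
      proof (intro equalityI subsetI)
        fix e assume "e \<in> {e \<in> M. \<exists>k\<in>\<phi> ` (topspace Y - ?Q). same_orbit k e}"
        then obtain y where "e \<in> M" "y \<in> topspace Y" "q y \<notin> U" "same_orbit (\<phi> y) e" by auto
        then show "e \<in> M - ?P" using pq pp \<phi>M by (metis (mono_tags, lifting) DiffI mem_Collect_eq)
      next
        fix e assume "e \<in> M - ?P"
        then have "e \<in> M" "p e \<notin> U" by auto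
        then show "e \<in> {e \<in> M. \<exists>k\<in>\<phi> ` (topspace Y - ?Q). same_orbit k e}"
          using s[of e] by (auto simp: p_def)
      qed
      then have "closedin mtopology (M - ?P)" using closed_orbit_of_compact[OF K] by simp
      then have "openin mtopology (M - (M - ?P))" by (metis openin_diff open_in_mspace)
      moreover have "M - (M - ?P) = ?P" by auto
      ultimately show "openin mtopology ?P" by simp
    qed
    also have "\<dots> \<longleftrightarrow> openin X U" using q U by (simp add: quotient_map_def)
    finally show "openin mtopology ?P = openin X U" .
  qed
  then show ?thesis using pp by blast
qed

end

section \<open>Lifting of homotopies along the orbit map\<close>

locale covering_action = free_isometric_action +
  fixes X :: "'d topology" and p
  assumes p_quotient: "quotient_map mtopology X p"
    and p_iff: "e \<in> M \<Longrightarrow> e' \<in> M \<Longrightarrow> p e = p e' \<longleftrightarrow> same_orbit e e'"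
begin

lemma p_cont: "continuous_map mtopology X p"
  by (rule quotient_imp_continuous_map[OF p_quotient])

lemma p_in: "e \<in> M \<Longrightarrow> p e \<in> topspace X"
  using quotient_imp_surjective_map[OF p_quotient] by auto

lemma p_surj: "x \<in> topspace X \<Longrightarrow> \<exists>e\<in>M. p e = x"
  using quotient_imp_surjective_map[OF p_quotient] by (metis imageE topspace_mtopology)

lemma p_inj_near: "e \<in> M \<Longrightarrow> e' \<in> M \<Longrightarrow> p e = p e' \<Longrightarrow> d e e' < \<epsilon> \<Longrightarrow> e = e'"
  using near_unique p_iff by blast

text \<open>The preimage of the image is a union of translates of the ball, and it is open because
  the action is isometric; openness then descends by the quotient map.\<close>

lemma openin_p_mball: "openin X (p ` mball e r)"
proof -
  have "openin mtopology {x \<in> M. p x \<in> p ` mball e r}"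
    unfolding openin_mtopology
  proof (intro conjI allI impI)
    fix x assume x: "x \<in> {x \<in> M. p x \<in> p ` mball e r}"
    then obtain y g where y: "y \<in> mball e r" "g \<in> carrier G" "y = act g x"
      using p_iff[of x] unfolding same_orbit_def by fastforce
    define s where "s = r - d e y"
    have s: "0 < s" using y by (simp add: s_def)
    have "mball x s \<subseteq> {x \<in> M. p x \<in> p ` mball e r}"
    proof
      fix z assume z: "z \<in> mball x s"
      then have zM: "z \<in> M" "act g z \<in> M" "d y (act g z) < s"
        using y act_closed by (simp_all add: act_dist)
      then have "act g z \<in> mball e r"
        using triangle[of e y "act g z"] y zM by (simp add: s_def)
      moreover have "p z = p (act g z)" using zM p_iff y unfolding same_orbit_def by blast
      ultimately show "z \<in> {x \<in> M. p x \<in> p ` mball e r}" using zM by blast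
    qed
    then show "\<exists>s>0. mball x s \<subseteq> {x \<in> M. p x \<in> p ` mball e r}" using s by blast
  qed auto
  moreover have "p ` mball e r \<subseteq> topspace X" using p_in by auto
  ultimately show ?thesis using p_quotient by (simp add: quotient_map_def)
qed

text \<open>Distinct points of a fibre are at least \<open>\<epsilon>\<close> apart, so a lift of
  \<open>\<beta> z\<close> within \<open>\<epsilon> / 2\<close> of \<open>\<alpha> z\<close> is
  unique; even though it is chosen point by point, it is therefore continuous.\<close>

lemma lift_nearby:
  assumes \<alpha>: "continuous_map Z mtopology \<alpha>" and \<beta>: "continuous_map Z X \<beta>"
    and near: "\<And>z. z \<in> topspace Z \<Longrightarrow> \<exists>e\<in>M. d (\<alpha> z) e < \<epsilon> / 2 \<and> p e = \<beta> z"
  shows "\<exists>\<gamma>. continuous_map Z mtopology \<gamma> \<and> (\<forall>z\<in>topspace Z. p (\<gamma> z) = \<beta> z \<and> d (\<alpha> z) (\<gamma> z) < \<epsilon> / 2)"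
proof -
  obtain \<gamma> where \<gamma>: "\<And>z. z \<in> topspace Z \<Longrightarrow> \<gamma> z \<in> M \<and> d (\<alpha> z) (\<gamma> z) < \<epsilon> / 2 \<and> p (\<gamma> z) = \<beta> z"
    using near by metis
  have \<alpha>M: "\<alpha> z \<in> M" if "z \<in> topspace Z" for z
    using continuous_map_image_subset_topspace[OF \<alpha>] that by auto
  have "continuous_map Z mtopology \<gamma>"
    unfolding continuous_map_to_metric
  proof (intro ballI allI impI)
    fix z0 and r :: real assume z0: "z0 \<in> topspace Z" and r: "0 < r"
    \<comment> \<open>The slack left below \<open>\<epsilon> / 2\<close> is shared between the
      movement of \<open>\<alpha>\<close> and that of the lift, so that the fibre point
      \<open>e\<close> found below stays within \<open>\<epsilon>\<close> of
      \<open>\<gamma> z\<close>.\<close>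
    define s where "s = min r ((\<epsilon> / 2 - d (\<alpha> z0) (\<gamma> z0)) / 2)"
    have s: "0 < s" "s \<le> r" "d (\<alpha> z0) (\<gamma> z0) + 2 * s \<le> \<epsilon> / 2"
      using \<gamma>[OF z0] r by (auto simp: s_def min_def field_simps)
    define N where "N = {z \<in> topspace Z. \<alpha> z \<in> mball (\<alpha> z0) s} \<inter> {z \<in> topspace Z. \<beta> z \<in> p ` mball (\<gamma> z0) s}"
    have "openin Z N" unfolding N_def
      using openin_continuous_map_preimage[OF \<alpha> openin_mball[of "\<alpha> z0" s]]
        openin_continuous_map_preimage[OF \<beta> openin_p_mball[of "\<gamma> z0" s]] by blast
    moreover have "\<beta> z0 \<in> p ` mball (\<gamma> z0) s"
      using \<gamma>[OF z0] s by (intro image_eqI[of _ _ "\<gamma> z0"]) auto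
    then have "z0 \<in> N" unfolding N_def using \<alpha>M z0 s by simp
    moreover have "\<gamma> z \<in> mball (\<gamma> z0) r" if z: "z \<in> N" for z
    proof -
      obtain e where e: "e \<in> M" "d (\<gamma> z0) e < s" "p e = \<beta> z"
        using z unfolding N_def by auto
      have zz: "z \<in> topspace Z" "d (\<alpha> z0) (\<alpha> z) < s" using z unfolding N_def by auto
      note m = \<gamma>[OF zz(1)] \<gamma>[OF z0] \<alpha>M[OF zz(1)] \<alpha>M[OF z0]
      have "d (\<alpha> z) e \<le> d (\<alpha> z0) (\<alpha> z) + (d (\<alpha> z0) (\<gamma> z0) + d (\<gamma> z0) e)"
        using triangle[of "\<alpha> z0" "\<gamma> z0" e] triangle''[of "\<alpha> z" "\<alpha> z0" e] m e by simp
      then have "d (\<gamma> z) e < \<epsilon>"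
        using triangle''[of "\<gamma> z" "\<alpha> z" e] m e s zz by simp
      then have "\<gamma> z = e" using p_inj_near m e by simp
      then show ?thesis using e s m by simp
    qed
    ultimately show "\<exists>U. openin Z U \<and> z0 \<in> U \<and> (\<forall>y\<in>U. \<gamma> y \<in> mball (\<gamma> z0) r)" by blast
  qed
  then show ?thesis using \<gamma> by blast
qed

text \<open>The radius \<open>\<epsilon> / 8\<close> lets points of a common ball lift to distance
  below \<open>\<epsilon> / 4\<close>; two such steps in succession stay below the
  \<open>\<epsilon> / 2\<close> that \<open>lift_nearby\<close> requires.\<close>

definition close :: "'d \<Rightarrow> 'd \<Rightarrow> bool" where
  "close x x' \<longleftrightarrow> (\<exists>e\<in>M. x \<in> p ` mball e (\<epsilon> / 8) \<and> x' \<in> p ` mball e (\<epsilon> / 8))"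

lemma close_lift:
  assumes "close (p e) x" "e \<in> M" shows "\<exists>e'\<in>M. d e e' < \<epsilon> / 4 \<and> p e' = x"
proof -
  obtain c u v where c: "c \<in> M" "u \<in> M" "v \<in> M" "d c u < \<epsilon> / 8" "d c v < \<epsilon> / 8" "p u = p e" "p v = x"
    using assms(1) unfolding close_def by auto
  obtain g where g: "g \<in> carrier G" "e = act g u" using p_iff c assms unfolding same_orbit_def by metis
  have "d e (act g v) = d u v" using g c by (simp add: act_dist)
  also have "\<dots> < \<epsilon> / 4" using triangle''[of u c v] c by simp
  finally have "d e (act g v) < \<epsilon> / 4" .
  moreover have "p (act g v) = x" using p_iff[of v "act g v"] c g act_closed unfolding same_orbit_def by metis
  ultimately show ?thesis using act_closed g c by blast
qed

lemma close_refl: "x \<in> topspace X \<Longrightarrow> close x x"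
  unfolding close_def using p_surj eps_pos by (metis centre_in_mball_iff image_eqI zero_less_divide_iff zero_less_numeral)

lemma close_sym: "close x y \<Longrightarrow> close y x"
  unfolding close_def by auto

lemma openin_close:
  assumes f: "continuous_map Z X f" and g: "continuous_map Z X g"
  shows "openin Z {z \<in> topspace Z. close (f z) (g z)}"
proof -
  have "{z \<in> topspace Z. close (f z) (g z)} =
      (\<Union>e\<in>M. {z \<in> topspace Z. f z \<in> p ` mball e (\<epsilon> / 8)} \<inter> {z \<in> topspace Z. g z \<in> p ` mball e (\<epsilon> / 8)})"
    unfolding close_def by auto
  then show ?thesis
    using openin_continuous_map_preimage[OF f openin_p_mball] openin_continuous_map_preimage[OF g openin_p_mball]
    by (auto intro!: openin_Union openin_Int)
qed

text \<open>Within one fibre, distance below \<open>\<epsilon>\<close> and distance 0 mean the same.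
  By the first description the set of agreement is open, by the second it is closed.\<close>

lemma lift_unique:
  assumes "connected_space Z" "continuous_map Z mtopology \<alpha>" "continuous_map Z mtopology \<beta>"
    and eq: "\<And>z. z \<in> topspace Z \<Longrightarrow> p (\<alpha> z) = p (\<beta> z)"
    and z0: "z0 \<in> topspace Z" "\<alpha> z0 = \<beta> z0" and z: "z \<in> topspace Z"
  shows "\<alpha> z = \<beta> z"
proof -
  have M: "\<alpha> z \<in> M" "\<beta> z \<in> M" if "z \<in> topspace Z" for z
    using continuous_map_image_subset_topspace[OF assms(2)] continuous_map_image_subset_topspace[OF assms(3)] that by auto
  have "continuous_map Z euclidean (\<lambda>z. mdist (metric (M, d)) (\<alpha> z) (\<beta> z))"
    using assms by (intro continuous_map_mdist) simp_all
  then have c: "continuous_map Z euclideanreal (\<lambda>z. d (\<alpha> z) (\<beta> z))" by simp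
  let ?T = "{z \<in> topspace Z. \<alpha> z = \<beta> z}"
  have "?T = {z \<in> topspace Z. d (\<alpha> z) (\<beta> z) \<in> {..<\<epsilon>}}"
    using M eq eps_pos p_inj_near by auto
  then have "openin Z ?T" using openin_continuous_map_preimage[OF c, of "{..<\<epsilon>}"] by simp
  moreover have "?T = {z \<in> topspace Z. d (\<alpha> z) (\<beta> z) \<in> {0}}"
    using M by auto
  then have "closedin Z ?T" using closedin_continuous_map_preimage[OF c, of "{0}"] by simp
  ultimately show ?thesis
    using assms(1) z0 z unfolding connected_space_clopen_in by blast
qed

text \<open>Over a short time interval the initial lift, held constant in time, is close enough for
  \<open>lift_nearby\<close>. The tube lemma for the compact space \<open>Y\<close> makes the length
  of the interval uniform in \<open>y\<close>, and \<open>Bolzano\<close> assembles the unit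
  interval from such pieces.\<close>

lemma homotopy_lift:
  assumes Y: "compact_space Y"
    and H: "continuous_map (prod_topology (top_of_set {0..1::real}) Y) X H"
    and h: "continuous_map Y mtopology h0" "\<And>y. y \<in> topspace Y \<Longrightarrow> p (h0 y) = H (0, y)"
  shows "\<exists>h. continuous_map (prod_topology (top_of_set {0..1}) Y) mtopology h \<and>
     (\<forall>t\<in>{0..1}. \<forall>y\<in>topspace Y. p (h (t, y)) = H (t, y)) \<and> (\<forall>y\<in>topspace Y. h (0, y) = h0 y)"
proof -
  define T where "T a b = prod_topology (top_of_set {a..b::real}) Y" for a b
  have Tsub: "T a b = subtopology (prod_topology euclideanreal Y) ({a..b} \<times> topspace Y)" for a b
    unfolding T_def by (simp add: prod_topology_subtopology)
  have topT: "topspace (T a b) = {a..b} \<times> topspace Y" for a b by (simp add: T_def)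
  have Tmono: "continuous_map (T a b) W f \<Longrightarrow> a \<le> a' \<Longrightarrow> b' \<le> b \<Longrightarrow> continuous_map (T a' b') W f"
    for a b a' b' W f
    unfolding Tsub by (erule continuous_map_from_subtopology_mono) auto
  \<comment> \<open>The property quantifies over every initial lift at time \<open>a\<close>, so
    that the second of two adjacent intervals can start where the first one ended.\<close>
  define P where "P a b \<longleftrightarrow> (0 \<le> a \<longrightarrow> b \<le> 1 \<longrightarrow> a \<le> b \<longrightarrow>
     (\<forall>h0. continuous_map Y mtopology h0 \<and> (\<forall>y\<in>topspace Y. p (h0 y) = H (a, y)) \<longrightarrow>
       (\<exists>h. continuous_map (T a b) mtopology h \<and>
          (\<forall>t\<in>{a..b}. \<forall>y\<in>topspace Y. p (h (t, y)) = H (t, y)) \<and> (\<forall>y\<in>topspace Y. h (a, y) = h0 y))))"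
    for a b
  have "P 0 1"
  proof (rule Bolzano)
    show "(0::real) \<le> 1" by simp
  next
    fix a b c assume ab: "P a b" and bc: "P b c" and le: "a \<le> b" "b \<le> c"
    show "P a c" unfolding P_def
    proof (intro impI allI)
      fix h0 assume 01: "0 \<le> a" "c \<le> 1" "a \<le> c"
        and h0: "continuous_map Y mtopology h0 \<and> (\<forall>y\<in>topspace Y. p (h0 y) = H (a, y))"
      obtain h1 where h1: "continuous_map (T a b) mtopology h1"
        "\<And>t y. t \<in> {a..b} \<Longrightarrow> y \<in> topspace Y \<Longrightarrow> p (h1 (t, y)) = H (t, y)"
        "\<And>y. y \<in> topspace Y \<Longrightarrow> h1 (a, y) = h0 y"
        using ab h0 01 le unfolding P_def by auto
      have "continuous_map Y (T a b) (Pair b)"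
        unfolding T_def using le by (auto simp: continuous_map_pairwise o_def)
      then have "continuous_map Y mtopology (\<lambda>y. h1 (b, y))"
        using continuous_map_compose[OF _ h1(1)] by (fastforce simp: o_def)
      then obtain h2 where h2: "continuous_map (T b c) mtopology h2"
        "\<And>t y. t \<in> {b..c} \<Longrightarrow> y \<in> topspace Y \<Longrightarrow> p (h2 (t, y)) = H (t, y)"
        "\<And>y. y \<in> topspace Y \<Longrightarrow> h2 (b, y) = h1 (b, y)"
        using bc h1(2)[of b] 01 le unfolding P_def by auto
      define h where "h z = (if fst z \<le> b then h1 z else h2 z)" for z
      have "continuous_map (T a c) mtopology h" unfolding h_def
      proof (rule continuous_map_cases_le)
        show "continuous_map (T a c) euclideanreal fst"
          unfolding T_def using continuous_map_fst continuous_map_in_subtopology by blast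
        have "subtopology (T a c) {x \<in> topspace (T a c). fst x \<le> b} = T a b"
          using le unfolding Tsub subtopology_subtopology by (intro arg_cong2[where f=subtopology]) auto
        then show "continuous_map (subtopology (T a c) {x \<in> topspace (T a c). fst x \<le> b}) mtopology h1"
          using h1 by simp
        have "subtopology (T a c) {x \<in> topspace (T a c). b \<le> fst x} = T b c"
          using le unfolding Tsub subtopology_subtopology by (intro arg_cong2[where f=subtopology]) auto
        then show "continuous_map (subtopology (T a c) {x \<in> topspace (T a c). b \<le> fst x}) mtopology h2"
          using h2 by simp
      qed (auto simp: topT h2(3))
      moreover have "\<forall>t\<in>{a..c}. \<forall>y\<in>topspace Y. p (h (t, y)) = H (t, y)"
        using h1(2) h2(2) by (auto simp: h_def)
      moreover have "\<forall>y\<in>topspace Y. h (a, y) = h0 y" using h1(3) le by (auto simp: h_def)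
      ultimately show "\<exists>h. continuous_map (T a c) mtopology h \<and>
          (\<forall>t\<in>{a..c}. \<forall>y\<in>topspace Y. p (h (t, y)) = H (t, y)) \<and> (\<forall>y\<in>topspace Y. h (a, y) = h0 y)"
        by blast
    qed
  next
    fix x :: real assume x: "0 \<le> x" "x \<le> 1"
    let ?W = "{z \<in> topspace (T 0 1). close (H (x, snd z)) (H z)}"
    have HT: "continuous_map (T 0 1) X H" using H unfolding T_def .
    have "continuous_map (T 0 1) (T 0 1) (\<lambda>z. (x, snd z))"
      unfolding T_def using x by (auto simp: continuous_map_pairwise o_def intro: continuous_map_snd)
    then have Hx: "continuous_map (T 0 1) X (\<lambda>z. H (x, snd z))"
      using continuous_map_compose[OF _ HT] by (fastforce simp: o_def)
    have W: "openin (T 0 1) ?W" by (rule openin_close[OF Hx HT])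
    have Hin: "H z \<in> topspace X" if "z \<in> topspace (T 0 1)" for z
      using continuous_map_image_subset_topspace[OF HT] that by auto
    have "\<exists>U V. openin (top_of_set {0..1}) U \<and> openin Y V \<and> x \<in> U \<and> topspace Y \<subseteq> V \<and> U \<times> V \<subseteq> ?W"
      using W[unfolded T_def] Y x Hin
      by (intro tube_lemma_right) (auto simp: compact_space_def T_def intro!: close_refl)
    then obtain U where U: "openin (top_of_set {0..1}) U" "x \<in> U"
      "\<And>t y. t \<in> U \<Longrightarrow> y \<in> topspace Y \<Longrightarrow> close (H (x, y)) (H (t, y))" by (force simp: subset_iff)
    obtain \<delta> where \<delta>: "0 < \<delta>" "\<And>t. t \<in> {0..1} \<Longrightarrow> \<bar>t - x\<bar> < \<delta> \<Longrightarrow> t \<in> U"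
      using U(1,2) unfolding openin_euclidean_subtopology_iff dist_real_def by blast
    have "P a b" if ab: "a \<le> x" "x \<le> b" "b - a < \<delta>" for a b
      unfolding P_def
    proof (intro impI allI)
      fix h0 assume 01: "0 \<le> a" "b \<le> 1" "a \<le> b"
        and h0: "continuous_map Y mtopology h0 \<and> (\<forall>y\<in>topspace Y. p (h0 y) = H (a, y))"
      have h0M: "h0 y \<in> M" if "y \<in> topspace Y" for y
        using h0 that continuous_map_image_subset_topspace by fastforce
      have inU: "t \<in> U" if "t \<in> {a..b}" for t using \<delta>(2)[of t] that ab 01 by auto
      have 1: "continuous_map (T a b) mtopology (\<lambda>z. h0 (snd z))"
        unfolding T_def using h0 continuous_map_compose[OF continuous_map_snd, of Y mtopology h0]
        by (simp add: o_def)
      have 2: "continuous_map (T a b) X H" using Tmono[OF HT] 01 by simp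
      have "\<exists>e\<in>M. d (h0 (snd z)) e < \<epsilon> / 2 \<and> p e = H z" if "z \<in> topspace (T a b)" for z
      proof -
        obtain t y where z: "z = (t, y)" "t \<in> {a..b}" "y \<in> topspace Y" using \<open>z \<in> topspace (T a b)\<close> topT by auto
        \<comment> \<open>Closeness is known only in comparison with the time \<open>x\<close> at
          which the tube was taken, so the point is moved from time \<open>a\<close> to
          \<open>x\<close> and then from \<open>x\<close> to \<open>t\<close>.\<close>
        have "close (p (h0 y)) (H (x, y))" using U(3)[OF inU[of a] z(3)] h0 z(3) 01 close_sym by auto
        then obtain e1 where e1: "e1 \<in> M" "d (h0 y) e1 < \<epsilon> / 4" "p e1 = H (x, y)"
          using close_lift h0M z by blast
        have "close (p e1) (H (t, y))" using U(3)[OF inU[of t] z(3)] e1 z by simp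
        then obtain e2 where e2: "e2 \<in> M" "d e1 e2 < \<epsilon> / 4" "p e2 = H (t, y)"
          using close_lift e1 by blast
        then show ?thesis using triangle[OF h0M[OF z(3)] e1(1) e2(1)] e1 z by (intro bexI[of _ e2]) auto
      qed
      from lift_nearby[OF 1 2 this] obtain h where h: "continuous_map (T a b) mtopology h"
        "\<And>z. z \<in> topspace (T a b) \<Longrightarrow> p (h z) = H z \<and> d (h0 (snd z)) (h z) < \<epsilon> / 2" by blast
      have hM: "h z \<in> M" if "z \<in> topspace (T a b)" for z
        using h(1) that continuous_map_image_subset_topspace by fastforce
      \<comment> \<open>The lift starts within \<open>\<epsilon> / 2\<close> of \<open>h0\<close>
        and over the same point, hence exactly at \<open>h0\<close>.\<close>
      have "h (a, y) = h0 y" if y: "y \<in> topspace Y" for y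
        using h(2)[of "(a, y)"] hM[of "(a, y)"] h0 h0M[OF y] y 01 eps_pos p_inj_near[of "h0 y" "h (a, y)"] topT by simp
      then show "\<exists>h. continuous_map (T a b) mtopology h \<and>
          (\<forall>t\<in>{a..b}. \<forall>y\<in>topspace Y. p (h (t, y)) = H (t, y)) \<and> (\<forall>y\<in>topspace Y. h (a, y) = h0 y)"
        using h topT by (intro exI[of _ h]) auto
    qed
    then show "\<exists>\<delta>>0. \<forall>a b. a \<le> x \<and> x \<le> b \<and> b - a < \<delta> \<longrightarrow> P a b" using \<delta>(1) by blast
  qed
  then show ?thesis using h unfolding P_def T_def by simp
qed

end

section \<open>The homotopy groups of the orbit space\<close>

locale geodesic_covering = covering_action +
  fixes c :: "'a \<Rightarrow> 'a \<Rightarrow> real \<Rightarrow> 'a"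
  assumes c_cont: "continuous_map (prod_topology mtopology (prod_topology mtopology (top_of_set {0..1})))
      mtopology (\<lambda>(e, e', t). c e e' t)"
    and c_0: "e \<in> M \<Longrightarrow> e' \<in> M \<Longrightarrow> c e e' 0 = e"
    and c_1: "e \<in> M \<Longrightarrow> e' \<in> M \<Longrightarrow> c e e' 1 = e'"
    and c_same: "e \<in> M \<Longrightarrow> t \<in> {0..1} \<Longrightarrow> c e e t = e"
    and M_nonempty: "M \<noteq> {}"
begin

lemma c_comp:
  assumes "continuous_map Z mtopology f" "continuous_map Z mtopology g" "continuous_map Z (top_of_set {0..1}) \<theta>"
  shows "continuous_map Z mtopology (\<lambda>z. c (f z) (g z) (\<theta> z))"
proof -
  have "continuous_map Z (prod_topology mtopology (prod_topology mtopology (top_of_set {0..1})))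
      (\<lambda>z. (f z, g z, \<theta> z))"
    using assms by (simp add: continuous_map_pairwise o_def)
  from continuous_map_compose[OF this c_cont] show ?thesis by (simp add: o_def)
qed

lemma continuous_map_p_c:
  assumes "continuous_map Z mtopology f" "continuous_map Z mtopology g" "continuous_map Z (top_of_set {0..1}) \<theta>"
  shows "continuous_map Z X (\<lambda>z. p (c (f z) (g z) (\<theta> z)))"
  using continuous_map_compose[OF c_comp[OF assms] p_cont] by (simp add: o_def)

lemma path_connected_M: "path_connected_space mtopology"
  unfolding path_connected_space_def pathin_def
proof (intro ballI)
  fix x y assume "x \<in> topspace mtopology" "y \<in> topspace mtopology"
  then have "continuous_map (top_of_set {0..1}) mtopology (\<lambda>t. c x y t)" "c x y 0 = x" "c x y 1 = y"
    by (auto simp: c_0 c_1 intro!: c_comp)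
  then show "\<exists>g. continuous_map (top_of_set {0..1::real}) mtopology g \<and> g 0 = x \<and> g 1 = y"
    by blast
qed

definition lifts :: "'a \<Rightarrow> (real \<Rightarrow> 'd) \<Rightarrow> (real \<Rightarrow> 'a) \<Rightarrow> bool" where
  "lifts e \<omega> \<l> \<longleftrightarrow> pathin mtopology \<l> \<and> (\<forall>t\<in>{0..1}. p (\<l> t) = \<omega> t) \<and> \<l> 0 = e"

lemma lifts_in: "lifts e \<omega> \<l> \<Longrightarrow> t \<in> {0..1} \<Longrightarrow> \<l> t \<in> M"
  unfolding lifts_def pathin_def using continuous_map_image_subset_topspace by fastforce

lemma lifts_exists:
  assumes "pathin X \<omega>" "e \<in> M" "p e = \<omega> 0"
  shows "\<exists>\<l>. lifts e \<omega> \<l>"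
proof -
  \<comment> \<open>A path is a homotopy of maps from the one-point space.\<close>
  let ?Y = "discrete_topology {()}"
  have "compact_space ?Y" by (simp add: compact_space_discrete_topology)
  moreover have "continuous_map (prod_topology (top_of_set {0..1}) ?Y) X (\<lambda>z. \<omega> (fst z))"
    using continuous_map_compose[OF continuous_map_fst assms(1)[unfolded pathin_def]] by (simp add: o_def)
  ultimately obtain h where h: "continuous_map (prod_topology (top_of_set {0..1}) ?Y) mtopology h"
    "\<forall>t\<in>{0..1}. \<forall>y\<in>topspace ?Y. p (h (t, y)) = \<omega> (fst (t, y))" "\<forall>y\<in>topspace ?Y. h (0, y) = e"
    using homotopy_lift[of ?Y "\<lambda>z. \<omega> (fst z)" "\<lambda>_. e"] assms by auto
  have "continuous_map (top_of_set {0..1}) (prod_topology (top_of_set {0..1}) ?Y) (\<lambda>t. (t, ()))"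
    by (simp add: continuous_map_pairwise o_def)
  from continuous_map_compose[OF this h(1)] have "pathin mtopology (\<lambda>t. h (t, ()))"
    by (simp add: pathin_def o_def)
  then show ?thesis using h(2,3) by (intro exI[of _ "\<lambda>t. h (t, ())"]) (simp add: lifts_def)
qed

lemma connected_interval: "connected_space (top_of_set {0..1::real})"
  using connectedin_iff_connected[of "{0..1::real}"] by (simp add: connectedin_def)

lemma lifts_unique:
  assumes "lifts e \<omega> \<l>" "lifts e \<omega> \<l>'" "t \<in> {0..1}" shows "\<l> t = \<l>' t"
proof (rule lift_unique[OF connected_interval])
  show "continuous_map (top_of_set {0..1}) mtopology \<l>" "continuous_map (top_of_set {0..1}) mtopology \<l>'"
    using assms unfolding lifts_def pathin_def by auto
  show "\<l> 0 = \<l>' 0" using assms by (simp add: lifts_def)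
qed (use assms in \<open>auto simp: lifts_def\<close>)

text \<open>This is the monodromy of the loop: the group element that carries \<open>e\<close> to
  the end of the lift starting at \<open>e\<close>.\<close>

definition deck :: "'a \<Rightarrow> (real \<Rightarrow> 'd) \<Rightarrow> 'b" where
  "deck e \<omega> = (THE g. g \<in> carrier G \<and> (\<exists>\<l>. lifts e \<omega> \<l> \<and> \<l> 1 = act g e))"

lemma deck_eqI:
  assumes "e \<in> M" "lifts e \<omega> \<l>" "g \<in> carrier G" "\<l> 1 = act g e"
  shows "deck e \<omega> = g"
  unfolding deck_def
proof (rule the_equality)
  fix h assume h: "h \<in> carrier G \<and> (\<exists>\<l>. lifts e \<omega> \<l> \<and> \<l> 1 = act h e)"
  then obtain \<l>' where "lifts e \<omega> \<l>'" "\<l>' 1 = act h e" by blast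
  then have "act h e = act g e" using lifts_unique[OF assms(2), of \<l>' 1] assms(4) by simp
  then show "h = g" using act_inj h assms by blast
qed (use assms in blast)

lemma deck_lift:
  assumes "e \<in> M" "\<omega> \<in> loops X (p e)"
  shows "deck e \<omega> \<in> carrier G" "\<exists>\<l>. lifts e \<omega> \<l> \<and> \<l> 1 = act (deck e \<omega>) e"
proof -
  obtain \<l> where \<l>: "lifts e \<omega> \<l>" using lifts_exists[of \<omega> e] assms by (auto simp: loops_def)
  have "p (\<l> 1) = p e" using \<l> assms by (simp add: lifts_def loops_def)
  then obtain g where "g \<in> carrier G" "\<l> 1 = act g e"
    using p_iff[of e "\<l> 1"] assms lifts_in[OF \<l>, of 1] unfolding same_orbit_def by auto
  then show "deck e \<omega> \<in> carrier G" "\<exists>\<l>. lifts e \<omega> \<l> \<and> \<l> 1 = act (deck e \<omega>) e"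
    using deck_eqI[OF assms(1) \<l>] \<l> by auto
qed

text \<open>Forwards, the two sides of a lifted homotopy lift constant paths, so they are constant
  and the lifts of both loops end at the same point. Backwards, equal ends let the geodesics
  \<open>c\<close> deform one lift into the other, and \<open>c_same\<close> keeps the ends fixed
  meanwhile.\<close>

lemma homotopic_iff_deck:
  assumes e: "e \<in> M" and \<omega>: "\<omega> \<in> loops X (p e)" "\<omega>' \<in> loops X (p e)"
  shows "homotopic_with (\<lambda>h. h 0 = p e \<and> h 1 = p e) (top_of_set {0..1}) X \<omega> \<omega>' \<longleftrightarrow>
     deck e \<omega> = deck e \<omega>'"
proof
  assume "homotopic_with (\<lambda>h. h 0 = p e \<and> h 1 = p e) (top_of_set {0..1}) X \<omega> \<omega>'"
  then obtain h where h: "continuous_map (prod_topology (top_of_set {0..1::real}) (top_of_set {0..1::real})) X h"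
    "\<And>s. h (0, s) = \<omega> s" "\<And>s. h (1, s) = \<omega>' s" "\<And>t. t \<in> {0..1} \<Longrightarrow> h (t, 0) = p e \<and> h (t, 1) = p e"
    unfolding homotopic_with_def by auto
  let ?I = "top_of_set {0..1::real}"
  obtain \<l> where \<l>: "lifts e \<omega> \<l>" "\<l> 1 = act (deck e \<omega>) e" using deck_lift[OF e \<omega>(1)] by blast
  have "compact_space ?I" by (simp add: compact_space_subtopology)
  moreover have "continuous_map ?I mtopology \<l>" "\<And>y. y \<in> topspace ?I \<Longrightarrow> p (\<l> y) = h (0, y)"
    using \<l>(1) h(2) by (auto simp: lifts_def pathin_def)
  ultimately obtain k where k: "continuous_map (prod_topology ?I ?I) mtopology k"
    "\<And>t s. t \<in> {0..1} \<Longrightarrow> s \<in> {0..1} \<Longrightarrow> p (k (t, s)) = h (t, s)" "\<And>s. s \<in> {0..1} \<Longrightarrow> k (0, s) = \<l> s"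
    using homotopy_lift[OF _ h(1), of \<l>] by auto
  have col: "continuous_map ?I mtopology (\<lambda>t. k (t, s))" if "s \<in> {0..1}" for s
  proof -
    have "continuous_map ?I (prod_topology ?I ?I) (\<lambda>t. (t, s))"
      using that by (simp del: prod_topology_subtopology_eu add: continuous_map_pairwise o_def)
    from continuous_map_compose[OF this k(1)] show ?thesis by (simp add: o_def)
  qed
  have side: "k (1, s) = \<l> s" if s: "s \<in> {0, 1}" for s
  proof -
    show ?thesis
    proof (rule lift_unique[OF connected_interval, where \<alpha> = "\<lambda>t. k (t, s)" and \<beta> = "\<lambda>_. \<l> s" and z = 1])
      show "continuous_map ?I mtopology (\<lambda>t. k (t, s))" using col s by auto
      have "\<l> s \<in> M" using lifts_in[OF \<l>(1)] s by auto
      then show "continuous_map ?I mtopology (\<lambda>_. \<l> s)" by simp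
      show "p (k (t, s)) = p (\<l> s)" if "t \<in> topspace ?I" for t
        using k(2)[of t s] k(2)[of 0 s] k(3)[of s] h(4)[of t] h(4)[of 0] s that by auto
      show "k (0, s) = \<l> s" using k(3) s by auto
    qed auto
  qed
  have "continuous_map ?I (prod_topology ?I ?I) (\<lambda>s. (1, s))"
    by (simp del: prod_topology_subtopology_eu add: continuous_map_pairwise o_def)
  from continuous_map_compose[OF this k(1)] have "pathin mtopology (\<lambda>s. k (1, s))"
    by (simp add: o_def pathin_def)
  then have "lifts e \<omega>' (\<lambda>s. k (1, s))"
    using k(2)[of 1] h(3) side[of 0] \<l>(1) by (simp add: lifts_def)
  then show "deck e \<omega> = deck e \<omega>'"
    using deck_eqI[OF e, of \<omega>' "\<lambda>s. k (1, s)" "deck e \<omega>"] side[of 1] \<l>(2) deck_lift(1)[OF e \<omega>(1)] by simp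
next
  assume eq: "deck e \<omega> = deck e \<omega>'"
  let ?I = "top_of_set {0..1::real}"
  obtain \<l> where \<l>: "lifts e \<omega> \<l>" "\<l> 1 = act (deck e \<omega>) e" using deck_lift[OF e \<omega>(1)] by blast
  obtain \<l>' where \<l>': "lifts e \<omega>' \<l>'" "\<l>' 1 = act (deck e \<omega>) e" using deck_lift[OF e \<omega>(2)] eq by auto
  have f: "continuous_map (prod_topology ?I ?I) ?I fst" "continuous_map (prod_topology ?I ?I) ?I snd"
    by (rule continuous_map_fst continuous_map_snd)+
  have "continuous_map (prod_topology ?I ?I) mtopology (\<lambda>z. \<l> (snd z))"
    "continuous_map (prod_topology ?I ?I) mtopology (\<lambda>z. \<l>' (snd z))"
    using continuous_map_compose[OF f(2)] \<l>(1) \<l>'(1) by (auto simp: lifts_def pathin_def o_def)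
  from continuous_map_p_c[OF this f(1)]
  have "continuous_map (prod_topology ?I ?I) X (\<lambda>z. p (c (\<l> (snd z)) (\<l>' (snd z)) (fst z)))" .
  moreover have "p (c (\<l> s) (\<l>' s) 0) = \<omega> s" "p (c (\<l> s) (\<l>' s) 1) = \<omega>' s" if "s \<in> {0..1}" for s
    using lifts_in[OF \<l>(1) that] lifts_in[OF \<l>'(1) that] \<l>(1) \<l>'(1) that
    by (auto simp: c_0 c_1 lifts_def)
  moreover have "\<l> 0 = e" "\<l>' 0 = e" using \<l> \<l>' by (auto simp: lifts_def)
  moreover have "p (act (deck e \<omega>) e) = p e"
    using p_iff[of e "act (deck e \<omega>) e"] e act_closed deck_lift(1)[OF e \<omega>(1)] by (auto simp: same_orbit_def)
  ultimately show "homotopic_with (\<lambda>h. h 0 = p e \<and> h 1 = p e) (top_of_set {0..1}) X \<omega> \<omega>'"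
    using e \<l>(2) \<l>'(2) act_closed deck_lift(1)[OF e \<omega>(1)]
    by (subst homotopic_with)
      (auto simp: c_same intro!: exI[of _ "\<lambda>z. p (c (\<l> (snd z)) (\<l>' (snd z)) (fst z))"])
qed

lemma loop_class_deck:
  assumes "e \<in> M" "\<omega> \<in> loops X (p e)"
  shows "loop_class X (p e) \<omega> = {\<omega>' \<in> loops X (p e). deck e \<omega>' = deck e \<omega>}"
  unfolding loop_class_def using homotopic_iff_deck[OF assms] by auto

lemma deck_surj:
  assumes e: "e \<in> M" and g: "g \<in> carrier G"
  shows "\<exists>\<omega>\<in>loops X (p e). deck e \<omega> = g"
proof -
  have ge: "act g e \<in> M" using assms act_closed by simp
  obtain \<l> where \<l>: "pathin mtopology \<l>" "\<l> 0 = e" "\<l> 1 = act g e"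
    using path_connected_M e ge unfolding path_connected_space_def by auto
  have "p (act g e) = p e" using p_iff[OF e ge] g by (auto simp: same_orbit_def)
  then have "(\<lambda>t. p (\<l> t)) \<in> loops X (p e)"
    using pathin_compose[OF \<l>(1) p_cont] \<l>(2,3) by (simp add: loops_def o_def)
  moreover have "deck e (\<lambda>t. p (\<l> t)) = g"
    using \<l> g e by (intro deck_eqI[of e _ \<l>]) (auto simp: lifts_def)
  ultimately show ?thesis by blast
qed

lemma pathin_concat:
  assumes "pathin T \<alpha>" "pathin T \<beta>" "\<alpha> 1 = \<beta> 0"
  shows "pathin T (loop_concat \<alpha> \<beta>)"
  unfolding pathin_def loop_concat_def
proof (rule continuous_map_cases_le)
  let ?I = "top_of_set {0..1::real}"
  show "continuous_map ?I euclideanreal (\<lambda>x. x)" by (simp add: continuous_map_from_subtopology)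
  have "continuous_map (subtopology ?I {x \<in> topspace ?I. x \<le> 1 / 2}) ?I (\<lambda>x. 2 * x)"
    by (auto simp: continuous_map_in_subtopology subtopology_subtopology intro!: continuous_intros)
  from continuous_map_compose[OF this assms(1)[unfolded pathin_def]]
  show "continuous_map (subtopology ?I {x \<in> topspace ?I. x \<le> 1 / 2}) T (\<lambda>x. \<alpha> (2 * x))" by (simp add: o_def)
  have "continuous_map (subtopology ?I {x \<in> topspace ?I. 1 / 2 \<le> x}) ?I (\<lambda>x. 2 * x - 1)"
    by (auto simp: continuous_map_in_subtopology subtopology_subtopology intro!: continuous_intros)
  from continuous_map_compose[OF this assms(2)[unfolded pathin_def]]
  show "continuous_map (subtopology ?I {x \<in> topspace ?I. 1 / 2 \<le> x}) T (\<lambda>x. \<beta> (2 * x - 1))" by (simp add: o_def)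
  show "\<alpha> (2 * x) = \<beta> (2 * x - 1)" if "x = 1 / 2" for x
    unfolding that using assms(3) by simp
qed auto

text \<open>The lift of the second loop has to start where the first lift ends, so it is translated
  by the deck element of the first loop. This puts the two elements into the order of the
  product.\<close>

lemma deck_concat:
  assumes e: "e \<in> M" and \<omega>: "\<omega> \<in> loops X (p e)" "\<omega>' \<in> loops X (p e)"
  shows "loop_concat \<omega> \<omega>' \<in> loops X (p e)" "deck e (loop_concat \<omega> \<omega>') = deck e \<omega> \<otimes> deck e \<omega>'"
proof -
  show "loop_concat \<omega> \<omega>' \<in> loops X (p e)"
    using \<omega> pathin_concat[of X \<omega> \<omega>'] by (simp add: loops_def loop_concat_def)
  let ?g = "deck e \<omega>" and ?g' = "deck e \<omega>'"
  note g = deck_lift(1)[OF e \<omega>(1)] and g' = deck_lift(1)[OF e \<omega>(2)]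
  obtain \<l> where \<l>: "lifts e \<omega> \<l>" "\<l> 1 = act ?g e" using deck_lift[OF e \<omega>(1)] by blast
  obtain \<l>' where \<l>': "lifts e \<omega>' \<l>'" "\<l>' 1 = act ?g' e" using deck_lift[OF e \<omega>(2)] by blast
  have "continuous_map mtopology mtopology (act ?g)"
    unfolding continuous_map_to_metric using g act_closed
    by (auto simp: act_dist intro!: exI[of _ "mball _ _"])
  then have "pathin mtopology (act ?g \<circ> \<l>')"
    using \<l>'(1) by (auto simp: lifts_def intro: pathin_compose)
  moreover have "p (act ?g (\<l>' t)) = \<omega>' t" if "t \<in> {0..1}" for t
  proof -
    have "p (\<l>' t) = p (act ?g (\<l>' t))"
      using p_iff[of "\<l>' t" "act ?g (\<l>' t)"] lifts_in[OF \<l>'(1) that] act_closed g by (auto simp: same_orbit_def)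
    then show ?thesis using \<l>'(1) that by (simp add: lifts_def)
  qed
  ultimately have "lifts e (loop_concat \<omega> \<omega>') (loop_concat \<l> (act ?g \<circ> \<l>'))"
    using \<l> \<l>' by (auto simp: lifts_def loop_concat_def intro!: pathin_concat)
  moreover have "loop_concat \<l> (act ?g \<circ> \<l>') 1 = act (?g \<otimes> ?g') e"
    using \<l>'(2) g g' e by (simp add: loop_concat_def act_mult)
  ultimately show "deck e (loop_concat \<omega> \<omega>') = ?g \<otimes> ?g'"
    using deck_eqI[OF e] g g' by blast
qed

lemma fundamental_group_iso:
  assumes e: "e \<in> M"
  shows "fundamental_group X (p e) \<cong> G"
proof -
  let ?x = "p e" let ?cl = "loop_class X (p e)"
  define f where "f A = deck e (SOME \<omega>. \<omega> \<in> A)" for A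
  have mem: "\<omega> \<in> ?cl \<omega>" if "\<omega> \<in> loops X ?x" for \<omega> using that loop_class_deck[OF e that] by simp
  have f: "f (?cl \<omega>) = deck e \<omega>" if "\<omega> \<in> loops X ?x" for \<omega>
  proof -
    have "(SOME \<omega>'. \<omega>' \<in> ?cl \<omega>) \<in> ?cl \<omega>" using someI[of "\<lambda>w. w \<in> ?cl \<omega>", OF mem[OF that]] .
    then show ?thesis unfolding f_def loop_class_deck[OF e that] by blast
  qed
  have mult: "(\<Union>p\<in>?cl \<omega>. \<Union>q\<in>?cl \<omega>'. ?cl (loop_concat p q)) = ?cl (loop_concat \<omega> \<omega>')"
    if w: "\<omega> \<in> loops X ?x" "\<omega>' \<in> loops X ?x" for \<omega> \<omega>'
  proof -
    have "?cl (loop_concat p q) = ?cl (loop_concat \<omega> \<omega>')" if "p \<in> ?cl \<omega>" "q \<in> ?cl \<omega>'" for p q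
      using that w by (simp add: loop_class_deck e deck_concat)
    then show ?thesis using mem w by blast
  qed
  have "f \<in> iso (fundamental_group X ?x) G"
    unfolding iso_def hom_def bij_betw_def
  proof (intro CollectI conjI ballI)
    show "f \<in> carrier (fundamental_group X ?x) \<rightarrow> carrier G"
      using f deck_lift(1)[OF e] by (auto simp: fundamental_group_def)
    show "f (A \<otimes>\<^bsub>fundamental_group X ?x\<^esub> B) = f A \<otimes> f B"
      if "A \<in> carrier (fundamental_group X ?x)" "B \<in> carrier (fundamental_group X ?x)" for A B
      using that mult f deck_concat[OF e] by (auto simp: fundamental_group_def)
    show "inj_on f (carrier (fundamental_group X ?x))"
    proof (rule inj_onI)
      fix A B assume "A \<in> carrier (fundamental_group X ?x)" "B \<in> carrier (fundamental_group X ?x)" "f A = f B"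
      then obtain \<omega> \<omega>' where "\<omega> \<in> loops X ?x" "A = ?cl \<omega>" "\<omega>' \<in> loops X ?x" "B = ?cl \<omega>'"
        "deck e \<omega> = deck e \<omega>'" using f by (auto simp: fundamental_group_def)
      then show "A = B" by (simp add: loop_class_deck e)
    qed
    show "f ` carrier (fundamental_group X ?x) = carrier G"
    proof
      show "f ` carrier (fundamental_group X ?x) \<subseteq> carrier G"
        using f deck_lift(1)[OF e] by (auto simp: fundamental_group_def)
      show "carrier G \<subseteq> f ` carrier (fundamental_group X ?x)"
      proof
        fix g assume "g \<in> carrier G"
        then obtain \<omega> where "\<omega> \<in> loops X ?x" "deck e \<omega> = g" using deck_surj[OF e] by blast
        then show "g \<in> f ` carrier (fundamental_group X ?x)"
          using f by (intro image_eqI[of _ _ "?cl \<omega>"]) (auto simp: fundamental_group_def)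
      qed
    qed
  qed
  then show ?thesis by (auto simp: is_iso_def)
qed

text \<open>Read through \<open>suspend\<close>, the sphere map is a homotopy that begins at a
  constant map and can be lifted. Once the lift descends to the sphere again, \<open>c\<close>
  contracts it to a point.\<close>

lemma sphere_null_homotopic:
  assumes f: "continuous_map (nsphere (Suc (Suc m))) X f"
  shows "\<exists>x\<in>topspace X. homotopic_with (\<lambda>_. True) (nsphere (Suc (Suc m))) X f (\<lambda>_. x)"
proof -
  let ?n = "Suc m" let ?S = "nsphere (Suc ?n)" let ?I = "top_of_set {0..1::real}"
  let ?Z = "prod_topology ?I (nsphere ?n)"
  note k = continuous_map_suspend[of ?n]
  have fk: "continuous_map ?Z X (\<lambda>z. f (suspend ?n z))"
    using continuous_map_compose[OF k f] by (simp add: o_def)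
  define y0 :: "nat \<Rightarrow> real" where "y0 = (\<lambda>n. if n = 0 then 1 else 0)"
  have y0: "y0 \<in> topspace (nsphere ?n)" using in_topspace_nsphere by (simp add: y0_def)
  have pole: "suspend ?n (s, y) = suspend ?n (s, y')" if "s \<in> {0, 1}" for s y y'
    using that by (auto simp: suspend_def fun_eq_iff)
  have "f (suspend ?n (0, y0)) \<in> topspace X"
    using continuous_map_image_subset_topspace[OF fk] y0 by (auto simp: image_subset_iff)
  then obtain e0 where e0: "e0 \<in> M" "p e0 = f (suspend ?n (0, y0))" using p_surj by blast
  obtain h where h: "continuous_map ?Z mtopology h"
    "\<And>t y. t \<in> {0..1} \<Longrightarrow> y \<in> topspace (nsphere ?n) \<Longrightarrow> p (h (t, y)) = f (suspend ?n (t, y))"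
    "\<And>y. y \<in> topspace (nsphere ?n) \<Longrightarrow> h (0, y) = e0"
  proof -
    have "p e0 = f (suspend ?n (0, y))" for y using e0(2) pole[of 0 y0 y] by simp
    moreover have "continuous_map (nsphere ?n) mtopology (\<lambda>_. e0)" using e0(1) by simp
    ultimately show ?thesis
      using homotopy_lift[OF compact_space_nsphere fk, of "\<lambda>_. e0"] that by blast
  qed
  have hM: "h z \<in> M" if "z \<in> topspace ?Z" for z
    using continuous_map_image_subset_topspace[OF h(1)] that by auto
  \<comment> \<open>The lifted homotopy ends with a map of the lower sphere into one fibre. It is
    constant because that sphere is connected, and this is where dimension at least two
    enters.\<close>
  have top: "h (1, y) = h (1, y0)" if y: "y \<in> topspace (nsphere ?n)" for y
  proof -
    show ?thesis
    proof (rule lift_unique[OF connected_space_nsphere, where \<alpha> = "\<lambda>y. h (1, y)" and \<beta> = "\<lambda>_. h (1, y0)" and z = y])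
      have "continuous_map (nsphere ?n) ?Z (\<lambda>y. (1, y))" by (simp add: continuous_map_pairwise o_def)
      from continuous_map_compose[OF this h(1)] show "continuous_map (nsphere ?n) mtopology (\<lambda>y. h (1, y))"
        by (simp add: o_def)
      show "continuous_map (nsphere ?n) mtopology (\<lambda>_. h (1, y0))" using hM[of "(1, y0)"] y0 by simp
      show "p (h (1, z)) = p (h (1, y0))" if "z \<in> topspace (nsphere ?n)" for z
        using h(2)[of 1 z] h(2)[of 1 y0] that y0 pole[of 1 z y0] by simp
    qed (use y y0 in auto)
  qed
  have "compact_space ?Z" by (simp add: compact_space_prod_topology compact_space_nsphere compact_space_subtopology)
  then have q: "quotient_map ?Z ?S (suspend ?n)"
    using k Hausdorff_space_nsphere suspend_surj by (intro continuous_imp_quotient_map) auto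
  have "h z = h z'" if zz: "z \<in> topspace ?Z" "z' \<in> topspace ?Z" "suspend ?n z = suspend ?n z'" for z z'
  proof -
    obtain s y s' y' where z: "z = (s, y)" "z' = (s', y')" by (cases z; cases z') auto
    have in01: "s \<in> {0..1}" "s' \<in> {0..1}" "y \<in> topspace (nsphere ?n)" "y' \<in> topspace (nsphere ?n)"
      using zz z by auto
    have "suspend ?n z (Suc ?n) = suspend ?n z' (Suc ?n)" using zz by simp
    then have s: "s = s'" by (simp add: suspend_def z)
    show ?thesis
    proof (cases "s \<in> {0, 1}")
      case True
      then show ?thesis using z s in01 h(3) top[of y] top[of y'] by auto
    next
      case False
      then have "0 < s" "s < 1" using in01 by auto
      then have "1 - (2 * s - 1)\<^sup>2 = 4 * (s * (1 - s))" "0 < s * (1 - s)"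
        by (simp_all add: power2_eq_square algebra_simps)
      then have "1 - (2 * s - 1)\<^sup>2 \<noteq> 0" by linarith
      have "y i = y' i" for i
      proof (cases "i = Suc ?n")
        case True then show ?thesis using in01 by (simp add: topspace_nsphere)
      next
        case False
        have "suspend ?n z i = suspend ?n z' i" using zz by simp
        then show ?thesis using False \<open>1 - (2 * s - 1)\<^sup>2 \<noteq> 0\<close> s by (simp add: suspend_def z)
      qed
      then have "y = y'" by (rule ext)
      then show ?thesis using z s by simp
    qed
  qed
  then obtain F where F: "continuous_map ?S mtopology F" "\<And>z. z \<in> topspace ?Z \<Longrightarrow> F (suspend ?n z) = h z"
    using quotient_map_lift_exists[OF q h(1)] by metis
  have pF: "p (F z) = f z" "F z \<in> M" if "z \<in> topspace ?S" for z
  proof -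
    show "F z \<in> M" using continuous_map_image_subset_topspace[OF F(1)] that by auto
    obtain t y where "t \<in> {0..1}" "y \<in> topspace (nsphere ?n)" "z = suspend ?n (t, y)"
      using \<open>z \<in> topspace ?S\<close> unfolding suspend_surj[of ?n, symmetric] by auto
    then show "p (F z) = f z" using F(2)[of "(t, y)"] h(2) by simp
  qed
  have "continuous_map (prod_topology ?I ?S) X (\<lambda>z. p (c (F (snd z)) e0 (fst z)))"
    using continuous_map_compose[OF continuous_map_snd F(1), of ?I] e0 continuous_map_fst[of ?I ?S]
    by (intro continuous_map_p_c) (simp_all add: o_def)
  then have "homotopic_with (\<lambda>_. True) ?S X f (\<lambda>_. p e0)"
    using pF e0 by (subst homotopic_with)
      (auto simp: c_0 c_1 intro!: exI[of _ "\<lambda>z. p (c (F (snd z)) e0 (fst z))"])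
  then show ?thesis using p_in e0 by blast
qed

theorem classifying_space_quotient: "classifying_space G X"
  unfolding classifying_space_def
proof (intro conjI allI impI ballI)
  obtain e where "e \<in> M" using M_nonempty by blast
  then show "topspace X \<noteq> {}" using p_in by blast
  show "path_connected_space X"
    by (rule path_connected_space_quotient_map_image[OF p_quotient path_connected_M])
  show "fundamental_group X x \<cong> G" if "x \<in> topspace X" for x
    using p_surj[OF that] fundamental_group_iso by auto
  fix n :: nat and f assume n: "2 \<le> n" and f: "continuous_map (nsphere n) X f"
  obtain m where "n = Suc (Suc m)" using n by (metis Suc_le_D numeral_2_eq_2 Suc_le_mono)
  then show "\<exists>x\<in>topspace X. homotopic_with (\<lambda>_. True) (nsphere n) X f (\<lambda>_. x)"
    using sphere_null_homotopic f by blast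
qed

end

section \<open>The geometric realization of a tree\<close>

text \<open>The axioms speak of distances only, so that words and lattice classes fit in without a
  notion of path. \<open>edge_step\<close> excludes vertices equidistant from the ends of an edge,
  and \<open>edge_cut\<close> says that every edge separates: vertices nearer to opposite ends are
  joined through it.\<close>

locale tree =
  fixes V :: "'v set" and Ed :: "('v \<times> 'v) set" and \<delta> :: "'v \<Rightarrow> 'v \<Rightarrow> nat"
  assumes \<delta>_0: "u \<in> V \<Longrightarrow> v \<in> V \<Longrightarrow> \<delta> u v = 0 \<longleftrightarrow> u = v"
    and \<delta>_sym: "u \<in> V \<Longrightarrow> v \<in> V \<Longrightarrow> \<delta> u v = \<delta> v u"
    and \<delta>_tri: "u \<in> V \<Longrightarrow> v \<in> V \<Longrightarrow> w \<in> V \<Longrightarrow> \<delta> u w \<le> \<delta> u v + \<delta> v w"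
    and Ed_iff: "(u, v) \<in> Ed \<longleftrightarrow> u \<in> V \<and> v \<in> V \<and> \<delta> u v = 1"
    and toward: "u \<in> V \<Longrightarrow> v \<in> V \<Longrightarrow> u \<noteq> v \<Longrightarrow> \<exists>u1. (u, u1) \<in> Ed \<and> \<delta> u v = Suc (\<delta> u1 v)"
    and edge_step: "(u, u1) \<in> Ed \<Longrightarrow> v \<in> V \<Longrightarrow> \<delta> u1 v = Suc (\<delta> u v) \<or> \<delta> u v = Suc (\<delta> u1 v)"
    and edge_cut: "(u, u1) \<in> Ed \<Longrightarrow> v \<in> V \<Longrightarrow> w \<in> V \<Longrightarrow> \<delta> u w = Suc (\<delta> u1 w) \<Longrightarrow>
        \<delta> u1 v = Suc (\<delta> u v) \<Longrightarrow> \<delta> w v = \<delta> u v + \<delta> u w"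
    and neighbour: "u \<in> V \<Longrightarrow> \<exists>w. (u, w) \<in> Ed"
    and V_nonempty: "V \<noteq> {}"
begin

lemma EdV: "(u, w) \<in> Ed \<Longrightarrow> u \<in> V \<and> w \<in> V"
  by (simp add: Ed_iff)

lemma Ed_sym: "(u, w) \<in> Ed \<Longrightarrow> (w, u) \<in> Ed"
  by (simp add: Ed_iff \<delta>_sym)

lemma Ed_neq: "(u, w) \<in> Ed \<Longrightarrow> u \<noteq> w"
  using \<delta>_0 by (force simp: Ed_iff)

text \<open>A point of the tree is encoded by its distances to the vertices.\<close>

definition pt :: "'v \<Rightarrow> 'v \<Rightarrow> real \<Rightarrow> 'v \<Rightarrow> real" where
  "pt u w s = (\<lambda>v. if v \<in> V then (1 - s) * real (\<delta> u v) + s * real (\<delta> w v) else 0)"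

definition vx :: "'v \<Rightarrow> 'v \<Rightarrow> real" where
  "vx u = (\<lambda>v. if v \<in> V then real (\<delta> u v) else 0)"

definition TR :: "('v \<Rightarrow> real) set" where
  "TR = {pt u w s | u w s. (u, w) \<in> Ed \<and> s \<in> {0..1}}"

text \<open>The outer absolute value provides the sign that \<open>Metric_space\<close> demands for
  arbitrary functions; for points of \<open>TR\<close> the supremum is nonnegative by
  itself.\<close>

definition supd :: "('v \<Rightarrow> real) \<Rightarrow> ('v \<Rightarrow> real) \<Rightarrow> real" where
  "supd f g = \<bar>SUP v\<in>V. \<bar>f v - g v\<bar>\<bar>"

lemma pt_in_TR: "(u, w) \<in> Ed \<Longrightarrow> s \<in> {0..1} \<Longrightarrow> pt u w s \<in> TR"
  unfolding TR_def by blast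

lemma pt_0: "pt u w 0 = vx u" and pt_1: "pt u w 1 = vx w"
  by (auto simp: pt_def vx_def)

lemma pt_flip: "pt u w s = pt w u (1 - s)"
  by (auto simp: pt_def)

lemma vx_in_TR: "u \<in> V \<Longrightarrow> vx u \<in> TR"
  using neighbour[of u] pt_in_TR[of u _ 0] by (auto simp: pt_0)

text \<open>Naming the nearer end first brings the parameter into the range for which
  \<open>small_displacement\<close> is stated.\<close>

lemma TR_half:
  assumes "x \<in> TR" obtains u w s where "(u, w) \<in> Ed" "0 \<le> s" "s \<le> 1/2" "x = pt u w s"
proof -
  obtain u w s where x: "(u, w) \<in> Ed" "s \<in> {0..1}" "x = pt u w s" using assms unfolding TR_def by blast
  show ?thesis
  proof (cases "s \<le> 1/2")
    case True then show ?thesis using that x by auto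
  next
    case False then show ?thesis using that[of w u "1 - s"] x pt_flip[of u w s] Ed_sym by auto
  qed
qed

lemma TR_outside: "f \<in> TR \<Longrightarrow> v \<notin> V \<Longrightarrow> f v = 0"
  unfolding TR_def pt_def by auto

lemma pt_near:
  assumes "(u, w) \<in> Ed" "s \<in> {0..1}" "v \<in> V" shows "\<bar>pt u w s v - \<delta> u v\<bar> \<le> 1"
proof -
  have "pt u w s v - \<delta> u v = s * (real (\<delta> w v) - \<delta> u v)" using assms by (simp add: pt_def algebra_simps)
  moreover have "\<bar>real (\<delta> w v) - \<delta> u v\<bar> = 1" using edge_step[OF assms(1,3)] by auto
  ultimately show ?thesis using assms(2) by (simp add: abs_mult)
qed

text \<open>A point differs from the distance function of an end of its edge by at most 1, and two
  vertex functions differ by at most the distance of the vertices; so the supremum in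
  \<open>supd\<close> is finite.\<close>

lemma TR_bounded:
  assumes "f \<in> TR" "g \<in> TR"
  shows "bdd_above ((\<lambda>v. \<bar>f v - g v\<bar>) ` V)"
proof -
  obtain u w s where f: "(u, w) \<in> Ed" "s \<in> {0..1}" "f = pt u w s" using assms unfolding TR_def by blast
  obtain u' w' s' where g: "(u', w') \<in> Ed" "s' \<in> {0..1}" "g = pt u' w' s'" using assms unfolding TR_def by blast
  have "\<bar>f v - g v\<bar> \<le> 2 + real (\<delta> u u')" if v: "v \<in> V" for v
  proof -
    have "\<delta> u v \<le> \<delta> u u' + \<delta> u' v" "\<delta> u' v \<le> \<delta> u u' + \<delta> u v"
      using \<delta>_tri[of u u' v] \<delta>_tri[of u' u v] \<delta>_sym[of u u'] EdV f g v by auto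
    then show ?thesis using pt_near[OF f(1,2) v] pt_near[OF g(1,2) v] f g by simp
  qed
  then show ?thesis by (intro bdd_aboveI2)
qed

lemma supd_ge:
  assumes "f \<in> TR" "g \<in> TR" "v \<in> V" shows "\<bar>f v - g v\<bar> \<le> supd f g"
  unfolding supd_def by (rule order_trans[OF cSUP_upper[OF assms(3) TR_bounded[OF assms(1,2)]] abs_ge_self])

lemma supd_le:
  assumes "f \<in> TR" "g \<in> TR" "\<And>v. v \<in> V \<Longrightarrow> \<bar>f v - g v\<bar> \<le> r" shows "supd f g \<le> r"
proof -
  obtain v where v: "v \<in> V" using V_nonempty by blast
  have "0 \<le> (SUP v\<in>V. \<bar>f v - g v\<bar>)"
    by (rule order_trans[OF abs_ge_zero cSUP_upper[OF v TR_bounded[OF assms(1,2)]]])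
  moreover have "(SUP v\<in>V. \<bar>f v - g v\<bar>) \<le> r" by (rule cSUP_least[OF V_nonempty assms(3)])
  ultimately show ?thesis by (simp add: supd_def)
qed

lemma supd_Metric: "Metric_space TR supd"
proof
  show "0 \<le> supd x y" for x y by (simp add: supd_def)
  show "supd x y = supd y x" for x y by (simp add: supd_def abs_minus_commute)
  fix x y assume xy: "x \<in> TR" "y \<in> TR"
  show "supd x y = 0 \<longleftrightarrow> x = y"
  proof
    assume "supd x y = 0"
    then have "x v = y v" for v using supd_ge[OF xy, of v] TR_outside[OF xy(1), of v] TR_outside[OF xy(2), of v]
      by (cases "v \<in> V") auto
    then show "x = y" by (rule ext)
  qed (use supd_le[OF xy, of 0] in \<open>auto simp: supd_def\<close>)
  fix z assume z: "z \<in> TR"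
  show "supd x z \<le> supd x y + supd y z"
  proof (rule supd_le[OF xy(1) z])
    fix v assume "v \<in> V"
    then show "\<bar>x v - z v\<bar> \<le> supd x y + supd y z"
      using supd_ge[OF xy, of v] supd_ge[OF xy(2) z, of v] by linarith
  qed
qed

sublocale T: Metric_space TR supd by (rule supd_Metric)

lemma supd_pt: "(u, w) \<in> Ed \<Longrightarrow> s \<in> {0..1} \<Longrightarrow> r \<in> {0..1} \<Longrightarrow> supd (pt u w s) (pt u w r) \<le> \<bar>s - r\<bar>"
proof (rule supd_le)
  assume a: "(u, w) \<in> Ed" "s \<in> {0..1}" "r \<in> {0..1}"
  fix v assume v: "v \<in> V"
  have "pt u w s v - pt u w r v = (s - r) * (real (\<delta> w v) - real (\<delta> u v))"
    using v by (simp add: pt_def algebra_simps)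
  moreover have "\<bar>real (\<delta> w v) - \<delta> u v\<bar> = 1" using edge_step[OF a(1) v] by auto
  ultimately show "\<bar>pt u w s v - pt u w r v\<bar> \<le> \<bar>s - r\<bar>" by (simp add: abs_mult)
qed (auto intro: pt_in_TR)

lemma continuous_map_pt:
  assumes "(u, w) \<in> Ed" "continuous_map Z (top_of_set {0..1}) \<theta>"
  shows "continuous_map Z T.mtopology (\<lambda>z. pt u w (\<theta> z))"
  unfolding T.continuous_map_to_metric
proof (intro ballI allI impI)
  fix z0 and e :: real assume z0: "z0 \<in> topspace Z" and e: "0 < e"
  have \<theta>: "\<theta> z \<in> {0..1}" if "z \<in> topspace Z" for z
    using continuous_map_image_subset_topspace[OF assms(2)] that by auto
  have c: "continuous_map Z euclideanreal \<theta>" using assms(2) continuous_map_in_subtopology by blast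
  let ?U = "{z \<in> topspace Z. \<theta> z \<in> {\<theta> z0 - e <..< \<theta> z0 + e}}"
  have "openin Z ?U" by (rule openin_continuous_map_preimage[OF c]) simp
  moreover have "pt u w (\<theta> z) \<in> T.mball (pt u w (\<theta> z0)) e" if "z \<in> ?U" for z
    using that supd_pt[OF assms(1) \<theta>[OF z0] \<theta>[of z]] pt_in_TR[OF assms(1) \<theta>[of z]]
      pt_in_TR[OF assms(1) \<theta>[OF z0]] by (auto simp: abs_if split: if_splits)
  ultimately show "\<exists>U. openin Z U \<and> z0 \<in> U \<and> (\<forall>y\<in>U. pt u w (\<theta> y) \<in> T.mball (pt u w (\<theta> z0)) e)"
    using z0 e by (intro exI[of _ ?U]) auto
qed

subsection \<open>Geodesics\<close>

text \<open>This is the point at distance \<open>r\<close> from \<open>a\<close> on the segment from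
  \<open>a\<close> to \<open>b\<close>: the triangle inequality through either end bounds its
  distance to \<open>v\<close> from below, and in a tree the larger of the two bounds is
  attained.\<close>

definition geo :: "'v \<Rightarrow> 'v \<Rightarrow> real \<Rightarrow> 'v \<Rightarrow> real" where
  "geo a b r = (\<lambda>v. if v \<in> V then max (real (\<delta> a v) - r) (real (\<delta> b v) - (real (\<delta> a b) - r)) else 0)"

lemma geo_sym: "a \<in> V \<Longrightarrow> b \<in> V \<Longrightarrow> geo a b r = geo b a (real (\<delta> a b) - r)"
  by (auto simp: geo_def \<delta>_sym[of a b] max.commute)

lemma pt_geo:
  assumes e: "(a, a1) \<in> Ed" and b: "b \<in> V" "\<delta> a b = Suc (\<delta> a1 b)" and s: "0 \<le> s" "s \<le> 1"
  shows "pt a a1 s = geo a b s"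
proof
  fix v
  show "pt a a1 s v = geo a b s v"
  proof (cases "v \<in> V")
    case v: True
    have V: "a \<in> V" "a1 \<in> V" using EdV e by auto
    show ?thesis
    \<comment> \<open>On the side of \<open>a\<close> the edge separates \<open>v\<close> from
      \<open>b\<close> and the second term of the maximum counts; on the side of \<open>a1\<close>
      the first one does.\<close>
    proof (cases "\<delta> a1 v = Suc (\<delta> a v)")
      case True
      then have "\<delta> b v = \<delta> a v + \<delta> a b" using edge_cut[OF e v b] by simp
      then show ?thesis using True v s by (simp add: pt_def geo_def max_def algebra_simps)
    next
      case False
      then have 1: "\<delta> a v = Suc (\<delta> a1 v)" using edge_step[OF e v] by blast
      have "\<delta> b v \<le> \<delta> a1 b + \<delta> a1 v" using \<delta>_tri[of b a1 v] \<delta>_sym[of b a1] V b v by simp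
      then have "real (\<delta> b v) \<le> \<delta> a1 b + \<delta> a1 v" by linarith
      then show ?thesis using 1 b v s by (simp add: pt_def geo_def max_def algebra_simps)
    qed
  qed (simp add: pt_def geo_def)
qed

lemma geo_in_TR:
  "a \<in> V \<Longrightarrow> b \<in> V \<Longrightarrow> 0 \<le> r \<Longrightarrow> r \<le> real (\<delta> a b) \<Longrightarrow> geo a b r \<in> TR"
proof (induction "\<delta> a b" arbitrary: a r)
  case 0
  then have "a = b" "r = 0" using \<delta>_0[of a b] by auto
  then have "geo a b r = vx a" using \<delta>_0[OF \<open>a \<in> V\<close> \<open>a \<in> V\<close>] by (auto simp: geo_def vx_def)
  then show ?case using vx_in_TR 0 by simp
next
  case (Suc n)
  then have "a \<noteq> b" using \<delta>_0[of a b] by auto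
  then obtain a1 where a1: "(a, a1) \<in> Ed" "\<delta> a b = Suc (\<delta> a1 b)" using toward Suc by blast
  then have V: "a1 \<in> V" using EdV by blast
  show ?case
  proof (cases "r \<le> 1")
    case True
    then show ?thesis using pt_geo[OF a1(1) _ a1(2), of r] pt_in_TR[OF a1(1), of r] Suc by simp
  next
    case False
    have "geo a b r = geo a1 b (r - 1)"
    proof
      fix v
      show "geo a b r v = geo a1 b (r - 1) v"
      proof (cases "v \<in> V")
        case v: True
        have "geo a b 1 v = vx a1 v"
          using pt_geo[OF a1(1) _ a1(2), of 1] Suc by (simp add: pt_1)
        then have "max (real (\<delta> a v) - 1) (real (\<delta> b v) - (real (\<delta> a b) - 1)) = real (\<delta> a1 v)" using v by (simp add: geo_def vx_def)
        \<comment> \<open>Shifting the formula for the vertex \<open>a1\<close> by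
          \<open>r - 1\<close> yields the first term of the segment that starts at
          \<open>a1\<close>; the extra term with \<open>2 - r\<close> is dominated because
          \<open>r > 1\<close>.\<close>
        then have "max (real (\<delta> a v) - r) (real (\<delta> b v) - real (\<delta> a b) + 2 - r) = real (\<delta> a1 v) - (r - 1)"
          by (auto simp: max_def split: if_splits)
        moreover have "real (\<delta> b v) - real (\<delta> a b) + 2 - r \<le> real (\<delta> b v) - (real (\<delta> a b) - r)" using False by simp
        ultimately show ?thesis using v a1(2) False by (auto simp: geo_def max_def split: if_splits)
      qed (simp add: geo_def)
    qed
    then show ?thesis using Suc.hyps(1)[of a1 "r - 1"] Suc.hyps(2) Suc.prems V a1 False by simp
  qed
qed

text \<open>Turning the edge of each point towards the other point gives one segment that carries
  both, and on a segment all metric statements can be read off from parameters.\<close>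

lemma common_geo:
  assumes "x \<in> TR" "y \<in> TR"
  shows "\<exists>a\<in>V. \<exists>b\<in>V. \<exists>s\<in>{0..real (\<delta> a b)}. \<exists>r\<in>{0..real (\<delta> a b)}. x = geo a b s \<and> y = geo a b r"
proof -
  obtain u u' s where x: "(u, u') \<in> Ed" "s \<in> {0..1}" "x = pt u u' s" using assms unfolding TR_def by blast
  obtain w w' r where y: "(w, w') \<in> Ed" "r \<in> {0..1}" "y = pt w w' r" using assms unfolding TR_def by blast
  have wV: "w \<in> V" "w' \<in> V" using EdV y by auto
  have "\<exists>a a1 s. (a, a1) \<in> Ed \<and> \<delta> a w = Suc (\<delta> a1 w) \<and> s \<in> {0..1} \<and> x = pt a a1 s"
  proof (cases "\<delta> u w = Suc (\<delta> u' w)")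
    case True then show ?thesis using x by blast
  next
    case False
    then have "\<delta> u' w = Suc (\<delta> u w)" using edge_step[OF x(1) wV(1)] by blast
    then show ?thesis using x Ed_sym pt_flip[of u u' s]
      by (intro exI[of _ u'] exI[of _ u] exI[of _ "1 - s"]) auto
  qed
  then obtain a a1 s where a: "(a, a1) \<in> Ed" "\<delta> a w = Suc (\<delta> a1 w)" "s \<in> {0..1}" "x = pt a a1 s" by blast
  have aV: "a \<in> V" "a1 \<in> V" using EdV a by auto
  have "\<exists>b b1 r. (b, b1) \<in> Ed \<and> \<delta> b a = Suc (\<delta> b1 a) \<and> r \<in> {0..1} \<and> y = pt b b1 r \<and> \<delta> a b = Suc (\<delta> a1 b)"
  proof (cases "\<delta> w a = Suc (\<delta> w' a)")
    case True then show ?thesis using y a by blast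
  next
    case False
    then have 1: "\<delta> w' a = Suc (\<delta> w a)" using edge_step[OF y(1) aV(1)] by blast
    \<comment> \<open>Exchanging the ends of the second edge replaces \<open>w\<close> by the vertex
      \<open>w'\<close>, one step further from \<open>a\<close>; it has to be checked that
      \<open>a1\<close> is still the end nearer to it.\<close>
    have "\<delta> a1 w' \<le> \<delta> a1 w + 1" using \<delta>_tri[of a1 w w'] aV wV y(1) by (simp add: Ed_iff)
    then have "\<delta> a w' = Suc (\<delta> a1 w')"
      using edge_step[OF a(1) wV(2)] 1 a(2) \<delta>_sym[of w' a] \<delta>_sym[of w a] aV wV by auto
    then show ?thesis using y 1 Ed_sym pt_flip[of w w' r]
      by (intro exI[of _ w'] exI[of _ w] exI[of _ "1 - r"]) auto
  qed
  then obtain b b1 r where b: "(b, b1) \<in> Ed" "\<delta> b a = Suc (\<delta> b1 a)" "r \<in> {0..1}" "y = pt b b1 r"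
    "\<delta> a b = Suc (\<delta> a1 b)" by blast
  have bV: "b \<in> V" using EdV b by auto
  have "x = geo a b s" using pt_geo[OF a(1) bV b(5)] a by simp
  moreover have "y = geo a b (real (\<delta> a b) - r)"
    using pt_geo[OF b(1) aV(1) b(2), of r] geo_sym[OF bV aV(1), of r] \<delta>_sym[of a b] aV bV b by simp
  ultimately show ?thesis using aV bV a(3) b(3,5)
    by (intro bexI[of _ a] bexI[of _ b] bexI[of _ s] bexI[of _ "real (\<delta> a b) - r"]) auto
qed

lemma supd_geo:
  assumes "a \<in> V" "b \<in> V" "s \<in> {0..real (\<delta> a b)}" "r \<in> {0..real (\<delta> a b)}"
  shows "supd (geo a b s) (geo a b r) = \<bar>s - r\<bar>"
proof (rule antisym)
  have T: "geo a b s \<in> TR" "geo a b r \<in> TR" using assms geo_in_TR by auto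
  show "supd (geo a b s) (geo a b r) \<le> \<bar>s - r\<bar>"
    by (rule supd_le[OF T]) (auto simp: geo_def max_def abs_if)
  \<comment> \<open>The value at \<open>a\<close> is the parameter itself, so the Lipschitz bound of
    the maximum is attained there.\<close>
  have "geo a b s a = s" "geo a b r a = r" using assms \<delta>_0[of a a] \<delta>_sym[of a b] by (auto simp: geo_def)
  then show "\<bar>s - r\<bar> \<le> supd (geo a b s) (geo a b r)" using supd_ge[OF T assms(1)] by simp
qed

text \<open>The formula of \<open>geo\<close> with \<open>f\<close>, \<open>g\<close> and
  \<open>supd f g\<close> in place of the ends and their distance. It involves no choice of a
  segment, so its continuity in all arguments is that of the maximum.\<close>

definition comb :: "('v \<Rightarrow> real) \<Rightarrow> ('v \<Rightarrow> real) \<Rightarrow> real \<Rightarrow> 'v \<Rightarrow> real" where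
  "comb f g t = (\<lambda>v. if v \<in> V then max (f v - t * supd f g) (g v - (1 - t) * supd f g) else 0)"

lemma comb_in_TR:
  assumes "f \<in> TR" "g \<in> TR" "t \<in> {0..1}" shows "comb f g t \<in> TR"
proof -
  have "\<exists>a\<in>V. \<exists>b\<in>V. \<exists>s\<in>{0..real (\<delta> a b)}. \<exists>r\<in>{s..real (\<delta> a b)}. f = geo a b s \<and> g = geo a b r"
  proof -
    obtain a b s r where 1: "a \<in> V" "b \<in> V" "s \<in> {0..real (\<delta> a b)}" "r \<in> {0..real (\<delta> a b)}"
      "f = geo a b s" "g = geo a b r" using common_geo[OF assms(1,2)] by blast
    show ?thesis
    proof (cases "s \<le> r")
      case True then show ?thesis using 1
        by (intro bexI[of _ a] bexI[of _ b] bexI[of _ s] bexI[of _ r]) auto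
    next
      case False
      then show ?thesis using 1 geo_sym[of a b] \<delta>_sym[of a b]
        by (intro bexI[of _ b] bexI[of _ a] bexI[of _ "real (\<delta> a b) - s"] bexI[of _ "real (\<delta> a b) - r"]) auto
    qed
  qed
  then obtain a b s r where 1: "a \<in> V" "b \<in> V" "s \<in> {0..real (\<delta> a b)}" "r \<in> {s..real (\<delta> a b)}"
    "f = geo a b s" "g = geo a b r" by blast
  define D where "D = supd f g"
  have D: "D = r - s" using supd_geo[of a b s r] 1 by (simp add: D_def)
  define A B where "A = t * D" and "B = (1 - t) * D"
  have "0 \<le> D" using 1 D by simp
  then have AB: "0 \<le> A" "0 \<le> B" using assms(3) by (simp_all add: A_def B_def)
  have AB: "0 \<le> A" "0 \<le> B" "A + B = D" using AB by (simp_all add: A_def B_def algebra_simps)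
  have "comb f g t = geo a b (s + A)"
  proof
    fix v show "comb f g t v = geo a b (s + A) v"
    proof (cases "v \<in> V")
      case True
      then show ?thesis
        using AB D unfolding comb_def D_def[symmetric] A_def[symmetric] B_def[symmetric]
        by (auto simp: 1 geo_def max_def)
    qed (simp add: comb_def geo_def)
  qed
  moreover have "0 \<le> s + A" "s + A \<le> \<delta> a b" using AB D 1 by auto
  ultimately show ?thesis using geo_in_TR 1 by simp
qed

lemma comb_0: "f \<in> TR \<Longrightarrow> g \<in> TR \<Longrightarrow> comb f g 0 = f"
proof
  fix v assume T: "f \<in> TR" "g \<in> TR"
  show "comb f g 0 v = f v"
    using supd_ge[OF T, of v] TR_outside[OF T(1), of v] by (auto simp: comb_def max_def abs_if split: if_splits)
qed

lemma comb_1: "f \<in> TR \<Longrightarrow> g \<in> TR \<Longrightarrow> comb f g 1 = g"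
proof
  fix v assume T: "f \<in> TR" "g \<in> TR"
  show "comb f g 1 v = g v"
    using supd_ge[OF T, of v] TR_outside[OF T(2), of v] by (auto simp: comb_def max_def abs_if split: if_splits)
qed

lemma comb_same: "f \<in> TR \<Longrightarrow> comb f f t = f"
  using TR_outside by (auto simp: comb_def fun_eq_iff)

lemma continuous_map_comb:
  assumes f: "continuous_map Z T.mtopology f" and g: "continuous_map Z T.mtopology g"
    and \<theta>: "continuous_map Z (top_of_set {0..1}) \<theta>"
  shows "continuous_map Z T.mtopology (\<lambda>z. comb (f z) (g z) (\<theta> z))"
  unfolding T.continuous_map_to_metric
proof (intro ballI allI impI)
  fix z0 and e :: real assume z0: "z0 \<in> topspace Z" and e: "0 < e"
  have fT: "f z \<in> TR" and gT: "g z \<in> TR" and tI: "\<theta> z \<in> {0..1}" if "z \<in> topspace Z" for z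
    using continuous_map_image_subset_topspace[OF f] continuous_map_image_subset_topspace[OF g]
      continuous_map_image_subset_topspace[OF \<theta>] that by auto
  have tc: "continuous_map Z euclideanreal \<theta>" using \<theta> continuous_map_in_subtopology by blast
  have dc: "continuous_map Z euclideanreal (\<lambda>z. supd (a z) (b z))"
    if "continuous_map Z T.mtopology a" "continuous_map Z T.mtopology b" for a b
    using continuous_map_mdist[of Z "metric (TR, supd)" a b] that by simp
  define D where "D z = supd (f z) (g z)" for z
  \<comment> \<open>A continuous function that vanishes at \<open>z0\<close> and bounds the distance
    of the two combined points: the maximum moves no more than its entries do, and
    \<open>\<psi>\<close> adds up the movements of all their parts.\<close>
  define \<psi> where "\<psi> z = supd (f z) (f z0) + supd (g z) (g z0) + \<bar>\<theta> z * D z - \<theta> z0 * D z0\<bar>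
      + \<bar>(1 - \<theta> z) * D z - (1 - \<theta> z0) * D z0\<bar>" for z
  have "continuous_map Z euclideanreal \<psi>"
    unfolding \<psi>_def D_def using fT[OF z0] gT[OF z0]
    by (intro continuous_map_add continuous_map_diff continuous_map_real_mult continuous_map_real_abs dc f g tc) auto
  then have "openin Z {z \<in> topspace Z. \<psi> z \<in> {..<e}}"
    by (rule openin_continuous_map_preimage) simp
  moreover have "\<psi> z0 < e" using e fT[OF z0] gT[OF z0] by (simp add: \<psi>_def)
  moreover have "comb (f z) (g z) (\<theta> z) \<in> T.mball (comb (f z0) (g z0) (\<theta> z0)) e"
    if z: "z \<in> topspace Z" "\<psi> z < e" for z
  proof -
    have c: "comb (f z) (g z) (\<theta> z) \<in> TR" "comb (f z0) (g z0) (\<theta> z0) \<in> TR"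
      using comb_in_TR fT gT tI z z0 by blast+
    have "supd (comb (f z0) (g z0) (\<theta> z0)) (comb (f z) (g z) (\<theta> z)) \<le> \<psi> z"
    proof (rule supd_le[OF c(2,1)])
      fix v assume v: "v \<in> V"
      have "\<bar>f z v - f z0 v\<bar> \<le> supd (f z) (f z0)" "\<bar>g z v - g z0 v\<bar> \<le> supd (g z) (g z0)"
        using supd_ge v fT gT z z0 by blast+
      moreover have "\<bar>max a b - max a' b'\<bar> \<le> max \<bar>a - a'\<bar> \<bar>b - b'\<bar>" for a b a' b' :: real by linarith
      then have "\<bar>comb (f z0) (g z0) (\<theta> z0) v - comb (f z) (g z) (\<theta> z) v\<bar> \<le>
          max \<bar>(f z0 v - \<theta> z0 * D z0) - (f z v - \<theta> z * D z)\<bar>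
            \<bar>(g z0 v - (1 - \<theta> z0) * D z0) - (g z v - (1 - \<theta> z) * D z)\<bar>"
        using v by (simp only: comb_def D_def if_True)
      moreover have "0 \<le> supd (f z) (f z0)" "0 \<le> supd (g z) (g z0)" by simp_all
      ultimately show "\<bar>comb (f z0) (g z0) (\<theta> z0) v - comb (f z) (g z) (\<theta> z) v\<bar> \<le> \<psi> z"
        unfolding \<psi>_def by linarith
    qed
    then show ?thesis using c z by simp
  qed
  ultimately show "\<exists>U. openin Z U \<and> z0 \<in> U \<and>
      (\<forall>y\<in>U. comb (f y) (g y) (\<theta> y) \<in> T.mball (comb (f z0) (g z0) (\<theta> z0)) e)"
    using z0 by (intro exI[of _ "{z \<in> topspace Z. \<psi> z \<in> {..<e}}"]) auto
qed

subsection \<open>Uniqueness of coordinates, displacement\<close>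

text \<open>Any other vertex has distance at least 1 from both ends, hence from the point. So an
  interior point knows its edge, and its values at the two ends recover the parameter.\<close>

lemma pt_less_1:
  assumes "(u, w) \<in> Ed" "0 < s" "s < 1"
  shows "{v \<in> V. pt u w s v < 1} = {u, w}" "pt u w s u = s" "pt u w s w = 1 - s"
proof -
  have uw: "u \<in> V" "w \<in> V" "\<delta> u w = 1" "\<delta> w u = 1" "\<delta> u u = 0" "\<delta> w w = 0"
    using assms(1) \<delta>_sym \<delta>_0 by (auto simp: Ed_iff)
  show "pt u w s u = s" "pt u w s w = 1 - s" using uw by (simp_all add: pt_def)
  have "\<not> pt u w s v < 1" if "v \<in> V" "v \<noteq> u" "v \<noteq> w" for v
  proof -
    have "1 \<le> \<delta> u v" "1 \<le> \<delta> w v" using that uw \<delta>_0 by (metis One_nat_def Suc_leI not_gr_zero)+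
    then have "1 \<le> real (\<delta> u v)" "1 \<le> real (\<delta> w v)" by simp_all
    then have "(1 - s) * 1 + s * 1 \<le> (1 - s) * real (\<delta> u v) + s * real (\<delta> w v)"
      using assms(2,3) by (intro add_mono mult_left_mono) auto
    then show ?thesis using that by (simp add: pt_def)
  qed
  then show "{v \<in> V. pt u w s v < 1} = {u, w}"
    using uw assms \<open>pt u w s u = s\<close> \<open>pt u w s w = 1 - s\<close> by auto
qed

lemma vx_less_1: "u \<in> V \<Longrightarrow> {v \<in> V. vx u v < 1} = {u}"
  using \<delta>_0[of u] by (auto simp: vx_def)

lemma vx_inj: "u \<in> V \<Longrightarrow> v \<in> V \<Longrightarrow> vx u = vx v \<Longrightarrow> u = v"
  using vx_less_1 by (metis singleton_inject)

lemma vx_neq_pt: "(u, w) \<in> Ed \<Longrightarrow> 0 < s \<Longrightarrow> s < 1 \<Longrightarrow> v \<in> V \<Longrightarrow> vx v \<noteq> pt u w s"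
  using vx_less_1[of v] pt_less_1(1)[of u w s] Ed_neq[of u w] by (metis doubleton_eq_iff insert_absorb2)

lemma pt_eq_pt:
  assumes "(u, w) \<in> Ed" "0 < s" "s < 1" "(u', w') \<in> Ed" "0 < s'" "s' < 1" "pt u w s = pt u' w' s'"
  shows "u' = u \<and> w' = w \<and> s' = s \<or> u' = w \<and> w' = u \<and> s' = 1 - s"
proof -
  have "{u, w} = {u', w'}" using pt_less_1(1)[OF assms(1-3)] pt_less_1(1)[OF assms(4-6)] assms(7) by simp
  then show ?thesis
    using pt_less_1(2,3)[OF assms(1-3)] pt_less_1(2,3)[OF assms(4-6)] assms(7)
    by (auto simp: doubleton_eq_iff)
qed

text \<open>The two functions are compared at \<open>u\<close> and \<open>u'\<close>. Since
  \<open>u\<close> is the nearer end, moving it by two or more edges, or by one edge without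
  reversing the edge, already costs 1. This is the origin of the value 1 for the displacement
  bound.\<close>

lemma small_displacement:
  assumes e: "(u, w) \<in> Ed" "(u', w') \<in> Ed" and s: "0 \<le> s" "s \<le> 1/2"
    and less: "supd (pt u w s) (pt u' w' s) < 1"
  shows "u' = u \<or> u' = w \<and> w' = u"
proof (rule ccontr)
  assume neg: "\<not> (u' = u \<or> u' = w \<and> w' = u)"
  have V: "u \<in> V" "w \<in> V" "u' \<in> V" "w' \<in> V" using e EdV by auto
  have at: "\<bar>pt u w s v - pt u' w' s v\<bar> < 1" if "v \<in> V" for v
    using supd_ge[OF pt_in_TR[OF e(1)] pt_in_TR[OF e(2)] that, of s s] less s by simp
  note sym = \<delta>_sym[OF V(1) V(3)] \<delta>_sym[OF V(1) V(2)] \<delta>_sym[OF V(3) V(4)]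
  have 0: "\<delta> u u = 0" "\<delta> u' u' = 0" "\<delta> w u = 1" "\<delta> w' u' = 1" using V e \<delta>_0 sym by (auto simp: Ed_iff)
  have "\<delta> u' u \<noteq> 0" using neg V \<delta>_0 by simp
  moreover have "\<not> 2 \<le> \<delta> u' u"
  proof
    assume 2: "2 \<le> \<delta> u' u"
    then have "1 \<le> \<delta> w' u" using edge_step[OF e(2) V(1)] by linarith
    have "(1 - s) * 2 + s * 1 \<le> (1 - s) * real (\<delta> u' u) + s * real (\<delta> w' u)"
      using s 2 \<open>1 \<le> \<delta> w' u\<close> by (intro add_mono mult_left_mono) auto
    then show False using at[OF V(1)] V 0 s by (simp add: pt_def)
  qed
  ultimately have 1: "\<delta> u' u = 1" by linarith
  show False
  proof (cases "u' = w")
    case False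
    then have "\<delta> w u' \<noteq> 0" using \<delta>_0 V by simp
    then have "\<delta> w u' = 2" using edge_step[OF e(1) V(3)] 1 sym by auto
    then show False using at[OF V(3)] V 0 1 sym by (simp add: pt_def)
  next
    case True
    then have "\<delta> w' u \<noteq> 0" using neg \<delta>_0 V by simp
    then have "\<delta> w' u = 2" using edge_step[OF e(2) V(1)] 1 by auto
    then show False using at[OF V(1)] V 0 1 sym by (simp add: pt_def)
  qed
qed

end

section \<open>Groups acting on a tree\<close>

locale tree_action = tree V Ed \<delta> + group G
  for V :: "'v set" and Ed \<delta> and G (structure) +
  fixes \<alpha> :: "'g \<Rightarrow> 'v \<Rightarrow> 'v"
  assumes \<alpha>_closed: "g \<in> carrier G \<Longrightarrow> v \<in> V \<Longrightarrow> \<alpha> g v \<in> V"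
    and \<alpha>_mult: "g \<in> carrier G \<Longrightarrow> h \<in> carrier G \<Longrightarrow> v \<in> V \<Longrightarrow> \<alpha> (g \<otimes> h) v = \<alpha> g (\<alpha> h v)"
    and \<alpha>_one: "v \<in> V \<Longrightarrow> \<alpha> \<one> v = v"
    and \<alpha>_edge: "g \<in> carrier G \<Longrightarrow> (u, w) \<in> Ed \<Longrightarrow> (\<alpha> g u, \<alpha> g w) \<in> Ed"
begin

lemma \<alpha>_inv: "g \<in> carrier G \<Longrightarrow> v \<in> V \<Longrightarrow> \<alpha> (inv g) (\<alpha> g v) = v"
  by (metis \<alpha>_mult \<alpha>_one inv_closed l_inv)

lemma \<alpha>_inv': "g \<in> carrier G \<Longrightarrow> v \<in> V \<Longrightarrow> \<alpha> g (\<alpha> (inv g) v) = v"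
  by (metis \<alpha>_mult \<alpha>_one inv_closed r_inv)

text \<open>A map that preserves edges cannot stretch a shortest path; equality follows by applying
  this to the inverse element as well.\<close>

lemma \<delta>_le: "g \<in> carrier G \<Longrightarrow> u \<in> V \<Longrightarrow> v \<in> V \<Longrightarrow> \<delta> (\<alpha> g u) (\<alpha> g v) \<le> \<delta> u v"
proof (induction "\<delta> u v" arbitrary: u)
  case 0
  then show ?case using \<delta>_0[of u v] \<delta>_0[of "\<alpha> g v" "\<alpha> g v"] \<alpha>_closed by auto
next
  case (Suc n)
  then have "u \<noteq> v" using \<delta>_0[of u v] by auto
  then obtain u1 where u1: "(u, u1) \<in> Ed" "\<delta> u v = Suc (\<delta> u1 v)" using toward Suc by blast
  then have "\<delta> (\<alpha> g u1) (\<alpha> g v) \<le> \<delta> u1 v" using Suc EdV by simp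
  moreover have "\<delta> (\<alpha> g u) (\<alpha> g u1) = 1" using \<alpha>_edge Suc u1 by (simp add: Ed_iff)
  moreover have "\<delta> (\<alpha> g u) (\<alpha> g v) \<le> \<delta> (\<alpha> g u) (\<alpha> g u1) + \<delta> (\<alpha> g u1) (\<alpha> g v)"
    using Suc u1 EdV \<alpha>_closed by (intro \<delta>_tri) auto
  ultimately show ?case using u1 by simp
qed

lemma \<delta>_\<alpha>: "g \<in> carrier G \<Longrightarrow> u \<in> V \<Longrightarrow> v \<in> V \<Longrightarrow> \<delta> (\<alpha> g u) (\<alpha> g v) = \<delta> u v"
  using \<delta>_le[of g u v] \<delta>_le[of "inv g" "\<alpha> g u" "\<alpha> g v"] by (simp add: \<alpha>_inv \<alpha>_closed)

text \<open>The distance from the moved point to \<open>v\<close> is the distance from the original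
  point to \<open>v\<close> moved back, hence the inverse.\<close>

definition fact :: "'g \<Rightarrow> ('v \<Rightarrow> real) \<Rightarrow> 'v \<Rightarrow> real" where
  "fact g f = (\<lambda>v. if v \<in> V then f (\<alpha> (inv g) v) else 0)"

lemma fact_pt: "g \<in> carrier G \<Longrightarrow> u \<in> V \<Longrightarrow> w \<in> V \<Longrightarrow> fact g (pt u w s) = pt (\<alpha> g u) (\<alpha> g w) s"
proof
  fix v assume a: "g \<in> carrier G" "u \<in> V" "w \<in> V"
  show "fact g (pt u w s) v = pt (\<alpha> g u) (\<alpha> g w) s v"
    using \<delta>_\<alpha>[of g u "\<alpha> (inv g) v"] \<delta>_\<alpha>[of g w "\<alpha> (inv g) v"] a
    by (cases "v \<in> V") (simp_all add: fact_def pt_def \<alpha>_closed \<alpha>_inv')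
qed

lemma fact_vx: "g \<in> carrier G \<Longrightarrow> u \<in> V \<Longrightarrow> fact g (vx u) = vx (\<alpha> g u)"
  using fact_pt[of g u u 0] by (simp add: pt_0)

lemma fact_closed: "g \<in> carrier G \<Longrightarrow> f \<in> TR \<Longrightarrow> fact g f \<in> TR"
  unfolding TR_def using fact_pt \<alpha>_edge EdV by blast

lemma fact_mult:
  assumes "g \<in> carrier G" "h \<in> carrier G" "f \<in> TR" shows "fact (g \<otimes> h) f = fact g (fact h f)"
proof -
  obtain u w s where "(u, w) \<in> Ed" "f = pt u w s" using assms unfolding TR_def by blast
  then show ?thesis using assms EdV[of u w] by (simp add: fact_pt \<alpha>_mult \<alpha>_closed)
qed

lemma fact_one:
  assumes "f \<in> TR" shows "fact \<one> f = f"
proof -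
  obtain u w s where "(u, w) \<in> Ed" "f = pt u w s" using assms unfolding TR_def by blast
  then show ?thesis using EdV[of u w] by (simp add: fact_pt \<alpha>_one)
qed

lemma fact_supd_le:
  assumes "g \<in> carrier G" "f \<in> TR" "f' \<in> TR" shows "supd (fact g f) (fact g f') \<le> supd f f'"
  using assms by (intro supd_le fact_closed) (auto simp: fact_def \<alpha>_closed intro!: supd_ge)

lemma fact_supd:
  assumes "g \<in> carrier G" "f \<in> TR" "f' \<in> TR" shows "supd (fact g f) (fact g f') = supd f f'"
proof (rule antisym[OF fact_supd_le[OF assms]])
  have "fact (inv g) (fact g f) = f" "fact (inv g) (fact g f') = f'"
    using assms by (simp_all add: fact_one flip: fact_mult)
  then show "supd f f' \<le> supd (fact g f) (fact g f')"
    using fact_supd_le[of "inv g" "fact g f" "fact g f'"] assms fact_closed by simp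
qed

end

section \<open>The product of two trees\<close>

text \<open>\<open>bt_product\<close> for an arbitrary graph, which separates the geometry from the
  lattices.\<close>

definition tree_product where
  "tree_product V Ed =
     \<lparr> sc_verts = V \<times> V,
       sc_edges = {Hor e y | e y. e \<in> Ed \<and> y \<in> V} \<union> {Ver x f | x f. x \<in> V \<and> f \<in> Ed},
       sc_src = pedge_src,
       sc_tgt = pedge_src \<circ> pedge_rev,
       sc_rev = pedge_rev,
       sc_squares = {dihedral_class pedge_rev
           (Hor (x, x') y, Ver x' (y, y'), Hor (x', x) y', Ver x (y', y)) | x x' y y'.
           (x, x') \<in> Ed \<and> (y, y') \<in> Ed},
       sc_bd = (\<lambda>s. s) \<rparr>"

fun pair_act :: "('v \<Rightarrow> 'v) \<Rightarrow> ('v \<Rightarrow> 'v) \<Rightarrow> 'v pedge \<Rightarrow> 'v pedge" where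
  "pair_act a b (Hor (x, x') y) = Hor (a x, a x') (b y)"
| "pair_act a b (Ver x (y, y')) = Ver (a x) (b y, b y')"

lemma pedge_rev_rev [simp]: "pedge_rev (pedge_rev e) = e"
  by (cases e rule: pedge_rev.cases) auto

lemma pair_act_rev: "pair_act a b (pedge_rev e) = pedge_rev (pair_act a b e)"
  by (cases e rule: pedge_rev.cases) auto

lemma pair_act_src: "pedge_src (pair_act a b e) = map_prod a b (pedge_src e)"
  by (cases e rule: pedge_rev.cases) auto

lemma dihedral_class_self: "p \<in> dihedral_class r p"
  by (cases p) auto

lemma dihedral_class_eq:
  assumes "\<And>e. r (r e) = e" "p \<in> dihedral_class r p'"
  shows "dihedral_class r p = dihedral_class r p'"
proof -
  obtain a b c d where p': "p' = (a, b, c, d)" by (cases p')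
  have sub: "dihedral_class r q \<subseteq> dihedral_class r p'" if "q \<in> dihedral_class r p'" for q
    using that unfolding p' dihedral_class.simps
    by (elim insertE emptyE) (simp_all add: assms(1))
  have "p' \<in> dihedral_class r p"
    using assms(2) unfolding p' dihedral_class.simps
    by (elim insertE emptyE) (simp_all add: assms(1))
  moreover have "dihedral_class r q \<subseteq> dihedral_class r p" if "q \<in> dihedral_class r p" for q
  proof -
    obtain a b c d where p: "p = (a, b, c, d)" by (cases p)
    show ?thesis using that unfolding p dihedral_class.simps
      by (elim insertE emptyE) (simp_all add: assms(1))
  qed
  ultimately show ?thesis using sub assms(2) by blast
qed

lemma map4_dihedral:
  assumes "\<And>e. f (r e) = r' (f e)"
  shows "map4 f ` dihedral_class r p = dihedral_class r' (map4 f p)"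
  by (cases p) (simp add: assms)

text \<open>One tree serves for both factors: both completions are Laurent series over the same
  field, so they have the same lattice classes, and the two places differ only in the actions
  \<open>\<alpha>\<close> and \<open>\<beta>\<close>.\<close>

locale tree_product_action = tree V Ed \<delta> + group G +
  A: tree_action V Ed \<delta> G \<alpha> + B: tree_action V Ed \<delta> G \<beta>
  for V :: "'v set" and Ed \<delta> and G (structure) and \<alpha> \<beta> :: "'g \<Rightarrow> 'v \<Rightarrow> 'v" +
  assumes free: "g \<in> carrier G \<Longrightarrow> u \<in> V \<Longrightarrow> v \<in> V \<Longrightarrow> \<alpha> g u = u \<Longrightarrow> \<beta> g v = v \<Longrightarrow> g = \<one>"
    and no_inv: "acts_without_inversion (carrier G) (\<lambda>g. pair_act (\<alpha> g) (\<beta> g)) (tree_product V Ed)"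
begin

abbreviation "XX \<equiv> tree_product V Ed"
abbreviation "pe g \<equiv> pair_act (\<alpha> g) (\<beta> g)"
abbreviation "pv g \<equiv> map_prod (\<alpha> g) (\<beta> g)"
abbreviation "ps g \<equiv> image (map4 (pe g))"
abbreviation "ve \<equiv> orbit pv (carrier G)"
abbreviation "oe \<equiv> orbit pe (carrier G)"
abbreviation "os \<equiv> orbit ps (carrier G)"

definition QQ where "QQ = quotient_complex (carrier G) pv pe ps XX"

text \<open>A boundary tuple read from the corner \<open>(x, y)\<close> with the horizontal edge
  first; \<open>corner'\<close> has the vertical edge first. Four corners and two directions give
  the eight members of a dihedral class.\<close>

definition corner :: "'v \<Rightarrow> 'v \<Rightarrow> 'v \<Rightarrow> 'v \<Rightarrow> 'v pedge \<times> 'v pedge \<times> 'v pedge \<times> 'v pedge" where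
  "corner x x' y y' = (Hor (x, x') y, Ver x' (y, y'), Hor (x', x) y', Ver x (y', y))"

definition corner' :: "'v \<Rightarrow> 'v \<Rightarrow> 'v \<Rightarrow> 'v \<Rightarrow> 'v pedge \<times> 'v pedge \<times> 'v pedge \<times> 'v pedge" where
  "corner' x x' y y' = (Ver x (y, y'), Hor (x, x') y', Ver x' (y', y), Hor (x', x) y)"

definition sq_tuple where
  "sq_tuple p \<longleftrightarrow> (\<exists>x x' y y'. (x, x') \<in> Ed \<and> (y, y') \<in> Ed \<and> (p = corner x x' y y' \<or> p = corner' x x' y y'))"

lemma sq_tupleI:
  assumes "(x, x') \<in> Ed" "(y, y') \<in> Ed"
  shows "sq_tuple (corner x x' y y')" "sq_tuple (corner' x x' y y')"
  unfolding sq_tuple_def using assms by blast+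

lemma Hor_in [simp]: "Hor (x, x') y \<in> sc_edges XX \<longleftrightarrow> (x, x') \<in> Ed \<and> y \<in> V"
  by (auto simp: tree_product_def)

lemma Ver_in [simp]: "Ver x (y, y') \<in> sc_edges XX \<longleftrightarrow> x \<in> V \<and> (y, y') \<in> Ed"
  by (auto simp: tree_product_def)

lemma XX_simps [simp]: "sc_verts XX = V \<times> V" "sc_src XX = pedge_src" "sc_tgt XX e = pedge_src (pedge_rev e)"
  "sc_rev XX = pedge_rev" "sc_bd XX s = s"
  by (auto simp: tree_product_def)

lemma edge_cases:
  assumes "e \<in> sc_edges XX"
  obtains x x' y where "e = Hor (x, x') y" "(x, x') \<in> Ed" "y \<in> V"
    | x y y' where "e = Ver x (y, y')" "x \<in> V" "(y, y') \<in> Ed"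
  using assms by (cases e rule: pedge_rev.cases) auto

lemma rev_edge: "e \<in> sc_edges XX \<Longrightarrow> pedge_rev e \<in> sc_edges XX"
  using Ed_sym by (erule_tac edge_cases) auto

lemma src_vert: "e \<in> sc_edges XX \<Longrightarrow> pedge_src e \<in> V \<times> V"
  using EdV by (erule_tac edge_cases) auto

lemma pe_edge: "g \<in> carrier G \<Longrightarrow> e \<in> sc_edges XX \<Longrightarrow> pe g e \<in> sc_edges XX"
  using A.\<alpha>_edge B.\<alpha>_edge A.\<alpha>_closed B.\<alpha>_closed by (erule_tac edge_cases) auto

lemma corner_squares: "(x, x') \<in> Ed \<Longrightarrow> (y, y') \<in> Ed \<Longrightarrow> dihedral_class pedge_rev (corner x x' y y') \<in> sc_squares XX"
  by (auto simp: tree_product_def corner_def)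

lemma corner_class: "p \<in> dihedral_class pedge_rev (corner x x' y y') \<longleftrightarrow>
   p \<in> {corner x x' y y', corner x' x y y', corner x x' y' y, corner x' x y' y,
        corner' x x' y y', corner' x' x y y', corner' x x' y' y, corner' x' x y' y}"
  by (auto simp: corner_def corner'_def)

lemma corner'_class: "dihedral_class pedge_rev (corner' x x' y y') = dihedral_class pedge_rev (corner x x' y y')"
  by (rule dihedral_class_eq) (auto simp: corner_def corner'_def)

lemma squares_iff: "s \<in> sc_squares XX \<longleftrightarrow>
    (\<exists>x x' y y'. (x, x') \<in> Ed \<and> (y, y') \<in> Ed \<and> s = dihedral_class pedge_rev (corner x x' y y'))"
  by (auto simp: tree_product_def corner_def)

lemma square_cases:
  assumes "s \<in> sc_squares XX"
  obtains x x' y y' where "(x, x') \<in> Ed" "(y, y') \<in> Ed" "s = dihedral_class pedge_rev (corner x x' y y')"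
  using assms unfolding squares_iff by (elim exE conjE) (rule that)

lemma square_member:
  assumes "s \<in> sc_squares XX" "p \<in> s"
  shows "sq_tuple p" "s = dihedral_class pedge_rev p"
proof -
  obtain x x' y y' where e: "(x, x') \<in> Ed" "(y, y') \<in> Ed" and s: "s = dihedral_class pedge_rev (corner x x' y y')"
    using assms(1) by (rule square_cases)
  have "p \<in> {corner x x' y y', corner x' x y y', corner x x' y' y, corner x' x y' y,
        corner' x x' y y', corner' x' x y y', corner' x x' y' y, corner' x' x y' y}"
    using assms(2) unfolding s by (simp only: corner_class)
  then show "sq_tuple p" using e e[THEN Ed_sym] by (elim insertE emptyE) (simp_all add: sq_tupleI)
  show "s = dihedral_class pedge_rev p"
    using dihedral_class_eq[OF pedge_rev_rev assms(2)[unfolded s]] s by simp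
qed

lemma tuple_square: "sq_tuple p \<Longrightarrow> dihedral_class pedge_rev p \<in> sc_squares XX"
  unfolding sq_tuple_def using corner_squares corner'_class by metis

lemma pe_corner: "map4 (pe g) (corner x x' y y') = corner (\<alpha> g x) (\<alpha> g x') (\<beta> g y) (\<beta> g y')"
  "map4 (pe g) (corner' x x' y y') = corner' (\<alpha> g x) (\<alpha> g x') (\<beta> g y) (\<beta> g y')"
  by (simp_all add: corner_def corner'_def)

lemma pe_tuple: "g \<in> carrier G \<Longrightarrow> sq_tuple p \<Longrightarrow> sq_tuple (map4 (pe g) p)"
  unfolding sq_tuple_def using A.\<alpha>_edge B.\<alpha>_edge pe_corner by metis

lemma ps_class: "ps g (dihedral_class pedge_rev p) = dihedral_class pedge_rev (map4 (pe g) p)"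
  by (rule map4_dihedral) (simp add: pair_act_rev)

lemma pe_mult: "g \<in> carrier G \<Longrightarrow> h \<in> carrier G \<Longrightarrow> e \<in> sc_edges XX \<Longrightarrow> pe (g \<otimes> h) e = pe g (pe h e)"
  using EdV A.\<alpha>_mult B.\<alpha>_mult by (erule_tac edge_cases) auto

lemma pe_one: "e \<in> sc_edges XX \<Longrightarrow> pe \<one> e = e"
  using EdV A.\<alpha>_one B.\<alpha>_one by (erule_tac edge_cases) auto

lemma oe_mem: "e' \<in> oe e \<longleftrightarrow> (\<exists>g\<in>carrier G. e' = pe g e)"
  by (auto simp: orbit_def)

lemma oe_self: "e \<in> sc_edges XX \<Longrightarrow> e \<in> oe e"
  using oe_mem pe_one by (metis one_closed)

lemma oe_act: "g \<in> carrier G \<Longrightarrow> e \<in> sc_edges XX \<Longrightarrow> oe (pe g e) = oe e"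
proof (intro equalityI subsetI)
  fix e' assume g: "g \<in> carrier G" "e \<in> sc_edges XX"
  { assume "e' \<in> oe (pe g e)"
    then obtain h where "h \<in> carrier G" "e' = pe h (pe g e)" unfolding oe_mem by blast
    then show "e' \<in> oe e" unfolding oe_mem using pe_mult[of h g e] g by (metis m_closed) }
  { assume "e' \<in> oe e"
    then obtain h where h: "h \<in> carrier G" "e' = pe h e" unfolding oe_mem by blast
    have "pe (h \<otimes> inv g) (pe g e) = pe (h \<otimes> inv g \<otimes> g) e" using pe_mult[of "h \<otimes> inv g" g e] g h by simp
    also have "h \<otimes> inv g \<otimes> g = h" using g h by (simp add: m_assoc)
    finally show "e' \<in> oe (pe g e)" unfolding oe_mem using g h by (metis inv_closed m_closed) }
qed

lemma oe_eq: "e \<in> sc_edges XX \<Longrightarrow> e' \<in> oe e \<Longrightarrow> oe e' = oe e"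
  using oe_act oe_mem by auto

lemma oe_edge: "e \<in> sc_edges XX \<Longrightarrow> e' \<in> oe e \<Longrightarrow> e' \<in> sc_edges XX"
  using pe_edge oe_mem by auto

lemma oe_rev: "pedge_rev ` oe e = oe (pedge_rev e)"
  by (auto simp: orbit_def image_image pair_act_rev)

lemma oe_src: "pedge_src ` oe e = ve (pedge_src e)"
  by (auto simp: orbit_def image_image pair_act_src)

lemma oe_map4: "g \<in> carrier G \<Longrightarrow> sq_tuple p \<Longrightarrow> map4 oe (map4 (pe g) p) = map4 oe p"
  using EdV Ed_sym by (auto simp: sq_tuple_def corner_def corner'_def oe_act simp del: pair_act.simps)

lemma QQ_simps [simp]: "sc_verts QQ = ve ` (V \<times> V)" "sc_edges QQ = oe ` sc_edges XX"
  "sc_squares QQ = os ` sc_squares XX" "sc_rev QQ = image pedge_rev" "sc_src QQ = image pedge_src"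
  "sc_tgt QQ O' = pedge_src ` pedge_rev ` O'"
  by (auto simp: QQ_def quotient_complex_def tree_product_def image_image)

lemma os_self: "s \<in> sc_squares XX \<Longrightarrow> s \<in> os s"
proof -
  assume "s \<in> sc_squares XX"
  then obtain x x' y y' where e: "(x, x') \<in> Ed" "(y, y') \<in> Ed" "s = dihedral_class pedge_rev (corner x x' y y')"
    by (rule square_cases)
  then have "ps \<one> s = s" using EdV by (simp add: ps_class pe_corner A.\<alpha>_one B.\<alpha>_one del: dihedral_class.simps)
  then show ?thesis unfolding orbit_def by (intro image_eqI[of _ _ \<one>] one_closed) (rule sym)
qed

lemma os_act:
  assumes "g \<in> carrier G" "sq_tuple p"
  shows "os (dihedral_class pedge_rev (map4 (pe g) p)) = os (dihedral_class pedge_rev p)"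
proof -
  have m: "map4 (pe h) (map4 (pe g) p) = map4 (pe (h \<otimes> g)) p" if "h \<in> carrier G" for h
    using assms that EdV by (auto simp: sq_tuple_def pe_corner A.\<alpha>_mult B.\<alpha>_mult)
  show ?thesis
  proof (intro equalityI subsetI)
    fix s assume "s \<in> os (dihedral_class pedge_rev (map4 (pe g) p))"
    then obtain h where h: "h \<in> carrier G" "s = dihedral_class pedge_rev (map4 (pe (h \<otimes> g)) p)"
      by (auto simp: orbit_def ps_class m simp del: dihedral_class.simps)
    then show "s \<in> os (dihedral_class pedge_rev p)"
      unfolding orbit_def ps_class using assms(1) h by (intro image_eqI[of _ _ "h \<otimes> g"] m_closed)
  next
    fix s assume "s \<in> os (dihedral_class pedge_rev p)"
    then obtain h where h: "h \<in> carrier G" "s = dihedral_class pedge_rev (map4 (pe h) p)"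
      by (auto simp: orbit_def ps_class simp del: dihedral_class.simps)
    then have "s = dihedral_class pedge_rev (map4 (pe (h \<otimes> inv g)) (map4 (pe g) p))"
      using assms m[of "h \<otimes> inv g"] by (simp add: m_assoc)
    then show "s \<in> os (dihedral_class pedge_rev (map4 (pe g) p))"
      unfolding orbit_def ps_class using assms(1) h(1)
      by (intro image_eqI[of _ _ "h \<otimes> inv g"] m_closed inv_closed)
  qed
qed

lemma os_class:
  assumes "s \<in> sc_squares XX" "s' \<in> os s" "p \<in> s'"
  shows "sq_tuple p" "os s = os (dihedral_class pedge_rev p)"
proof -
  obtain g where g: "g \<in> carrier G" "s' = ps g s" using assms(2) by (auto simp: orbit_def)
  then obtain p0 where p0: "p0 \<in> s" "p = map4 (pe g) p0" using assms(3) by auto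
  show "sq_tuple p" using pe_tuple[OF g(1)] square_member[OF assms(1) p0(1)] p0 by simp
  show "os s = os (dihedral_class pedge_rev p)"
    unfolding p0(2) os_act[OF g(1) square_member(1)[OF assms(1) p0(1)]]
    by (rule arg_cong[OF square_member(2)[OF assms(1) p0(1)]])
qed

text \<open>\<open>quotient_complex\<close> collects the tuples of all squares in the orbit, but
  translating a tuple does not change the orbits of its edges, so a single square suffices.\<close>

lemma bd_os: "s \<in> sc_squares XX \<Longrightarrow> sc_bd QQ (os s) = map4 oe ` s"
proof -
  assume s: "s \<in> sc_squares XX"
  have "sc_bd QQ (os s) = map4 oe ` (\<Union>s'\<in>os s. s')"
    by (simp add: QQ_def quotient_complex_def)
  also have "\<dots> = map4 oe ` s"
  proof (intro equalityI subsetI)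
    fix t assume "t \<in> map4 oe ` (\<Union>s'\<in>os s. s')"
    then obtain g p where "g \<in> carrier G" "p \<in> s" "t = map4 oe (map4 (pe g) p)" by (auto simp: orbit_def)
    then show "t \<in> map4 oe ` s" using oe_map4 square_member(1)[OF s] by auto
  qed (use os_self[OF s] in blast)
  finally show ?thesis .
qed

lemma bd_os_class: "sq_tuple p \<Longrightarrow> sc_bd QQ (os (dihedral_class pedge_rev p)) = dihedral_class (image pedge_rev) (map4 oe p)"
  using bd_os[OF tuple_square] map4_dihedral[of oe pedge_rev "image pedge_rev" p] oe_rev by simp

lemma square_complex_QQ: "square_complex QQ"
  unfolding square_complex_def
proof (intro conjI ballI)
  fix O' assume "O' \<in> sc_edges QQ"
  then obtain e where e: "e \<in> sc_edges XX" "O' = oe e" by auto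
  note r = rev_edge[OF e(1)]
  show "sc_src QQ O' \<in> sc_verts QQ" "sc_tgt QQ O' \<in> sc_verts QQ" "sc_rev QQ O' \<in> sc_edges QQ"
    "sc_src QQ (sc_rev QQ O') = sc_tgt QQ O'" "sc_tgt QQ (sc_rev QQ O') = sc_src QQ O'" "sc_rev QQ (sc_rev QQ O') = O'"
    using src_vert[OF e(1)] src_vert[OF r] r by (auto simp: e oe_src oe_rev)
  show "sc_rev QQ O' \<noteq> O'"
  proof
    assume "sc_rev QQ O' = O'"
    then have "pedge_rev e \<in> oe e" using oe_self[OF r] by (simp add: e oe_rev)
    then show False using no_inv e unfolding oe_mem acts_without_inversion_def by force
  qed
next
  fix S assume "S \<in> sc_squares QQ"
  then obtain x x' y y' where e: "(x, x') \<in> Ed" "(y, y') \<in> Ed" "S = os (dihedral_class pedge_rev (corner x x' y y'))"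
    using squares_iff by auto
  have sq: "sq_tuple (corner x x' y y')" using e by (simp add: sq_tupleI)
  have "closed_path4 QQ (map4 oe (corner x x' y y'))"
    using e EdV Ed_sym by (auto simp: corner_def oe_rev oe_src)
  then have "closed_path4 QQ (map4 oe (corner x x' y y')) \<and>
      sc_bd QQ S = dihedral_class (sc_rev QQ) (map4 oe (corner x x' y y'))"
    using bd_os_class[OF sq] unfolding e(3) QQ_simps(4) by (rule conjI)
  then show "\<exists>p. closed_path4 QQ p \<and> sc_bd QQ S = dihedral_class (sc_rev QQ) p" by (rule exI)
qed

end

section \<open>Characteristic maps of the cells of the quotient\<close>

lemma compact_space_finite_sum:
  assumes "finite I" "\<And>i. i \<in> I \<Longrightarrow> compact_space (T i)"
  shows "compact_space (sum_topology T I)"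
proof -
  have "compactin (sum_topology T I) (Pair i ` topspace (T i))" if "i \<in> I" for i
    using image_compactin[OF _ continuous_map_component_injection[OF that]] assms(2)[OF that]
    by (simp add: compact_space_def)
  then have "compactin (sum_topology T I) (\<Union>i\<in>I. Pair i ` topspace (T i))"
    using assms(1) by (intro compactin_Union) auto
  moreover have "(\<Union>i\<in>I. Pair i ` topspace (T i)) = topspace (sum_topology T I)" by auto
  ultimately show ?thesis by (simp add: compact_space_def)
qed

lemma continuous_map_from_sum:
  assumes "\<And>i. i \<in> I \<Longrightarrow> continuous_map (T i) Y (\<lambda>x. f (i, x))"
  shows "continuous_map (sum_topology T I) Y f"
  unfolding continuous_map_def
proof (intro conjI allI impI)
  show "f \<in> topspace (sum_topology T I) \<rightarrow> topspace Y"
    using assms by (force simp: continuous_map_def)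
  fix U assume U: "openin Y U"
  show "openin (sum_topology T I) {x \<in> topspace (sum_topology T I). f x \<in> U}"
    unfolding openin_sum_topology
  proof (intro conjI ballI)
    fix i assume i: "i \<in> I"
    have "{x. (i, x) \<in> {x \<in> topspace (sum_topology T I). f x \<in> U}} = {x \<in> topspace (T i). f (i, x) \<in> U}"
      using i by auto
    then show "openin (T i) {x. (i, x) \<in> {x \<in> topspace (sum_topology T I). f x \<in> U}}"
      using openin_continuous_map_preimage[OF assms[OF i] U] by simp
  qed auto
qed

context tree_product_action
begin

sublocale TT: Metric_space12 TR supd TR supd
  by unfold_locales

definition eact where "eact g = map_prod (A.fact g) (B.fact g)"

lemma edge_no_inv: "g \<in> carrier G \<Longrightarrow> e \<in> sc_edges XX \<Longrightarrow> pe g e \<noteq> pedge_rev e"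
  using no_inv unfolding acts_without_inversion_def by simp

lemma square_no_inv:
  "g \<in> carrier G \<Longrightarrow> sq_tuple p \<Longrightarrow> map4 (pe g) p \<in> dihedral_class pedge_rev p \<Longrightarrow> map4 (pe g) p = p"
  using no_inv tuple_square[of p] dihedral_class_self[of p] unfolding acts_without_inversion_def by simp

text \<open>Each coordinate moves by less than 1, so \<open>small_displacement\<close> leaves in
  each factor a fixed end or a reversed edge. Every combination with a reversal inverts an edge or
  turns a square; otherwise the vertex \<open>(u, v)\<close> is fixed and freeness applies.\<close>

lemma eact_displacement:
  assumes g: "g \<in> carrier G" and e: "e \<in> TR \<times> TR" and less: "prod_dist supd supd e (eact g e) < 1"
  shows "g = \<one>"
proof -
  obtain x y where xy: "e = (x, y)" "x \<in> TR" "y \<in> TR" using e by blast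
  obtain u w s where x: "(u, w) \<in> Ed" "0 \<le> s" "s \<le> 1/2" "x = pt u w s" using TR_half xy(2) by blast
  obtain v z r where y: "(v, z) \<in> Ed" "0 \<le> r" "r \<le> 1/2" "y = pt v z r" using TR_half xy(3) by blast
  have V: "u \<in> V" "w \<in> V" "v \<in> V" "z \<in> V" using EdV x y by auto
  have "supd x (A.fact g x) < 1" "supd y (B.fact g y) < 1"
    using less TT.component_le_prod_metric(1)[of x "A.fact g x" y "B.fact g y"]
      TT.component_le_prod_metric(2)[of y "B.fact g y" x "A.fact g x"] by (auto simp: xy eact_def)
  then have s: "supd (pt u w s) (pt (\<alpha> g u) (\<alpha> g w) s) < 1" "supd (pt v z r) (pt (\<beta> g v) (\<beta> g z) r) < 1"
    using x y V g by (simp_all add: A.fact_pt B.fact_pt)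
  have a: "\<alpha> g u = u \<or> \<alpha> g u = w \<and> \<alpha> g w = u"
    using small_displacement[OF x(1) A.\<alpha>_edge[OF g x(1)] x(2,3) s(1)] .
  have b: "\<beta> g v = v \<or> \<beta> g v = z \<and> \<beta> g z = v"
    using small_displacement[OF y(1) B.\<alpha>_edge[OF g y(1)] y(2,3) s(2)] .
  have "\<not> (\<alpha> g u = w \<and> \<alpha> g w = u \<and> \<beta> g v = v)" "\<not> (\<alpha> g u = u \<and> \<beta> g v = z \<and> \<beta> g z = v)"
    using edge_no_inv[OF g, of "Hor (u, w) v"] edge_no_inv[OF g, of "Ver u (v, z)"] x(1) y(1) V by auto
  moreover have "\<not> (\<alpha> g u = w \<and> \<alpha> g w = u \<and> \<beta> g v = z \<and> \<beta> g z = v)"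
  proof
    assume "\<alpha> g u = w \<and> \<alpha> g w = u \<and> \<beta> g v = z \<and> \<beta> g z = v"
    then have c: "map4 (pe g) (corner u w v z) = corner w u z v" by (simp add: pe_corner)
    have "map4 (pe g) (corner u w v z) \<in> dihedral_class pedge_rev (corner u w v z)"
      unfolding c corner_class by simp
    from square_no_inv[OF g sq_tupleI(1)[OF x(1) y(1)] this]
    have "corner w u z v = corner u w v z" unfolding c .
    then show False using Ed_neq[OF x(1)] by (simp add: corner_def)
  qed
  ultimately have "\<alpha> g u = u" "\<beta> g v = v" using a b by blast+
  then show ?thesis using free g V by blast
qed

sublocale FA: free_isometric_action "TR \<times> TR" "prod_dist supd supd" G eact 1
proof
  show "eact g e \<in> TR \<times> TR" if "g \<in> carrier G" "e \<in> TR \<times> TR" for g e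
    using that A.fact_closed B.fact_closed by (auto simp: eact_def)
  show "eact (g \<otimes> h) e = eact g (eact h e)" if "g \<in> carrier G" "h \<in> carrier G" "e \<in> TR \<times> TR" for g h e
    using that A.fact_mult B.fact_mult by (auto simp: eact_def)
  show "eact \<one> e = e" if "e \<in> TR \<times> TR" for e
    using that A.fact_one B.fact_one by (auto simp: eact_def)
  show "prod_dist supd supd (eact g e) (eact g e') = prod_dist supd supd e e'"
    if "g \<in> carrier G" "e \<in> TR \<times> TR" "e' \<in> TR \<times> TR" for g e e'
    using that A.fact_supd B.fact_supd by (auto simp: eact_def prod_dist_def)
qed (use eact_displacement in auto)

text \<open>Points of an edge and of a square, in the coordinates of the sides of the unit square that
  are used by \<^const>\<open>glue\<close>.\<close>

fun evE :: "'v pedge \<Rightarrow> real \<Rightarrow> ('v \<Rightarrow> real) \<times> ('v \<Rightarrow> real)" where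
  "evE (Hor (x, x') y) s = (pt x x' s, vx y)"
| "evE (Ver x (y, y')) s = (vx x, pt y y' s)"

fun evT :: "'v pedge \<times> 'v pedge \<times> 'v pedge \<times> 'v pedge \<Rightarrow> real \<Rightarrow> real \<Rightarrow> ('v \<Rightarrow> real) \<times> ('v \<Rightarrow> real)" where
  "evT (Hor (x, x') y, Ver x'' (y', y''), e, f) s t = (pt x x' s, pt y' y'' t)"
| "evT (Ver x (y, y'), Hor (x', x'') y'', e, f) s t = (pt x' x'' t, pt y y' s)"
| "evT (Hor a b, Hor c d, e, f) s t = undefined"
| "evT (Ver a b, Ver c d, e, f) s t = undefined"

lemma evT_corner: "evT (corner x x' y y') s t = (pt x x' s, pt y y' t)"
  "evT (corner' x x' y y') s t = (pt x x' t, pt y y' s)"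
  by (simp_all add: corner_def corner'_def)

lemma evE_act: "g \<in> carrier G \<Longrightarrow> e \<in> sc_edges XX \<Longrightarrow> evE (pe g e) s = eact g (evE e s)"
  using EdV by (erule_tac edge_cases) (auto simp: eact_def A.fact_pt B.fact_pt A.fact_vx B.fact_vx)

lemma evE_rev: "evE (pedge_rev e) s = evE e (1 - s)"
  using pt_flip by (cases e rule: pedge_rev.cases) auto

lemma evT_act: "g \<in> carrier G \<Longrightarrow> sq_tuple p \<Longrightarrow> evT (map4 (pe g) p) s t = eact g (evT p s t)"
  using EdV by (auto simp: sq_tuple_def pe_corner evT_corner eact_def A.fact_pt B.fact_pt)

lemma evT_sides:
  assumes "sq_tuple (a, b, c, d)"
  shows "evT (a, b, c, d) x 0 = evE a x" "evT (a, b, c, d) 1 x = evE b x"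
    "evT (a, b, c, d) (1 - x) 1 = evE c x" "evT (a, b, c, d) 0 (1 - x) = evE d x"
  using assms pt_flip unfolding sq_tuple_def corner_def corner'_def by (auto simp: pt_0 pt_1)

lemma evT_in: "sq_tuple p \<Longrightarrow> s \<in> {0..1} \<Longrightarrow> t \<in> {0..1} \<Longrightarrow> evT p s t \<in> TR \<times> TR"
  unfolding sq_tuple_def using pt_in_TR by (auto simp: evT_corner)

lemma evE_in: "e \<in> sc_edges XX \<Longrightarrow> s \<in> {0..1} \<Longrightarrow> evE e s \<in> TR \<times> TR"
  using pt_in_TR vx_in_TR by (erule_tac edge_cases) auto

lemma evT_dihedral:
  assumes "p' \<in> dihedral_class pedge_rev (corner x x' y y')" "s \<in> {0..1}" "t \<in> {0..1}"
  shows "\<exists>s'\<in>{0..1}. \<exists>t'\<in>{0..1}. evT p' s' t' = (pt x x' s, pt y y' t)"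
proof -
  have "1 - s \<in> {0..1}" "1 - t \<in> {0..1}" using assms by auto
  note i = assms(2,3) this
  have f: "pt x' x (1 - s) = pt x x' s" "pt y' y (1 - t) = pt y y' t" by (simp_all add: pt_def fun_eq_iff)
  show ?thesis using assms(1) unfolding corner_class
    by (elim insertE emptyE) (simp only: evT_corner, use i f in metis)+
qed

text \<open>In each factor an interior point determines its edge up to orientation, by
  \<open>pt_eq_pt\<close>; the two orientations and the order of reading make up the dihedral
  class.\<close>

lemma evT_interior_eq:
  assumes "sq_tuple p" "sq_tuple p'" "0 < s" "s < 1" "0 < t" "t < 1" "0 < s'" "s' < 1" "0 < t'" "t' < 1"
    and "evT p s t = evT p' s' t'"
  shows "p' \<in> dihedral_class pedge_rev p" "p' = p \<Longrightarrow> s' = s \<and> t' = t"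
proof -
  obtain x x' y y' S T where p: "(x, x') \<in> Ed" "(y, y') \<in> Ed" "0 < S" "S < 1" "0 < T" "T < 1"
    "evT p s t = (pt x x' S, pt y y' T)"
    "p = corner x x' y y' \<and> S = s \<and> T = t \<or> p = corner' x x' y y' \<and> S = t \<and> T = s"
    using assms(1,3-6) unfolding sq_tuple_def by (auto simp: evT_corner)
  obtain X X' Y Y' S' T' where p': "(X, X') \<in> Ed" "(Y, Y') \<in> Ed" "0 < S'" "S' < 1" "0 < T'" "T' < 1"
    "evT p' s' t' = (pt X X' S', pt Y Y' T')"
    "p' = corner X X' Y Y' \<and> S' = s' \<and> T' = t' \<or> p' = corner' X X' Y Y' \<and> S' = t' \<and> T' = s'"
    using assms(2,7-10) unfolding sq_tuple_def by (auto simp: evT_corner)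
  have eq: "pt x x' S = pt X X' S'" "pt y y' T = pt Y Y' T'" using assms(11) p p' by auto
  have c: "X = x \<and> X' = x' \<and> S' = S \<or> X = x' \<and> X' = x \<and> S' = 1 - S"
    "Y = y \<and> Y' = y' \<and> T' = T \<or> Y = y' \<and> Y' = y \<and> T' = 1 - T"
    using pt_eq_pt[OF p(1,3,4) p'(1,3,4) eq(1)] pt_eq_pt[OF p(2,5,6) p'(2,5,6) eq(2)] by auto
  have cl: "dihedral_class pedge_rev p = dihedral_class pedge_rev (corner x x' y y')"
    using p(8) corner'_class by auto
  have "p' \<in> {corner x x' y y', corner x' x y y', corner x x' y' y, corner x' x y' y,
        corner' x x' y y', corner' x' x y y', corner' x x' y' y, corner' x' x y' y}"
    using c p'(8) by (elim disjE conjE) simp_all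
  then show "p' \<in> dihedral_class pedge_rev p" unfolding cl corner_class .
  show "s' = s \<and> t' = t" if "p' = p"
    using that c p(8) p'(8) Ed_neq[OF p(1)] Ed_neq[OF p(2)] by (auto simp: corner_def corner'_def)
qed

text \<open>Representatives for the orbits of cells. For a square the tuple is taken over exactly
  the boundary description that \<open>glue\<close> picks by its own choice, since the coordinates
  of the square have to match the glued sides.\<close>

definition rv where "rv v = (SOME z. z \<in> v)" for v :: "('v \<times> 'v) set"
definition re where "re O' = (SOME e. e \<in> O')" for O' :: "'v pedge set"
definition rt where "rt S = (SOME p. p \<in> \<Union>S \<and> map4 oe p = (SOME q. q \<in> sc_bd QQ S))"

lemma ve_act: "g \<in> carrier G \<Longrightarrow> z \<in> V \<times> V \<Longrightarrow> ve (pv g z) = ve z"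
proof -
  assume a: "g \<in> carrier G" "z \<in> V \<times> V"
  then have z: "fst z \<in> V" "snd z \<in> V" by auto
  show ?thesis
  proof (intro equalityI subsetI)
    fix x assume "x \<in> ve (pv g z)"
    then obtain h where h: "h \<in> carrier G" "x = pv h (pv g z)" by (auto simp: orbit_def)
    then have "x = pv (h \<otimes> g) z" using a z by (simp add: prod_eq_iff A.\<alpha>_mult B.\<alpha>_mult)
    then show "x \<in> ve z" unfolding orbit_def by (rule image_eqI) (intro m_closed a h)
  next
    fix x assume "x \<in> ve z"
    then obtain h where h: "h \<in> carrier G" "x = pv h z" by (auto simp: orbit_def)
    then have "x = pv (h \<otimes> inv g) (pv g z)"
      using a z by (simp add: prod_eq_iff A.\<alpha>_mult B.\<alpha>_mult A.\<alpha>_closed B.\<alpha>_closed A.\<alpha>_inv B.\<alpha>_inv)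
    then show "x \<in> ve (pv g z)" unfolding orbit_def by (rule image_eqI) (intro m_closed inv_closed a h)
  qed
qed

lemma rv: "v \<in> sc_verts QQ \<Longrightarrow> rv v \<in> v \<and> rv v \<in> V \<times> V \<and> v = ve (rv v)"
proof -
  assume "v \<in> sc_verts QQ"
  then obtain z where z: "z \<in> V \<times> V" "v = ve z" by auto
  have "z = pv \<one> z" using z A.\<alpha>_one B.\<alpha>_one by auto
  then have "z \<in> v" unfolding z(2) orbit_def by (rule image_eqI) simp
  then have "rv v \<in> v" unfolding rv_def by (rule someI)
  then obtain g where g: "g \<in> carrier G" "rv v = pv g z" using z by (auto simp: orbit_def)
  then have "v = ve (rv v)" using ve_act z by simp
  moreover have "rv v \<in> V \<times> V" using g z A.\<alpha>_closed B.\<alpha>_closed by auto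
  ultimately show ?thesis using \<open>rv v \<in> v\<close> by blast
qed

lemma re: "O' \<in> sc_edges QQ \<Longrightarrow> re O' \<in> O' \<and> re O' \<in> sc_edges XX \<and> O' = oe (re O')"
proof -
  assume "O' \<in> sc_edges QQ"
  then obtain e where e: "e \<in> sc_edges XX" "O' = oe e" by auto
  then have "e \<in> O'" using oe_self by simp
  then have m: "re O' \<in> O'" unfolding re_def by (rule someI)
  show ?thesis using oe_eq[OF e(1) m[unfolded e(2)]] oe_edge[OF e(1) m[unfolded e(2)]] e(2) m by auto
qed

lemma rt:
  assumes "S \<in> sc_squares QQ"
  shows "sq_tuple (rt S)" "map4 oe (rt S) = (SOME q. q \<in> sc_bd QQ S)" "S = os (dihedral_class pedge_rev (rt S))"
proof -
  obtain s where s: "s \<in> sc_squares XX" "S = os s" using assms by auto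
  from s(1) obtain x x' y y' where "s = dihedral_class pedge_rev (corner x x' y y')" by (rule square_cases)
  then have "corner x x' y y' \<in> s" by (simp only: dihedral_class_self)
  then have "\<exists>q. q \<in> sc_bd QQ S" unfolding s(2) bd_os[OF s(1)] by blast
  then have "(SOME q. q \<in> sc_bd QQ S) \<in> sc_bd QQ S" by (rule someI_ex)
  then obtain p where p: "p \<in> s" "(SOME q. q \<in> sc_bd QQ S) = map4 oe p"
    unfolding s(2) bd_os[OF s(1)] by blast
  have "p \<in> \<Union>S" using p(1) os_self[OF s(1)] unfolding s(2) by blast
  then have "\<exists>p. p \<in> \<Union>S \<and> map4 oe p = (SOME q. q \<in> sc_bd QQ S)"
    using p(2) by (intro exI[of _ p]) simp
  then have rt: "rt S \<in> \<Union>S \<and> map4 oe (rt S) = (SOME q. q \<in> sc_bd QQ S)"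
    unfolding rt_def by (rule someI_ex)
  then show "map4 oe (rt S) = (SOME q. q \<in> sc_bd QQ S)" by blast
  obtain s' where "s' \<in> os s" "rt S \<in> s'" using rt s(2) by blast
  then show "sq_tuple (rt S)" "S = os (dihedral_class pedge_rev (rt S))"
    using os_class[OF s(1)] s(2) by auto
qed

text \<open>The characteristic maps of all cells at once, with values in the product upstairs
  instead of the quotient; they are the map to which \<open>orbit_space_quotient\<close> is
  applied.\<close>

fun chr :: "(('v \<times> 'v) set, 'v pedge set, ('v pedge \<times> 'v pedge \<times> 'v pedge \<times> 'v pedge) set set) cell \<times> real \<times> real
    \<Rightarrow> ('v \<Rightarrow> real) \<times> ('v \<Rightarrow> real)" where
  "chr (VCell v, _) = map_prod vx vx (rv v)"
| "chr (ECell e, z) = evE (re e) (fst z)"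
| "chr (SCell S, z) = evT (rt S) (fst z) (snd z)"

abbreviation "YY \<equiv> sum_topology cell_space (cells QQ)"

lemma YY_cells:
  "(VCell v, z) \<in> topspace YY \<longleftrightarrow> v \<in> sc_verts QQ \<and> z = (0, 0)"
  "(ECell e, z) \<in> topspace YY \<longleftrightarrow> e \<in> sc_edges QQ \<and> fst z \<in> {0..1} \<and> snd z = 0"
  "(SCell S, z) \<in> topspace YY \<longleftrightarrow> S \<in> sc_squares QQ \<and> fst z \<in> {0..1} \<and> snd z \<in> {0..1}"
  by (cases z; auto simp: cells_def simp del: QQ_simps)+

lemma chr_in: "y \<in> topspace YY \<Longrightarrow> chr y \<in> TR \<times> TR"
proof -
  assume y: "y \<in> topspace YY"
  obtain k z where kz: "y = (k, z)" by (cases y)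
  show ?thesis
  proof (cases k)
    case (VCell v)
    then have "rv v \<in> V \<times> V" using y rv unfolding kz by (simp only: YY_cells)
    then show ?thesis using kz VCell vx_in_TR by auto
  next
    case (ECell e)
    then show ?thesis using y re[of e] evE_in unfolding kz by (simp only: YY_cells chr.simps)
  next
    case (SCell S)
    then show ?thesis using y rt(1)[of S] evT_in unfolding kz by (simp only: YY_cells chr.simps)
  qed
qed

lemma continuous_map_pair_pt:
  assumes "(x, x') \<in> Ed" "(y, y') \<in> Ed" "continuous_map Z (top_of_set {0..1}) f" "continuous_map Z (top_of_set {0..1}) g"
  shows "continuous_map Z TT.Prod_metric.mtopology (\<lambda>z. (pt x x' (f z), pt y y' (g z)))"
  unfolding TT.mtopology_prod_metric using assms
  by (simp add: continuous_map_pairwise o_def continuous_map_pt)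

lemma continuous_chr: "continuous_map YY TT.Prod_metric.mtopology chr"
proof (rule continuous_map_from_sum)
  fix k assume k: "k \<in> cells QQ"
  have zero: "continuous_map Z (top_of_set {0..1::real}) (\<lambda>_. 0)" for Z :: "(real \<times> real) topology" by simp
  show "continuous_map (cell_space k) TT.Prod_metric.mtopology (\<lambda>z. chr (k, z))"
  proof (cases k)
    case (VCell v)
    have "chr (VCell v, (0, 0)) \<in> TR \<times> TR"
      using chr_in[of "(VCell v, (0, 0))"] k VCell by (simp add: cells_def image_iff)
    then show ?thesis unfolding VCell by simp
  next
    case (ECell e)
    then have "e \<in> sc_edges QQ" using k by (auto simp: cells_def simp del: QQ_simps)
    from re[OF this] have "re e \<in> sc_edges XX" by blast
    moreover have f: "continuous_map (cell_space k) (top_of_set {0..1}) fst"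
      unfolding ECell by (auto intro!: continuous_on_fst continuous_on_id)
    ultimately show ?thesis unfolding ECell
    proof (cases rule: edge_cases)
      case (1 x x' y)
      \<comment> \<open>A vertex is the end of some edge, so the constant coordinate can be written
        as \<open>pt y y' 0\<close> and the continuity of pairs of \<open>pt\<close> covers this
        case too.\<close>
      obtain y' where "(y, y') \<in> Ed" using neighbour 1 by blast
      then show "continuous_map (cell_space (ECell e)) TT.Prod_metric.mtopology (\<lambda>z. chr (ECell e, z))"
        using continuous_map_pair_pt[OF 1(2) _ f[unfolded ECell] zero] 1 by (simp add: pt_0)
    next
      case (2 x y y')
      obtain x' where "(x, x') \<in> Ed" using neighbour 2 by blast
      then show "continuous_map (cell_space (ECell e)) TT.Prod_metric.mtopology (\<lambda>z. chr (ECell e, z))"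
        using continuous_map_pair_pt[OF _ 2(3) zero f[unfolded ECell]] 2 by (simp add: pt_0)
    qed
  next
    case (SCell S)
    then have "S \<in> sc_squares QQ" using k by (auto simp: cells_def simp del: QQ_simps)
    from rt(1)[OF this] obtain x x' y y' where e: "(x, x') \<in> Ed" "(y, y') \<in> Ed"
      "rt S = corner x x' y y' \<or> rt S = corner' x x' y y'" unfolding sq_tuple_def by blast
    have f: "continuous_map (cell_space k) (top_of_set {0..1}) fst" "continuous_map (cell_space k) (top_of_set {0..1}) snd"
      unfolding SCell by (auto intro!: continuous_on_fst continuous_on_snd continuous_on_id)
    then show ?thesis
      using continuous_map_pair_pt[OF e(1,2) f] continuous_map_pair_pt[OF e(1,2) f(2,1)] e(3)
      unfolding SCell by (auto simp: evT_corner)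
  qed
qed

lemma compact_YY: "finite_complex QQ \<Longrightarrow> compact_space YY"
proof (rule compact_space_finite_sum)
  show "finite_complex QQ \<Longrightarrow> finite (cells QQ)" by (auto simp: finite_complex_def cells_def)
  show "compact_space (cell_space i)" for i :: "(('v \<times> 'v) set, 'v pedge set, ('v pedge \<times> 'v pedge \<times> 'v pedge \<times> 'v pedge) set set) cell"
    by (cases i) (auto simp: compact_space_subtopology compact_Times)
qed

lemma chr_cover:
  assumes "e \<in> TR \<times> TR" shows "\<exists>y\<in>topspace YY. FA.same_orbit (chr y) e"
proof -
  obtain x x' s y y' t where e: "e = (pt x x' s, pt y y' t)" "(x, x') \<in> Ed" "(y, y') \<in> Ed" "s \<in> {0..1}" "t \<in> {0..1}"
    using assms unfolding TR_def by blast
  let ?p = "corner x x' y y'"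
  define S where "S = os (dihedral_class pedge_rev ?p)"
  have p: "sq_tuple ?p" using e sq_tupleI by blast
  have S: "S \<in> sc_squares QQ" unfolding S_def using tuple_square[OF p] by simp
  \<comment> \<open>The chosen tuple may read a translate of the square from another corner;
    \<open>evT_dihedral\<close> finds the coordinates of the point in that reading.\<close>
  have "dihedral_class pedge_rev (rt S) \<in> os (dihedral_class pedge_rev ?p)"
    using rt(3)[OF S] os_self[OF tuple_square[OF rt(1)[OF S]]] unfolding S_def by simp
  then obtain g where g: "g \<in> carrier G" "dihedral_class pedge_rev (rt S) = dihedral_class pedge_rev (map4 (pe g) ?p)"
    unfolding orbit_def ps_class by blast
  then have "rt S \<in> dihedral_class pedge_rev (corner (\<alpha> g x) (\<alpha> g x') (\<beta> g y) (\<beta> g y'))"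
    using dihedral_class_self[of "rt S" pedge_rev] pe_corner(1) by metis
  then obtain s' t' where st: "s' \<in> {0..1}" "t' \<in> {0..1}"
    "evT (rt S) s' t' = (pt (\<alpha> g x) (\<alpha> g x') s, pt (\<beta> g y) (\<beta> g y') t)"
    using evT_dihedral e(4,5) by blast
  then have "evT (rt S) s' t' = eact g e"
    using g e EdV by (simp add: eact_def A.fact_pt B.fact_pt)
  then have "FA.same_orbit e (chr (SCell S, (s', t')))" using g unfolding FA.same_orbit_def by auto
  moreover have "(SCell S, (s', t')) \<in> topspace YY" using S st unfolding YY_cells by simp
  ultimately show ?thesis using FA.same_orbit_sym assms by blast
qed

end

section \<open>Glued points are the points of one orbit\<close>

context tree_product_action
begin

abbreviation vv :: "'v \<times> 'v \<Rightarrow> ('v \<Rightarrow> real) \<times> ('v \<Rightarrow> real)" where "vv \<equiv> map_prod vx vx"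

lemma vv_act: "g \<in> carrier G \<Longrightarrow> z \<in> V \<times> V \<Longrightarrow> vv (pv g z) = eact g (vv z)"
  by (auto simp: eact_def A.fact_vx B.fact_vx)

lemma evE_0: "evE e 0 = vv (pedge_src e)" and evE_1: "evE e 1 = vv (pedge_src (pedge_rev e))"
  by (cases e rule: pedge_rev.cases; simp add: pt_0 pt_1)+

lemma vert_lift: "v \<in> sc_verts QQ \<Longrightarrow> z \<in> v \<Longrightarrow> FA.same_orbit (vv (rv v)) (vv z)"
proof -
  assume v: "v \<in> sc_verts QQ" "z \<in> v"
  then obtain g where "g \<in> carrier G" "z = pv g (rv v)" using rv[OF v(1)] by (auto simp: orbit_def)
  then show ?thesis using vv_act rv[OF v(1)] unfolding FA.same_orbit_def by auto
qed

lemma edge_lift: "O' \<in> sc_edges QQ \<Longrightarrow> e \<in> O' \<Longrightarrow> FA.same_orbit (evE (re O') s) (evE e s)"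
proof -
  assume O': "O' \<in> sc_edges QQ" "e \<in> O'"
  then have "e \<in> oe (re O')" using re[OF O'(1)] by auto
  then obtain g where "g \<in> carrier G" "e = pe g (re O')" unfolding oe_mem by blast
  then show ?thesis using evE_act re[OF O'(1)] unfolding FA.same_orbit_def by auto
qed

lemma src_in: "O' \<in> sc_edges QQ \<Longrightarrow> sc_src QQ O' \<in> sc_verts QQ \<and> sc_tgt QQ O' \<in> sc_verts QQ \<and> sc_rev QQ O' \<in> sc_edges QQ"
  using square_complex_QQ unfolding square_complex_def by blast

lemma side_lift:
  assumes S: "S \<in> sc_squares QQ" and abcd: "(a, b, c, d) = (SOME q. q \<in> sc_bd QQ S)"
    and x: "x \<in> {0..1}"
  shows "FA.same_orbit (chr (ECell a, x, 0)) (chr (SCell S, x, 0)) \<and>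
    FA.same_orbit (chr (ECell b, x, 0)) (chr (SCell S, 1, x)) \<and>
    FA.same_orbit (chr (ECell c, x, 0)) (chr (SCell S, 1 - x, 1)) \<and>
    FA.same_orbit (chr (ECell d, x, 0)) (chr (SCell S, 0, 1 - x)) \<and>
    {a, b, c, d} \<subseteq> sc_edges QQ"
proof -
  obtain a' b' c' d' where r: "rt S = (a', b', c', d')" by (cases "rt S")
  note rt = rt(1,2)[OF S]
  have "(oe a', oe b', oe c', oe d') = (a, b, c, d)"
    using rt(2) unfolding abcd[symmetric] r map4.simps .
  then have o: "a = oe a'" "b = oe b'" "c = oe c'" "d = oe d'" by simp_all
  have "\<forall>e\<in>{a', b', c', d'}. e \<in> sc_edges XX"
    using rt(1) EdV Ed_sym unfolding r sq_tuple_def corner_def corner'_def by auto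
  then have e: "a' \<in> a" "b' \<in> b" "c' \<in> c" "d' \<in> d" "{a, b, c, d} \<subseteq> sc_edges QQ"
    using oe_self o by auto
  then show ?thesis
    using edge_lift[of a a' x] edge_lift[of b b' x] edge_lift[of c c' x] edge_lift[of d d' x]
      evT_sides[OF rt(1)[unfolded r]] by (simp add: r del: QQ_simps)
qed

lemma glue_same_orbit:
  assumes "glue QQ y y'"
  shows "y \<in> topspace YY \<and> y' \<in> topspace YY \<and> FA.same_orbit (chr y') (chr y)"
  using assms
proof cases
  case (1 e)
  have "pedge_src (re e) \<in> sc_src QQ e" using re[OF 1(3)] by simp
  then show ?thesis using 1 src_in[OF 1(3)] vert_lift[of "sc_src QQ e" "pedge_src (re e)"]
    by (simp add: YY_cells evE_0 del: QQ_simps topspace_sum_topology)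
next
  case (2 e)
  have "pedge_src (pedge_rev (re e)) \<in> sc_tgt QQ e" using re[OF 2(3)] by simp
  then show ?thesis using 2 src_in[OF 2(3)] vert_lift[of "sc_tgt QQ e" "pedge_src (pedge_rev (re e))"]
    by (simp add: YY_cells evE_1 del: QQ_simps topspace_sum_topology)
next
  case (3 e x)
  have "pedge_rev (re e) \<in> sc_rev QQ e" using re[OF 3(3)] by simp
  then show ?thesis using 3 src_in[OF 3(3)] edge_lift[of "sc_rev QQ e" "pedge_rev (re e)" "1 - x"]
    by (simp add: YY_cells evE_rev del: QQ_simps topspace_sum_topology)
next
  case (4 s x a b c d)
  then show ?thesis using side_lift[OF 4(3) 4(5) 4(4)]
    by (simp add: YY_cells del: QQ_simps topspace_sum_topology chr.simps)
next
  case (5 s x a b c d)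
  then show ?thesis using side_lift[OF 5(3) 5(5) 5(4)]
    by (simp add: YY_cells del: QQ_simps topspace_sum_topology chr.simps)
next
  case (6 s x a b c d)
  then show ?thesis using side_lift[OF 6(3) 6(5) 6(4)]
    by (simp add: YY_cells del: QQ_simps topspace_sum_topology chr.simps)
next
  case (7 s x a b c d)
  then show ?thesis using side_lift[OF 7(3) 7(5) 7(4)]
    by (simp add: YY_cells del: QQ_simps topspace_sum_topology chr.simps)
qed

lemma glued_same_orbit:
  assumes "equivclp (glue QQ) y y'" "y \<in> topspace YY"
  shows "y' \<in> topspace YY \<and> FA.same_orbit (chr y) (chr y')"
  using assms(1)
proof (induction rule: equivclp_induct)
  case base
  then show ?case using assms(2) FA.same_orbit_refl chr_in by blast
next
  case (step z z')
  then have "z \<in> topspace YY" "z' \<in> topspace YY" "FA.same_orbit (chr z) (chr z')"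
    using glue_same_orbit FA.same_orbit_sym chr_in by blast+
  then show ?case using step.IH FA.same_orbit_trans chr_in assms(2) by blast
qed

text \<open>Normal forms for the glueing: \<open>to_inner\<close> moves every point into an open
  cell, and \<open>inner_unique\<close> compares points of open cells through their coordinates.
  Together they settle the equivalence relation generated by \<open>glue\<close>.\<close>

definition inner where
  "inner y \<longleftrightarrow> (\<exists>v. y = (VCell v, 0, 0)) \<or> (\<exists>e s. y = (ECell e, s, 0) \<and> 0 < s \<and> s < 1) \<or>
     (\<exists>S s t. y = (SCell S, s, t) \<and> 0 < s \<and> s < 1 \<and> 0 < t \<and> t < (1::real))"

lemma edge_to_inner:
  assumes "e \<in> sc_edges QQ" "s \<in> {0..1}"
  shows "\<exists>y. equivclp (glue QQ) (ECell e, s, 0) y \<and> inner y"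
proof -
  consider "s = 0" | "s = 1" | "0 < s" "s < 1" using assms(2) by force
  then show ?thesis
  proof cases
    case 1
    then show ?thesis using glue.intros(1)[OF assms(1)]
      by (intro exI[of _ "(VCell (sc_src QQ e), 0, 0)"] conjI) (auto simp: inner_def simp del: QQ_simps)
  next
    case 2
    then show ?thesis using glue.intros(2)[OF assms(1)]
      by (intro exI[of _ "(VCell (sc_tgt QQ e), 0, 0)"] conjI) (auto simp: inner_def simp del: QQ_simps)
  next
    case 3
    then show ?thesis by (intro exI[of _ "(ECell e, s, 0)"]) (simp add: inner_def)
  qed
qed

lemma to_inner:
  assumes "y \<in> topspace YY"
  shows "\<exists>y'. equivclp (glue QQ) y y' \<and> inner y'"
proof -
  obtain k s t where y: "y = (k, s, t)" by (cases y)
  show ?thesis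
  proof (cases k)
    case (VCell v)
    then have "y = (VCell v, 0, 0)" using assms unfolding y VCell YY_cells by simp
    then show ?thesis by (intro exI[of _ y]) (simp add: inner_def)
  next
    case (ECell e)
    then show ?thesis using edge_to_inner[of e s] assms unfolding y ECell YY_cells by simp
  next
    case (SCell S)
    then have S: "S \<in> sc_squares QQ" "s \<in> {0..1}" "t \<in> {0..1}" using assms unfolding y SCell YY_cells by auto
    obtain a b c d where abcd: "(a, b, c, d) = (SOME q. q \<in> sc_bd QQ S)" by (cases "SOME q. q \<in> sc_bd QQ S") auto
    have E: "a \<in> sc_edges QQ" "b \<in> sc_edges QQ" "c \<in> sc_edges QQ" "d \<in> sc_edges QQ"
      using side_lift[OF S(1) abcd S(2)] by blast+
    have step: "\<exists>y'. equivclp (glue QQ) y y' \<and> inner y'"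
      if st: "glue QQ y (ECell e, x, 0)" "e \<in> sc_edges QQ" "x \<in> {0..1}" for e x
    proof -
      from edge_to_inner[OF st(2,3)]
      obtain y' where y': "equivclp (glue QQ) (ECell e, x, 0) y'" "inner y'" by (elim exE conjE)
      have "equivclp (glue QQ) y y'" by (rule equivclp_trans[OF r_into_equivclp[of "glue QQ", OF st(1)] y'(1)])
      then show ?thesis using y'(2) by (intro exI[of _ y'] conjI)
    qed
    have m: "1 - s \<in> {0..1}" "1 - t \<in> {0..1}" using S by auto
    consider "t = 0" | "s = 1" | "t = 1" | "s = 0" | "0 < s" "s < 1" "0 < t" "t < 1" using S by force
    then show ?thesis
    proof cases
      case 1
      then show ?thesis using step[OF _ E(1) S(2)] glue.intros(4)[OF S(1) S(2) abcd] y SCell by simp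
    next
      case 2
      then show ?thesis using step[OF _ E(2) S(3)] glue.intros(5)[OF S(1) S(3) abcd] y SCell by simp
    next
      case 3
      then show ?thesis using step[OF _ E(3) m(1)] glue.intros(6)[OF S(1) m(1) abcd] y SCell by simp
    next
      case 4
      then show ?thesis using step[OF _ E(4) m(2)] glue.intros(7)[OF S(1) m(2) abcd] y SCell by simp
    next
      case 5
      then show ?thesis using y SCell by (intro exI[of _ y]) (simp add: inner_def)
    qed
  qed
qed

lemma vv_neq_evE: "z \<in> V \<times> V \<Longrightarrow> e \<in> sc_edges XX \<Longrightarrow> 0 < s \<Longrightarrow> s < 1 \<Longrightarrow> vv z \<noteq> evE e s"
  using vx_neq_pt by (erule_tac edge_cases) (auto simp: map_prod_def split: prod.splits)

lemma vv_neq_evT: "z \<in> V \<times> V \<Longrightarrow> sq_tuple p \<Longrightarrow> 0 < s \<Longrightarrow> s < 1 \<Longrightarrow> 0 < t \<Longrightarrow> t < 1 \<Longrightarrow> vv z \<noteq> evT p s t"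
  unfolding sq_tuple_def using vx_neq_pt by (auto simp: evT_corner)

lemma evE_neq_evT:
  "e \<in> sc_edges XX \<Longrightarrow> sq_tuple p \<Longrightarrow> 0 < s \<Longrightarrow> s < 1 \<Longrightarrow> 0 < t \<Longrightarrow> t < 1 \<Longrightarrow> evE e r \<noteq> evT p s t"
  unfolding sq_tuple_def using vx_neq_pt by (erule_tac edge_cases) (auto simp: evT_corner)

lemma evE_eq:
  assumes "e \<in> sc_edges XX" "e' \<in> sc_edges XX" "0 < s" "s < 1" "0 < s'" "s' < 1" "evE e s = evE e' s'"
  shows "e' = e \<and> s' = s \<or> e' = pedge_rev e \<and> s' = 1 - s"
  using assms(1)
proof (cases rule: edge_cases)
  case hor: (1 x x' y)
  show ?thesis using assms(2)
  proof (cases rule: edge_cases)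
    case (1 X X' Y)
    then show ?thesis
      using assms hor pt_eq_pt[of x x' s X X' s'] vx_inj[of y Y] by auto
  next
    case (2 X Y Y')
    then show ?thesis
      using assms hor vx_neq_pt[of Y Y' s' y] by simp
  qed
next
  case ver: (2 x y y')
  show ?thesis using assms(2)
  proof (cases rule: edge_cases)
    case (1 X X' Y)
    then show ?thesis
      using assms ver vx_neq_pt[of X X' s' x] by simp
  next
    case (2 X Y Y')
    then show ?thesis
      using assms ver pt_eq_pt[of y y' s Y Y' s'] vx_inj[of x X] by auto
  qed
qed

lemma inner_cases:
  assumes "inner y" "y \<in> topspace YY"
  obtains v where "y = (VCell v, 0, 0)" "v \<in> sc_verts QQ"
  | e s where "y = (ECell e, s, 0)" "e \<in> sc_edges QQ" "0 < s" "s < 1"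
  | S s t where "y = (SCell S, s, t)" "S \<in> sc_squares QQ" "0 < s" "s < 1" "0 < t" "t < 1"
  using assms unfolding inner_def
  by (elim disjE exE conjE) (simp_all add: YY_cells del: QQ_simps topspace_sum_topology)

lemma inner_unique:
  assumes y: "inner y" "y \<in> topspace YY" and y': "inner y'" "y' \<in> topspace YY"
    and orb: "FA.same_orbit (chr y) (chr y')"
  shows "equivclp (glue QQ) y y'"
proof -
  obtain g where g: "g \<in> carrier G" "chr y' = eact g (chr y)" using orb unfolding FA.same_orbit_def by blast
  show ?thesis using y
  proof (cases rule: inner_cases)
    case (1 v)
    have z: "rv v \<in> V \<times> V" "v = ve (rv v)" using rv[OF 1(2)] by auto
    have z': "pv g (rv v) \<in> V \<times> V" using z g A.\<alpha>_closed B.\<alpha>_closed by auto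
    have eq: "chr y' = vv (pv g (rv v))" using 1 g z vv_act by simp
    show ?thesis using y'
    proof (cases rule: inner_cases)
      case (1 v')
      have w: "rv v' \<in> V \<times> V" "v' = ve (rv v')" using rv[OF 1(2)] by auto
      have "vv (rv v') = vv (pv g (rv v))" using eq 1 by simp
      then have "rv v' = pv g (rv v)" using w z' vx_inj by (auto simp: prod_eq_iff)
      then have "v' = v" using ve_act[OF g(1) z(1)] z(2) w(2) by simp
      then show ?thesis using 1 \<open>y = (VCell v, 0, 0)\<close> by simp
    next
      case (2 e s)
      then show ?thesis using eq re[of e] vv_neq_evE[OF z', of "re e" s] by (simp del: QQ_simps)
    next
      case (3 S s t)
      then show ?thesis using eq rt(1)[of S] vv_neq_evT[OF z', of "rt S" s t] by (simp del: QQ_simps)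
    qed
  next
    case (2 e s)
    have e: "re e \<in> sc_edges XX" "e = oe (re e)" using re[OF 2(2)] by auto
    have e': "pe g (re e) \<in> sc_edges XX" "oe (pe g (re e)) = e" using pe_edge oe_act e g by auto
    have eq: "chr y' = evE (pe g (re e)) s" using 2 g e evE_act by simp
    show ?thesis using y'
    proof (cases rule: inner_cases)
      case (1 v')
      have "rv v' \<in> V \<times> V" using rv[OF 1(2)] by auto
      then show ?thesis using eq 1 vv_neq_evE[OF _ e'(1) 2(3,4), of "rv v'"] by simp
    next
      case (2 f r)
      have f: "re f \<in> sc_edges XX" "f = oe (re f)" using re[OF 2(2)] by auto
      have "evE (pe g (re e)) s = evE (re f) r" using eq 2 by simp
      then have "re f = pe g (re e) \<and> r = s \<or> re f = pedge_rev (pe g (re e)) \<and> r = 1 - s"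
        using evE_eq[OF e'(1) f(1)] 2 \<open>0 < s\<close> \<open>s < 1\<close> by simp
      then show ?thesis
      proof
        assume "re f = pe g (re e) \<and> r = s"
        then have "f = e" "r = s" using e'(2) f(2) by auto
        then show ?thesis using 2 \<open>y = (ECell e, s, 0)\<close> by simp
      next
        \<comment> \<open>An interior point of an edge also has coordinates on the reversed edge;
          this is what the third rule of \<open>glue\<close> identifies.\<close>
        assume a: "re f = pedge_rev (pe g (re e)) \<and> r = 1 - s"
        then have "f = sc_rev QQ e" using e'(2) f(2) oe_rev by (metis QQ_simps(4))
        then show ?thesis
          using 2 \<open>y = (ECell e, s, 0)\<close> glue.intros(3)[OF \<open>e \<in> sc_edges QQ\<close>, of s] a \<open>0 < s\<close> \<open>s < 1\<close>
          by (auto simp del: QQ_simps)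
      qed
    next
      case (3 S r t)
      then show ?thesis using eq rt(1)[of S] evE_neq_evT[OF e'(1), of "rt S" r t s] by (simp del: QQ_simps)
    qed
  next
    case (3 S s t)
    note S = rt[OF 3(2)]
    have p: "sq_tuple (map4 (pe g) (rt S))" by (rule pe_tuple[OF g(1) S(1)])
    have eq: "chr y' = evT (map4 (pe g) (rt S)) s t" using 3 g S evT_act by simp
    show ?thesis using y'
    proof (cases rule: inner_cases)
      case (1 v')
      have "rv v' \<in> V \<times> V" using rv[OF 1(2)] by auto
      then show ?thesis using eq 1 vv_neq_evT[OF _ p 3(3-6), of "rv v'"] by simp
    next
      case (2 f r)
      then show ?thesis using eq re[of f] evE_neq_evT[OF _ p 3(3-6), of "re f" r] by (simp del: QQ_simps)
    next
      case T: (3 T s' t')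
      note T' = rt[OF T(2)]
      have eq': "evT (map4 (pe g) (rt S)) s t = evT (rt T) s' t'" using eq T by simp
      note i = evT_interior_eq[OF p T'(1) 3(3-6) T(3-6) eq']
      have "T = os (dihedral_class pedge_rev (map4 (pe g) (rt S)))"
        using T'(3) dihedral_class_eq[OF pedge_rev_rev i(1)] by simp
      also have "\<dots> = S" using os_act[OF g(1) S(1)] S(3) by simp
      finally have "T = S" .
      \<comment> \<open>Both squares have the same representative, so \<open>g\<close> maps its
        tuple into its own class. The absence of inversions makes the tuple fixed, and then the
        coordinates agree.\<close>
      then have m: "rt S \<in> dihedral_class pedge_rev (map4 (pe g) (rt S))" using i(1) by simp
      have "map4 (pe g) (rt S) \<in> dihedral_class pedge_rev (rt S)"
        using dihedral_class_eq[OF pedge_rev_rev m] dihedral_class_self by simp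
      then have "map4 (pe g) (rt S) = rt S" by (rule square_no_inv[OF g(1) S(1)])
      then have "s' = s \<and> t' = t" using i(2) \<open>T = S\<close> by simp
      then show ?thesis using T 3 \<open>T = S\<close> by simp
    qed
  qed
qed

lemma glued_iff:
  assumes y: "y \<in> topspace YY" "y' \<in> topspace YY"
  shows "equivclp (glue QQ) y y' \<longleftrightarrow> FA.same_orbit (chr y) (chr y')"
proof
  assume "FA.same_orbit (chr y) (chr y')"
  obtain z where z: "equivclp (glue QQ) y z" "inner z" using to_inner y by blast
  obtain z' where z': "equivclp (glue QQ) y' z'" "inner z'" using to_inner y by blast
  have zz: "z \<in> topspace YY" "FA.same_orbit (chr y) (chr z)" using glued_same_orbit z y by auto
  have zz': "z' \<in> topspace YY" "FA.same_orbit (chr y') (chr z')" using glued_same_orbit z' y by auto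
  have "FA.same_orbit (chr z) (chr z')"
    using \<open>FA.same_orbit (chr y) (chr y')\<close> zz zz' FA.same_orbit_sym FA.same_orbit_trans chr_in y by meson
  then have "equivclp (glue QQ) z z'" using inner_unique z z' zz zz' by blast
  then show "equivclp (glue QQ) y y'"
    by (rule equivclp_trans[OF equivclp_trans[OF z(1)] equivclp_sym[OF z'(1)]])
qed (use glued_same_orbit y in blast)

theorem classifying_space_realization:
  assumes "finite_complex QQ"
  shows "classifying_space G (realization QQ)"
proof -
  let ?q = "\<lambda>x. {y \<in> topspace YY. equivclp (glue QQ) x y}"
  have q: "quotient_map YY (realization QQ) ?q"
    unfolding realization_def by (rule quotient_map_quotient_topology) simp
  have qq: "?q y = ?q y' \<longleftrightarrow> FA.same_orbit (chr y) (chr y')" if "y \<in> topspace YY" "y' \<in> topspace YY" for y y'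
  proof -
    have "?q y = ?q y' \<longleftrightarrow> equivclp (glue QQ) y y'"
    proof
      assume "?q y = ?q y'"
      moreover have "y' \<in> ?q y'" using that by simp
      ultimately have "y' \<in> ?q y" by blast
      then show "equivclp (glue QQ) y y'" by blast
    next
      assume "equivclp (glue QQ) y y'"
      then have "equivclp (glue QQ) y z \<longleftrightarrow> equivclp (glue QQ) y' z" for z
        using equivclp_trans[of "glue QQ" y y' z] equivclp_trans[of "glue QQ" y' y z] equivclp_sym[of "glue QQ" y y']
        by blast
      then show "?q y = ?q y'" by simp
    qed
    then show ?thesis using glued_iff that by blast
  qed
  obtain p where p: "quotient_map TT.Prod_metric.mtopology (realization QQ) p"
    "\<forall>e\<in>TR \<times> TR. \<forall>e'\<in>TR \<times> TR. p e = p e' \<longleftrightarrow> FA.same_orbit e e'"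
    using FA.orbit_space_quotient[OF compact_YY[OF assms] q continuous_chr chr_cover qq] by blast
  define c where "c e e' t = (comb (fst e) (fst e') t, comb (snd e) (snd e') t)" for e e' t
  let ?M = "TT.Prod_metric.mtopology"
  let ?Z = "prod_topology ?M (prod_topology ?M (top_of_set {0..1::real}))"
  interpret geodesic_covering "TR \<times> TR" "prod_dist supd supd" G eact 1 "realization QQ" p c
  proof
    show "quotient_map ?M (realization QQ) p" by (rule p(1))
    show "p e = p e' \<longleftrightarrow> FA.same_orbit e e'" if "e \<in> TR \<times> TR" "e' \<in> TR \<times> TR" for e e' using p(2) that by blast
    have i: "continuous_map ?Z ?M fst" "continuous_map ?Z ?M (fst \<circ> snd)"
      by (rule continuous_map_fst continuous_map_compose[OF continuous_map_snd continuous_map_fst])+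
    have f: "continuous_map ?Z T.mtopology (fst \<circ> fst)" "continuous_map ?Z T.mtopology (snd \<circ> fst)"
      "continuous_map ?Z T.mtopology (fst \<circ> (fst \<circ> snd))" "continuous_map ?Z T.mtopology (snd \<circ> (fst \<circ> snd))"
      using continuous_map_compose[OF i(1), of T.mtopology] continuous_map_compose[OF i(2), of T.mtopology]
      unfolding TT.mtopology_prod_metric using continuous_map_fst continuous_map_snd by blast+
    have f5: "continuous_map ?Z (top_of_set {0..1}) (snd \<circ> snd)"
      by (rule continuous_map_compose[OF continuous_map_snd continuous_map_snd])
    show "continuous_map ?Z ?M (\<lambda>(e, e', t). c e e' t)"
      using continuous_map_comb[OF f(1,3) f5] continuous_map_comb[OF f(2,4) f5]
      unfolding c_def TT.mtopology_prod_metric by (simp add: continuous_map_pairwise o_def case_prod_unfold)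
    show "TR \<times> TR \<noteq> {}" using V_nonempty vx_in_TR by auto
  qed (auto simp: c_def comb_0 comb_1 comb_same)
  show ?thesis by (rule classifying_space_quotient)
qed

end

section \<open>The field with \<open>q\<^sup>2\<close> elements inside the quaternion algebra\<close>

lemma rf_const_simps:
  "rf_const (x + y) = rf_const x + rf_const y" "rf_const (x * y) = rf_const x * rf_const y"
  "rf_const (- x) = - rf_const x" "rf_const (x - y) = rf_const x - rf_const y"
  "rf_const 0 = 0" "rf_const 1 = 1"
  by (simp_all add: rf_const_def Zero_fract_def One_fract_def mult.commute one_pCons)

lemma rf_const_inj [simp]: "rf_const x = rf_const y \<longleftrightarrow> x = y"
  by (simp add: rf_const_def eq_fract)

lemma rf_const_0_iff [simp]: "rf_const x = 0 \<longleftrightarrow> x = 0"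
  using rf_const_inj[of x 0] unfolding rf_const_simps(5) .

lemma rf_linear_nonzero:
  assumes "b \<noteq> 0" shows "rf_const a * rf_t - rf_const b \<noteq> 0"
  using assms by (simp add: rf_const_def rf_t_def Zero_fract_def eq_fract)

lemma rf_t_nonzero: "rf_t \<noteq> 0"
  by (simp add: rf_t_def Zero_fract_def eq_fract)

lemma D_alg_simps [simp]:
  "carrier (D_alg c) = UNIV" "\<zero>\<^bsub>D_alg c\<^esub> = Quat 0 0 0 0" "\<one>\<^bsub>D_alg c\<^esub> = Quat 1 0 0 0"
  by (simp_all add: D_alg_def quat_algebra_def)

lemma D_add [simp]: "Quat x0 x1 x2 x3 \<oplus>\<^bsub>D_alg c\<^esub> Quat y0 y1 y2 y3 = Quat (x0 + y0) (x1 + y1) (x2 + y2) (x3 + y3)"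
  by (simp add: D_alg_def quat_algebra_def)

lemma D_mult: "Quat x0 x1 x2 x3 \<otimes>\<^bsub>D_alg c\<^esub> Quat y0 y1 y2 y3 =
    qmul (rf_const c) (rf_t * (rf_t - 1)) (Quat x0 x1 x2 x3) (Quat y0 y1 y2 y3)"
  by (simp add: D_alg_def quat_algebra_def)

lemma D_ring: "ring (D_alg c)"
  unfolding D_alg_def by (rule quat_algebra_ring)

lemma D_neg [simp]: "\<ominus>\<^bsub>D_alg c\<^esub> Quat x0 x1 x2 x3 = Quat (- x0) (- x1) (- x2) (- x3)"
proof -
  interpret ring "D_alg c" by (rule D_ring)
  show ?thesis by (rule minus_equality) simp_all
qed

lemma D_diff [simp]: "Quat x0 x1 x2 x3 \<ominus>\<^bsub>D_alg c\<^esub> Quat y0 y1 y2 y3 = Quat (x0 - y0) (x1 - y1) (x2 - y2) (x3 - y3)"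
  by (simp add: a_minus_def)

definition zq :: "'a::field \<Rightarrow> 'a \<Rightarrow> 'a ratfun quat" where
  "zq x y = Quat (rf_const x) (rf_const y) 0 0"

lemma zq_inj [simp]: "zq x y = zq x' y' \<longleftrightarrow> x = x' \<and> y = y'"
  by (simp add: zq_def)

lemma zq_mult: "zq x y \<otimes>\<^bsub>D_alg c\<^esub> zq x' y' = zq (x * x' + c * y * y') (x * y' + y * x')"
  by (simp add: zq_def D_mult rf_const_simps)

lemma zq_diff: "zq x y \<ominus>\<^bsub>D_alg c\<^esub> zq x' y' = zq (x - x') (y - y')"
  by (simp add: zq_def rf_const_simps)

lemma zq_neg: "\<ominus>\<^bsub>D_alg c\<^esub> zq x y = zq (- x) (- y)"
  by (simp add: zq_def rf_const_simps)

lemma power_card: "(x::'a::{field,finite}) ^ CARD('a) = x"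
proof (cases "x = 0")
  case False
  have "x * (\<Prod>y\<in>UNIV-{0}. x * y) = x * x ^ (CARD('a) - 1) * \<Prod>(UNIV-{0})"
    by (simp add: prod.distrib mult_ac)
  also have "x * x ^ (CARD('a) - 1) = x ^ Suc (CARD('a) - 1)" by (subst power_Suc) auto
  also have "Suc (CARD('a) - 1) = CARD('a)" using finite_UNIV_card_ge_0[where ?'a = 'a] by simp
  also have "(\<Prod>y\<in>UNIV-{0}. x * y) = (\<Prod>y\<in>UNIV-{0}. y)"
    by (rule prod.reindex_bij_witness[of _ "\<lambda>y. y / x" "\<lambda>y. x * y"]) (use False in auto)
  finally show ?thesis by simp
qed (use finite_UNIV_card_ge_0[where ?'a = 'a] in auto)

text \<open>Otherwise \<open>c\<close> together with the nonzero squares would be more than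
  \<open>m\<close> roots of the polynomial \<open>X^m - 1\<close>. This is Euler's
  criterion.\<close>

lemma nonsquare_power:
  fixes c :: "'a::{field,finite}"
  assumes m: "CARD('a) = Suc (2 * m)" and c: "c \<noteq> 0" "\<not> (\<exists>x. c = x\<^sup>2)"
  shows "c ^ m = - 1"
proof (rule ccontr)
  assume n1: "c ^ m \<noteq> - 1"
  have odd: "odd CARD('a)" using m by simp
  have pow: "x ^ (2 * m) = 1" if "x \<noteq> 0" for x :: 'a
    using power_card[of x] that unfolding m by simp
  have "(c ^ m)\<^sup>2 = 1" using pow[OF c(1)] by (simp add: power_mult [symmetric] mult.commute)
  then have c1: "c ^ m = 1" using n1 by (simp add: power2_eq_1_iff)
  have "m \<noteq> 0"
  proof -
    have "card {0, 1 :: 'a} \<le> CARD('a)" by (intro card_mono) auto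
    then show ?thesis using m by simp
  qed
  let ?P = "monom 1 m - 1 :: 'a poly" let ?R = "range (\<lambda>x::'a. x\<^sup>2)"
  have P1: "coeff ?P m = 1" using \<open>m \<noteq> 0\<close> by simp
  have P: "?P \<noteq> 0"
  proof
    assume "?P = 0"
    then show False using P1 by (simp only: coeff_0 zero_neq_one)
  qed
  have "insert c (?R - {0}) \<subseteq> {x. poly ?P x = 0}"
    using c1 pow by (auto simp: poly_monom power_mult [symmetric])
  then have "card (insert c (?R - {0})) \<le> card {x. poly ?P x = 0}" by (intro card_mono) auto
  also have "\<dots> \<le> degree ?P" by (rule card_poly_roots_bound[OF P])
  also have "\<dots> \<le> m" by (rule degree_diff_le) (simp_all add: degree_monom_le)
  finally have "card (insert c (?R - {0})) \<le> m" .
  moreover have "card (insert c (?R - {0})) = Suc (card ?R - 1)"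
    using c by (subst card_insert_disjoint) (auto simp: card_Diff_singleton image_iff intro: exI[of _ 0])
  moreover have "CARD('a) + 1 \<le> 2 * card ?R" by (rule squares_card[OF two_nonzero[OF odd]])
  ultimately show False using m by linarith
qed

lemma card_prime_power_CHAR:
  assumes "prime p" "CARD('a::{field,finite}) = p ^ k" shows "CHAR('a) = p" "prime CHAR('a)"
proof -
  show pr: "prime CHAR('a)"
    by (rule prime_CHAR_semidom[OF finite_imp_CHAR_pos]) simp
  \<comment> \<open>Translation by 1 permutes the field, so adding 1 to every element does not
    change the sum, and the cardinality is 0 in the field.\<close>
  have "(\<Sum>x\<in>UNIV. x :: 'a) = (\<Sum>x\<in>UNIV. x + 1)"
    by (rule sum.reindex_bij_witness[of _ "\<lambda>x. x + 1" "\<lambda>x. x - 1"]) auto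
  then have "of_nat CARD('a) = (0 :: 'a)" by (simp add: sum.distrib)
  then have "CHAR('a) dvd p ^ k" using assms(2) by (simp only: of_nat_eq_0_iff_char_dvd)
  then have "CHAR('a) dvd p" using pr prime_dvd_power by blast
  then show "CHAR('a) = p" using pr assms by (simp add: primes_dvd_imp_eq)
qed

text \<open>Powers in \<open>\<F>\<^sub>q[Z]\<close> are computed in the polynomial ring modulo \<open>Z\<^sup>2 - c\<close>.\<close>

lemma zq_pow:
  fixes c :: "'a::field"
  shows "zq x y [^]\<^bsub>D_alg c\<^esub> (n::nat) =
    zq (coeff ([:x, y:] ^ n mod [:- c, 0, 1:]) 0) (coeff ([:x, y:] ^ n mod [:- c, 0, 1:]) 1)"
proof (induction n)
  case 0
  have "degree (1 :: 'a poly) < degree [:- c, 0, 1:]" by simp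
  then have "1 mod [:- c, 0, 1:] = (1 :: 'a poly)" by (rule mod_poly_less)
  then show ?case by (simp add: nat_pow_def zq_def rf_const_simps)
next
  case (Suc n)
  let ?m = "[:- c, 0, 1:]" let ?r = "[:x, y:] ^ n mod ?m"
  have "degree ?r < 2" using degree_mod_less'[of ?m "[:x, y:] ^ n"] by (cases "?r = 0") auto
  then have "coeff ?r (Suc (Suc i)) = 0" for i by (intro coeff_eq_0) simp
  then have "?r = [:coeff ?r 0, coeff ?r 1:]"
    by (intro poly_eqI) (simp add: coeff_pCons split: nat.split)
  then obtain a b where r: "?r = [:a, b:]" by blast
  have "[:x, y:] ^ Suc n mod ?m = (?r * [:x, y:]) mod ?m"
    by (simp only: power_Suc2 mod_mult_left_eq)
  also have "?r * [:x, y:] = [:a * x + c * b * y, a * y + b * x:] + [:b * y:] * ?m"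
    unfolding r by (simp add: algebra_simps)
  also have "\<dots> mod ?m = [:a * x + c * b * y, a * y + b * x:] mod ?m" by (simp only: mod_mult_self1)
  also have "\<dots> = [:a * x + c * b * y, a * y + b * x:]" by (rule mod_poly_less) simp
  finally show ?case using Suc unfolding r by (simp add: nat_pow_def zq_mult)
qed

text \<open>The \<open>q\<close>-th power is additive and fixes constants, and with
  \<open>q = 2 m + 1\<close> the power \<open>Z^q = Z (Z^2)^m\<close> becomes
  \<open>c^m Z = -Z\<close> by Euler's criterion. So \<open>bar\<close> is the conjugation of the
  quadratic extension.\<close>

lemma bar_zq:
  fixes c :: "'a::{field,finite}"
  assumes q: "prime p" "odd p" "CARD('a) = p ^ k" and c: "c \<noteq> 0" "\<not> (\<exists>x. c = x\<^sup>2)"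
  shows "bar c (zq x y) = zq x (- y)"
proof -
  let ?m = "[:- c, 0, 1:]"
  have "odd CARD('a)" using q by simp
  then obtain m where "CARD('a) = 2 * m + 1" by (rule oddE)
  then have m: "CARD('a) = Suc (2 * m)" by simp
  have ch: "prime CHAR('a poly)" "CARD('a) = CHAR('a poly) ^ k"
    using card_prime_power_CHAR[OF q(1,3)] q(3) by simp_all
  have "[:x, y:] ^ CARD('a) = ([:x:] + [:0, y:]) ^ CARD('a)" by simp
  also have "\<dots> = [:x:] ^ CARD('a) + [:0, y:] ^ CARD('a)" by (rule freshmans_dream'[OF ch])
  also have "[:x:] ^ CARD('a) = [:x:]" by (simp add: poly_const_pow power_card)
  also have "[:0, y:] = [:y:] * [:0, 1:]" by simp
  also have "([:y:] * [:0, 1:]) ^ CARD('a) = [:y:] * ([:0, 1:] * ([:0, 1:]\<^sup>2) ^ m)"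
    unfolding power_mult_distrib by (simp add: poly_const_pow power_card) (simp add: m power_mult)
  finally have 1: "[:x, y:] ^ CARD('a) = [:x:] + [:y:] * ([:0, 1:] * ([:0, 1:]\<^sup>2) ^ m)" .
  have "[:0, 1:]\<^sup>2 = [:c:] + ?m" by (simp add: power2_eq_square)
  then have "[:0, 1:]\<^sup>2 mod ?m = [:c:] mod ?m" by (simp only: mod_add_self2)
  then have "([:0, 1:]\<^sup>2 mod ?m) ^ m mod ?m = ([:c:] mod ?m) ^ m mod ?m" by (simp only:)
  then have "([:0, 1:]\<^sup>2) ^ m mod ?m = [:c:] ^ m mod ?m" by (simp only: power_mod)
  also have "[:c:] ^ m = [:-1:]" by (simp add: poly_const_pow nonsquare_power[OF m c])
  finally have "([:y:] * ([:0, 1:] * ([:0, 1:]\<^sup>2) ^ m)) mod ?m = ([:y:] * ([:0, 1:] * [:-1:])) mod ?m"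
    by (intro mod_mult_cong refl)
  then have "[:x, y:] ^ CARD('a) mod ?m = ([:x:] + [:y:] * ([:0, 1:] * [:-1:])) mod ?m"
    unfolding 1 by (intro mod_add_cong refl)
  also have "\<dots> = [:x, - y:] mod ?m" by simp
  also have "\<dots> = [:x, - y:]" by (rule mod_poly_less) simp
  finally show ?thesis unfolding bar_def zq_pow by simp
qed

locale quaternion =
  fixes p k :: nat and c :: "'a::{field,finite}"
  assumes p: "prime p" "odd p" "CARD('a) = p ^ k" and c0: "c \<noteq> 0" and c_nonsquare: "\<not> (\<exists>x. c = x\<^sup>2)"
begin

sublocale D: ring "D_alg c" by (rule D_ring)

lemma two: "(2::'a) \<noteq> 0"
  using two_nonzero[where ?'a = 'a] p by simp

lemma norm_form_0: "x\<^sup>2 - c * y\<^sup>2 = 0 \<longleftrightarrow> x = 0 \<and> y = (0::'a)"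
proof
  assume a: "x\<^sup>2 - c * y\<^sup>2 = 0"
  have "y = 0"
  proof (rule ccontr)
    assume "y \<noteq> 0"
    then have "c = (x / y)\<^sup>2" using a by (simp add: power_divide field_simps)
    then show False using c_nonsquare by blast
  qed
  then show "x = 0 \<and> y = 0" using a by simp
qed simp

lemma bar [simp]: "bar c (zq x y) = zq x (- y)"
  by (rule bar_zq[OF p c0 c_nonsquare])

lemma Nm_zq: "Nm c (zq x y) = qscalar (rf_const (x\<^sup>2 - c * y\<^sup>2))"
  by (simp add: Nm_def zq_mult) (simp add: zq_def power2_eq_square rf_const_simps mult.assoc)

lemma norm_set_iff: "w \<in> norm_set c n \<longleftrightarrow> (\<exists>x y. w = zq x y \<and> x\<^sup>2 - c * y\<^sup>2 = n)"
  unfolding norm_set_def FqZ_def using Nm_zq by (auto simp: zq_def)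

lemma zq_norm: "zq x y \<in> norm_set c n \<longleftrightarrow> x\<^sup>2 - c * y\<^sup>2 = n"
  by (auto simp: norm_set_iff)

lemma norm_set_neg: "w \<in> norm_set c n \<Longrightarrow> \<ominus>\<^bsub>D_alg c\<^esub> w \<in> norm_set c n"
  unfolding norm_set_iff using zq_neg by fastforce

lemma norm_set_neg_neq: "w \<in> norm_set c n \<Longrightarrow> n \<noteq> 0 \<Longrightarrow> \<ominus>\<^bsub>D_alg c\<^esub> w \<noteq> w"
proof -
  assume w: "w \<in> norm_set c n" "n \<noteq> 0"
  then obtain x y where xy: "w = zq x y" "x\<^sup>2 - c * y\<^sup>2 = n" unfolding norm_set_iff by blast
  have neg: "- z = z \<Longrightarrow> z = 0" for z :: 'a
    using two by (metis add.right_inverse mult_2 mult_eq_0_iff)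
  show ?thesis using xy w neg[of x] neg[of y] by (auto simp: zq_neg)
qed

lemma finite_norm_set: "finite (norm_set c n)"
proof -
  have "norm_set c n \<subseteq> (\<lambda>(x, y). zq x y) ` UNIV" by (auto simp: norm_set_iff image_def)
  then show ?thesis by (rule finite_subset) simp
qed

lemma zq_inv:
  assumes "x\<^sup>2 - c * y\<^sup>2 = n" "n \<noteq> 0"
  shows "inv\<^bsub>D_alg c\<^esub> (zq x y) = zq (x / n) (- y / n)"
proof (rule D.inv_unique'[symmetric])
  have "x * (x / n) + c * y * (- y / n) = (x\<^sup>2 - c * y\<^sup>2) / n" by (simp add: power2_eq_square diff_divide_distrib)
  then have 1: "x * (x / n) + c * y * (- y / n) = 1" using assms by simp
  then show "zq x y \<otimes>\<^bsub>D_alg c\<^esub> zq (x / n) (- y / n) = \<one>\<^bsub>D_alg c\<^esub>"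
    unfolding zq_mult by (simp add: zq_def rf_const_simps)
  show "zq (x / n) (- y / n) \<otimes>\<^bsub>D_alg c\<^esub> zq x y = \<one>\<^bsub>D_alg c\<^esub>"
    unfolding zq_mult using 1 by (simp add: zq_def rf_const_simps mult.commute mult.left_commute)
qed simp_all

text \<open>Coordinates of \<open>\<sigma>\<^sub>\<xi>(w)\<close> for \<open>\<xi> = x + y Z\<close>
  and \<open>w = u + v Z\<close>: the quotient of \<open>w - \<xi>\<close> by its conjugate is its
  square divided by its norm, which leaves a denominator in the base field.\<close>

definition sg1 where "sg1 x y u v = (u * ((u - x)\<^sup>2 + c * (v - y)\<^sup>2) - 2 * c * v * (u - x) * (v - y)) / ((u - x)\<^sup>2 - c * (v - y)\<^sup>2)"
definition sg2 where "sg2 x y u v = (2 * u * (u - x) * (v - y) - v * ((u - x)\<^sup>2 + c * (v - y)\<^sup>2)) / ((u - x)\<^sup>2 - c * (v - y)\<^sup>2)"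

lemma sigma_zq:
  assumes "(u - x)\<^sup>2 - c * (v - y)\<^sup>2 \<noteq> 0"
  shows "sigma c (zq x y) (zq u v) = zq (sg1 x y u v) (sg2 x y u v)"
proof -
  define A B where "A = u - x" and "B = v - y"
  define n where "n = A\<^sup>2 - c * B\<^sup>2"
  have "n \<noteq> 0" using assms by (simp add: n_def A_def B_def)
  moreover have "A\<^sup>2 - c * (- B)\<^sup>2 = n" by (simp add: n_def)
  ultimately have n: "A\<^sup>2 - c * (- B)\<^sup>2 = n" "n \<noteq> 0" by simp_all
  have "bar c (zq u v) \<ominus>\<^bsub>D_alg c\<^esub> bar c (zq x y) = zq A (- B)" by (simp add: zq_diff A_def B_def)
  then have "sigma c (zq x y) (zq u v) = zq u (- v) \<otimes>\<^bsub>D_alg c\<^esub> zq A B \<otimes>\<^bsub>D_alg c\<^esub> zq (A / n) (B / n)"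
    by (simp add: sigma_def zq_diff zq_inv[OF n] flip: A_def B_def)
  also have "\<dots> = zq (sg1 x y u v) (sg2 x y u v)"
    unfolding zq_mult sg1_def sg2_def A_def[symmetric] B_def[symmetric] n_def[symmetric] using n(2)
    by (simp add: field_simps power2_eq_square)
  finally show ?thesis .
qed

text \<open>The quotient of \<open>w - \<xi>\<close> by its conjugate has norm 1, and
  \<open>w\<close> and its conjugate have the same norm.\<close>

lemma sg_norm:
  assumes "(u - x)\<^sup>2 - c * (v - y)\<^sup>2 \<noteq> 0"
  shows "(sg1 x y u v)\<^sup>2 - c * (sg2 x y u v)\<^sup>2 = u\<^sup>2 - c * v\<^sup>2"
proof -
  define A B where "A = u - x" and "B = v - y"
  define n where "n = A\<^sup>2 - c * B\<^sup>2"
  have "(u * (A\<^sup>2 + c * B\<^sup>2) - 2 * c * v * A * B)\<^sup>2 - c * (2 * u * A * B - v * (A\<^sup>2 + c * B\<^sup>2))\<^sup>2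
      = (u\<^sup>2 - c * v\<^sup>2) * (A\<^sup>2 - c * B\<^sup>2)\<^sup>2"
    by (simp add: power2_eq_square algebra_simps)
  then have "(u * (A\<^sup>2 + c * B\<^sup>2) - 2 * c * v * A * B)\<^sup>2 - c * (2 * u * A * B - v * (A\<^sup>2 + c * B\<^sup>2))\<^sup>2
      = (u\<^sup>2 - c * v\<^sup>2) * n\<^sup>2" unfolding n_def .
  moreover have "n \<noteq> 0" using assms by (simp add: n_def A_def B_def)
  ultimately show ?thesis
    unfolding sg1_def sg2_def A_def[symmetric] B_def[symmetric] n_def[symmetric]
    by (simp add: power_divide diff_divide_distrib[symmetric] nonzero_divide_eq_eq)
qed

text \<open>With \<open>\<mu> = \<sigma>\<^sub>\<xi>(\<lambda>)\<close> and
  \<open>\<nu> = \<sigma>\<^sub>\<lambda>(\<xi>)\<close> these equations say that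
  \<open>\<xi> + \<mu> = \<lambda> + \<nu>\<close> and that \<open>\<xi>\<close> times the conjugate
  of \<open>\<mu>\<close> is \<open>\<lambda>\<close> times the conjugate of \<open>\<nu>\<close>.
  The product of two generators depends on nothing else.\<close>

lemma sg_relation:
  assumes "(u - x)\<^sup>2 - c * (v - y)\<^sup>2 \<noteq> 0"
  shows "x + sg1 x y u v = u + sg1 u v x y" "y + sg2 x y u v = v + sg2 u v x y"
    "x * sg1 x y u v - c * y * sg2 x y u v = u * sg1 u v x y - c * v * sg2 u v x y"
    "y * sg1 x y u v - x * sg2 x y u v = v * sg1 u v x y - u * sg2 u v x y"
proof -
  define A B where "A = u - x" and "B = v - y"
  define n where "n = A\<^sup>2 - c * B\<^sup>2"
  have n0: "n \<noteq> 0" using assms by (simp add: n_def A_def B_def)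
  have neg: "x - u = - A" "y - v = - B" by (simp_all add: A_def B_def)
  have s: "sg1 x y u v = (u * (A\<^sup>2 + c * B\<^sup>2) - 2 * c * v * A * B) / n"
    "sg2 x y u v = (2 * u * A * B - v * (A\<^sup>2 + c * B\<^sup>2)) / n"
    "sg1 u v x y = (x * (A\<^sup>2 + c * B\<^sup>2) - 2 * c * y * A * B) / n"
    "sg2 u v x y = (2 * x * A * B - y * (A\<^sup>2 + c * B\<^sup>2)) / n"
    unfolding sg1_def sg2_def neg A_def[symmetric] B_def[symmetric] by (simp_all add: n_def)
  have u: "u = x + A" "v = y + B" by (simp_all add: A_def B_def)
  note n = n_def
  have d: "a + b / n = a' + b' / n \<longleftrightarrow> a * n + b = a' * n + b'" for a b a' b'
    using n0 by (simp add: field_simps)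
  have e: "a * (b / n) - c' * (d' / n) = a' * (b' / n) - c'' * (d'' / n) \<longleftrightarrow> a * b - c' * d' = a' * b' - c'' * d''"
    for a b c' d' a' b' c'' d'' using n0 by (simp add: field_simps)
  show "x + sg1 x y u v = u + sg1 u v x y" "y + sg2 x y u v = v + sg2 u v x y"
    unfolding s d unfolding n u by (simp_all add: algebra_simps power2_eq_square)
  show "x * sg1 x y u v - c * y * sg2 x y u v = u * sg1 u v x y - c * v * sg2 u v x y"
    "y * sg1 x y u v - x * sg2 x y u v = v * sg1 u v x y - u * sg2 u v x y"
    unfolding s e by (simp_all add: algebra_simps power2_eq_square)
qed

lemma norm_diff_nonzero:
  assumes "x\<^sup>2 - c * y\<^sup>2 \<noteq> u\<^sup>2 - c * v\<^sup>2" shows "(u - x)\<^sup>2 - c * (v - y)\<^sup>2 \<noteq> 0"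
  using assms unfolding norm_form_0 by auto

text \<open>If \<open>\<sigma>\<^sub>\<lambda>(\<xi>) = -\<xi>\<close> and \<open>\<sigma>\<^sub>\<xi>(\<lambda>) = -\<lambda>\<close>, both norms equal half the trace of \<open>\<xi>\<close> times the
  conjugate of \<open>\<lambda>\<close>.\<close>

lemma sg_not_neg:
  assumes "x\<^sup>2 - c * y\<^sup>2 \<noteq> u\<^sup>2 - c * v\<^sup>2"
  shows "\<not> (sg1 x y u v = - u \<and> sg2 x y u v = - v \<and> sg1 u v x y = - x \<and> sg2 u v x y = - y)"
proof
  assume a: "sg1 x y u v = - u \<and> sg2 x y u v = - v \<and> sg1 u v x y = - x \<and> sg2 u v x y = - y"
  note r = sg_relation(1,2)[OF norm_diff_nonzero[OF assms]]
  have "x - u = u - x" "y - v = v - y" using r a by auto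
  then have "2 * x = 2 * u" "2 * y = 2 * v" by (metis add_diff_eq diff_add_cancel mult_2 add.commute diff_diff_eq2)+
  then show False using two assms by simp
qed

section \<open>The generators and their relations in the quaternion algebra\<close>

definition el :: "'a \<Rightarrow> 'a \<Rightarrow> 'a ratfun quat" where
  "el x y = Quat (rf_const c * rf_t) 0 (- (rf_const c * rf_const y)) (- rf_const x)"

lemma gamma_el: "gamma c (zq x y) \<otimes>\<^bsub>D_alg c\<^esub> qZ = el x y"
  by (simp add: gamma_def zq_def D_mult el_def)

lemma el_mult: "el x y \<otimes>\<^bsub>D_alg c\<^esub> el u v =
   Quat (rf_const c * rf_const c * rf_t * rf_t - rf_const c * rf_const (x * u - c * y * v) * (rf_t * (rf_t - 1)))
     (- (rf_const c * rf_const (y * u - x * v) * (rf_t * (rf_t - 1))))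
     (- (rf_const c * rf_t * rf_const c * rf_const (y + v)))
     (- (rf_const c * rf_t * rf_const (x + u)))"
  by (simp add: el_def D_mult rf_const_simps algebra_simps)

text \<open>The relation holds in \<open>D\<close> itself, before scalars are divided out, because
  all coefficients in \<open>el_mult\<close> agree by \<open>sg_relation\<close>.\<close>

lemma el_relation:
  assumes "x\<^sup>2 - c * y\<^sup>2 \<noteq> u\<^sup>2 - c * v\<^sup>2"
  shows "el x y \<otimes>\<^bsub>D_alg c\<^esub> el (sg1 x y u v) (sg2 x y u v) = el u v \<otimes>\<^bsub>D_alg c\<^esub> el (sg1 u v x y) (sg2 u v x y)"
  unfolding el_mult sg_relation[OF norm_diff_nonzero[OF assms]] ..

text \<open>\<open>el (- x) (- y)\<close> is the quaternion conjugate of \<open>el x y\<close>, so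
  the scalar is the reduced norm. Modulo scalars, the negated label therefore gives the inverse
  generator.\<close>

lemma el_neg: "el x y \<otimes>\<^bsub>D_alg c\<^esub> el (- x) (- y) =
    qscalar (rf_const c * rf_t * (rf_const (c + (x\<^sup>2 - c * y\<^sup>2)) * rf_t - rf_const (x\<^sup>2 - c * y\<^sup>2)))"
  unfolding el_mult by (simp add: rf_const_simps power2_eq_square algebra_simps)

lemma qscalar_mult: "qscalar a \<otimes>\<^bsub>D_alg c\<^esub> qscalar b = qscalar (a * b)"
  by (simp add: D_mult)

lemma qscalar_comm: "qscalar a \<otimes>\<^bsub>D_alg c\<^esub> w = w \<otimes>\<^bsub>D_alg c\<^esub> qscalar a"
  by (cases w) (simp add: D_mult)

section \<open>The group of units modulo scalars\<close>

abbreviation "HH \<equiv> qscalar ` (- {0 :: 'a ratfun})"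
abbreviation "UD \<equiv> units_of (D_alg c)"

lemma qscalar_unit: "a \<noteq> 0 \<Longrightarrow> qscalar a \<in> Units (D_alg c)"
  unfolding Units_def by (auto simp: qscalar_mult intro!: exI[of _ "qscalar (inverse a)"])

lemma el_unit:
  assumes "x\<^sup>2 - c * y\<^sup>2 \<noteq> 0" shows "el x y \<in> Units (D_alg c)"
proof -
  define m where "m = rf_const c * rf_t * (rf_const (c + (x\<^sup>2 - c * y\<^sup>2)) * rf_t - rf_const (x\<^sup>2 - c * y\<^sup>2))"
  have m: "m \<noteq> 0" unfolding m_def using c0 rf_t_nonzero rf_linear_nonzero[OF assms] by simp
  have 1: "el x y \<otimes>\<^bsub>D_alg c\<^esub> el (- x) (- y) = qscalar m" unfolding m_def by (rule el_neg)
  have 2: "el (- x) (- y) \<otimes>\<^bsub>D_alg c\<^esub> el x y = qscalar m" unfolding m_def using el_neg[of "- x" "- y"] by simp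
  have "el x y \<otimes>\<^bsub>D_alg c\<^esub> (el (- x) (- y) \<otimes>\<^bsub>D_alg c\<^esub> qscalar (inverse m)) = \<one>\<^bsub>D_alg c\<^esub>"
    using m 1 by (simp add: D.m_assoc[symmetric] qscalar_mult)
  moreover have "(el (- x) (- y) \<otimes>\<^bsub>D_alg c\<^esub> qscalar (inverse m)) \<otimes>\<^bsub>D_alg c\<^esub> el x y = \<one>\<^bsub>D_alg c\<^esub>"
    using m 2 by (simp add: D.m_assoc qscalar_comm[of "inverse m" "el x y"]) (simp add: D.m_assoc[symmetric] qscalar_mult)
  ultimately show ?thesis unfolding Units_def by auto
qed

lemma UD_group: "group UD" by (rule D.units_group)

sublocale U: group UD by (rule UD_group)

lemma HH_normal: "HH \<lhd> UD"
proof -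
  have "subgroup HH UD"
  proof (rule U.subgroupI)
    show "HH \<subseteq> carrier UD" using qscalar_unit by (auto simp: units_of_carrier)
    have "qscalar 1 \<in> HH" by simp
    then show "HH \<noteq> {}" by blast
    show "inv\<^bsub>UD\<^esub> a \<in> HH" if a: "a \<in> HH" for a
    proof -
      obtain b where b: "a = qscalar b" "b \<noteq> 0" using a by auto
      have "inv\<^bsub>UD\<^esub> a = qscalar (inverse b)"
        using b qscalar_unit[of b] qscalar_unit[of "inverse b"]
        by (intro U.inv_equality) (simp_all add: units_of_carrier units_of_mult units_of_one qscalar_mult)
      then show ?thesis using b by simp
    qed
    show "a \<otimes>\<^bsub>UD\<^esub> b \<in> HH" if "a \<in> HH" "b \<in> HH" for a b
      using that by (auto simp: units_of_mult qscalar_mult)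
  qed
  then show ?thesis
    by (intro U.normalI) (auto simp: r_coset_def l_coset_def units_of_mult qscalar_comm)
qed

sublocale H: normal HH UD by (rule HH_normal)

lemma PD_group: "group (PD c)"
  unfolding PD_def by (rule H.factorgroup_is_group)

sublocale P: group "PD c" by (rule PD_group)

definition pr where "pr w = HH #>\<^bsub>UD\<^esub> w"

lemma PD_carrier: "carrier (PD c) = pr ` Units (D_alg c)"
  by (simp add: PD_def carrier_FactGroup units_of_carrier pr_def)

lemma PD_one: "\<one>\<^bsub>PD c\<^esub> = HH"
  by (simp add: PD_def)

lemma pr_mult: "w \<in> Units (D_alg c) \<Longrightarrow> w' \<in> Units (D_alg c) \<Longrightarrow> pr w \<otimes>\<^bsub>PD c\<^esub> pr w' = pr (w \<otimes>\<^bsub>D_alg c\<^esub> w')"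
  using H.rcos_sum[of w w'] by (simp add: PD_def pr_def units_of_carrier units_of_mult)

lemma pr_mem: "w' \<in> pr w \<longleftrightarrow> (\<exists>a. a \<noteq> 0 \<and> w' = qscalar a \<otimes>\<^bsub>D_alg c\<^esub> w)"
  by (auto simp: pr_def r_coset_def units_of_mult)

lemma pr_scalar: "b \<noteq> 0 \<Longrightarrow> pr (qscalar b) = \<one>\<^bsub>PD c\<^esub>"
  unfolding PD_one
proof (intro equalityI subsetI)
  fix w assume b: "b \<noteq> 0"
  { assume "w \<in> pr (qscalar b)" then show "w \<in> HH" using b by (auto simp: pr_mem qscalar_mult) }
  { assume "w \<in> HH"
    then obtain a where "w = qscalar a" "a \<noteq> 0" by auto
    then show "w \<in> pr (qscalar b)" using b by (auto simp: pr_mem qscalar_mult intro!: exI[of _ "a / b"]) }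
qed

lemma gen_zq: "gen c (zq x y) = pr (el x y)"
  by (simp add: gen_def gamma_el pr_def)

lemma gen_closed: "w \<in> norm_set c n \<Longrightarrow> n \<noteq> 0 \<Longrightarrow> gen c w \<in> carrier (PD c)"
  unfolding norm_set_iff PD_carrier using gen_zq el_unit by auto

lemma gen_neg:
  assumes "w \<in> norm_set c n" "n \<noteq> 0"
  shows "gen c (\<ominus>\<^bsub>D_alg c\<^esub> w) = inv\<^bsub>PD c\<^esub> gen c w"
proof -
  obtain x y where xy: "w = zq x y" "x\<^sup>2 - c * y\<^sup>2 = n" using assms unfolding norm_set_iff by blast
  have 1: "el x y \<in> Units (D_alg c)" "el (- x) (- y) \<in> Units (D_alg c)"
    using el_unit[of x y] el_unit[of "- x" "- y"] xy assms by auto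
  have "gen c (\<ominus>\<^bsub>D_alg c\<^esub> w) \<otimes>\<^bsub>PD c\<^esub> gen c w = pr (el (- x) (- y) \<otimes>\<^bsub>D_alg c\<^esub> el x y)"
    using 1 by (simp add: xy zq_neg gen_zq pr_mult)
  also have "\<dots> = \<one>\<^bsub>PD c\<^esub>"
  proof -
    have "rf_const c * rf_t * (rf_const (c + n) * rf_t - rf_const n) \<noteq> 0"
      using c0 rf_t_nonzero rf_linear_nonzero[OF assms(2), of "c + n"] by simp
    then show ?thesis using el_neg[of "- x" "- y"] xy(2) pr_scalar by simp
  qed
  finally show ?thesis
    using gen_closed[OF assms] gen_closed[OF norm_set_neg[OF assms(1)] assms(2)] by (simp add: P.inv_equality)
qed

lemma sigma_norm:
  assumes "\<xi> \<in> norm_set c n" "w \<in> norm_set c n'" "n \<noteq> n'"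
  shows "sigma c \<xi> w \<in> norm_set c n'"
proof -
  obtain x y u v where xy: "\<xi> = zq x y" "x\<^sup>2 - c * y\<^sup>2 = n" "w = zq u v" "u\<^sup>2 - c * v\<^sup>2 = n'"
    using assms unfolding norm_set_iff by blast
  have "(u - x)\<^sup>2 - c * (v - y)\<^sup>2 \<noteq> 0" using norm_diff_nonzero xy assms by simp
  then show ?thesis using sigma_zq sg_norm xy by (auto simp: zq_norm)
qed

lemma gen_relation:
  assumes "\<xi> \<in> norm_set c n" "w \<in> norm_set c n'" "n \<noteq> n'" "n \<noteq> 0" "n' \<noteq> 0"
  shows "gen c \<xi> \<otimes>\<^bsub>PD c\<^esub> gen c (sigma c \<xi> w) = gen c w \<otimes>\<^bsub>PD c\<^esub> gen c (sigma c w \<xi>)"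
proof -
  obtain x y u v where xy: "\<xi> = zq x y" "x\<^sup>2 - c * y\<^sup>2 = n" "w = zq u v" "u\<^sup>2 - c * v\<^sup>2 = n'"
    using assms unfolding norm_set_iff by blast
  have d: "(u - x)\<^sup>2 - c * (v - y)\<^sup>2 \<noteq> 0" "(x - u)\<^sup>2 - c * (y - v)\<^sup>2 \<noteq> 0" using norm_diff_nonzero xy assms by simp_all
  have un: "el x y \<in> Units (D_alg c)" "el u v \<in> Units (D_alg c)"
    "el (sg1 x y u v) (sg2 x y u v) \<in> Units (D_alg c)" "el (sg1 u v x y) (sg2 u v x y) \<in> Units (D_alg c)"
    using el_unit[of x y] el_unit[of u v] el_unit[of "sg1 x y u v" "sg2 x y u v"] sg_norm[OF d(1)]
      el_unit[of "sg1 u v x y" "sg2 u v x y"] sg_norm[OF d(2)] xy assms(4,5) by argo+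
  show ?thesis unfolding xy(1,3) sigma_zq[OF d(1)] sigma_zq[OF d(2)] gen_zq
    using un el_relation[of x y u v] xy assms by (simp add: pr_mult)
qed

text \<open>Were both equations true, the group element along the diagonal of the square would give
  it a half turn. Their failure rules this out and keeps the four label pairs of a square
  distinct.\<close>

lemma sigma_not_neg:
  assumes "\<xi> \<in> norm_set c n" "w \<in> norm_set c n'" "n \<noteq> n'"
  shows "\<not> (sigma c \<xi> w = \<ominus>\<^bsub>D_alg c\<^esub> w \<and> sigma c w \<xi> = \<ominus>\<^bsub>D_alg c\<^esub> \<xi>)"
proof -
  obtain x y u v where xy: "\<xi> = zq x y" "x\<^sup>2 - c * y\<^sup>2 = n" "w = zq u v" "u\<^sup>2 - c * v\<^sup>2 = n'"
    using assms unfolding norm_set_iff by blast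
  have d: "(u - x)\<^sup>2 - c * (v - y)\<^sup>2 \<noteq> 0" "(x - u)\<^sup>2 - c * (y - v)\<^sup>2 \<noteq> 0" using norm_diff_nonzero xy assms by simp_all
  show ?thesis unfolding xy(1,3) sigma_zq[OF d(1)] sigma_zq[OF d(2)] zq_neg zq_inj
    using sg_not_neg[of x y u v] xy assms by blast
qed

end

section \<open>Trees of words\<close>

definition pref :: "'l list \<Rightarrow> 'l list set" where
  "pref w = {u. prefix u w \<and> u \<noteq> []}"

text \<open>A nonempty prefix stands for the edge that ends in it, so \<open>pref w\<close> is the
  path from the root to \<open>w\<close> and the symmetric difference is the path between two words.
  The metric axioms become statements about finite sets.\<close>

definition wdist :: "'l list \<Rightarrow> 'l list \<Rightarrow> nat" where
  "wdist u v = card ((pref u - pref v) \<union> (pref v - pref u))"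

lemma finite_pref [simp]: "finite (pref w)"
  unfolding pref_def by (rule finite_subset[of _ "set (prefixes w)"]) auto

lemma pref_snoc: "pref (w @ [x]) = insert (w @ [x]) (pref w)" and snoc_not_pref: "w @ [x] \<notin> pref w"
  by (auto simp: pref_def dest: prefix_length_le)

lemma pref_Nil [simp]: "pref [] = {}"
  by (auto simp: pref_def)

lemma pref_self: "w \<noteq> [] \<Longrightarrow> w \<in> pref w"
  by (simp add: pref_def)

lemma pref_subset: "u \<in> pref w \<Longrightarrow> pref u \<subseteq> pref w"
  by (auto simp: pref_def)

lemma pref_total: "u \<in> pref w \<Longrightarrow> v \<in> pref w \<Longrightarrow> u \<in> pref v \<or> v \<in> pref u"
  unfolding pref_def using prefix_same_cases by auto

lemma pref_subset_iff: "pref u \<subseteq> pref v \<longleftrightarrow> prefix u v"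
proof
  assume "pref u \<subseteq> pref v"
  then show "prefix u v" using pref_self[of u] by (cases "u = []") (auto simp: pref_def)
qed (auto simp: pref_def)

lemma pref_inj: "pref u = pref v \<Longrightarrow> u = v"
proof -
  assume "pref u = pref v"
  then have "prefix u v" "prefix v u" by (simp_all only: order_refl flip: pref_subset_iff)
  then show ?thesis by (rule prefix_order.antisym)
qed

lemma wdist_eq_0: "wdist u v = 0 \<longleftrightarrow> u = v"
  unfolding wdist_def using pref_inj by auto

lemma wdist_sym: "wdist u v = wdist v u"
  by (simp add: wdist_def Un_commute)

lemma wdist_tri: "wdist u w \<le> wdist u v + wdist v w"
proof -
  have "wdist u w \<le> card (((pref u - pref v) \<union> (pref v - pref u)) \<union> ((pref v - pref w) \<union> (pref w - pref v)))"
    unfolding wdist_def by (rule card_mono) auto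
  also have "\<dots> \<le> wdist u v + wdist v w" unfolding wdist_def by (rule card_Un_le)
  finally show ?thesis .
qed

text \<open>Appending a letter toggles a single element of the symmetric difference.\<close>

lemma wdist_snoc:
  "wdist (w @ [x]) v = (if w @ [x] \<in> pref v then wdist w v - 1 else Suc (wdist w v))"
  "w @ [x] \<in> pref v \<Longrightarrow> wdist w v \<noteq> 0"
proof -
  let ?S = "\<lambda>u. (pref u - pref v) \<union> (pref v - pref u)"
  have 1: "?S (w @ [x]) = ?S w - {w @ [x]}" "w @ [x] \<in> ?S w" if "w @ [x] \<in> pref v"
    using that snoc_not_pref[of w x] by (auto simp: pref_snoc)
  have 2: "?S (w @ [x]) = insert (w @ [x]) (?S w)" "w @ [x] \<notin> ?S w" if "w @ [x] \<notin> pref v"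
    using that snoc_not_pref[of w x] by (auto simp: pref_snoc)
  show "wdist w v \<noteq> 0" if "w @ [x] \<in> pref v"
  proof -
    have "?S w \<noteq> {}" using 1(2)[OF that] by blast
    then show ?thesis unfolding wdist_def by (simp only: card_0_eq finite_Un finite_Diff finite_pref simp_thms)
  qed
  show "wdist (w @ [x]) v = (if w @ [x] \<in> pref v then wdist w v - 1 else Suc (wdist w v))"
  proof (cases "w @ [x] \<in> pref v")
    case True
    then show ?thesis unfolding wdist_def 1(1)[OF True] using 1(2)[OF True] by (simp only: card_Diff_singleton if_True)
  next
    case False
    have "finite (?S w)" by simp
    from card_insert_disjoint[OF this 2(2)[OF False]] show ?thesis
      unfolding wdist_def 2(1)[OF False] using False by simp
  qed
qed

lemma wdist_snoc_self: "wdist (w @ [x]) w = 1" "wdist w (w @ [x]) = 1"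
  using wdist_snoc(1)[of w x w] snoc_not_pref[of w x] wdist_eq_0[of w w] wdist_sym[of w "w @ [x]"] by simp_all

text \<open>A symmetric difference with one element lies on one side, so one prefix set contains the
  other; an extension by more than one letter would contribute a second prefix.\<close>

lemma wdist_1:
  assumes "wdist u v = 1" shows "(\<exists>x. v = u @ [x]) \<or> (\<exists>x. u = v @ [x])"
proof -
  have *: "\<exists>x. v = u @ [x]" if d: "wdist u v = 1" and s: "pref u \<subseteq> pref v" for u v :: "'l list"
  proof -
    from s have "prefix u v" by (simp only: pref_subset_iff)
    then obtain ys where v: "v = u @ ys" by (rule prefixE)
    have "ys \<noteq> []" using d v by (auto simp: wdist_def)
    then obtain y zs where ys: "ys = y # zs" by (cases ys) auto
    have "zs = []"
    proof (rule ccontr)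
      assume "zs \<noteq> []"
      have "{u @ [y], v} \<subseteq> (pref u - pref v) \<union> (pref v - pref u)"
        using \<open>zs \<noteq> []\<close> by (auto simp: pref_def v ys)
      then have "card {u @ [y], v} \<le> wdist u v" unfolding wdist_def by (intro card_mono) auto
      then show False using d \<open>zs \<noteq> []\<close> by (simp add: v ys)
    qed
    then show ?thesis using v ys by simp
  qed
  obtain a where a: "(pref u - pref v) \<union> (pref v - pref u) = {a}"
    using assms unfolding wdist_def by (rule card_1_singletonE)
  show ?thesis
  proof (cases "a \<in> pref v")
    case True
    moreover have "pref u - pref v \<subseteq> {a}" unfolding a[symmetric] by simp
    ultimately have "pref u \<subseteq> pref v" by auto
    then show ?thesis using *[OF assms] by simp
  next
    case False
    moreover have "pref v - pref u \<subseteq> {a}" unfolding a[symmetric] by simp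
    ultimately have "pref v \<subseteq> pref u" by auto
    then show ?thesis using *[of v u] assms wdist_sym[of u v] by simp
  qed
qed

lemma word_tree:
  fixes R :: "'l list set"
  assumes pre: "\<And>u w. w \<in> R \<Longrightarrow> prefix u w \<Longrightarrow> u \<in> R"
    and nb: "\<And>w. w \<in> R \<Longrightarrow> \<exists>w'\<in>R. wdist w w' = 1" and ne: "R \<noteq> {}"
  shows "tree R {(u, w). u \<in> R \<and> w \<in> R \<and> wdist u w = 1} wdist"
proof
  fix u v w
  show "wdist u v = 0 \<longleftrightarrow> u = v" "wdist u v = wdist v u" "wdist u w \<le> wdist u v + wdist v w"
    by (rule wdist_eq_0 wdist_sym wdist_tri)+
next
  fix u v assume uv: "u \<in> R" "v \<in> R" "u \<noteq> v"
  have "\<exists>u1\<in>R. wdist u u1 = 1 \<and> wdist u v = Suc (wdist u1 v)"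
  proof (cases "u \<in> pref v \<or> u = []")
    case True
    then have "prefix u v" by (auto simp: pref_def)
    then obtain y ys where v: "v = u @ y # ys" using uv(3) by (auto simp: prefix_def) (metis list.exhaust)
    have "u @ [y] \<in> pref v" by (simp add: v pref_def)
    moreover have "u @ [y] \<in> R" using pre[OF uv(2)] by (simp add: v)
    moreover have "wdist u (u @ [y]) = 1" by (rule wdist_snoc_self)
    ultimately show ?thesis using wdist_snoc[of u y v] by (intro bexI[of _ "u @ [y]"]) auto
  next
    case False
    then obtain u1 x where u: "u = u1 @ [x]" by (cases u rule: rev_cases) auto
    have "u1 \<in> R" using pre[OF uv(1)] by (simp add: u)
    moreover have "wdist u u1 = 1" unfolding u by (rule wdist_snoc_self)
    ultimately show ?thesis using wdist_snoc(1)[of u1 x v] False u by (intro bexI[of _ u1]) auto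
  qed
  then show "\<exists>u1. (u, u1) \<in> {(u, w). u \<in> R \<and> w \<in> R \<and> wdist u w = 1} \<and> wdist u v = Suc (wdist u1 v)"
    using uv(1) by auto
next
  fix u u1 v assume "(u, u1) \<in> {(u, w). u \<in> R \<and> w \<in> R \<and> wdist u w = 1}"
  then have "(\<exists>x. u1 = u @ [x]) \<or> (\<exists>x. u = u1 @ [x])" using wdist_1 by blast
  then show "wdist u1 v = Suc (wdist u v) \<or> wdist u v = Suc (wdist u1 v)"
    using wdist_snoc[of u _ v] wdist_snoc[of u1 _ v] by (auto split: if_splits)
next
  fix u u1 v w assume e: "(u, u1) \<in> {(u, w). u \<in> R \<and> w \<in> R \<and> wdist u w = 1}"
    and w: "wdist u w = Suc (wdist u1 w)" and v: "wdist u1 v = Suc (wdist u v)"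
  \<comment> \<open>The paths from \<open>u\<close> to \<open>w\<close> and from \<open>u\<close> to
    \<open>v\<close> leave \<open>u\<close> in different directions; since their edge sets are
    disjoint, the distances add up.\<close>
  have "((pref u - pref w) \<union> (pref w - pref u)) \<inter> ((pref u - pref v) \<union> (pref v - pref u)) = {}"
  proof -
    consider x where "u1 = u @ [x]" | x where "u = u1 @ [x]" using e wdist_1 by blast
    then show ?thesis
    proof cases
      case (1 x)
      have "u1 \<in> pref w" using w wdist_snoc(1)[of u x w] 1 by (auto split: if_splits)
      have "u1 \<notin> pref v" using v wdist_snoc[of u x v] 1 by (auto split: if_splits)
      have "pref u \<subseteq> pref w" using pref_subset[OF \<open>u1 \<in> pref w\<close>] 1 pref_snoc[of u x] by auto
      moreover have "y \<notin> pref v" if "y \<in> pref w" "y \<notin> pref u" for y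
      proof
        assume "y \<in> pref v"
        have "y \<noteq> u1" using \<open>y \<in> pref v\<close> \<open>u1 \<notin> pref v\<close> by blast
        then have "u1 \<in> pref y" using pref_total[OF that(1) \<open>u1 \<in> pref w\<close>] that(2) 1 pref_snoc[of u x] by auto
        then show False using pref_subset[OF \<open>y \<in> pref v\<close>] \<open>u1 \<notin> pref v\<close> by blast
      qed
      ultimately show ?thesis by blast
    next
      case (2 x)
      have "u \<notin> pref w" using w wdist_snoc[of u1 x w] 2 by (auto split: if_splits)
      have "u \<in> pref v" using v wdist_snoc(1)[of u1 x v] 2 by (auto split: if_splits)
      have "pref u \<subseteq> pref v" using pref_subset[OF \<open>u \<in> pref v\<close>] .
      moreover have "y \<notin> pref w" if "y \<in> pref v" "y \<notin> pref u" for y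
      proof
        assume "y \<in> pref w"
        have "u \<in> pref y" using pref_total[OF that(1) \<open>u \<in> pref v\<close>] that(2) by auto
        then show False using pref_subset[OF \<open>y \<in> pref w\<close>] \<open>u \<notin> pref w\<close> by blast
      qed
      ultimately show ?thesis by blast
    qed
  qed
  note disj = this
  have "(pref w - pref v) \<union> (pref v - pref w) =
      ((pref u - pref v) \<union> (pref v - pref u)) \<union> ((pref u - pref w) \<union> (pref w - pref u))"
    using disj by blast
  then show "wdist w v = wdist u v + wdist u w"
    unfolding wdist_def using disj by (simp add: card_Un_disjoint Int_commute)
next
  fix u assume "u \<in> R"
  then show "\<exists>w. (u, w) \<in> {(u, w). u \<in> R \<and> w \<in> R \<and> wdist u w = 1}" using nb by blast
qed (use ne in auto)

lemma tree_transport: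
  assumes "tree R E \<delta>" and \<phi>: "bij_betw \<phi> V R"
  shows "tree V {(u, v). u \<in> V \<and> v \<in> V \<and> (\<phi> u, \<phi> v) \<in> E} (\<lambda>u v. \<delta> (\<phi> u) (\<phi> v))"
proof -
  interpret T: tree R E \<delta> by fact
  have R: "\<phi> v \<in> R" if "v \<in> V" for v using \<phi> that by (auto simp: bij_betw_def)
  have inj: "\<phi> u = \<phi> v \<longleftrightarrow> u = v" if "u \<in> V" "v \<in> V" for u v
    using \<phi> that by (auto simp: bij_betw_def inj_on_def)
  have surj: "\<exists>v\<in>V. \<phi> v = r" if "r \<in> R" for r using \<phi> that by (auto simp: bij_betw_def)
  show ?thesis
  proof
    fix u v assume uv: "u \<in> V" "v \<in> V"
    show "\<delta> (\<phi> u) (\<phi> v) = 0 \<longleftrightarrow> u = v" using T.\<delta>_0 R inj uv by simp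
    show "\<delta> (\<phi> u) (\<phi> v) = \<delta> (\<phi> v) (\<phi> u)" using T.\<delta>_sym R uv by simp
    show "\<delta> (\<phi> u) (\<phi> w) \<le> \<delta> (\<phi> u) (\<phi> v) + \<delta> (\<phi> v) (\<phi> w)" if "w \<in> V" for w using T.\<delta>_tri R uv that by simp
    show "\<exists>u1. (u, u1) \<in> {(u, v). u \<in> V \<and> v \<in> V \<and> (\<phi> u, \<phi> v) \<in> E} \<and> \<delta> (\<phi> u) (\<phi> v) = Suc (\<delta> (\<phi> u1) (\<phi> v))"
      if ne: "u \<noteq> v"
    proof -
      have "\<phi> u \<noteq> \<phi> v" using inj uv ne by simp
      then obtain r where r: "(\<phi> u, r) \<in> E" "\<delta> (\<phi> u) (\<phi> v) = Suc (\<delta> r (\<phi> v))" using T.toward[OF R R] uv by blast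
      obtain u1 where "u1 \<in> V" "\<phi> u1 = r" using surj T.EdV[OF r(1)] by blast
      then show ?thesis using r uv by (intro exI[of _ u1]) simp
    qed
  next
    fix u v show "(u, v) \<in> {(u, v). u \<in> V \<and> v \<in> V \<and> (\<phi> u, \<phi> v) \<in> E} \<longleftrightarrow>
        u \<in> V \<and> v \<in> V \<and> \<delta> (\<phi> u) (\<phi> v) = 1" using T.Ed_iff R by auto
  next
    fix u u1 v assume "(u, u1) \<in> {(u, v). u \<in> V \<and> v \<in> V \<and> (\<phi> u, \<phi> v) \<in> E}" "v \<in> V"
    then show "\<delta> (\<phi> u1) (\<phi> v) = Suc (\<delta> (\<phi> u) (\<phi> v)) \<or> \<delta> (\<phi> u) (\<phi> v) = Suc (\<delta> (\<phi> u1) (\<phi> v))"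
      using T.edge_step R by simp
  next
    fix u u1 v w assume "(u, u1) \<in> {(u, v). u \<in> V \<and> v \<in> V \<and> (\<phi> u, \<phi> v) \<in> E}" "v \<in> V" "w \<in> V"
      "\<delta> (\<phi> u) (\<phi> w) = Suc (\<delta> (\<phi> u1) (\<phi> w))" "\<delta> (\<phi> u1) (\<phi> v) = Suc (\<delta> (\<phi> u) (\<phi> v))"
    then show "\<delta> (\<phi> w) (\<phi> v) = \<delta> (\<phi> u) (\<phi> v) + \<delta> (\<phi> u) (\<phi> w)"
      using T.edge_cut[of "\<phi> u" "\<phi> u1" "\<phi> v" "\<phi> w"] R by simp
  next
    fix u assume u: "u \<in> V"
    obtain r where r: "(\<phi> u, r) \<in> E" using T.neighbour R u by blast
    obtain u1 where "u1 \<in> V" "\<phi> u1 = r" using surj T.EdV[OF r] by blast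
    then show "\<exists>w. (u, w) \<in> {(u, v). u \<in> V \<and> v \<in> V \<and> (\<phi> u, \<phi> v) \<in> E}" using r u by blast
  next
    show "V \<noteq> {}" using T.V_nonempty surj by auto
  qed
qed

section \<open>Words in generators that act on a graph\<close>

locale letters_on_graph = group G for G (structure) +
  fixes act :: "'g \<Rightarrow> 'v \<Rightarrow> 'v" and V :: "'v set" and Ed :: "('v \<times> 'v) set"
    and \<Lambda> :: "'l set" and letter :: "'l \<Rightarrow> 'g" and neg :: "'l \<Rightarrow> 'l" and v0 :: 'v
  assumes act_closed: "g \<in> carrier G \<Longrightarrow> v \<in> V \<Longrightarrow> act g v \<in> V"
    and act_mult: "g \<in> carrier G \<Longrightarrow> h \<in> carrier G \<Longrightarrow> v \<in> V \<Longrightarrow> act (g \<otimes> h) v = act g (act h v)"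
    and act_one: "v \<in> V \<Longrightarrow> act \<one> v = v"
    and act_edge: "g \<in> carrier G \<Longrightarrow> (u, w) \<in> Ed \<Longrightarrow> (act g u, act g w) \<in> Ed"
    and EdV: "(u, w) \<in> Ed \<Longrightarrow> u \<in> V \<and> w \<in> V"
    and v0: "v0 \<in> V"
    and letter_closed: "l \<in> \<Lambda> \<Longrightarrow> letter l \<in> carrier G"
    and neg_closed: "l \<in> \<Lambda> \<Longrightarrow> neg l \<in> \<Lambda>"
    and neg_neg: "l \<in> \<Lambda> \<Longrightarrow> neg (neg l) = l"
    and neg_neq: "l \<in> \<Lambda> \<Longrightarrow> neg l \<noteq> l"
    and letter_neg: "l \<in> \<Lambda> \<Longrightarrow> letter (neg l) = inv (letter l)"
    and edges_v0: "(v0, v) \<in> Ed \<longleftrightarrow> (\<exists>l\<in>\<Lambda>. v = act (letter l) v0)"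
    and letters_nonempty: "\<Lambda> \<noteq> {}"
begin

definition word :: "'l list \<Rightarrow> 'g" where
  "word w = foldr (\<lambda>l g. letter l \<otimes> g) w \<one>"

lemma word_simps [simp]: "word [] = \<one>" "word (l # w) = letter l \<otimes> word w"
  by (simp_all add: word_def)

lemma word_closed: "set w \<subseteq> \<Lambda> \<Longrightarrow> word w \<in> carrier G"
  by (induction w) (auto simp: letter_closed)

lemma word_append: "set u \<subseteq> \<Lambda> \<Longrightarrow> set w \<subseteq> \<Lambda> \<Longrightarrow> word (u @ w) = word u \<otimes> word w"
  by (induction u) (auto simp: letter_closed word_closed m_assoc)

definition winv :: "'l list \<Rightarrow> 'l list" where "winv w = map neg (rev w)"

lemma winv_set: "set w \<subseteq> \<Lambda> \<Longrightarrow> set (winv w) \<subseteq> \<Lambda>"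
  by (auto simp: winv_def neg_closed)

lemma word_winv: "set w \<subseteq> \<Lambda> \<Longrightarrow> word (winv w) = inv (word w)"
proof (induction w)
  case (Cons l w)
  then have "word (winv (l # w)) = word (winv w) \<otimes> word [neg l]"
    using word_append[of "winv w" "[neg l]"] winv_set[of w] neg_closed by (simp add: winv_def)
  then show ?case using Cons by (simp add: letter_neg letter_closed word_closed inv_mult_group)
qed (simp add: winv_def)

definition red :: "'l list \<Rightarrow> bool" where
  "red w \<longleftrightarrow> set w \<subseteq> \<Lambda> \<and> successively (\<lambda>a b. b \<noteq> neg a) w"

lemma red_reduce:
  "set w \<subseteq> \<Lambda> \<Longrightarrow> \<exists>w'. red w' \<and> word w' = word w"
proof (induction w)
  case Nil
  show ?case by (intro exI[of _ "[]"]) (simp add: red_def)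
next
  case (Cons l w)
  then obtain w' where w': "red w'" "word w' = word w" by auto
  show ?case
  proof (cases w')
    case Nil
    then show ?thesis using w' Cons by (intro exI[of _ "[l]"]) (auto simp: red_def)
  next
    case w'_eq: (Cons m w'')
    show ?thesis
    proof (cases "m = neg l")
      case True
      have "red w''" using w' w'_eq by (cases w'') (auto simp: red_def)
      moreover have "word (l # w) = word w''"
      proof -
        have "set w'' \<subseteq> \<Lambda>" using w' w'_eq by (auto simp: red_def)
        have "word (l # w) = letter l \<otimes> word w'" using w' by simp
        also have "\<dots> = letter l \<otimes> (inv (letter l) \<otimes> word w'')"
          using w'_eq True Cons letter_neg by simp
        also have "\<dots> = word w''"
          using Cons letter_closed word_closed[OF \<open>set w'' \<subseteq> \<Lambda>\<close>] by (simp add: m_assoc[symmetric])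
        finally show ?thesis .
      qed
      ultimately show ?thesis by (intro exI[of _ w'']) simp
    next
      case False
      then show ?thesis using w' w'_eq Cons by (intro exI[of _ "l # w'"]) (auto simp: red_def)
    qed
  qed
qed

lemma red_prefix: "red w \<Longrightarrow> prefix u w \<Longrightarrow> red u"
  unfolding red_def prefix_def by (auto simp: successively_append_iff)

lemma red_winv: "red w \<Longrightarrow> red (winv w)"
proof -
  assume w: "red w"
  then have s: "set w \<subseteq> \<Lambda>" by (simp add: red_def)
  have "successively (\<lambda>a b. neg a \<noteq> neg (neg b)) w"
  proof (rule successively_mono)
    show "successively (\<lambda>a b. b \<noteq> neg a) w" using w by (simp add: red_def)
    fix a b assume "a \<in> set w" "b \<in> set w" "b \<noteq> neg a"
    then show "neg a \<noteq> neg (neg b)" using neg_neg s by auto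
  qed
  then show ?thesis using winv_set[OF s] by (simp add: red_def winv_def successively_map successively_rev)
qed

end

text \<open>The graph is not assumed to be a tree. That reduced words move the base vertex and that
  words reach every vertex is what a place of splitting supplies, and \<open>graph_tree\<close>
  deduces the tree from it.\<close>

locale free_letters_on_graph = letters_on_graph +
  assumes free_word: "red w \<Longrightarrow> w \<noteq> [] \<Longrightarrow> act (word w) v0 \<noteq> v0"
    and transitive_word: "v \<in> V \<Longrightarrow> \<exists>w. set w \<subseteq> \<Lambda> \<and> v = act (word w) v0"
begin

text \<open>If the words began with different letters, the inverse of one followed by the other
  would be reduced and yet fix the base vertex. So the first letters agree and can be
  cancelled.\<close>

lemma red_unique:
  "red u \<Longrightarrow> red w \<Longrightarrow> act (word u) v0 = act (word w) v0 \<Longrightarrow> u = w"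
proof (induction u arbitrary: w)
  case Nil
  then show ?case using free_word[of w] act_one v0 by (cases "w = []") auto
next
  case (Cons a u)
  have s: "set (a # u) \<subseteq> \<Lambda>" "set w \<subseteq> \<Lambda>" using Cons.prems by (auto simp: red_def)
  have eq: "act (word (winv (a # u) @ w)) v0 = v0"
  proof -
    have "act (word (winv (a # u) @ w)) v0 = act (inv (word (a # u))) (act (word w) v0)"
      using s winv_set[OF s(1)] by (simp only: word_append word_winv act_mult[OF _ _ v0] word_closed inv_closed)
    also have "\<dots> = act (inv (word (a # u)) \<otimes> word (a # u)) v0"
      using Cons.prems(3) word_closed[OF s(1)] by (simp only: act_mult[OF _ _ v0] inv_closed)
    also have "\<dots> = v0" using word_closed[OF s(1)] act_one v0 by (simp only: l_inv)
    finally show ?thesis .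
  qed
  have "\<not> red (winv (a # u) @ w)"
    using free_word[of "winv (a # u) @ w"] eq by (auto simp: winv_def)
  then have ex: "w \<noteq> []" "hd w = neg (last (winv (a # u)))"
    using red_winv[OF Cons.prems(1)] Cons.prems(2) unfolding red_def
    by (auto simp: successively_append_iff)
  then obtain b w' where w: "w = b # w'" by (cases w) auto
  have "b = a" using ex(2) w s neg_neg by (simp add: winv_def)
  have r: "red u" "red w'" using Cons.prems(1,2) w unfolding red_def by (auto simp: successively_Cons)
  have cl: "word u \<in> carrier G" "word w' \<in> carrier G" "letter a \<in> carrier G"
    using r word_closed letter_closed s by (auto simp: red_def)
  have "act (letter a) (act (word u) v0) = act (letter a) (act (word w') v0)"
    using Cons.prems(3) w \<open>b = a\<close> cl v0 by (simp add: act_mult)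
  then have "act (inv (letter a)) (act (letter a) (act (word u) v0)) =
      act (inv (letter a)) (act (letter a) (act (word w') v0))" by simp
  then have "act (word u) v0 = act (word w') v0"
    using cl v0 act_closed act_one by (simp add: act_mult[symmetric] m_assoc[symmetric])
  then show ?case using Cons.IH r w \<open>b = a\<close> by simp
qed

definition rw where
  "rw v = (THE w. red w \<and> act (word w) v0 = v)"

lemma rw: "v \<in> V \<Longrightarrow> red (rw v) \<and> act (word (rw v)) v0 = v"
proof -
  assume "v \<in> V"
  then obtain w where "set w \<subseteq> \<Lambda>" "v = act (word w) v0" using transitive_word by blast
  then obtain w' where "red w' \<and> act (word w') v0 = v" using red_reduce by metis
  then show ?thesis unfolding rw_def by (rule theI) (use red_unique \<open>red w' \<and> act (word w') v0 = v\<close> in auto)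
qed

lemma rw_word: "red w \<Longrightarrow> rw (act (word w) v0) = w"
  using rw[of "act (word w) v0"] red_unique act_closed word_closed v0 by (auto simp: red_def)

lemma rw_bij: "bij_betw rw V {w. red w}"
proof (rule bij_betw_byWitness[where f' = "\<lambda>w. act (word w) v0"])
  show "(\<lambda>w. act (word w) v0) ` {w. red w} \<subseteq> V" using act_closed word_closed v0 by (auto simp: red_def)
qed (use rw rw_word in auto)

text \<open>Moving \<open>u\<close> to the base vertex turns its neighbours into those listed by
  \<open>edges_v0\<close>, so they belong to the word of \<open>u\<close> with one more letter; that
  letter either extends the reduced word or cancels its last letter.\<close>

lemma edge_iff:
  assumes "u \<in> V" "w \<in> V"
  shows "(u, w) \<in> Ed \<longleftrightarrow> wdist (rw u) (rw w) = 1"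
proof -
  let ?u = "rw u"
  have u: "red ?u" "set ?u \<subseteq> \<Lambda>" "u = act (word ?u) v0" using rw[OF assms(1)] by (auto simp: red_def)
  have wu: "word ?u \<in> carrier G" using word_closed u by blast
  have "(u, w) \<in> Ed \<longleftrightarrow> (v0, act (inv (word ?u)) w) \<in> Ed"
  proof
    assume "(u, w) \<in> Ed"
    then have "(act (inv (word ?u)) u, act (inv (word ?u)) w) \<in> Ed" using act_edge wu by simp
    moreover have "act (inv (word ?u)) u = v0" using u(3) wu v0 act_one by (metis act_mult inv_closed l_inv)
    ultimately show "(v0, act (inv (word ?u)) w) \<in> Ed" by simp
  next
    assume "(v0, act (inv (word ?u)) w) \<in> Ed"
    then have "(act (word ?u) v0, act (word ?u) (act (inv (word ?u)) w)) \<in> Ed" using act_edge wu by simp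
    moreover have "act (word ?u) (act (inv (word ?u)) w) = w"
      using wu assms act_one by (metis act_mult inv_closed r_inv)
    ultimately show "(u, w) \<in> Ed" using u by simp
  qed
  also have "\<dots> \<longleftrightarrow> (\<exists>l\<in>\<Lambda>. w = act (word (?u @ [l])) v0)"
  proof -
    have "act (inv (word ?u)) w = act (letter l) v0 \<longleftrightarrow> w = act (word (?u @ [l])) v0" if "l \<in> \<Lambda>" for l
    proof -
      have l: "letter l \<in> carrier G" "word (?u @ [l]) = word ?u \<otimes> letter l"
        using that letter_closed word_append[of ?u "[l]"] u by simp_all
      then have "act (word (?u @ [l])) v0 = act (word ?u) (act (letter l) v0)" using wu v0 act_mult by simp
      moreover have "act (word ?u) (act (inv (word ?u)) w) = w"
        using wu assms act_one by (metis act_mult inv_closed r_inv)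
      moreover have "act (inv (word ?u)) (act (word ?u) (act (letter l) v0)) = act (letter l) v0"
        using wu l v0 act_one act_closed by (metis act_mult inv_closed l_inv)
      ultimately show ?thesis by metis
    qed
    then show ?thesis unfolding edges_v0 by blast
  qed
  also have "\<dots> \<longleftrightarrow> wdist ?u (rw w) = 1"
  proof
    assume "\<exists>l\<in>\<Lambda>. w = act (word (?u @ [l])) v0"
    then obtain l where l: "l \<in> \<Lambda>" "w = act (word (?u @ [l])) v0" by blast
    show "wdist ?u (rw w) = 1"
    proof (cases "red (?u @ [l])")
      case True
      then have "rw w = ?u @ [l]" using rw_word l by simp
      then show ?thesis by (simp only: wdist_snoc_self)
    next
      case False
      then obtain u1 where u1: "?u = u1 @ [neg l]"
      proof -
        have "?u \<noteq> []" "l = neg (last ?u)" using False u(1) l(1) by (auto simp: red_def successively_append_iff)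
        moreover have "last ?u \<in> \<Lambda>" using u(2) \<open>?u \<noteq> []\<close> by (meson last_in_set subsetD)
        ultimately have "?u = butlast ?u @ [neg l]" using neg_neg by (metis append_butlast_last_id)
        then show ?thesis using that by blast
      qed
      then have s: "set u1 \<subseteq> \<Lambda>" using u by auto
      have "word (?u @ [l]) = word u1 \<otimes> (inv (letter l) \<otimes> letter l)"
        using u1 s l word_append[of u1 "[neg l, l]"] letter_neg neg_closed letter_closed by simp
      then have "w = act (word u1) v0" using l letter_closed word_closed[OF s] by simp
      moreover have "red u1" using red_prefix[OF u(1)] u1 by (metis prefixI)
      ultimately have "rw w = u1" using rw_word by simp
      then show ?thesis unfolding u1 by (simp only: wdist_snoc_self)
    qed
  next
    assume "wdist ?u (rw w) = 1"
    then consider l where "rw w = ?u @ [l]" | l where "?u = rw w @ [l]" using wdist_1 by blast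
    then show "\<exists>l\<in>\<Lambda>. w = act (word (?u @ [l])) v0"
    proof cases
      case 1
      then show ?thesis using rw[OF assms(2)] by (auto simp: red_def intro!: bexI[of _ l])
    next
      case (2 l)
      have l: "l \<in> \<Lambda>" "set (rw w) \<subseteq> \<Lambda>" using u(2) 2 by auto
      have "word (?u @ [neg l]) = word (rw w) \<otimes> (letter l \<otimes> inv (letter l))"
        using 2 l word_append[of "rw w" "[l, neg l]"] letter_neg neg_closed letter_closed by simp
      then have "act (word (?u @ [neg l])) v0 = w" using l letter_closed word_closed rw[OF assms(2)] by simp
      then show ?thesis using neg_closed l by metis
    qed
  qed
  finally show ?thesis .
qed

theorem graph_tree: "tree V Ed (\<lambda>u v. wdist (rw u) (rw v))"
proof -
  have nb: "\<exists>w'\<in>{w. red w}. wdist w w' = 1" if "w \<in> {w. red w}" for w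
  proof -
    let ?v = "act (word w) v0"
    have w: "red w" "word w \<in> carrier G" using that word_closed by (auto simp: red_def)
    obtain l where "l \<in> \<Lambda>" using letters_nonempty by blast
    then have "(v0, act (letter l) v0) \<in> Ed" using edges_v0 by blast
    then have "(?v, act (word w) (act (letter l) v0)) \<in> Ed" using act_edge w by blast
    then have "wdist (rw ?v) (rw (act (word w) (act (letter l) v0))) = 1" "act (word w) (act (letter l) v0) \<in> V"
      using edge_iff EdV by blast+
    then show ?thesis unfolding rw_word[OF w(1)] by (intro bexI[rotated]) (use rw in blast)+
  qed
  have T: "tree {w. red w} {(u, w). u \<in> {w. red w} \<and> w \<in> {w. red w} \<and> wdist u w = 1} wdist"
  proof (rule word_tree[OF _ nb])
    show "u \<in> {w. red w}" if "w \<in> {w. red w}" "prefix u w" for u w using red_prefix that by simp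
    have "red []" by (simp add: red_def)
    then show "{w. red w} \<noteq> {}" by blast
  qed
  have "Ed = {(u, v). u \<in> V \<and> v \<in> V \<and> (rw u, rw v) \<in> {(u, w). u \<in> {w. red w} \<and> w \<in> {w. red w} \<and> wdist u w = 1}}"
  proof (intro equalityI subrelI)
    fix u v assume uv: "(u, v) \<in> Ed"
    then have "u \<in> V" "v \<in> V" using EdV by blast+
    then show "(u, v) \<in> {(u, v). u \<in> V \<and> v \<in> V \<and>
        (rw u, rw v) \<in> {(u, w). u \<in> {w. red w} \<and> w \<in> {w. red w} \<and> wdist u w = 1}}"
      using rw[of u] rw[of v] edge_iff[of u v] uv by simp
  next
    fix u v assume "(u, v) \<in> {(u, v). u \<in> V \<and> v \<in> V \<and>
        (rw u, rw v) \<in> {(u, w). u \<in> {w. red w} \<and> w \<in> {w. red w} \<and> wdist u w = 1}}"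
    then show "(u, v) \<in> Ed" using edge_iff[of u v] by simp
  qed
  then show ?thesis using tree_transport[OF T rw_bij] by simp
qed

end

section \<open>Laurent series\<close>

definition intg :: "'a::field fls \<Rightarrow> bool" where "intg x \<longleftrightarrow> 0 \<le> fls_subdegree x"

abbreviation r0 :: "'a::field fls \<Rightarrow> 'a" where "r0 x \<equiv> fls_nth x 0"

lemma intg_fps: "intg x \<Longrightarrow> x = fps_to_fls (fls_regpart x)"
  unfolding intg_def by simp

lemma intg_of_fps [simp]: "intg (fps_to_fls g)"
  by (simp add: intg_def fls_subdegree_fls_to_fps_gt0)

lemma intg_add [simp]: "intg x \<Longrightarrow> intg y \<Longrightarrow> intg (x + y)"
  by (metis intg_fps intg_of_fps fps_to_fls_plus)

lemma intg_mult [simp]: "intg x \<Longrightarrow> intg y \<Longrightarrow> intg (x * y)"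
  by (metis intg_fps intg_of_fps fls_times_fps_to_fls)

lemma intg_minus [simp]: "intg x \<Longrightarrow> intg (- x)"
  by (simp add: intg_def)

lemma intg_diff [simp]: "intg x \<Longrightarrow> intg y \<Longrightarrow> intg (x - y)"
  using intg_add[of x "- y"] by simp

lemma intg_const [simp]: "intg (fls_const a)" "intg 0" "intg 1" "intg fls_X"
  by (simp_all add: intg_def)

lemma r0_mult: "intg x \<Longrightarrow> intg y \<Longrightarrow> r0 (x * y) = r0 x * r0 y"
proof -
  assume "intg x" "intg y"
  then obtain g h where "x = fps_to_fls g" "y = fps_to_fls h" using intg_fps by blast
  then show ?thesis by (simp add: fls_times_fps_to_fls[symmetric])
qed

lemma intg_square [simp]: "intg x \<Longrightarrow> intg (x\<^sup>2)" and r0_square: "intg x \<Longrightarrow> r0 (x\<^sup>2) = (r0 x)\<^sup>2"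
  by (simp_all add: power2_eq_square r0_mult)

lemma intg_X_div:
  assumes "intg x" "r0 x = 0" shows "\<exists>y. intg y \<and> x = fls_X * y"
proof -
  have "0 < fls_subdegree x \<or> x = 0"
    using assms unfolding intg_def by (metis nth_fls_subdegree_nonzero order_le_less)
  then have "intg (fls_X_inv * x)"
    by (cases "x = 0") (auto simp: intg_def fls_X_inv_times_conv_shift)
  moreover have "fls_X * (fls_X_inv * x) = x"
    by (simp add: fls_X_times_conv_shift fls_X_inv_times_conv_shift)
  ultimately show ?thesis by metis
qed

lemma intg_unit:
  assumes "intg x" "r0 x \<noteq> 0" shows "intg (inverse x)" "r0 (inverse x) \<noteq> 0" "x \<noteq> 0" "fls_subdegree x = 0"
proof -
  show "fls_subdegree x = 0" using assms fls_subdegree_leI[of x 0] unfolding intg_def by linarith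
  then show i: "intg (inverse x)" by (simp add: intg_def)
  show x0: "x \<noteq> 0" using assms by auto
  have "r0 x * r0 (inverse x) = 1" using r0_mult[OF assms(1) i] x0 by simp
  then show "r0 (inverse x) \<noteq> 0" by auto
qed

text \<open>The index \<open>m\<close> only has to bound the order from below, so that one
  \<open>m\<close> serves for both series in a norm form.\<close>

lemma nth_square_min:
  assumes "\<And>k. k < m \<Longrightarrow> fls_nth x k = 0"
  shows "fls_nth (x\<^sup>2) (m + m) = (fls_nth (x::'a::field fls) m)\<^sup>2"
proof (cases "fls_nth x m = 0")
  case True
  have "x = 0 \<or> m < fls_subdegree x"
    using assms True by (metis linorder_neqE nth_fls_subdegree_nonzero)
  then show ?thesis using True by (auto simp: power2_eq_square intro: fls_times_nth_eq0)
next
  case False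
  then have "fls_subdegree x = m" using assms by (intro fls_subdegree_eqI) auto
  then show ?thesis using fls_times_base[of x x] by (simp add: power2_eq_square)
qed

section \<open>The tree at a place where the quaternion algebra splits\<close>

lemma mat_vec: "mat k *v (v :: 'a::field fls^2) = k *s v"
  by (simp add: vec_eq_iff matrix_vector_mult_def mat_def sum_2 forall_2)

text \<open>Common form of the two places. \<open>A\<close> is the image of \<open>Z\<close>,
  \<open>B\<close> that of \<open>F\<close> scaled so that its square \<open>f\<close> is a unit,
  and \<open>s\<close> is \<open>t\<close> up to a scalar. By \<open>crit\<close> the determinant of
  a generator whose label has norm \<open>n0\<close> is the uniformizer times the unit
  \<open>\<nu>\<close>.\<close>

locale local_place =
  fixes c n0 :: "'a::{field,finite}" and A B :: "'a fls^2^2" and s f \<nu> :: "'a fls"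
  assumes two: "(2::'a) \<noteq> 0" and c0: "c \<noteq> 0" and nonsq: "\<not> (\<exists>x. c = x\<^sup>2)"
    and AA: "A ** A = mat (fls_const c)" and BB: "B ** B = mat f" and AB: "A ** B = - (B ** A)"
    and s: "intg s" "r0 s \<noteq> 0" and f: "intg f" "r0 f \<noteq> 0"
    and crit: "s\<^sup>2 * fls_const (c\<^sup>2) + fls_const c * f * fls_const n0 = fls_X * \<nu>"
    and \<nu>: "intg \<nu>" "r0 \<nu> \<noteq> 0"
begin

lemma norm_form_0: "x\<^sup>2 - c * y\<^sup>2 = 0 \<Longrightarrow> x = 0 \<and> y = (0::'a)"
proof
  assume a: "x\<^sup>2 - c * y\<^sup>2 = 0"
  show "y = 0"
  proof (rule ccontr)
    assume "y \<noteq> 0"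
    then have "c = (x / y)\<^sup>2" using a by (simp add: power_divide field_simps)
    then show False using nonsq by blast
  qed
  then show "x = 0" using a by simp
qed

text \<open>The form is anisotropic over the residue field: at the lowest order \<open>m\<close> of
  \<open>x\<close> and \<open>y\<close> the coefficient of index \<open>2 m\<close> is its value at
  a nonzero vector, hence nonzero. So \<open>m\<close> cannot be negative.\<close>

lemma norm_form_intg:
  assumes "intg (x\<^sup>2 - fls_const c * y\<^sup>2)" shows "intg x" "intg y"
proof -
  have *: "0 \<le> m" if m: "\<And>k. k < m \<Longrightarrow> fls_nth x k = 0" "\<And>k. k < m \<Longrightarrow> fls_nth y k = 0"
    "fls_nth x m \<noteq> 0 \<or> fls_nth y m \<noteq> 0" for m
  proof (rule ccontr)
    assume "\<not> 0 \<le> m"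
    then have "fls_nth (x\<^sup>2 - fls_const c * y\<^sup>2) (m + m) = 0"
      using assms unfolding intg_def by (intro fls_eq0_below_subdegree) linarith
    then have "(fls_nth x m)\<^sup>2 - c * (fls_nth y m)\<^sup>2 = 0"
      using nth_square_min[of m x] nth_square_min[of m y] m by simp
    then show False using norm_form_0 m(3) by blast
  qed
  define mm where "mm = min (if x = 0 then fls_subdegree y else fls_subdegree x)
    (if y = 0 then fls_subdegree x else fls_subdegree y)"
  have "intg x \<and> intg y"
  proof (cases "x = 0 \<and> y = 0")
    case False
    have "0 \<le> mm"
    proof (rule *)
      show "fls_nth x k = 0" "fls_nth y k = 0" if "k < mm" for k
        using that unfolding mm_def by (auto split: if_splits)
      show "fls_nth x mm \<noteq> 0 \<or> fls_nth y mm \<noteq> 0"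
        using False unfolding mm_def by (auto simp: min_def split: if_splits)
    qed
    then show ?thesis unfolding mm_def intg_def using False by (auto split: if_splits)
  qed simp
  then show "intg x" "intg y" by auto
qed

lemma fls_nonsq: "x\<^sup>2 \<noteq> fls_const c"
proof
  assume a: "x\<^sup>2 = fls_const c"
  then have "intg (x\<^sup>2 - fls_const c * 0\<^sup>2)" by simp
  then have "intg x" by (rule norm_form_intg)
  then have "(r0 x)\<^sup>2 = c" using r0_square[of x] a by simp
  then show False using nonsq by blast
qed

lemma AAv: "A *v (A *v v) = fls_const c *s v" and BBv: "B *v (B *v v) = f *s v"
  and ABv: "B *v (A *v v) = - (A *v (B *v v))"
proof -
  show "A *v (A *v v) = fls_const c *s v" "B *v (B *v v) = f *s v"
    by (simp_all add: matrix_vector_mul_assoc AA BB mat_vec)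
  have "(- (B ** A)) *v v = - ((B ** A) *v v)"
    by (simp add: vec_eq_iff matrix_vector_mult_def sum_2)
  then show "B *v (A *v v) = - (A *v (B *v v))" by (simp add: matrix_vector_mul_assoc AB)
qed

definition e1 :: "'a fls^2" where "e1 = vector [1, 0]"

text \<open>The plane is one-dimensional over the field generated by \<open>A\<close>, and
  \<open>cvec x y\<close> is the multiple of \<open>e1\<close> by \<open>x + y Z\<close>.\<close>

definition cvec :: "'a fls \<Rightarrow> 'a fls \<Rightarrow> 'a fls^2" where "cvec x y = x *s e1 + y *s (A *v e1)"

lemma cvec_nth: "cvec x y $ 1 = x + y * A$1$1" "cvec x y $ 2 = y * A$2$1"
  by (simp_all add: cvec_def e1_def matrix_vector_mult_def sum_2)

lemma A21: "A$2$1 \<noteq> 0"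
proof
  assume a: "A$2$1 = 0"
  have "(A ** A)$1$1 = fls_const c" by (simp add: AA mat_def)
  then have "(A$1$1)\<^sup>2 = fls_const c" using a by (simp add: matrix_matrix_mult_def sum_2 power2_eq_square)
  then show False using fls_nonsq by blast
qed

lemma cvec_eq [simp]: "cvec x y = cvec x' y' \<longleftrightarrow> x = x' \<and> y = y'"
proof
  assume a: "cvec x y = cvec x' y'"
  then have "y * A$2$1 = y' * A$2$1" "x + y * A$1$1 = x' + y' * A$1$1" using cvec_nth by metis+
  then show "x = x' \<and> y = y'" using A21 by simp
qed simp

lemma cvec_ex: "\<exists>x y. v = cvec x y"
proof -
  have "v = cvec (v$1 - v$2 / A$2$1 * A$1$1) (v$2 / A$2$1)"
    using A21 by (simp add: vec_eq_iff forall_2 cvec_nth)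
  then show ?thesis by blast
qed

lemma cvec_add: "cvec x y + cvec x' y' = cvec (x + x') (y + y')"
  and cvec_smult: "k *s cvec x y = cvec (k * x) (k * y)"
  and cvec_minus: "- cvec x y = cvec (- x) (- y)"
  and cvec_diff: "cvec x y - cvec x' y' = cvec (x - x') (y - y')"
  by (simp_all add: vec_eq_iff forall_2 cvec_nth algebra_simps)

lemma A_cvec: "A *v cvec x y = cvec (fls_const c * y) x"
  by (simp add: cvec_def matrix_vector_right_distrib vector_scalar_commute AAv)

definition \<beta> where "\<beta> = (SOME b. \<exists>b'. B *v e1 = cvec b b')"
definition \<beta>' where "\<beta>' = (SOME b'. B *v e1 = cvec \<beta> b')"

lemma B_e1: "B *v e1 = cvec \<beta> \<beta>'"
proof -
  have "\<exists>b b'. B *v e1 = cvec b b'" using cvec_ex by blast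
  then have "\<exists>b'. B *v e1 = cvec \<beta> b'" unfolding \<beta>_def by (rule someI_ex)
  then show ?thesis unfolding \<beta>'_def by (rule someI_ex)
qed

lemma B_cvec: "B *v cvec x y = cvec (\<beta> * x - fls_const c * \<beta>' * y) (\<beta>' * x - \<beta> * y)"
proof -
  have "B *v cvec x y = x *s (B *v e1) - y *s (A *v (B *v e1))"
    by (simp add: cvec_def matrix_vector_right_distrib vector_scalar_commute ABv)
  also have "\<dots> = cvec (\<beta> * x - fls_const c * \<beta>' * y) (\<beta>' * x - \<beta> * y)"
    by (simp add: B_e1 A_cvec cvec_smult cvec_diff mult_ac)
  finally show ?thesis .
qed

text \<open>\<open>B\<close> is semilinear for the conjugation \<open>Z \<mapsto> -Z\<close>, so its
  square is multiplication by the norm of \<open>\<beta> + \<beta>' Z\<close>. As this norm is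
  integral, so are \<open>\<beta>\<close> and \<open>\<beta>'\<close>, and \<open>B\<close>
  preserves the standard lattice.\<close>

lemma \<beta>_norm: "\<beta>\<^sup>2 - fls_const c * \<beta>'\<^sup>2 = f"
proof -
  have e: "e1 = cvec 1 0" by (simp add: cvec_def)
  have "f *s cvec 1 0 = B *v (B *v cvec 1 0)" by (simp add: BBv)
  then show ?thesis unfolding B_cvec cvec_smult by (simp add: power2_eq_square algebra_simps)
qed

lemma \<beta>_intg: "intg \<beta>" "intg \<beta>'"
  using norm_form_intg[of \<beta> \<beta>'] \<beta>_norm f by auto

text \<open>The standard lattice, stable under \<open>A\<close> and \<open>B\<close>.
  \<open>L1\<close> is its multiple by the uniformizer, written through residues so that congruences
  become equations in the residue field.\<close>

definition L0 where "L0 = {cvec x y | x y. intg x \<and> intg y}"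
definition L1 where "L1 = {cvec x y | x y. intg x \<and> intg y \<and> r0 x = 0 \<and> r0 y = 0}"

lemma L0_iff: "cvec x y \<in> L0 \<longleftrightarrow> intg x \<and> intg y"
  by (auto simp: L0_def)

lemma L1_iff: "cvec x y \<in> L1 \<longleftrightarrow> intg x \<and> intg y \<and> r0 x = 0 \<and> r0 y = 0"
  by (auto simp: L1_def)

lemma L0_cases: assumes "v \<in> L0" obtains x y where "v = cvec x y" "intg x" "intg y"
  using assms by (auto simp: L0_def)

lemma L1_cases: assumes "v \<in> L1" obtains x y where "v = cvec x y" "intg x" "intg y" "r0 x = 0" "r0 y = 0"
  using assms by (auto simp: L1_def)

lemma L0_add: "v \<in> L0 \<Longrightarrow> w \<in> L0 \<Longrightarrow> v + w \<in> L0"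
  by (elim L0_cases) (simp add: cvec_add L0_iff)

lemma L0_smult: "v \<in> L0 \<Longrightarrow> intg k \<Longrightarrow> k *s v \<in> L0"
  by (auto elim!: L0_cases simp: cvec_smult L0_iff)

lemma L1_add: "v \<in> L1 \<Longrightarrow> w \<in> L1 \<Longrightarrow> v + w \<in> L1"
  by (elim L1_cases) (simp add: cvec_add L1_iff)

lemma L1_minus: "v \<in> L1 \<Longrightarrow> - v \<in> L1"
  by (elim L1_cases) (simp add: cvec_minus L1_iff)

lemma L1_diff: "v \<in> L1 \<Longrightarrow> w \<in> L1 \<Longrightarrow> v - w \<in> L1"
  using L1_add[of v "- w"] L1_minus by simp

lemma L1_smult: "v \<in> L1 \<Longrightarrow> intg k \<Longrightarrow> k *s v \<in> L1"
  by (elim L1_cases) (simp add: cvec_smult L1_iff r0_mult)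

lemma L1_X: "L1 = (\<lambda>v. fls_X *s v) ` L0"
proof (intro equalityI subsetI)
  fix v assume "v \<in> L1"
  then obtain x y where v: "v = cvec x y" "intg x" "intg y" "r0 x = 0" "r0 y = 0" by (auto simp: L1_def)
  obtain x' y' where "intg x'" "x = fls_X * x'" "intg y'" "y = fls_X * y'" using intg_X_div v by metis
  then show "v \<in> (\<lambda>v. fls_X *s v) ` L0" using v L0_iff cvec_smult by (intro image_eqI[of _ _ "cvec x' y'"]) auto
next
  fix v assume "v \<in> (\<lambda>v. fls_X *s v) ` L0"
  then show "v \<in> L1" by (auto elim!: L0_cases simp: cvec_smult L1_iff r0_mult)
qed

lemma L1_unit:
  assumes "k *s v \<in> L1" "intg k" "r0 k \<noteq> 0" shows "v \<in> L1"
proof -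
  have "inverse k *s (k *s v) \<in> L1" by (rule L1_smult[OF assms(1) intg_unit(1)[OF assms(2,3)]])
  then show ?thesis using intg_unit(3)[OF assms(2,3)] by (simp add: vector_smult_assoc)
qed

lemma A_L0: "v \<in> L0 \<Longrightarrow> A *v v \<in> L0"
  by (auto elim!: L0_cases simp: A_cvec L0_iff)

lemma B_L0: "v \<in> L0 \<Longrightarrow> B *v v \<in> L0"
  using \<beta>_intg by (auto elim!: L0_cases simp: B_cvec L0_iff)

lemma A_L1: "v \<in> L1 \<Longrightarrow> A *v v \<in> L1"
  unfolding L1_X using A_L0 by (auto simp: vector_scalar_commute)

lemma B_L1: "v \<in> L1 \<Longrightarrow> B *v v \<in> L1"
  unfolding L1_X using B_L0 by (auto simp: vector_scalar_commute)

text \<open>The quotient of \<open>L0\<close> by \<open>L1\<close> is one-dimensional over the field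
  with \<open>q^2\<close> elements. The coefficients come from Cramer's rule; its determinant
  \<open>?d\<close> is the norm of the residue of \<open>n\<close>, nonzero because the form is
  anisotropic.\<close>

lemma span_mod:
  assumes "n \<in> L0" "n \<notin> L1" "w \<in> L0"
  shows "\<exists>a b. w - (fls_const a *s n + fls_const b *s (A *v n)) \<in> L1"
proof -
  obtain p q where n: "n = cvec p q" "intg p" "intg q" using assms(1) by (rule L0_cases)
  obtain w1 w2 where w: "w = cvec w1 w2" "intg w1" "intg w2" using assms(3) by (rule L0_cases)
  let ?d = "(r0 p)\<^sup>2 - c * (r0 q)\<^sup>2"
  have d: "?d \<noteq> 0" using norm_form_0 assms(2) n L1_iff by blast
  define a where "a = (r0 w1 * r0 p - c * r0 q * r0 w2) / ?d"
  define b where "b = (r0 p * r0 w2 - r0 q * r0 w1) / ?d"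
  have ab: "a * ?d = r0 w1 * r0 p - c * r0 q * r0 w2" "b * ?d = r0 p * r0 w2 - r0 q * r0 w1"
    using d by (simp_all add: a_def b_def)
  have "(a * r0 p + b * (c * r0 q)) * ?d = (a * ?d) * r0 p + (b * ?d) * (c * r0 q)"
    "(a * r0 q + b * r0 p) * ?d = (a * ?d) * r0 q + (b * ?d) * r0 p" by (simp_all only: algebra_simps)
  then have "(a * r0 p + b * (c * r0 q)) * ?d = r0 w1 * ?d" "(a * r0 q + b * r0 p) * ?d = r0 w2 * ?d"
    unfolding ab by (simp_all add: power2_eq_square algebra_simps)
  then have "a * r0 p + b * (c * r0 q) = r0 w1" "a * r0 q + b * r0 p = r0 w2"
    using d by simp_all
  then have "w - (fls_const a *s n + fls_const b *s (A *v n)) \<in> L1"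
    unfolding n w A_cvec cvec_smult cvec_add cvec_diff L1_iff using n w by (simp add: r0_mult)
  then show ?thesis by blast
qed

lemma span_mod_inj:
  assumes "n \<in> L0" "n \<notin> L1" "fls_const a *s n + fls_const b *s (A *v n) \<in> L1"
  shows "a = 0 \<and> b = 0"
proof -
  obtain p q where n: "n = cvec p q" "intg p" "intg q" using assms(1) by (rule L0_cases)
  let ?d = "(r0 p)\<^sup>2 - c * (r0 q)\<^sup>2"
  have d: "?d \<noteq> 0" using norm_form_0 assms(2) n L1_iff by blast
  have "a * r0 p + b * (c * r0 q) = 0" "a * r0 q + b * r0 p = 0"
    using assms(3) unfolding n A_cvec cvec_smult cvec_add L1_iff using n by (simp_all add: r0_mult)
  then have "(a * r0 p + b * (c * r0 q)) * r0 p - c * r0 q * (a * r0 q + b * r0 p) = 0"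
    "(a * r0 q + b * r0 p) * r0 p - r0 q * (a * r0 p + b * (c * r0 q)) = 0" by simp_all
  then have "a * ?d = 0" "b * ?d = 0" by (simp_all add: power2_eq_square algebra_simps)
  then show ?thesis using d by simp
qed

section \<open>The generators modulo the uniformizer\<close>

definition op where
  "op x y = mat (s * fls_const c) - (mat (fls_const x) ** (A ** B) + mat (fls_const (c * y)) ** B)"

lemma op_v: "op x y *v v = (s * fls_const c) *s v -
    (fls_const x *s (A *v (B *v v)) + fls_const (c * y) *s (B *v v))"
  unfolding op_def
  by (simp add: matrix_vector_mult_diff_rdistrib matrix_vector_mult_add_rdistrib mat_vec
      flip: matrix_vector_mul_assoc)

lemma op_linear: "op x y *v (k *s v + l *s w) = k *s (op x y *v v) + l *s (op x y *v w)"
  by (simp add: matrix_vector_right_distrib vector_scalar_commute)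

definition nn where "nn x y = s\<^sup>2 * fls_const (c\<^sup>2) + fls_const c * f * fls_const (x\<^sup>2 - c * y\<^sup>2)"

lemma op_cvec: "op x y *v cvec p q =
   cvec ((s * fls_const c - fls_const (x * c) * \<beta>' - fls_const (c * y) * \<beta>) * p
        + (fls_const (x * c) * \<beta> + fls_const (c * c * y) * \<beta>') * q)
       (- (fls_const x * \<beta> + fls_const (c * y) * \<beta>') * p
        + (s * fls_const c + fls_const (x * c) * \<beta>' + fls_const (c * y) * \<beta>) * q)"
  unfolding op_v B_cvec A_cvec cvec_smult cvec_add cvec_diff
  by (simp add: algebra_simps flip: fls_const_mult_const)

lemma nn_beta: "nn x y = s\<^sup>2 * fls_const (c\<^sup>2) +
    fls_const c * (\<beta>\<^sup>2 - fls_const c * \<beta>'\<^sup>2) * fls_const (x\<^sup>2 - c * y\<^sup>2)"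
  by (simp only: nn_def \<beta>_norm)

lemma op_det:
  "(s * fls_const c - fls_const (x * c) * \<beta>' - fls_const (c * y) * \<beta>) *
      (s * fls_const c + fls_const (x * c) * \<beta>' + fls_const (c * y) * \<beta>)
   - (fls_const (x * c) * \<beta> + fls_const (c * c * y) * \<beta>') * (- (fls_const x * \<beta> + fls_const (c * y) * \<beta>')) = nn x y"
  unfolding nn_beta
  by (simp add: power2_eq_square algebra_simps fls_minus_const[symmetric] flip: fls_const_mult_const)

lemma op_op: "op x y *v (op (- x) (- y) *v v) = nn x y *s v"
proof -
  obtain p q where v: "v = cvec p q" using cvec_ex by blast
  define a b b' d where "a = fls_const (x * c) * \<beta>' + fls_const (c * y) * \<beta>" and "b = fls_const (x * c) * \<beta> + fls_const (c * c * y) * \<beta>'"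
    and "b' = fls_const x * \<beta> + fls_const (c * y) * \<beta>'" and "d = s * fls_const c"
  have 1: "op x y *v cvec p q = cvec ((d - a) * p + b * q) (- b' * p + (d + a) * q)" for p q
    unfolding op_cvec a_def b_def b'_def d_def by (simp add: algebra_simps)
  have 2: "op (- x) (- y) *v cvec p q = cvec ((d + a) * p - b * q) (b' * p + (d - a) * q)" for p q
    unfolding op_cvec a_def b_def b'_def d_def by (simp add: algebra_simps fls_const_uminus)
  have 3: "(d - a) * (d + a) + b * b' = nn x y"
    using op_det[of x y] unfolding a_def b_def b'_def d_def by (simp add: algebra_simps)
  show ?thesis unfolding v 1 2 cvec_smult 3[symmetric] cvec_eq by (simp add: algebra_simps)
qed

lemma op_L0: "v \<in> L0 \<Longrightarrow> op x y *v v \<in> L0"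
proof -
  assume "v \<in> L0"
  then obtain p q where "v = cvec p q" "intg p" "intg q" by (rule L0_cases)
  then show ?thesis using s \<beta>_intg unfolding op_cvec by (simp add: op_cvec L0_iff)
qed

lemma op_L1: "v \<in> L1 \<Longrightarrow> op x y *v v \<in> L1"
  unfolding L1_X using op_L0 by (auto simp: vector_scalar_commute)

lemma nn_intg: "intg (nn x y)" and r0_nn: "r0 (nn x y) = (r0 s)\<^sup>2 * c\<^sup>2 + c * r0 f * (x\<^sup>2 - c * y\<^sup>2)"
  using s f by (simp_all add: nn_def r0_mult r0_square)

text \<open>The residue is an affine function of the norm of the label with nonzero slope, and
  \<open>crit\<close> gives its zero.\<close>

lemma r0_nn_iff: "r0 (nn x y) = 0 \<longleftrightarrow> x\<^sup>2 - c * y\<^sup>2 = n0"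
proof -
  have "r0 (fls_X * \<nu>) = 0" using \<nu> by (simp add: r0_mult)
  then have "(r0 s)\<^sup>2 * c\<^sup>2 + c * r0 f * n0 = 0"
    unfolding crit[symmetric] using s f by (simp add: r0_mult r0_square)
  then have "r0 (nn x y) = 0 \<longleftrightarrow> c * r0 f * (x\<^sup>2 - c * y\<^sup>2) = c * r0 f * n0"
    unfolding r0_nn by (metis add_left_cancel)
  then show ?thesis using c0 f by simp
qed

lemma nn_crit: "x\<^sup>2 - c * y\<^sup>2 = n0 \<Longrightarrow> nn x y = fls_X * \<nu>"
  by (simp add: nn_def flip: crit)

lemma op_unit_L0:
  assumes "x\<^sup>2 - c * y\<^sup>2 \<noteq> n0" shows "(*v) (op x y) ` L0 = L0"
proof
  show "(*v) (op x y) ` L0 \<subseteq> L0" using op_L0 by auto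
  have u: "intg (nn x y)" "r0 (nn x y) \<noteq> 0" using nn_intg r0_nn_iff assms by auto
  show "L0 \<subseteq> (*v) (op x y) ` L0"
  proof
    fix v assume v: "v \<in> L0"
    let ?w = "inverse (nn x y) *s (op (- x) (- y) *v v)"
    have "op x y *v ?w = v"
      using intg_unit(3)[OF u] by (simp add: vector_scalar_commute op_op vector_smult_assoc)
    moreover have "?w \<in> L0" using L0_smult[OF op_L0[OF v] intg_unit(1)[OF u]] .
    ultimately show "v \<in> (*v) (op x y) ` L0" by (metis image_eqI)
  qed
qed

lemma ABm_not_L1:
  assumes "m \<in> L0" "m \<notin> L1" shows "A *v (B *v m) \<in> L0" "A *v (B *v m) \<notin> L1"
proof -
  show "A *v (B *v m) \<in> L0" using A_L0 B_L0 assms by blast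
  show "A *v (B *v m) \<notin> L1"
  proof
    assume "A *v (B *v m) \<in> L1"
    then have "B *v (A *v (A *v (B *v m))) \<in> L1" using A_L1 B_L1 by blast
    then have "(fls_const c * f) *s m \<in> L1" by (simp add: AAv vector_scalar_commute BBv vector_smult_assoc)
    then show False using L1_unit f c0 assms by (simp add: r0_mult)
  qed
qed

lemma conj_op_v: "op (- x) (- y) *v m = (s * fls_const c) *s m +
    (fls_const x *s (A *v (B *v m)) + fls_const y *s (A *v (A *v (B *v m))))"
  unfolding op_v by (simp add: AAv vector_smult_assoc fls_const_uminus algebra_simps)

text \<open>By \<open>conj_op_v\<close>, sending \<open>m\<close> into \<open>L1\<close> is a linear
  equation for \<open>x + y Z\<close> over the residue field whose coefficient \<open>A B m\<close>
  is nonzero. It is solvable, and \<open>kernel_unique\<close> adds that the solution is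
  unique.\<close>

lemma kernel_exists:
  assumes "m \<in> L0" "m \<notin> L1"
  shows "\<exists>x y. x\<^sup>2 - c * y\<^sup>2 = n0 \<and> op (- x) (- y) *v m \<in> L1"
proof -
  note n = ABm_not_L1[OF assms]
  let ?w = "- ((s * fls_const c) *s m)"
  have "(- (s * fls_const c)) *s m \<in> L0" using s by (intro L0_smult assms) simp
  then have "?w \<in> L0" by simp
  then obtain a b where "?w - (fls_const a *s (A *v (B *v m)) + fls_const b *s (A *v (A *v (B *v m)))) \<in> L1"
    using span_mod[OF n] by blast
  from L1_minus[OF this] have k: "op (- a) (- b) *v m \<in> L1" unfolding conj_op_v by (simp add: add_ac)
  \<comment> \<open>Applying the conjugate operator shows that the determinant kills
    \<open>m\<close> modulo the uniformizer, which forces the label to have norm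
    \<open>n0\<close>.\<close>
  then have "nn a b *s m \<in> L1" using op_L1[OF k, of a b] by (simp add: op_op)
  then have "r0 (nn a b) = 0" using L1_unit nn_intg assms by blast
  then show ?thesis using k r0_nn_iff by blast
qed

lemma kernel_unique:
  assumes "m \<in> L0" "m \<notin> L1" "op (- x) (- y) *v m \<in> L1" "op (- u) (- v) *v m \<in> L1"
  shows "x = u \<and> y = v"
proof -
  have "op (- x) (- y) *v m - op (- u) (- v) *v m \<in> L1" using L1_diff assms by blast
  moreover have "op (- x) (- y) *v m - op (- u) (- v) *v m =
      fls_const (x - u) *s (A *v (B *v m)) + fls_const (y - v) *s (A *v (A *v (B *v m)))"
    unfolding conj_op_v by (simp add: vec_eq_iff algebra_simps flip: fls_minus_const)
  ultimately show ?thesis using span_mod_inj[OF ABm_not_L1[OF assms(1,2)]] by fastforce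
qed

lemma kernel_image:
  assumes "x\<^sup>2 - c * y\<^sup>2 = n0" "v \<in> L0" shows "op (- x) (- y) *v (op x y *v v) \<in> L1"
proof -
  have "op (- x) (- y) *v (op x y *v v) = nn (- x) (- y) *s v"
    using op_op[of "- x" "- y" v] by simp
  also have "\<dots> = fls_X *s (\<nu> *s v)" using nn_crit[of "- x" "- y"] assms(1) by (simp add: vector_smult_assoc)
  finally have eq: "op (- x) (- y) *v (op x y *v v) = fls_X *s (\<nu> *s v)" .
  show ?thesis unfolding eq L1_X by (rule imageI[OF L0_smult[OF assms(2) \<nu>(1)]])
qed

text \<open>Modulo the uniformizer the image of a critical operator is the whole kernel of its
  conjugate: the determinant is the uniformizer times a unit, so the first factor cancels and the
  second is inverted.\<close>

lemma image_of_kernel: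
  assumes "x\<^sup>2 - c * y\<^sup>2 = n0" "op (- x) (- y) *v v \<in> L1" shows "\<exists>w\<in>L0. v = op x y *v w"
proof -
  obtain w where w: "w \<in> L0" "op (- x) (- y) *v v = fls_X *s w" using assms(2) unfolding L1_X by auto
  have "nn x y *s v = fls_X *s (op x y *v w)"
    unfolding op_op[symmetric] w(2) by (simp add: vector_scalar_commute)
  then have "fls_X *s (\<nu> *s v) = fls_X *s (op x y *v w)" using nn_crit[OF assms(1)] by (simp add: vector_smult_assoc)
  then have "\<nu> *s v = op x y *v w" by (simp add: vec_eq_iff)
  then have "v = op x y *v (inverse \<nu> *s w)"
    using intg_unit(3)[OF \<nu>] by (simp add: vector_scalar_commute vector_smult_assoc flip: \<open>\<nu> *s v = op x y *v w\<close>)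
  then show ?thesis using L0_smult[OF w(1) intg_unit(1)[OF \<nu>]] by blast
qed

text \<open>The trace of the operator is twice \<open>s c\<close>, a unit in odd characteristic, so
  its residue cannot be the zero matrix.\<close>

lemma op_not_L1: "\<exists>v\<in>L0. op x y *v v \<notin> L1"
proof (rule ccontr)
  assume "\<not> (\<exists>v\<in>L0. op x y *v v \<notin> L1)"
  then have "op x y *v cvec 1 0 \<in> L1" "op x y *v cvec 0 1 \<in> L1" by (auto simp: L0_iff)
  then have "r0 (s * fls_const c - fls_const (x * c) * \<beta>' - fls_const (c * y) * \<beta>) = 0"
    "r0 (s * fls_const c + fls_const (x * c) * \<beta>' + fls_const (c * y) * \<beta>) = 0"
    unfolding op_cvec L1_iff by simp_all
  then have "2 * (r0 s * c) = 0" using s by (simp add: r0_mult algebra_simps)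
  then show False using two s c0 by simp
qed

end

subsection \<open>Lattices\<close>

definition lat :: "'a::field fls^2 \<Rightarrow> 'a fls^2 \<Rightarrow> ('a fls^2) set" where
  "lat u w = {x *s u + y *s w | x y. intg x \<and> intg y}"

lemma is_lattice_lat:
  "is_lattice L \<longleftrightarrow> (\<exists>u w. (\<forall>x y. x *s u + y *s w = 0 \<longrightarrow> x = 0 \<and> y = 0) \<and> L = lat u w)"
  by (simp add: is_lattice_def lat_def intg_def)

lemma lat_image_pairs: "lat u w = (\<lambda>(x, y). x *s u + y *s w) ` {(x, y). intg x \<and> intg y}"
  unfolding lat_def by auto

lemma lat_smult: "(\<lambda>v. k *s v) ` lat u w = lat (k *s u) (k *s w)"
proof -
  have "k *s (x *s u + y *s w) = x *s (k *s u) + y *s (k *s w)" for x y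
    by (simp add: vec_eq_iff algebra_simps)
  then show ?thesis unfolding lat_image_pairs image_image by (intro image_cong) auto
qed

lemma lat_image: "(*v) M ` lat u w = lat (M *v u) (M *v w)" for M :: "'a::field fls^2^2"
proof -
  have "M *v (x *s u + y *s w) = x *s (M *v u) + y *s (M *v w)" for x y
    by (simp add: matrix_vector_right_distrib vector_scalar_commute)
  then show ?thesis unfolding lat_image_pairs image_image by (intro image_cong) auto
qed

lemma smult_smult_image: "(\<lambda>v. k *s v) ` (\<lambda>v. l *s v) ` L = (\<lambda>v. (k * l) *s v) ` L"
  for L :: "('a::field fls^2) set"
  by (simp add: image_image vector_smult_assoc)

lemma smult_1_image: "(\<lambda>v. 1 *s v) ` L = L" for L :: "('a::field fls^2) set"
  by (simp add: vector_smult_lid)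

lemma lattice_smult:
  assumes "is_lattice L" "k \<noteq> 0" shows "is_lattice ((\<lambda>v. k *s v) ` L)"
proof -
  obtain u w where uw: "\<And>x y. x *s u + y *s w = 0 \<Longrightarrow> x = 0 \<and> y = 0" "L = lat u w"
    using assms(1) unfolding is_lattice_lat by blast
  have "x = 0 \<and> y = 0" if "x *s (k *s u) + y *s (k *s w) = 0" for x y
    using uw(1)[of "x * k" "y * k"] that assms(2) by (simp add: vector_smult_assoc)
  then show ?thesis unfolding is_lattice_lat uw(2) lat_smult by blast
qed

lemma homothety_self: "L \<in> homothety_class L"
  unfolding homothety_class_def using smult_1_image[of L] by (intro CollectI exI[of _ 1]) simp

lemma homothety_eq:
  assumes "k \<noteq> 0" shows "homothety_class ((\<lambda>v. k *s v) ` L) = homothety_class L"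
proof (intro equalityI subsetI)
  fix M assume "M \<in> homothety_class ((\<lambda>v. k *s v) ` L)"
  then obtain x where "x \<noteq> 0" "M = (\<lambda>v. x *s v) ` (\<lambda>v. k *s v) ` L" by (auto simp: homothety_class_def)
  then show "M \<in> homothety_class L" unfolding homothety_class_def smult_smult_image
    using assms by (intro CollectI exI[of _ "x * k"]) simp
next
  fix M assume "M \<in> homothety_class L"
  then obtain x where x: "x \<noteq> 0" "M = (\<lambda>v. x *s v) ` L" by (auto simp: homothety_class_def)
  have "M = (\<lambda>v. (x / k) *s v) ` (\<lambda>v. k *s v) ` L" unfolding smult_smult_image using assms x by simp
  then show "M \<in> homothety_class ((\<lambda>v. k *s v) ` L)" unfolding homothety_class_def
    using x assms by (intro CollectI exI[of _ "x / k"]) simp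
qed

lemma homothety_eqD:
  assumes "homothety_class L = homothety_class L'"
  shows "\<exists>k. k \<noteq> 0 \<and> L' = (\<lambda>v. k *s v) ` L"
proof -
  have "L' \<in> homothety_class L" using assms homothety_self[of L'] by simp
  then show ?thesis by (auto simp: homothety_class_def)
qed

section \<open>Lattices as images of words\<close>

context local_place
begin

definition co2 where "co2 v = v$2 / A$2$1" for v :: "'a fls^2"
definition co1 where "co1 v = v$1 - v$2 / A$2$1 * A$1$1" for v :: "'a fls^2"

lemma co_cvec [simp]: "co1 (cvec x y) = x" "co2 (cvec x y) = y"
  using A21 by (simp_all add: co1_def co2_def cvec_nth)

lemma cvec_co: "cvec (co1 v) (co2 v) = v"
  using cvec_ex[of v] by auto

lemma L0_co: "v \<in> L0 \<longleftrightarrow> intg (co1 v) \<and> intg (co2 v)"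
  using L0_iff[of "co1 v" "co2 v"] by (simp add: cvec_co)

text \<open>The determinant of two vectors in the coordinates of \<open>cvec\<close>; its order
  measures how far the lattice they span is from \<open>L0\<close>.\<close>

definition dt where "dt u w = co1 u * co2 w - co2 u * co1 w"

lemma dt_cvec: "dt (cvec p q) (cvec p' q') = p * q' - q * p'"
  by (simp add: dt_def)

lemma cvec_zero: "cvec 0 0 = 0"
  by (simp add: cvec_def)

lemma indep_dt:
  assumes "\<And>x y. x *s u + y *s w = 0 \<Longrightarrow> x = 0 \<and> y = 0" shows "dt u w \<noteq> 0"
proof
  assume d: "dt u w = 0"
  obtain p q p' q' where uw: "u = cvec p q" "w = cvec p' q'" using cvec_ex by metis
  have "p * q' = q * p'" using d by (simp add: uw dt_cvec)
  then have "q' *s u + (- q) *s w = cvec 0 0" "p' *s u + (- p) *s w = cvec 0 0"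
    by (simp_all add: uw cvec_smult cvec_add algebra_simps)
  then have "q' = 0 \<and> - q = 0" "p' = 0 \<and> - p = 0" using assms cvec_zero by metis+
  then have "1 *s u + 0 *s w = 0" by (simp add: uw cvec_zero)
  then show False using assms[of 1 0] by simp
qed

lemma L0_lat: "L0 = lat e1 (A *v e1)"
  unfolding L0_def lat_def cvec_def by auto

lemma L0_lattice: "is_lattice L0"
proof -
  have "x = 0 \<and> y = 0" if "x *s e1 + y *s (A *v e1) = 0" for x y
  proof -
    have "cvec x y = cvec 0 0" using that cvec_zero by (simp add: cvec_def)
    then show ?thesis by simp
  qed
  then show ?thesis unfolding is_lattice_lat using L0_lat by blast
qed

lemma lat_L0: "u \<in> L0 \<Longrightarrow> w \<in> L0 \<Longrightarrow> lat u w \<subseteq> L0"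
  unfolding lat_def using L0_add L0_smult by blast

lemma lat_mem: "u \<in> lat u w" "w \<in> lat u w"
proof -
  have "u = 1 *s u + 0 *s w" "w = 0 *s u + 1 *s w" by (simp_all add: vec_eq_iff)
  then show "u \<in> lat u w" "w \<in> lat u w" unfolding lat_def using intg_const by blast+
qed

lemma dt_intg: "u \<in> L0 \<Longrightarrow> w \<in> L0 \<Longrightarrow> intg (dt u w)"
  by (simp add: dt_def L0_co)

lemma lat_unit:
  assumes "u \<in> L0" "w \<in> L0" "r0 (dt u w) \<noteq> 0" shows "lat u w = L0"
proof
  show "lat u w \<subseteq> L0" by (rule lat_L0[OF assms(1,2)])
  show "L0 \<subseteq> lat u w"
  proof
    fix v assume v: "v \<in> L0"
    note d = intg_unit[OF dt_intg[OF assms(1,2)] assms(3)]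
    have "v = (dt v w * inverse (dt u w)) *s u + (dt u v * inverse (dt u w)) *s w"
    proof -
      obtain p q where u: "u = cvec p q" using cvec_ex by blast
      obtain p' q' where w: "w = cvec p' q'" using cvec_ex by blast
      obtain a b where v: "v = cvec a b" using cvec_ex by blast
      have D: "p * q' - q * p' \<noteq> 0" using d(3) by (simp add: u w dt_cvec)
      have "(a * q' - b * p') * p + (p * b - q * a) * p' = a * (p * q' - q * p')"
        "(a * q' - b * p') * q + (p * b - q * a) * q' = b * (p * q' - q * p')" by (simp_all add: algebra_simps)
      then have "((a * q' - b * p') * p + (p * b - q * a) * p') * inverse (p * q' - q * p') = a"
        "((a * q' - b * p') * q + (p * b - q * a) * q') * inverse (p * q' - q * p') = b" using D by simp_all
      then show ?thesis
        unfolding u v w dt_cvec cvec_smult cvec_add cvec_eq by (simp add: algebra_simps)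
    qed
    moreover have "intg (dt v w * inverse (dt u w))" "intg (dt u v * inverse (dt u w))"
      using d(1) dt_intg v assms by simp_all
    ultimately show "v \<in> lat u w" unfolding lat_def by blast
  qed
qed

text \<open>If the determinant is not a unit, the generators of the lattice are proportional modulo
  the uniformizer. A critical conjugate that kills a nonzero one of them, provided by
  \<open>kernel_exists\<close>, therefore kills the whole lattice.\<close>

lemma lat_nonunit:
  assumes u: "u \<in> L0" and w: "w \<in> L0" and d: "r0 (dt u w) = 0" and n: "u \<notin> L1 \<or> w \<notin> L1"
  shows "\<exists>x y. x\<^sup>2 - c * y\<^sup>2 = n0 \<and> (\<forall>v\<in>lat u w. op (- x) (- y) *v v \<in> L1)"
proof -
  have main: "\<exists>x y. x\<^sup>2 - c * y\<^sup>2 = n0 \<and> op (- x) (- y) *v m \<in> L1 \<and> op (- x) (- y) *v n \<in> L1"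
    if m: "m \<in> L0" "m \<notin> L1" and n: "n \<in> L0" and mn: "r0 (co1 m) * r0 (co2 n) = r0 (co2 m) * r0 (co1 n)" for m n
  proof -
    obtain x y where xy: "x\<^sup>2 - c * y\<^sup>2 = n0" "op (- x) (- y) *v m \<in> L1" using kernel_exists[OF m] by blast
    have "\<exists>l. n - fls_const l *s m \<in> L1"
    proof -
      obtain p q where mm: "m = cvec p q" "intg p" "intg q" using m(1) by (rule L0_cases)
      obtain p' q' where nn: "n = cvec p' q'" "intg p'" "intg q'" using n by (rule L0_cases)
      have e: "r0 p * r0 q' = r0 q * r0 p'" using mn mm nn by simp
      show ?thesis
      proof (cases "r0 p = 0")
        case True
        then have "r0 q \<noteq> 0" using m(2) mm by (simp add: L1_iff)
        then show ?thesis using e True mm nn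
          by (intro exI[of _ "r0 q' / r0 q"]) (simp add: cvec_smult cvec_diff L1_iff r0_mult)
      next
        case False
        then show ?thesis using e mm nn
          by (intro exI[of _ "r0 p' / r0 p"]) (simp add: cvec_smult cvec_diff L1_iff r0_mult field_simps)
      qed
    qed
    then obtain l where l: "n - fls_const l *s m \<in> L1" by blast
    have "n = fls_const l *s m + 1 *s (n - fls_const l *s m)" by (simp add: vec_eq_iff)
    then have "op (- x) (- y) *v n = fls_const l *s (op (- x) (- y) *v m) + 1 *s (op (- x) (- y) *v (n - fls_const l *s m))"
      using op_linear by metis
    also have "\<dots> \<in> L1" using xy(2) op_L1[OF l] by (intro L1_add L1_smult) auto
    finally show ?thesis using xy by blast
  qed
  have e: "r0 (co1 u) * r0 (co2 w) = r0 (co2 u) * r0 (co1 w)"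
    using d u w by (simp add: dt_def r0_mult L0_co)
  have "\<exists>x y. x\<^sup>2 - c * y\<^sup>2 = n0 \<and> op (- x) (- y) *v u \<in> L1 \<and> op (- x) (- y) *v w \<in> L1"
  proof (cases "u \<in> L1")
    case False then show ?thesis using main[OF u _ w] e by blast
  next
    case True
    then have "w \<notin> L1" using n by blast
    then show ?thesis using main[OF w _ u] e by (metis mult.commute)
  qed
  then obtain x y where xy: "x\<^sup>2 - c * y\<^sup>2 = n0" "op (- x) (- y) *v u \<in> L1" "op (- x) (- y) *v w \<in> L1" by blast
  have "op (- x) (- y) *v v \<in> L1" if v: "v \<in> lat u w" for v
  proof -
    obtain a b where "v = a *s u + b *s w" "intg a" "intg b" using v unfolding lat_def by blast
    then show ?thesis using xy by (simp add: op_linear L1_add L1_smult)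
  qed
  then show ?thesis using xy(1) by blast
qed

lemma dt_op: "dt (op x y *v u) (op x y *v w) = nn x y * dt u w"
proof -
  obtain p q p' q' where uw: "u = cvec p q" "w = cvec p' q'" using cvec_ex by metis
  define a b b' d where "a = fls_const (x * c) * \<beta>' + fls_const (c * y) * \<beta>" and "b = fls_const (x * c) * \<beta> + fls_const (c * c * y) * \<beta>'"
    and "b' = fls_const x * \<beta> + fls_const (c * y) * \<beta>'" and "d = s * fls_const c"
  have 1: "op x y *v cvec p q = cvec ((d - a) * p + b * q) (- b' * p + (d + a) * q)" for p q
    unfolding op_cvec a_def b_def b'_def d_def by (simp add: algebra_simps)
  have 3: "(d - a) * (d + a) + b * b' = nn x y"
    using op_det[of x y] unfolding a_def b_def b'_def d_def by (simp add: algebra_simps)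
  show ?thesis unfolding uw 1 dt_cvec 3[symmetric] by (simp add: algebra_simps)
qed

definition prodop :: "('a \<times> 'a) list \<Rightarrow> 'a fls^2 \<Rightarrow> 'a fls^2" where
  "prodop ws v = foldr (\<lambda>l v. op (fst l) (snd l) *v v) ws v"

lemma prodop_simps [simp]: "prodop [] v = v" "prodop (l # ws) v = op (fst l) (snd l) *v prodop ws v"
  by (simp_all add: prodop_def)

lemma prodop_L0: "v \<in> L0 \<Longrightarrow> prodop ws v \<in> L0"
  by (induction ws) (auto simp: op_L0)

definition crl :: "('a \<times> 'a) set" where "crl = {l. (fst l)\<^sup>2 - c * (snd l)\<^sup>2 = n0}"

text \<open>Induction on the order of the determinant. A unit determinant means \<open>L0\<close>.
  Generators that both lie in \<open>L1\<close> are divided by the uniformizer, which lowers the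
  order by 2; otherwise \<open>lat_nonunit\<close> splits off a critical operator on the left, which
  lowers it by 1.\<close>

lemma lattice_word_aux:
  "u \<in> L0 \<Longrightarrow> w \<in> L0 \<Longrightarrow> dt u w \<noteq> 0 \<Longrightarrow> nat (fls_subdegree (dt u w)) = N \<Longrightarrow>
   \<exists>ws k. set ws \<subseteq> crl \<and> k \<noteq> 0 \<and> lat u w = (\<lambda>v. k *s v) ` prodop ws ` L0"
proof (induction N arbitrary: u w rule: less_induct)
  case (less N)
  note uw = less.prems(1,2)
  show ?case
  proof (cases "r0 (dt u w) = 0")
    case False
    then have "lat u w = (\<lambda>v. 1 *s v) ` prodop [] ` L0" using lat_unit[OF uw] by (simp add: vector_smult_lid)
    then show ?thesis by (intro exI[of _ "[]"] exI[of _ 1]) simp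
  next
    case True
    have pos: "0 < fls_subdegree (dt u w)"
      using True less.prems(3) dt_intg[OF uw] unfolding intg_def
      by (metis nth_fls_subdegree_nonzero order_le_less)
    show ?thesis
    proof (cases "u \<in> L1 \<and> w \<in> L1")
      case True
      then obtain u' w' where u': "u' \<in> L0" "u = fls_X *s u'" and w': "w' \<in> L0" "w = fls_X *s w'"
        unfolding L1_X by blast
      obtain p q p' q' where e: "u' = cvec p q" "w' = cvec p' q'" using cvec_ex by metis
      have d: "dt u w = fls_X * (fls_X * dt u' w')" by (simp add: u' w' e cvec_smult dt_cvec algebra_simps)
      then have d0: "dt u' w' \<noteq> 0" using less.prems(3) by auto
      then have "fls_subdegree (dt u w) = 2 + fls_subdegree (dt u' w')" unfolding d by simp
      then have "nat (fls_subdegree (dt u' w')) < N" using less.prems(4) dt_intg[OF u'(1) w'(1)] unfolding intg_def by simp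
      from less.IH[OF this u'(1) w'(1) d0 refl] obtain ws k where
        ws: "set ws \<subseteq> crl" "k \<noteq> 0" "lat u' w' = (\<lambda>v. k *s v) ` prodop ws ` L0" by blast
      have "lat u w = (\<lambda>v. fls_X *s v) ` lat u' w'" unfolding lat_smult u' w' ..
      then have "lat u w = (\<lambda>v. (fls_X * k) *s v) ` prodop ws ` L0" unfolding ws(3) smult_smult_image .
      then show ?thesis using ws(1,2) by (intro exI[of _ ws] exI[of _ "fls_X * k"]) simp
    next
      case False
      then obtain x y where xy: "x\<^sup>2 - c * y\<^sup>2 = n0" "\<And>v. v \<in> lat u w \<Longrightarrow> op (- x) (- y) *v v \<in> L1"
        using lat_nonunit[OF uw True] by blast
      obtain u' where u': "u' \<in> L0" "u = op x y *v u'" using image_of_kernel[OF xy(1)] xy(2)[OF lat_mem(1)] by blast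
      obtain w' where w': "w' \<in> L0" "w = op x y *v w'" using image_of_kernel[OF xy(1)] xy(2)[OF lat_mem(2)] by blast
      have d: "dt u w = fls_X * \<nu> * dt u' w'" unfolding u' w' dt_op nn_crit[OF xy(1)] ..
      then have d0: "dt u' w' \<noteq> 0" using less.prems(3) by auto
      then have "fls_subdegree (dt u w) = 1 + fls_subdegree (dt u' w')"
        unfolding d using intg_unit(3,4)[OF \<nu>] by simp
      then have "nat (fls_subdegree (dt u' w')) < N" using less.prems(4) dt_intg[OF u'(1) w'(1)] unfolding intg_def by simp
      from less.IH[OF this u'(1) w'(1) d0 refl] obtain ws k where
        ws: "set ws \<subseteq> crl" "k \<noteq> 0" "lat u' w' = (\<lambda>v. k *s v) ` prodop ws ` L0" by blast
      have "lat u w = (*v) (op x y) ` lat u' w'" unfolding lat_image u' w' ..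
      then have "lat u w = (\<lambda>v. k *s v) ` prodop ((x, y) # ws) ` L0"
        unfolding ws(3) by (simp add: image_image vector_scalar_commute)
      then show ?thesis using ws(1,2) xy(1) by (intro exI[of _ "(x, y) # ws"] exI[of _ k]) (simp add: crl_def)
    qed
  qed
qed

lemma X_pow_intg: "\<exists>N. \<forall>m\<ge>N. intg (fls_X ^ m * x)"
proof (cases "x = 0")
  case False
  then have "intg (fls_X ^ m * x)" if "nat (- fls_subdegree x) \<le> m" for m
    using that by (simp add: intg_def)
  then show ?thesis by blast
qed simp

lemma lattice_word:
  assumes "is_lattice L"
  shows "\<exists>ws k. set ws \<subseteq> crl \<and> k \<noteq> 0 \<and> L = (\<lambda>v. k *s v) ` prodop ws ` L0"
proof -
  obtain u w where uw: "\<And>x y. x *s u + y *s w = 0 \<Longrightarrow> x = 0 \<and> y = 0" "L = lat u w"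
    using assms unfolding is_lattice_lat by blast
  obtain p q p' q' where e: "u = cvec p q" "w = cvec p' q'" using cvec_ex by metis
  obtain N1 N2 N3 N4 where N: "\<And>m. m \<ge> N1 \<Longrightarrow> intg (fls_X ^ m * p)" "\<And>m. m \<ge> N2 \<Longrightarrow> intg (fls_X ^ m * q)"
    "\<And>m. m \<ge> N3 \<Longrightarrow> intg (fls_X ^ m * p')" "\<And>m. m \<ge> N4 \<Longrightarrow> intg (fls_X ^ m * q')" using X_pow_intg by metis
  define m where "m = N1 + N2 + N3 + N4"
  define X :: "'a fls" where "X = fls_X ^ m"
  have X: "X \<noteq> 0" by (simp add: X_def)
  have i: "X *s u \<in> L0" "X *s w \<in> L0" using N[of m] by (simp_all add: e cvec_smult L0_iff m_def X_def)
  have "dt (X *s u) (X *s w) = X * X * dt u w" by (simp add: e cvec_smult dt_cvec algebra_simps)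
  then have "dt (X *s u) (X *s w) \<noteq> 0" using X indep_dt[OF uw(1)] by simp
  from lattice_word_aux[OF i this refl] obtain ws k where
    ws: "set ws \<subseteq> crl" "k \<noteq> 0" "lat (X *s u) (X *s w) = (\<lambda>v. k *s v) ` prodop ws ` L0" by blast
  have "L = (\<lambda>v. (inverse X * X) *s v) ` lat u w" using X by (simp add: uw(2) vector_smult_lid)
  also have "\<dots> = (\<lambda>v. inverse X *s v) ` lat (X *s u) (X *s w)"
    unfolding lat_smult[symmetric] smult_smult_image ..
  also have "\<dots> = (\<lambda>v. (inverse X * k) *s v) ` prodop ws ` L0" unfolding ws(3) smult_smult_image ..
  finally show ?thesis using ws X by (intro exI[of _ ws] exI[of _ "inverse X * k"]) simp
qed

text \<open>Strictness comes from \<open>op_not_L1\<close>, used for the operator at the lower end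
  and for its conjugate at the upper end.\<close>

lemma op_between:
  assumes "x\<^sup>2 - c * y\<^sup>2 = n0" shows "L1 \<subset> (*v) (op x y) ` L0" "(*v) (op x y) ` L0 \<subset> L0"
proof -
  have 1: "L1 \<subseteq> (*v) (op x y) ` L0"
  proof
    fix v assume "v \<in> L1"
    then obtain w where "w \<in> L0" "v = op x y *v w" using image_of_kernel[OF assms op_L1] by blast
    then show "v \<in> (*v) (op x y) ` L0" by (intro image_eqI)
  qed
  have 2: "(*v) (op x y) ` L0 \<subseteq> L0" using op_L0 by auto
  have "(*v) (op x y) ` L0 \<noteq> L1"
  proof
    assume e: "(*v) (op x y) ` L0 = L1"
    obtain v where "v \<in> L0" "op x y *v v \<notin> L1" using op_not_L1 by blast
    then show False unfolding e[symmetric] by simp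
  qed
  then show "L1 \<subset> (*v) (op x y) ` L0" using 1 by simp
  have "(*v) (op x y) ` L0 \<noteq> L0"
  proof
    assume e: "(*v) (op x y) ` L0 = L0"
    obtain v where v: "v \<in> L0" "op (- x) (- y) *v v \<notin> L1" using op_not_L1 by blast
    have "v \<in> (*v) (op x y) ` L0" unfolding e by (rule v(1))
    then obtain w where w: "w \<in> L0" "v = op x y *v w" by (rule imageE)
    show False using kernel_image[OF assms w(1)] v(2) unfolding w(2) by simp
  qed
  then show "(*v) (op x y) ` L0 \<subset> L0" using 2 by simp
qed

text \<open>\<open>L\<close> is a critical operator applied to some lattice. Were that lattice
  smaller than \<open>L0\<close>, a critical conjugate would kill it modulo the uniformizer. As it
  contains the image of \<open>L0\<close> under the conjugate of the first operator, uniqueness of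
  kernels makes this the first operator itself, and \<open>L\<close> would lie in
  \<open>L1\<close>.\<close>

lemma between_op:
  assumes L: "is_lattice L" and sub: "L1 \<subset> L" "L \<subset> L0"
  shows "\<exists>x y. x\<^sup>2 - c * y\<^sup>2 = n0 \<and> L = (*v) (op x y) ` L0"
proof -
  have step: "\<exists>x y. x\<^sup>2 - c * y\<^sup>2 = n0 \<and> (\<forall>v\<in>lat u w. op (- x) (- y) *v v \<in> L1)"
    if "u \<in> L0" "w \<in> L0" "lat u w \<noteq> L0" "\<not> lat u w \<subseteq> L1" for u w
  proof (rule lat_nonunit[OF that(1,2)])
    show "r0 (dt u w) = 0" using lat_unit that by blast
    show "u \<notin> L1 \<or> w \<notin> L1"
    proof (rule ccontr)
      assume "\<not> (u \<notin> L1 \<or> w \<notin> L1)"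
      then have "lat u w \<subseteq> L1" unfolding lat_def using L1_add L1_smult by blast
      then show False using that by blast
    qed
  qed
  obtain u w where uw: "L = lat u w" using L unfolding is_lattice_lat by blast
  have uL: "u \<in> L0" "w \<in> L0" using sub(2) lat_mem uw by blast+
  obtain x y where xy: "x\<^sup>2 - c * y\<^sup>2 = n0" "\<And>v. v \<in> lat u w \<Longrightarrow> op (- x) (- y) *v v \<in> L1"
    using step[OF uL] sub uw by blast
  obtain u' where u': "u' \<in> L0" "u = op x y *v u'" using image_of_kernel[OF xy(1)] xy(2)[OF lat_mem(1)] by blast
  obtain w' where w': "w' \<in> L0" "w = op x y *v w'" using image_of_kernel[OF xy(1)] xy(2)[OF lat_mem(2)] by blast
  have L_op: "L = (*v) (op x y) ` lat u' w'" unfolding lat_image uw u' w' ..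
  have nn0: "nn x y \<noteq> 0" using nn_crit[OF xy(1)] intg_unit(3)[OF \<nu>] by simp
  have "lat u' w' = L0"
  proof (rule ccontr)
    assume ne: "lat u' w' \<noteq> L0"
    have inv: "op (- x) (- y) *v v \<in> lat u' w'" if v: "v \<in> L0" for v
    proof -
      have "fls_X *s v \<in> L" using sub(1) v unfolding L1_X by auto
      then obtain v' where v': "v' \<in> lat u' w'" "fls_X *s v = op x y *v v'" unfolding L_op by auto
      have "fls_X *s (op (- x) (- y) *v v) = op (- x) (- y) *v (op x y *v v')"
        unfolding v'(2)[symmetric] by (simp add: vector_scalar_commute)
      also have "\<dots> = nn x y *s v'" using op_op[of "- x" "- y" v'] by (simp add: nn_def)
      also have "\<dots> = fls_X *s (\<nu> *s v')" by (simp add: nn_crit[OF xy(1)] vector_smult_assoc)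
      finally have "op (- x) (- y) *v v = \<nu> *s v'" by (simp add: vec_eq_iff)
      moreover have "\<nu> *s v' \<in> lat u' w'"
      proof -
        obtain a b where ab: "v' = a *s u' + b *s w'" "intg a" "intg b" using v'(1) unfolding lat_def by blast
        then have "\<nu> *s v' = (\<nu> * a) *s u' + (\<nu> * b) *s w'" by (simp add: vec_eq_iff algebra_simps)
        moreover have "intg (\<nu> * a)" "intg (\<nu> * b)" using ab \<nu>(1) by simp_all
        ultimately show ?thesis unfolding lat_def by blast
      qed
      ultimately show ?thesis by simp
    qed
    obtain v where v: "v \<in> L0" "op (- x) (- y) *v v \<notin> L1" using op_not_L1 by blast
    let ?m = "op (- x) (- y) *v v"
    have mL: "?m \<in> L0" using op_L0 v by blast
    obtain x2 y2 where x2: "x2\<^sup>2 - c * y2\<^sup>2 = n0" "\<And>v. v \<in> lat u' w' \<Longrightarrow> op (- x2) (- y2) *v v \<in> L1"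
      using step[OF u'(1) w'(1) ne] inv[OF v(1)] v(2) by blast
    have "op (- (- x)) (- (- y)) *v ?m \<in> L1" by (rule kernel_image[OF _ v(1)]) (use xy in simp)
    then have eq: "- x = x2 \<and> - y = y2" using kernel_unique[OF mL v(2)] x2(2)[OF inv[OF v(1)]] by blast
    have "op x y *v v' \<in> L1" if "v' \<in> lat u' w'" for v' using x2(2)[OF that] eq by auto
    then have "L \<subseteq> L1" unfolding L_op by auto
    then show False using sub by blast
  qed
  then show ?thesis using L_op xy(1) by blast
qed

text \<open>A vector in the image of a letter lies in the kernel of the conjugate letter, and by
  \<open>kernel_unique\<close> no other critical operator kills it unless it is already in
  \<open>L1\<close>. In a reduced word the next operator is never that conjugate.\<close>

lemma prodop_primitive:
  "set ws \<subseteq> crl \<Longrightarrow> successively (\<lambda>a b. b \<noteq> (- fst a, - snd a)) ws \<Longrightarrow> \<exists>v\<in>L0. prodop ws v \<notin> L1"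
proof (induction ws)
  case Nil
  have "cvec 1 0 \<in> L0" "cvec 1 0 \<notin> L1" by (simp_all add: L0_iff L1_iff)
  then show ?case by auto
next
  case (Cons l ws)
  show ?case
  proof (cases ws)
    case Nil
    then show ?thesis using op_not_L1 by simp
  next
    case ws: (Cons l' ws')
    obtain v where v: "v \<in> L0" "prodop ws v \<notin> L1" using Cons ws by (auto simp: successively_Cons)
    have ne: "l' \<noteq> (- fst l, - snd l)" using Cons.prems ws by simp
    have m: "prodop ws v \<in> L0" using prodop_L0 v by blast
    have "op (- fst l') (- snd l') *v prodop ws v \<in> L1"
      unfolding ws prodop_simps using Cons.prems(1) ws prodop_L0[OF v(1)]
      by (intro kernel_image) (auto simp: crl_def)
    then have "op (fst l) (snd l) *v prodop ws v \<notin> L1"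
      using kernel_unique[OF m v(2), of "- fst l" "- snd l" "fst l'" "snd l'"] ne by (cases l') auto
    then show ?thesis using v(1) by auto
  qed
qed

text \<open>A factor \<open>k\<close> divisible by the uniformizer contradicts
  \<open>prodop_primitive\<close>; a unit \<open>k\<close> contradicts that the first letter maps
  \<open>L0\<close> into a proper sublattice.\<close>

lemma prodop_not_homothetic:
  assumes ws: "set ws \<subseteq> crl" "successively (\<lambda>a b. b \<noteq> (- fst a, - snd a)) ws" "ws \<noteq> []"
  shows "prodop ws ` L0 \<noteq> (\<lambda>v. k *s v) ` L0"
proof
  assume eq: "prodop ws ` L0 = (\<lambda>v. k *s v) ` L0"
  have "k *s cvec 1 0 \<in> prodop ws ` L0" unfolding eq by (rule imageI) (simp add: L0_iff)
  then obtain v where v: "v \<in> L0" "k *s cvec 1 0 = prodop ws v" by (rule imageE)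
  have "k *s cvec 1 0 \<in> L0" unfolding v(2) by (rule prodop_L0[OF v(1)])
  then have k: "intg k" by (simp add: cvec_smult L0_iff)
  obtain l ws' where l: "ws = l # ws'" using ws(3) by (cases ws) auto
  show False
  proof (cases "r0 k = 0")
    case True
    then obtain k' where k': "intg k'" "k = fls_X * k'" using intg_X_div k by blast
    obtain v where v: "v \<in> L0" "prodop ws v \<notin> L1" using prodop_primitive[OF ws(1,2)] by blast
    have "prodop ws v \<in> (\<lambda>v. k *s v) ` L0" unfolding eq[symmetric] using v(1) by (rule imageI)
    then obtain w where w: "w \<in> L0" "prodop ws v = k *s w" by (rule imageE)
    have "prodop ws v = fls_X *s (k' *s w)" unfolding w(2) k'(2) by (simp add: vector_smult_assoc)
    then have "prodop ws v \<in> L1" unfolding L1_X by (rule image_eqI) (rule L0_smult[OF w(1) k'(1)])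
    then show False using v(2) by simp
  next
    case False
    note u = intg_unit[OF k False]
    have "(fst l)\<^sup>2 - c * (snd l)\<^sup>2 = n0" using ws(1) l by (auto simp: crl_def)
    from op_between(2)[OF this] obtain v where v: "v \<in> L0" "v \<notin> (*v) (op (fst l) (snd l)) ` L0" by blast
    have "v = k *s (inverse k *s v)" using u(3) by (simp add: vector_smult_assoc vector_smult_lid)
    then have "v \<in> (\<lambda>v. k *s v) ` L0" by (rule image_eqI) (rule L0_smult[OF v(1) u(1)])
    then have "v \<in> prodop ws ` L0" unfolding eq .
    then obtain w where w: "w \<in> L0" "v = prodop ws w" by (rule imageE)
    have "v \<in> (*v) (op (fst l) (snd l)) ` L0"
      unfolding w(2) l prodop_simps by (rule imageI) (rule prodop_L0[OF w(1)])
    then show False using v(2) by simp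
  qed
qed

end

section \<open>The action on the Bruhat--Tits trees\<close>

locale bt_representation = Q: quaternion p k c for p k :: nat and c :: "'a::{field,finite}" +
  fixes \<iota> :: "'a ratfun \<Rightarrow> 'a fls" and \<rho> :: "'a ratfun quat \<Rightarrow> 'a fls^2^2"
  assumes spl: "splitting \<iota> (D_alg c) \<rho>" and \<iota>_1: "\<iota> 1 = 1" and \<iota>_nonzero: "z \<noteq> 0 \<Longrightarrow> \<iota> z \<noteq> 0"
begin

lemma \<rho>_scalar: "\<rho> (qscalar z) = mat (\<iota> z)" and \<rho>_mult: "\<rho> (u \<otimes>\<^bsub>D_alg c\<^esub> w) = \<rho> u ** \<rho> w"
  and \<rho>_add: "\<rho> (u \<oplus>\<^bsub>D_alg c\<^esub> w) = \<rho> u + \<rho> w"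
  using spl unfolding splitting_def by blast+

lemma \<rho>_inverse:
  assumes "w \<in> Units (D_alg c)"
  shows "\<exists>M. \<forall>v. M *v (\<rho> w *v v) = v"
proof -
  obtain w' where "w' \<otimes>\<^bsub>D_alg c\<^esub> w = \<one>\<^bsub>D_alg c\<^esub>" using assms unfolding Units_def by blast
  then have "\<rho> w' ** \<rho> w = mat 1" using \<rho>_scalar[of 1] by (simp add: \<iota>_1 flip: \<rho>_mult)
  then have "\<rho> w' *v (\<rho> w *v v) = v" for v by (simp add: matrix_vector_mul_assoc)
  then show ?thesis by blast
qed

lemma \<rho>_inj: "w \<in> Units (D_alg c) \<Longrightarrow> inj ((*v) (\<rho> w))"
  using \<rho>_inverse[of w] by (metis injI)

lemma smult_image: "(\<lambda>v. z *s v) ` (*v) M ` L = (*v) M ` (\<lambda>v. z *s v) ` L" for L :: "('a fls^2) set"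
  by (simp add: image_image vector_scalar_commute)

lemma \<rho>_scaled: "(*v) (\<rho> (qscalar z \<otimes>\<^bsub>D_alg c\<^esub> w)) ` L = (\<lambda>v. \<iota> z *s v) ` (*v) (\<rho> w) ` L"
  by (simp add: \<rho>_mult \<rho>_scalar image_image mat_vec flip: matrix_vector_mul_assoc)

lemma lattice_\<rho>:
  assumes "w \<in> Units (D_alg c)" "is_lattice L" shows "is_lattice ((*v) (\<rho> w) ` L)"
proof -
  obtain a b where ab: "\<And>x y. x *s a + y *s b = 0 \<Longrightarrow> x = 0 \<and> y = 0" "L = lat a b"
    using assms(2) unfolding is_lattice_lat by blast
  have "x = 0 \<and> y = 0" if "x *s (\<rho> w *v a) + y *s (\<rho> w *v b) = 0" for x y
  proof (rule ab(1))
    have "\<rho> w *v (x *s a + y *s b) = \<rho> w *v 0"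
      using that by (simp add: matrix_vector_right_distrib vector_scalar_commute)
    then show "x *s a + y *s b = 0" using injD[OF \<rho>_inj[OF assms(1)]] by blast
  qed
  then show ?thesis unfolding is_lattice_lat ab(2) lat_image by blast
qed

text \<open>Scalars act by homotheties, so neither the representative of the coset nor that of the
  class matters.\<close>

lemma act_pr:
  assumes "w \<in> Units (D_alg c)"
  shows "bt_act \<rho> (Q.pr w) (homothety_class L) = homothety_class ((*v) (\<rho> w) ` L)"
proof (intro equalityI subsetI)
  fix M assume "M \<in> bt_act \<rho> (Q.pr w) (homothety_class L)"
  then obtain x L' where x: "M = (*v) (\<rho> x) ` L'" "x \<in> Q.pr w" "L' \<in> homothety_class L"
    unfolding bt_act_def by blast
  obtain z where z: "z \<noteq> 0" "x = qscalar z \<otimes>\<^bsub>D_alg c\<^esub> w" using x(2) unfolding Q.pr_mem by blast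
  obtain y where y: "y \<noteq> 0" "L' = (\<lambda>v. y *s v) ` L" using x(3) unfolding homothety_class_def by blast
  have "M = (\<lambda>v. (\<iota> z * y) *s v) ` (*v) (\<rho> w) ` L"
    unfolding x(1) y(2) z(2) \<rho>_scaled smult_image[symmetric] smult_smult_image by (simp add: mult.commute)
  then show "M \<in> homothety_class ((*v) (\<rho> w) ` L)"
    unfolding homothety_class_def using y(1) \<iota>_nonzero[OF z(1)] by (intro CollectI exI[of _ "\<iota> z * y"]) simp
next
  fix M assume "M \<in> homothety_class ((*v) (\<rho> w) ` L)"
  then obtain y where y: "y \<noteq> 0" "M = (\<lambda>v. y *s v) ` (*v) (\<rho> w) ` L" unfolding homothety_class_def by blast
  have "w \<in> Q.pr w" unfolding Q.pr_mem by (intro exI[of _ 1]) (cases w, simp add: D_mult)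
  moreover have "(\<lambda>v. y *s v) ` L \<in> homothety_class L" unfolding homothety_class_def using y(1) by blast
  moreover have "M = (*v) (\<rho> w) ` (\<lambda>v. y *s v) ` L" unfolding y(2) smult_image ..
  ultimately show "M \<in> bt_act \<rho> (Q.pr w) (homothety_class L)" unfolding bt_act_def by blast
qed

lemma bt_vert_cases: assumes "C \<in> bt_verts" obtains L where "is_lattice L" "C = homothety_class L"
  using assms unfolding bt_verts_def by blast

lemma PD_cases: assumes "g \<in> carrier (PD c)" obtains w where "w \<in> Units (D_alg c)" "g = Q.pr w"
  using assms unfolding Q.PD_carrier by blast

lemma act_closed:
  assumes "g \<in> carrier (PD c)" "C \<in> bt_verts" shows "bt_act \<rho> g C \<in> bt_verts"
proof -
  obtain w where w: "w \<in> Units (D_alg c)" "g = Q.pr w" using assms(1) by (rule PD_cases)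
  obtain L where L: "is_lattice L" "C = homothety_class L" using assms(2) by (rule bt_vert_cases)
  show ?thesis unfolding w(2) L(2) act_pr[OF w(1)] bt_verts_def using lattice_\<rho>[OF w(1) L(1)] by blast
qed

lemma act_mult:
  assumes "g \<in> carrier (PD c)" "h \<in> carrier (PD c)" "C \<in> bt_verts"
  shows "bt_act \<rho> (g \<otimes>\<^bsub>PD c\<^esub> h) C = bt_act \<rho> g (bt_act \<rho> h C)"
proof -
  obtain w where w: "w \<in> Units (D_alg c)" "g = Q.pr w" using assms(1) by (rule PD_cases)
  obtain u where u: "u \<in> Units (D_alg c)" "h = Q.pr u" using assms(2) by (rule PD_cases)
  obtain L where L: "is_lattice L" "C = homothety_class L" using assms(3) by (rule bt_vert_cases)
  have "w \<otimes>\<^bsub>D_alg c\<^esub> u \<in> Units (D_alg c)" using w u by simp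
  then show ?thesis unfolding w(2) u(2) L(2) Q.pr_mult[OF w(1) u(1)]
    by (simp add: act_pr w(1) u(1) \<rho>_mult image_image matrix_vector_mul_assoc)
qed

lemma act_one:
  assumes "C \<in> bt_verts" shows "bt_act \<rho> \<one>\<^bsub>PD c\<^esub> C = C"
proof -
  obtain L where L: "is_lattice L" "C = homothety_class L" using assms by (rule bt_vert_cases)
  have "bt_act \<rho> (Q.pr (qscalar 1)) C = C"
    unfolding L(2) by (subst act_pr) (auto simp: Q.qscalar_unit \<rho>_scalar \<iota>_1)
  then show ?thesis by (simp only: Q.pr_scalar[OF one_neq_zero])
qed

lemma act_edge:
  assumes "g \<in> carrier (PD c)" "(C, C') \<in> bt_edges"
  shows "(bt_act \<rho> g C, bt_act \<rho> g C') \<in> bt_edges"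
proof -
  obtain w where w: "w \<in> Units (D_alg c)" "g = Q.pr w" using assms(1) by (rule PD_cases)
  have C: "C \<in> bt_verts" "C' \<in> bt_verts" using assms(2) unfolding bt_edges_def by auto
  obtain L L' where L: "L \<in> C" "L' \<in> C'" "(\<lambda>v. fls_X *s v) ` L \<subset> L'" "L' \<subset> L"
    using assms(2) unfolding bt_edges_def by auto
  have m: "w \<in> g" unfolding w(2) Q.pr_mem by (intro exI[of _ 1]) (cases w, simp add: D_mult)
  have "(*v) (\<rho> w) ` L' \<subset> (*v) (\<rho> w) ` L" "(*v) (\<rho> w) ` (\<lambda>v. fls_X *s v) ` L \<subset> (*v) (\<rho> w) ` L'"
    using L(3,4) \<rho>_inj[OF w(1)] by (auto intro!: image_strict_mono inj_on_subset[OF \<rho>_inj[OF w(1)]])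
  moreover have "(*v) (\<rho> w) ` L \<in> bt_act \<rho> g C" "(*v) (\<rho> w) ` L' \<in> bt_act \<rho> g C'"
    using m L(1,2) unfolding bt_act_def by blast+
  ultimately show ?thesis unfolding bt_edges_def smult_image[symmetric]
    using act_closed[OF assms(1)] C by blast
qed

end

text \<open>The factor \<open>\<kappa>\<close> disappears in homothety classes.
  \<open>\<Sigma>\<close> may exceed the critical generators of the place, so that both places can
  be interpreted with the same group.\<close>

locale bt_place = bt_representation p k c \<iota> \<rho> + local_place c n0 A B s f \<nu>
  for p k :: nat and c :: "'a::{field,finite}" and \<iota> \<rho> and n0 A B s f \<nu> +
  fixes \<kappa> :: "'a fls" and \<Sigma> :: "'a ratfun quat set set"
  assumes \<kappa>: "\<kappa> \<noteq> 0" and \<rho>_el: "\<rho> (Q.el x y) = mat \<kappa> ** op x y" and n0: "n0 \<noteq> 0"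
    and \<Sigma>: "\<Sigma> \<subseteq> carrier (PD c)" "gen c ` norm_set c n0 \<subseteq> \<Sigma>"
begin

abbreviation "\<Gamma> \<equiv> subgroup_generated (PD c) \<Sigma>"

definition C0 where "C0 = homothety_class L0"

lemma C0: "C0 \<in> bt_verts"
  unfolding C0_def bt_verts_def using L0_lattice by blast

lemma gen_act:
  assumes "x\<^sup>2 - c * y\<^sup>2 \<noteq> 0"
  shows "bt_act \<rho> (gen c (zq x y)) (homothety_class L) = homothety_class ((*v) (op x y) ` L)"
proof -
  have "(*v) (\<rho> (Q.el x y)) ` L = (\<lambda>v. \<kappa> *s v) ` (*v) (op x y) ` L"
    by (simp add: \<rho>_el image_image mat_vec flip: matrix_vector_mul_assoc)
  then show ?thesis unfolding Q.gen_zq act_pr[OF Q.el_unit[OF assms]] using homothety_eq[OF \<kappa>] by simp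
qed

lemma gen_fix:
  assumes "w \<in> norm_set c n" "n \<noteq> 0" "n \<noteq> n0" shows "bt_act \<rho> (gen c w) C0 = C0"
proof -
  obtain x y where xy: "w = zq x y" "x\<^sup>2 - c * y\<^sup>2 = n" using assms(1) unfolding Q.norm_set_iff by blast
  have "x\<^sup>2 - c * y\<^sup>2 \<noteq> 0" "x\<^sup>2 - c * y\<^sup>2 \<noteq> n0" using xy assms by auto
  then show ?thesis unfolding xy(1) C0_def using gen_act op_unit_L0 by simp
qed

lemma neighbours:
  "(C0, C') \<in> bt_edges \<longleftrightarrow> (\<exists>l\<in>norm_set c n0. C' = bt_act \<rho> (gen c l) C0)"
proof
  assume e: "(C0, C') \<in> bt_edges"
  obtain L L' where L: "L \<in> C0" "L' \<in> C'" "(\<lambda>v. fls_X *s v) ` L \<subset> L'" "L' \<subset> L"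
    using e unfolding bt_edges_def by auto
  obtain z where z: "z \<noteq> 0" "L = (\<lambda>v. z *s v) ` L0" using L(1) unfolding C0_def homothety_class_def by blast
  have C': "C' \<in> bt_verts" using e unfolding bt_edges_def by auto
  obtain L2 where L2: "is_lattice L2" "C' = homothety_class L2" using C' by (rule bt_vert_cases)
  obtain z2 where z2: "z2 \<noteq> 0" "L' = (\<lambda>v. z2 *s v) ` L2" using L(2) unfolding L2(2) homothety_class_def by blast
  \<comment> \<open>Rescaling turns the larger lattice into \<open>L0\<close>, so that
    \<open>between_op\<close> applies to the smaller one.\<close>
  define M where "M = (\<lambda>v. inverse z *s v) ` L'"
  have M2: "M = (\<lambda>v. (inverse z * z2) *s v) ` L2" unfolding M_def z2(2) smult_smult_image ..
  have lM: "is_lattice M" unfolding M2 using L2(1) z z2 by (intro lattice_smult) simp_all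
  have "inj (\<lambda>v :: 'a fls^2. inverse z *s v)"
    by (rule inj_on_inverseI[where g = "\<lambda>v. z *s v"]) (simp add: z vector_smult_assoc vector_smult_lid)
  then have "(\<lambda>v. inverse z *s v) ` (\<lambda>v. fls_X *s v) ` L \<subset> M" "M \<subset> (\<lambda>v. inverse z *s v) ` L"
    unfolding M_def using L(3,4) by (auto intro!: image_strict_mono intro: inj_on_subset)
  moreover have "(\<lambda>v. inverse z *s v) ` (\<lambda>v. fls_X *s v) ` L = L1" "(\<lambda>v. inverse z *s v) ` L = L0"
  proof -
    have e: "inverse z * (fls_X * z) = fls_X" using z(1) by simp
    show "(\<lambda>v. inverse z *s v) ` (\<lambda>v. fls_X *s v) ` L = L1" "(\<lambda>v. inverse z *s v) ` L = L0"
      unfolding z(2) smult_smult_image L1_X mult.assoc e using z(1) by (simp_all add: vector_smult_lid)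
  qed
  ultimately have "L1 \<subset> M" "M \<subset> L0" by simp_all
  then obtain x y where xy: "x\<^sup>2 - c * y\<^sup>2 = n0" "M = (*v) (op x y) ` L0" using between_op[OF lM] by blast
  have "C' = homothety_class M" unfolding M2 L2(2) using z z2 by (intro homothety_eq[symmetric]) simp
  also have "\<dots> = bt_act \<rho> (gen c (zq x y)) C0" unfolding xy(2) C0_def by (rule gen_act[symmetric]) (simp only: xy(1) n0 not_False_eq_True)
  finally show "\<exists>l\<in>norm_set c n0. C' = bt_act \<rho> (gen c l) C0"
    using xy(1) by (intro bexI[of _ "zq x y"]) (simp_all add: Q.zq_norm)
next
  assume "\<exists>l\<in>norm_set c n0. C' = bt_act \<rho> (gen c l) C0"
  then obtain x y where xy: "x\<^sup>2 - c * y\<^sup>2 = n0" "C' = bt_act \<rho> (gen c (zq x y)) C0"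
    by (metis Q.norm_set_iff)
  have e: "C' = homothety_class ((*v) (op x y) ` L0)" unfolding xy(2) C0_def by (rule gen_act) (simp only: xy(1) n0 not_False_eq_True)
  have "gen c (zq x y) \<in> carrier (PD c)" using xy(1) n0 Q.zq_norm by (intro Q.gen_closed) auto
  then have "C' \<in> bt_verts" unfolding xy(2) using act_closed C0 by blast
  moreover have "L0 \<in> C0" "(*v) (op x y) ` L0 \<in> C'" unfolding C0_def e by (rule homothety_self)+
  ultimately show "(C0, C') \<in> bt_edges"
    unfolding bt_edges_def using C0 op_between[OF xy(1)] unfolding L1_X by blast
qed

lemma \<Gamma>_closed: "g \<in> carrier \<Gamma> \<Longrightarrow> g \<in> carrier (PD c)"
  using Q.P.carrier_subgroup_generated_subset by blast

lemma gen_\<Gamma>: "l \<in> norm_set c n0 \<Longrightarrow> gen c l \<in> carrier \<Gamma>"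
  using Q.P.subgroup_generated_subset_carrier_subset[OF \<Sigma>(1)] \<Sigma>(2) by blast

lemma \<Gamma>_group: "group \<Gamma>" by simp

sublocale T: letters_on_graph \<Gamma> "bt_act \<rho>" bt_verts bt_edges "norm_set c n0" "gen c"
  "\<lambda>l. \<ominus>\<^bsub>D_alg c\<^esub> l" C0
proof -
  interpret group \<Gamma> by (rule \<Gamma>_group)
  show "letters_on_graph \<Gamma> (bt_act \<rho>) bt_verts bt_edges (norm_set c n0) (gen c) (\<lambda>l. \<ominus>\<^bsub>D_alg c\<^esub> l) C0"
  proof
    show "(u, w) \<in> bt_edges \<Longrightarrow> u \<in> bt_verts \<and> w \<in> bt_verts" for u w :: "'a btvert"
      unfolding bt_edges_def by simp
    obtain x y where "x\<^sup>2 - c * y\<^sup>2 = n0" using norm_surj[OF Q.two c0] by blast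
    then have "zq x y \<in> norm_set c n0" by (simp add: Q.zq_norm)
    then show "norm_set c n0 \<noteq> {}" by blast
    fix l assume l: "l \<in> norm_set c n0"
    show "gen c (\<ominus>\<^bsub>D_alg c\<^esub> l) = inv\<^bsub>\<Gamma>\<^esub> gen c l"
      using Q.gen_neg[OF l n0] gen_\<Gamma>[OF l] by simp
    show "\<ominus>\<^bsub>D_alg c\<^esub> l \<noteq> l" by (rule Q.norm_set_neg_neq[OF l n0])
    show "\<ominus>\<^bsub>D_alg c\<^esub> l \<in> norm_set c n0" by (rule Q.norm_set_neg[OF l])
  qed (use act_closed act_mult act_one act_edge \<Gamma>_closed C0 gen_\<Gamma> neighbours in \<open>simp_all\<close>)
qed

lemma word_act:
  "set ws \<subseteq> crl \<Longrightarrow> bt_act \<rho> (T.word (map (case_prod zq) ws)) C0 = homothety_class (prodop ws ` L0)"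
proof (induction ws)
  case Nil
  have "bt_act \<rho> \<one>\<^bsub>\<Gamma>\<^esub> C0 = C0" by (simp add: act_one C0)
  then show ?case by (simp add: C0_def)
next
  case (Cons l ws)
  obtain x y where xy: "l = (x, y)" by (cases l)
  have l: "x\<^sup>2 - c * y\<^sup>2 = n0" "set ws \<subseteq> crl" using Cons.prems xy by (auto simp: crl_def)
  have ne: "x\<^sup>2 - c * y\<^sup>2 \<noteq> 0" by (simp only: l(1) n0 not_False_eq_True)
  have m: "zq x y \<in> norm_set c n0" "set (map (case_prod zq) ws) \<subseteq> norm_set c n0"
    using l by (auto simp: crl_def Q.zq_norm)
  have "bt_act \<rho> (T.word (map (case_prod zq) (l # ws))) C0 =
      bt_act \<rho> (gen c (zq x y)) (bt_act \<rho> (T.word (map (case_prod zq) ws)) C0)"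
    unfolding list.map T.word_simps xy prod.case by (rule T.act_mult[OF gen_\<Gamma>[OF m(1)] T.word_closed[OF m(2)] C0])
  also have "\<dots> = homothety_class ((*v) (op x y) ` prodop ws ` L0)"
    unfolding Cons.IH[OF l(2)] by (rule gen_act[OF ne])
  finally show ?case by (simp add: image_image xy)
qed

lemma word_pairs:
  assumes "set w \<subseteq> norm_set c n0" shows "\<exists>ws. w = map (case_prod zq) ws \<and> set ws \<subseteq> crl"
  using assms
proof (induction w)
  case (Cons l w)
  then obtain ws where ws: "w = map (case_prod zq) ws" "set ws \<subseteq> crl" by auto
  obtain x y where xy: "l = zq x y" "x\<^sup>2 - c * y\<^sup>2 = n0" using Cons.prems by (auto simp: Q.norm_set_iff)
  then show ?case using ws by (intro exI[of _ "(x, y) # ws"]) (simp add: crl_def)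
qed simp

sublocale T: free_letters_on_graph \<Gamma> "bt_act \<rho>" bt_verts bt_edges "norm_set c n0" "gen c"
  "\<lambda>l. \<ominus>\<^bsub>D_alg c\<^esub> l" C0
proof
  fix w assume w: "T.red w" "w \<noteq> []"
  obtain ws where ws: "w = map (case_prod zq) ws" "set ws \<subseteq> crl"
    using word_pairs w(1) unfolding T.red_def by blast
  have "successively (\<lambda>a b. case_prod zq b \<noteq> \<ominus>\<^bsub>D_alg c\<^esub> (case_prod zq a)) ws"
    using w(1) unfolding T.red_def ws(1) successively_map by blast
  then have s: "successively (\<lambda>a b. b \<noteq> (- fst a, - snd a)) ws"
    by (rule successively_mono) (auto simp: zq_neg)
  show "bt_act \<rho> (T.word w) C0 \<noteq> C0"
  proof
    assume "bt_act \<rho> (T.word w) C0 = C0"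
    then have "homothety_class L0 = homothety_class (prodop ws ` L0)"
      using word_act[OF ws(2)] unfolding ws(1) by (simp add: C0_def)
    then obtain z where "prodop ws ` L0 = (\<lambda>v. z *s v) ` L0" using homothety_eqD by blast
    then show False using prodop_not_homothetic[OF ws(2) s, of z] w(2) unfolding ws(1) by auto
  qed
next
  fix C :: "'a btvert" assume "C \<in> bt_verts"
  then obtain L where L: "is_lattice L" "C = homothety_class L" by (rule bt_vert_cases)
  obtain ws z where ws: "set ws \<subseteq> crl" "z \<noteq> 0" "L = (\<lambda>v. z *s v) ` prodop ws ` L0"
    using lattice_word[OF L(1)] by blast
  have "C = homothety_class (prodop ws ` L0)" unfolding L(2) ws(3) by (rule homothety_eq[OF ws(2)])
  then have "C = bt_act \<rho> (T.word (map (case_prod zq) ws)) C0" using word_act[OF ws(1)] by simp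
  moreover have "set (map (case_prod zq) ws) \<subseteq> norm_set c n0" using ws(1) by (auto simp: crl_def Q.zq_norm)
  ultimately show "\<exists>w. set w \<subseteq> norm_set c n0 \<and> C = bt_act \<rho> (T.word w) C0" by blast
qed

end

section \<open>A group with two families of generators acting on a product of trees\<close>

text \<open>This is what remains of the arithmetic: each family of letters yields the tree of one
  factor and fixes the base vertex of the other, and \<open>relation\<close> is the source of the
  squares.\<close>

locale lattice_pair = group G +
  H: free_letters_on_graph G \<alpha> V Ed \<Lambda>h gn ng x0 +
  I: free_letters_on_graph G \<beta> V Ed \<Lambda>v gn ng y0
  for G (structure) and \<alpha> \<beta> :: "'g \<Rightarrow> 'v \<Rightarrow> 'v" and V :: "'v set" and Ed
    and \<Lambda>h \<Lambda>v :: "'l set" and gn :: "'l \<Rightarrow> 'g" and ng :: "'l \<Rightarrow> 'l" and x0 y0 :: 'v +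
  fixes sig :: "'l \<Rightarrow> 'l \<Rightarrow> 'l"
  assumes fix_h: "b \<in> \<Lambda>h \<Longrightarrow> \<beta> (gn b) y0 = y0" and fix_v: "a \<in> \<Lambda>v \<Longrightarrow> \<alpha> (gn a) x0 = x0"
    and generated: "carrier G \<subseteq> generate G (gn ` (\<Lambda>v \<union> \<Lambda>h))"
    and sig_h: "a \<in> \<Lambda>v \<Longrightarrow> b \<in> \<Lambda>h \<Longrightarrow> sig a b \<in> \<Lambda>h"
    and sig_v: "a \<in> \<Lambda>v \<Longrightarrow> b \<in> \<Lambda>h \<Longrightarrow> sig b a \<in> \<Lambda>v"
    and relation: "a \<in> \<Lambda>v \<Longrightarrow> b \<in> \<Lambda>h \<Longrightarrow> gn a \<otimes> gn (sig a b) = gn b \<otimes> gn (sig b a)"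
    and sig_not_neg: "a \<in> \<Lambda>v \<Longrightarrow> b \<in> \<Lambda>h \<Longrightarrow> \<not> (sig a b = ng b \<and> sig b a = ng a)"
    and finite_labels: "finite \<Lambda>h" "finite \<Lambda>v"
begin

text \<open>The relation for \<open>a\<close> and the inverse of \<open>b\<close> can be solved for
  the product of \<open>b\<close> and \<open>a\<close>.\<close>

lemma swap_letters:
  assumes "b \<in> \<Lambda>h" "a \<in> \<Lambda>v"
  shows "\<exists>a'\<in>\<Lambda>v. \<exists>b'\<in>\<Lambda>h. gn b \<otimes> gn a = gn a' \<otimes> gn b'"
proof -
  have n: "ng b \<in> \<Lambda>h" by (rule H.neg_closed[OF assms(1)])
  let ?s = "sig a (ng b)" and ?a = "sig (ng b) a"
  have m: "?s \<in> \<Lambda>h" "?a \<in> \<Lambda>v" using sig_h sig_v assms(2) n by auto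
  note cl = H.letter_closed[OF assms(1)] I.letter_closed[OF assms(2)] H.letter_closed[OF m(1)] I.letter_closed[OF m(2)]
  have "(gn b \<otimes> gn a) \<otimes> gn ?s = gn b \<otimes> (inv (gn b) \<otimes> gn ?a)"
    using relation[OF assms(2) n] H.letter_neg[OF assms(1)] cl by (simp add: m_assoc)
  also have "\<dots> = gn ?a" using cl by (simp add: m_assoc[symmetric])
  finally have "gn b \<otimes> gn a = gn ?a \<otimes> inv (gn ?s)" using cl inv_solve_right[of "gn b \<otimes> gn a" "gn ?a" "gn ?s"] by simp
  then have "gn b \<otimes> gn a = gn ?a \<otimes> gn (ng ?s)" using H.letter_neg[OF m(1)] by simp
  then show ?thesis using m H.neg_closed by blast
qed

lemma swap_letter_word:
  "b \<in> \<Lambda>h \<Longrightarrow> set u \<subseteq> \<Lambda>v \<Longrightarrow> \<exists>u' b'. set u' \<subseteq> \<Lambda>v \<and> b' \<in> \<Lambda>h \<and> gn b \<otimes> I.word u = I.word u' \<otimes> gn b'"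
proof (induction u arbitrary: b)
  case Nil
  then show ?case using H.letter_closed by (intro exI[of _ "[]"] exI[of _ b]) simp
next
  case (Cons a u)
  then obtain a' b' where ab: "a' \<in> \<Lambda>v" "b' \<in> \<Lambda>h" "gn b \<otimes> gn a = gn a' \<otimes> gn b'" using swap_letters[of b a] by auto
  obtain u' b2 where u: "set u' \<subseteq> \<Lambda>v" "b2 \<in> \<Lambda>h" "gn b' \<otimes> I.word u = I.word u' \<otimes> gn b2"
    using Cons.IH[OF ab(2)] Cons.prems by auto
  have cl: "gn a \<in> carrier G" "gn b \<in> carrier G" "gn a' \<in> carrier G" "gn b' \<in> carrier G" "gn b2 \<in> carrier G"
    "I.word u \<in> carrier G" "I.word u' \<in> carrier G"
    using Cons.prems ab u H.letter_closed I.letter_closed I.word_closed by auto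
  have "gn b \<otimes> I.word (a # u) = (gn b \<otimes> gn a) \<otimes> I.word u" using cl by (simp add: m_assoc)
  also have "\<dots> = gn a' \<otimes> (gn b' \<otimes> I.word u)" unfolding ab(3) using cl by (simp add: m_assoc)
  also have "\<dots> = I.word (a' # u') \<otimes> gn b2" unfolding u(3) using cl by (simp add: m_assoc)
  finally show ?case using ab(1) u(1,2) by (intro exI[of _ "a' # u'"] exI[of _ b2]) simp
qed

lemma swap_words:
  "set w \<subseteq> \<Lambda>h \<Longrightarrow> set u \<subseteq> \<Lambda>v \<Longrightarrow>
   \<exists>u' w'. set u' \<subseteq> \<Lambda>v \<and> set w' \<subseteq> \<Lambda>h \<and> H.word w \<otimes> I.word u = I.word u' \<otimes> H.word w'"
proof (induction w arbitrary: u)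
  case Nil
  then show ?case using I.word_closed by (intro exI[of _ u] exI[of _ "[]"]) simp
next
  case (Cons b w)
  then have "set w \<subseteq> \<Lambda>h" by simp
  from Cons.IH[OF this Cons.prems(2)] obtain u1 w1 where
    1: "set u1 \<subseteq> \<Lambda>v" "set w1 \<subseteq> \<Lambda>h" "H.word w \<otimes> I.word u = I.word u1 \<otimes> H.word w1" by blast
  obtain u2 b2 where 2: "set u2 \<subseteq> \<Lambda>v" "b2 \<in> \<Lambda>h" "gn b \<otimes> I.word u1 = I.word u2 \<otimes> gn b2"
    using swap_letter_word[of b u1] Cons.prems 1 by auto
  have cl: "gn b \<in> carrier G" "gn b2 \<in> carrier G" "H.word w \<in> carrier G" "I.word u \<in> carrier G"
    "I.word u1 \<in> carrier G" "H.word w1 \<in> carrier G" "I.word u2 \<in> carrier G"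
    using Cons.prems 1 2 H.letter_closed I.letter_closed I.word_closed H.word_closed by auto
  have "H.word (b # w) \<otimes> I.word u = gn b \<otimes> (H.word w \<otimes> I.word u)" using cl by (simp add: m_assoc)
  also have "\<dots> = (gn b \<otimes> I.word u1) \<otimes> H.word w1" unfolding 1(3) using cl by (simp add: m_assoc)
  also have "\<dots> = I.word u2 \<otimes> H.word (b2 # w1)" unfolding 2(3) using cl by (simp add: m_assoc)
  finally show ?case using 1 2 by (intro exI[of _ u2] exI[of _ "b2 # w1"]) simp
qed

lemma factorization:
  assumes "g \<in> carrier G"
  shows "\<exists>u w. set u \<subseteq> \<Lambda>v \<and> set w \<subseteq> \<Lambda>h \<and> g = I.word u \<otimes> H.word w"
proof -
  have letter: "\<exists>u w. set u \<subseteq> \<Lambda>v \<and> set w \<subseteq> \<Lambda>h \<and> gn l = I.word u \<otimes> H.word w" if l: "l \<in> \<Lambda>v \<union> \<Lambda>h" for l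
  proof (cases "l \<in> \<Lambda>v")
    case True
    then show ?thesis using I.letter_closed by (intro exI[of _ "[l]"] exI[of _ "[]"]) simp
  next
    case False
    then show ?thesis using l H.letter_closed by (intro exI[of _ "[]"] exI[of _ "[l]"]) simp
  qed
  have "g \<in> generate G (gn ` (\<Lambda>v \<union> \<Lambda>h))" using assms generated by blast
  then show ?thesis
  proof (induction rule: generate.induct)
    case one
    show ?case by (intro exI[of _ "[]"]) simp
  next
    case (incl h)
    then show ?case using letter by blast
  next
    case (inv h)
    then obtain l where l: "l \<in> \<Lambda>v \<union> \<Lambda>h" "h = gn l" by blast
    then have "inv h = gn (ng l)" "ng l \<in> \<Lambda>v \<union> \<Lambda>h"
      using H.letter_neg I.letter_neg H.neg_closed I.neg_closed by auto
    then show ?case using letter by simp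
  next
    case (eng h1 h2)
    then obtain u w u' w' where 1: "set u \<subseteq> \<Lambda>v" "set w \<subseteq> \<Lambda>h" "h1 = I.word u \<otimes> H.word w"
      and 2: "set u' \<subseteq> \<Lambda>v" "set w' \<subseteq> \<Lambda>h" "h2 = I.word u' \<otimes> H.word w'" by blast
    obtain u2 w2 where 3: "set u2 \<subseteq> \<Lambda>v" "set w2 \<subseteq> \<Lambda>h" "H.word w \<otimes> I.word u' = I.word u2 \<otimes> H.word w2"
      using swap_words[OF 1(2) 2(1)] by blast
    note cl = I.word_closed[OF 1(1)] H.word_closed[OF 1(2)] I.word_closed[OF 2(1)] H.word_closed[OF 2(2)]
      I.word_closed[OF 3(1)] H.word_closed[OF 3(2)]
    have "h1 \<otimes> h2 = I.word u \<otimes> (H.word w \<otimes> I.word u') \<otimes> H.word w'" unfolding 1(3) 2(3) using cl by (simp add: m_assoc)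
    also have "\<dots> = (I.word u \<otimes> I.word u2) \<otimes> (H.word w2 \<otimes> H.word w')" unfolding 3(3) using cl by (simp add: m_assoc)
    also have "\<dots> = I.word (u @ u2) \<otimes> H.word (w2 @ w')"
      using 1 2 3 by (simp only: I.word_append H.word_append)
    finally show ?case using 1 2 3 by (intro exI[of _ "u @ u2"] exI[of _ "w2 @ w'"]) simp
  qed
qed

lemma fix_word_h: "set w \<subseteq> \<Lambda>h \<Longrightarrow> \<beta> (H.word w) y0 = y0"
  by (induction w) (simp_all add: I.act_one I.v0 I.act_mult H.letter_closed H.word_closed fix_h)

text \<open>In a factorization the \<open>b\<close>-word fixes \<open>y0\<close>, so the
  \<open>a\<close>-word fixes it too and reduces to the empty word; then the \<open>b\<close>-word
  fixes \<open>x0\<close> and vanishes as well.\<close>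

lemma base_free:
  assumes g: "g \<in> carrier G" "\<alpha> g x0 = x0" "\<beta> g y0 = y0" shows "g = \<one>"
proof -
  obtain u w where uw: "set u \<subseteq> \<Lambda>v" "set w \<subseteq> \<Lambda>h" "g = I.word u \<otimes> H.word w" using factorization[OF g(1)] by blast
  obtain u' where u': "I.red u'" "I.word u' = I.word u" using I.red_reduce[OF uw(1)] by blast
  have "\<beta> (I.word u) y0 = y0"
    using g(3) uw(3) I.act_mult[OF I.word_closed[OF uw(1)] H.word_closed[OF uw(2)] I.v0] fix_word_h[OF uw(2)] by simp
  then have "u' = []" using I.free_word[OF u'(1)] u'(2) by metis
  then have "I.word u = \<one>" using u'(2) by simp
  then have g': "g = H.word w" unfolding uw(3) using H.word_closed[OF uw(2)] by simp
  obtain w' where w': "H.red w'" "H.word w' = H.word w" using H.red_reduce[OF uw(2)] by blast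
  have "w' = []" using H.free_word[OF w'(1)] w'(2) g(2) g' by metis
  then show ?thesis using w'(2) g' by simp
qed

lemma base_eq:
  assumes "g \<in> carrier G" "h \<in> carrier G" "\<alpha> g x0 = \<alpha> h x0" "\<beta> g y0 = \<beta> h y0" shows "g = h"
proof -
  have "inv h \<otimes> g = \<one>"
  proof (rule base_free)
    have "\<alpha> (inv h \<otimes> g) x0 = \<alpha> (inv h \<otimes> h) x0" "\<beta> (inv h \<otimes> g) y0 = \<beta> (inv h \<otimes> h) y0"
      using assms H.v0 I.v0 by (simp_all only: H.act_mult I.act_mult inv_closed)
    then show "\<alpha> (inv h \<otimes> g) x0 = x0" "\<beta> (inv h \<otimes> g) y0 = y0"
      using assms H.v0 I.v0 H.act_one I.act_one by simp_all
  qed (use assms in simp)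
  moreover have "g = h \<otimes> (inv h \<otimes> g)" using assms by (simp flip: m_assoc)
  ultimately show ?thesis using assms by simp
qed

text \<open>An \<open>a\<close>-word takes \<open>y0\<close> to \<open>y\<close>; a
  \<open>b\<close>-word applied before it corrects the first coordinate and leaves \<open>y0\<close>
  in place.\<close>

lemma base_transitive:
  assumes "x \<in> V" "y \<in> V" shows "\<exists>g\<in>carrier G. x = \<alpha> g x0 \<and> y = \<beta> g y0"
proof -
  obtain u where u: "set u \<subseteq> \<Lambda>v" "y = \<beta> (I.word u) y0" using I.transitive_word[OF assms(2)] by blast
  note uc = I.word_closed[OF u(1)]
  have "\<alpha> (inv (I.word u)) x \<in> V" using uc assms(1) H.act_closed by simp
  then obtain w where w: "set w \<subseteq> \<Lambda>h" "\<alpha> (inv (I.word u)) x = \<alpha> (H.word w) x0" using H.transitive_word by blast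
  note wc = H.word_closed[OF w(1)]
  have "\<alpha> (I.word u \<otimes> H.word w) x0 = \<alpha> (I.word u) (\<alpha> (inv (I.word u)) x)"
    unfolding w(2) using uc wc H.v0 by (simp only: H.act_mult)
  also have "\<dots> = x" using uc assms(1) H.act_one by (simp flip: H.act_mult)
  finally have "x = \<alpha> (I.word u \<otimes> H.word w) x0" ..
  moreover have "y = \<beta> (I.word u \<otimes> H.word w) y0"
    using uc wc I.v0 u(2) fix_word_h[OF w(1)] by (simp add: I.act_mult)
  ultimately show ?thesis using uc wc by blast
qed

lemma \<alpha>_conj: "g \<in> carrier G \<Longrightarrow> h \<in> carrier G \<Longrightarrow> v \<in> V \<Longrightarrow> \<alpha> (inv h \<otimes> (g \<otimes> h)) v = \<alpha> (inv h) (\<alpha> g (\<alpha> h v))"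
  by (simp add: H.act_mult H.act_closed)

lemma \<beta>_conj: "g \<in> carrier G \<Longrightarrow> h \<in> carrier G \<Longrightarrow> v \<in> V \<Longrightarrow> \<beta> (inv h \<otimes> (g \<otimes> h)) v = \<beta> (inv h) (\<beta> g (\<beta> h v))"
  by (simp add: I.act_mult I.act_closed)

lemma \<alpha>_inv: "h \<in> carrier G \<Longrightarrow> v \<in> V \<Longrightarrow> \<alpha> (inv h) (\<alpha> h v) = v" "h \<in> carrier G \<Longrightarrow> v \<in> V \<Longrightarrow> \<alpha> h (\<alpha> (inv h) v) = v"
  by (simp_all add: H.act_one flip: H.act_mult)

lemma \<beta>_inv: "h \<in> carrier G \<Longrightarrow> v \<in> V \<Longrightarrow> \<beta> (inv h) (\<beta> h v) = v" "h \<in> carrier G \<Longrightarrow> v \<in> V \<Longrightarrow> \<beta> h (\<beta> (inv h) v) = v"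
  by (simp_all add: I.act_one flip: I.act_mult)

lemma free_action:
  assumes "g \<in> carrier G" "x \<in> V" "y \<in> V" "\<alpha> g x = x" "\<beta> g y = y" shows "g = \<one>"
proof -
  obtain h where h: "h \<in> carrier G" "x = \<alpha> h x0" "y = \<beta> h y0" using base_transitive[OF assms(2,3)] by blast
  have e: "g \<otimes> h = h" using assms h H.v0 I.v0 by (intro base_eq) (simp_all add: H.act_mult I.act_mult)
  then show ?thesis using assms(1) h(1) r_cancel_one by blast
qed

text \<open>\<open>gsq a b\<close> moves the base point to the opposite corner of the square spanned by the edges to
  \<open>xb b\<close> and \<open>ya a\<close>: its two factorizations are the two paths around that square.\<close>

definition xb where "xb b = \<alpha> (gn b) x0"
definition ya where "ya a = \<beta> (gn a) y0"
definition gsq where "gsq a b = gn a \<otimes> gn (sig a b)"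

lemma gsq:
  assumes "a \<in> \<Lambda>v" "b \<in> \<Lambda>h"
  shows "gsq a b \<in> carrier G" "gsq a b = gn b \<otimes> gn (sig b a)" "\<alpha> (gsq a b) x0 = xb b" "\<beta> (gsq a b) y0 = ya a"
    "\<alpha> (gn a) (xb (sig a b)) = xb b" "\<beta> (gn b) (ya (sig b a)) = ya a"
    "\<alpha> (gsq a b) (xb (ng (sig a b))) = x0" "\<beta> (gsq a b) (ya (ng (sig b a))) = y0"
proof -
  let ?s = "sig a b" and ?a = "sig b a"
  have m: "?s \<in> \<Lambda>h" "?a \<in> \<Lambda>v" using sig_h sig_v assms by auto
  note cl = I.letter_closed[OF assms(1)] H.letter_closed[OF assms(2)] H.letter_closed[OF m(1)] I.letter_closed[OF m(2)]
  show "gsq a b \<in> carrier G" using cl by (simp add: gsq_def)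
  show e: "gsq a b = gn b \<otimes> gn ?a" unfolding gsq_def by (rule relation[OF assms])
  show x: "\<alpha> (gsq a b) x0 = xb b" unfolding e xb_def using cl H.v0 fix_v[OF m(2)] by (simp add: H.act_mult)
  show y: "\<beta> (gsq a b) y0 = ya a" unfolding gsq_def ya_def using cl I.v0 fix_h[OF m(1)] by (simp add: I.act_mult)
  show "\<alpha> (gn a) (xb ?s) = xb b" using x cl H.v0 unfolding gsq_def xb_def by (simp add: H.act_mult)
  show "\<beta> (gn b) (ya ?a) = ya a" using y cl I.v0 unfolding e ya_def by (simp add: I.act_mult)
  have "\<alpha> (gsq a b) (xb (ng ?s)) = \<alpha> (gn a) (\<alpha> (gn ?s) (\<alpha> (inv (gn ?s)) x0))"
    unfolding gsq_def xb_def H.letter_neg[OF m(1)] using cl H.v0 H.act_closed by (simp only: H.act_mult inv_closed)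
  then show "\<alpha> (gsq a b) (xb (ng ?s)) = x0" using cl H.v0 fix_v[OF assms(1)] by (simp add: \<alpha>_inv)
  have "\<beta> (gsq a b) (ya (ng ?a)) = \<beta> (gn b) (\<beta> (gn ?a) (\<beta> (inv (gn ?a)) y0))"
    unfolding e ya_def I.letter_neg[OF m(2)] using cl I.v0 I.act_closed by (simp only: I.act_mult inv_closed)
  then show "\<beta> (gsq a b) (ya (ng ?a)) = y0" using cl I.v0 fix_h[OF assms(2)] by (simp add: \<beta>_inv)
qed

lemma x_neg: "b \<in> \<Lambda>h \<Longrightarrow> \<alpha> (gn b) (xb (ng b)) = x0"
  unfolding xb_def H.letter_neg using H.letter_closed H.v0 by (simp add: \<alpha>_inv)

lemma y_neg: "a \<in> \<Lambda>v \<Longrightarrow> \<beta> (gn a) (ya (ng a)) = y0"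
  unfolding ya_def I.letter_neg using I.letter_closed I.v0 by (simp add: \<beta>_inv)

lemma xb_edge: "(x0, x) \<in> Ed \<longleftrightarrow> (\<exists>b\<in>\<Lambda>h. x = xb b)"
  unfolding xb_def by (rule H.edges_v0)

lemma ya_edge: "(y0, y) \<in> Ed \<longleftrightarrow> (\<exists>a\<in>\<Lambda>v. y = ya a)"
  unfolding ya_def by (rule I.edges_v0)

lemma xb_inj: "b \<in> \<Lambda>h \<Longrightarrow> b' \<in> \<Lambda>h \<Longrightarrow> xb b = xb b' \<Longrightarrow> b = b'"
  using H.red_unique[of "[b]" "[b']"] H.letter_closed by (simp add: H.red_def xb_def)

lemma ya_inj: "a \<in> \<Lambda>v \<Longrightarrow> a' \<in> \<Lambda>v \<Longrightarrow> ya a = ya a' \<Longrightarrow> a = a'"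
  using I.red_unique[of "[a]" "[a']"] I.letter_closed by (simp add: I.red_def ya_def)

lemma x_two: "b \<in> \<Lambda>h \<Longrightarrow> b' \<in> \<Lambda>h \<Longrightarrow> \<alpha> (gn b) (xb b') = x0 \<Longrightarrow> b' = ng b"
  using H.free_word[of "[b, b']"] H.letter_closed H.v0 by (auto simp: H.red_def xb_def H.act_mult)

lemma y_two: "a \<in> \<Lambda>v \<Longrightarrow> a' \<in> \<Lambda>v \<Longrightarrow> \<beta> (gn a) (ya a') = y0 \<Longrightarrow> a' = ng a"
  using I.free_word[of "[a, a']"] I.letter_closed I.v0 by (auto simp: I.red_def ya_def I.act_mult)

lemma base_edge:
  assumes "(x, x') \<in> Ed" "y \<in> V"
  shows "\<exists>h\<in>carrier G. \<exists>b\<in>\<Lambda>h. x = \<alpha> h x0 \<and> x' = \<alpha> h (xb b) \<and> y = \<beta> h y0"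
proof -
  have V: "x \<in> V" "x' \<in> V" using H.EdV assms(1) by auto
  obtain h where h: "h \<in> carrier G" "x = \<alpha> h x0" "y = \<beta> h y0" using base_transitive[OF V(1) assms(2)] by blast
  have "(\<alpha> (inv h) x, \<alpha> (inv h) x') \<in> Ed" using H.act_edge assms(1) h(1) by simp
  then obtain b where "b \<in> \<Lambda>h" "\<alpha> (inv h) x' = xb b" using h H.v0 xb_edge by (auto simp: \<alpha>_inv)
  then show ?thesis using h V by (metis \<alpha>_inv(2))
qed

lemma base_edge':
  assumes "x \<in> V" "(y, y') \<in> Ed"
  shows "\<exists>h\<in>carrier G. \<exists>a\<in>\<Lambda>v. x = \<alpha> h x0 \<and> y = \<beta> h y0 \<and> y' = \<beta> h (ya a)"
proof -
  have V: "y \<in> V" "y' \<in> V" using H.EdV assms(2) by auto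
  obtain h where h: "h \<in> carrier G" "x = \<alpha> h x0" "y = \<beta> h y0" using base_transitive[OF assms(1) V(1)] by blast
  have "(\<beta> (inv h) y, \<beta> (inv h) y') \<in> Ed" using I.act_edge assms(2) h(1) by simp
  then obtain a where "a \<in> \<Lambda>v" "\<beta> (inv h) y' = ya a" using h I.v0 ya_edge by (auto simp: \<beta>_inv)
  then show ?thesis using h V by (metis \<beta>_inv(2))
qed

lemma base_square:
  assumes "(x, x') \<in> Ed" "(y, y') \<in> Ed"
  shows "\<exists>h\<in>carrier G. \<exists>a\<in>\<Lambda>v. \<exists>b\<in>\<Lambda>h. x = \<alpha> h x0 \<and> x' = \<alpha> h (xb b) \<and> y = \<beta> h y0 \<and> y' = \<beta> h (ya a)"
proof -
  have V: "y \<in> V" "y' \<in> V" using H.EdV assms(2) by auto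
  obtain h b where h: "h \<in> carrier G" "b \<in> \<Lambda>h" "x = \<alpha> h x0" "x' = \<alpha> h (xb b)" "y = \<beta> h y0"
    using base_edge[OF assms(1) V(1)] by blast
  have "(\<beta> (inv h) y, \<beta> (inv h) y') \<in> Ed" using I.act_edge assms(2) h(1) by simp
  then obtain a where "a \<in> \<Lambda>v" "\<beta> (inv h) y' = ya a" using h I.v0 ya_edge by (auto simp: \<beta>_inv)
  then show ?thesis using h V by (metis \<beta>_inv(2))
qed

lemma xb_V: "b \<in> \<Lambda>h \<Longrightarrow> xb b \<in> V" and ya_V: "a \<in> \<Lambda>v \<Longrightarrow> ya a \<in> V"
  unfolding xb_def ya_def using H.act_closed I.act_closed H.letter_closed I.letter_closed H.v0 I.v0 by auto

text \<open>Conjugated to the base vertex, an element that reverses a horizontal edge agrees there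
  with \<open>gn b\<close> and so equals it. Then the letter \<open>b\<close> twice in a row fixes
  \<open>x0\<close>, and the label \<open>b\<close> would be its own negative.\<close>

lemma no_flip_h:
  assumes "g \<in> carrier G" "(x, x') \<in> Ed" "y \<in> V" "\<alpha> g x = x'" "\<alpha> g x' = x" "\<beta> g y = y" shows False
proof -
  obtain h b where h: "h \<in> carrier G" "b \<in> \<Lambda>h" "x = \<alpha> h x0" "x' = \<alpha> h (xb b)" "y = \<beta> h y0"
    using base_edge[OF assms(2,3)] by blast
  let ?g = "inv h \<otimes> (g \<otimes> h)"
  have g: "\<alpha> ?g x0 = xb b" "\<alpha> ?g (xb b) = x0" "\<beta> ?g y0 = y0"
    using assms h H.v0 I.v0 xb_V[OF h(2)] by (simp_all add: \<alpha>_conj \<beta>_conj \<alpha>_inv \<beta>_inv)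
  have "?g = gn b" using assms(1) h g H.letter_closed fix_h by (intro base_eq) (simp_all add: xb_def)
  then show False using g(2) x_two[OF h(2) h(2)] H.neg_neq[OF h(2)] by simp
qed

lemma no_flip_v:
  assumes "g \<in> carrier G" "x \<in> V" "(y, y') \<in> Ed" "\<alpha> g x = x" "\<beta> g y = y'" "\<beta> g y' = y" shows False
proof -
  obtain h a where h: "h \<in> carrier G" "a \<in> \<Lambda>v" "x = \<alpha> h x0" "y = \<beta> h y0" "y' = \<beta> h (ya a)"
    using base_edge'[OF assms(2,3)] by blast
  let ?g = "inv h \<otimes> (g \<otimes> h)"
  have g: "\<beta> ?g y0 = ya a" "\<beta> ?g (ya a) = y0" "\<alpha> ?g x0 = x0"
    using assms h H.v0 I.v0 ya_V[OF h(2)] by (simp_all add: \<alpha>_conj \<beta>_conj \<alpha>_inv \<beta>_inv)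
  have "?g = gn a" using assms(1) h g I.letter_closed fix_v by (intro base_eq) (simp_all add: ya_def)
  then show False using g(2) y_two[OF h(2) h(2)] I.neg_neq[OF h(2)] by simp
qed

lemma no_flip_hv:
  assumes "g \<in> carrier G" "(x, x') \<in> Ed" "(y, y') \<in> Ed"
    "\<alpha> g x = x'" "\<alpha> g x' = x" "\<beta> g y = y'" "\<beta> g y' = y" shows False
proof -
  obtain h a b where h: "h \<in> carrier G" "a \<in> \<Lambda>v" "b \<in> \<Lambda>h" "x = \<alpha> h x0" "x' = \<alpha> h (xb b)" "y = \<beta> h y0" "y' = \<beta> h (ya a)"
    using base_square[OF assms(2,3)] by blast
  let ?g = "inv h \<otimes> (g \<otimes> h)"
  have g: "\<alpha> ?g x0 = xb b" "\<alpha> ?g (xb b) = x0" "\<beta> ?g y0 = ya a" "\<beta> ?g (ya a) = y0"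
    using assms h H.v0 I.v0 xb_V[OF h(3)] ya_V[OF h(2)] by (simp_all add: \<alpha>_conj \<beta>_conj \<alpha>_inv \<beta>_inv)
  note s = gsq[OF h(2,3)]
  have "?g = gsq a b" using assms(1) h(1) g s by (intro base_eq) simp_all
  then have e: "\<alpha> (gsq a b) (xb b) = x0" "\<beta> (gsq a b) (ya a) = y0" using g by simp_all
  have m: "sig a b \<in> \<Lambda>h" "sig b a \<in> \<Lambda>v" using sig_h sig_v h by auto
  have inj: "\<alpha> (gsq a b) u = \<alpha> (gsq a b) v \<Longrightarrow> u = v" "\<beta> (gsq a b) u = \<beta> (gsq a b) v \<Longrightarrow> u = v" if "u \<in> V" "v \<in> V" for u v
    using that s(1) by (metis \<alpha>_inv(1), metis \<beta>_inv(1))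
  \<comment> \<open>By \<open>gsq\<close>, the neighbours that are taken to the base vertices belong
    to the negatives of the labels on the far sides. A half turn takes \<open>xb b\<close> and
    \<open>ya a\<close> there, so the labels would coincide.\<close>
  have "xb b = xb (ng (sig a b))" using e s(7) m h xb_V H.neg_closed by (rule_tac inj(1)) auto
  moreover have "ya a = ya (ng (sig b a))" using e s(8) m h ya_V I.neg_closed by (rule_tac inj(2)) auto
  ultimately have "b = ng (sig a b)" "a = ng (sig b a)" using xb_inj ya_inj H.neg_closed I.neg_closed m h by auto
  then show False using sig_not_neg[OF h(2,3)] H.neg_neg[OF m(1)] I.neg_neg[OF m(2)] by metis
qed

lemma no_inversion: "acts_without_inversion (carrier G) (\<lambda>g. pair_act (\<alpha> g) (\<beta> g)) (tree_product V Ed)"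
  unfolding acts_without_inversion_def
proof (intro ballI conjI impI)
  fix g e assume g: "g \<in> carrier G" and e: "e \<in> sc_edges (tree_product V Ed)"
  show "pair_act (\<alpha> g) (\<beta> g) e \<noteq> sc_rev (tree_product V Ed) e"
  proof
    assume a: "pair_act (\<alpha> g) (\<beta> g) e = sc_rev (tree_product V Ed) e"
    show False
    proof (cases e rule: pedge_rev.cases)
      case (1 x x' y)
      then show False using a e no_flip_h[OF g, of x x' y] by (auto simp: tree_product_def)
    next
      case (2 x y y')
      then show False using a e no_flip_v[OF g, of x y y'] by (auto simp: tree_product_def)
    qed
  qed
next
  fix g s p assume g: "g \<in> carrier G" and s: "s \<in> sc_squares (tree_product V Ed)"
    and p: "p \<in> sc_bd (tree_product V Ed) s" "map4 (pair_act (\<alpha> g) (\<beta> g)) p \<in> sc_bd (tree_product V Ed) s"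
  obtain x x' y y' where e: "(x, x') \<in> Ed" "(y, y') \<in> Ed"
    and sq: "s = dihedral_class pedge_rev (Hor (x, x') y, Ver x' (y, y'), Hor (x', x) y', Ver x (y', y))"
    using s by (auto simp: tree_product_def)
  have V: "x \<in> V" "x' \<in> V" "y \<in> V" "y' \<in> V" using e H.EdV by auto
  have ps: "p \<in> s" "map4 (pair_act (\<alpha> g) (\<beta> g)) p \<in> s" using p by (simp_all add: tree_product_def)
  \<comment> \<open>Horizontal edges stay horizontal, so quarter turns do not occur, and in each
    factor the edge is either fixed or reversed.\<close>
  have "(\<alpha> g x = x \<and> \<alpha> g x' = x' \<or> \<alpha> g x = x' \<and> \<alpha> g x' = x) \<and> (\<beta> g y = y \<and> \<beta> g y' = y' \<or> \<beta> g y = y' \<and> \<beta> g y' = y)"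
    using ps unfolding sq by auto
  then have "\<alpha> g x = x \<and> \<alpha> g x' = x' \<and> \<beta> g y = y \<and> \<beta> g y' = y'"
    using no_flip_h[OF g e(1) V(3)] no_flip_v[OF g V(1) e(2)] no_flip_hv[OF g e] by blast
  then show "map4 (pair_act (\<alpha> g) (\<beta> g)) p = p" using ps(1) unfolding sq by auto
qed

sublocale TP: tree_product_action V Ed "\<lambda>u v. wdist (H.rw u) (H.rw v)" G \<alpha> \<beta>
proof -
  interpret tree V Ed "\<lambda>u v. wdist (H.rw u) (H.rw v)" by (rule H.graph_tree)
  show "tree_product_action V Ed (\<lambda>u v. wdist (H.rw u) (H.rw v)) G \<alpha> \<beta>"
  proof
    show "acts_without_inversion (carrier G) (\<lambda>g. pair_act (\<alpha> g) (\<beta> g)) (tree_product V Ed)"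
      by (rule no_inversion)
  qed (rule H.act_closed H.act_mult H.act_one H.act_edge I.act_closed I.act_mult I.act_one I.act_edge free_action; assumption)+
qed

end

lemma map4_dihedral_on:
  assumes "\<And>e. e \<in> {a, b, c, d} \<Longrightarrow> f (r e) = r' (f e)"
  shows "map4 f ` dihedral_class r (a, b, c, d) = dihedral_class r' (map4 f (a, b, c, d))"
  using assms by simp

fun label_rev :: "('l \<Rightarrow> 'l) \<Rightarrow> 'l sedge \<Rightarrow> 'l sedge" where
  "label_rev n (Aedge \<xi>) = Aedge (n \<xi>)"
| "label_rev n (Bedge \<eta>) = Bedge (n \<eta>)"

section \<open>The quotient as a labelled complex\<close>

context lattice_pair
begin

abbreviation "srev \<equiv> label_rev ng"

definition etup where "etup a b = (Aedge a, Bedge (sig a b), srev (Aedge (sig b a)), srev (Bedge b))"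
definition esq where "esq a b = dihedral_class srev (etup a b)"

definition label_complex where
  "label_complex = \<lparr> sc_verts = {()}, sc_edges = Aedge ` \<Lambda>v \<union> Bedge ` \<Lambda>h, sc_src = (\<lambda>_. ()), sc_tgt = (\<lambda>_. ()),
     sc_rev = srev, sc_squares = {esq a b | a b. a \<in> \<Lambda>v \<and> b \<in> \<Lambda>h}, sc_bd = (\<lambda>s. s) \<rparr>"

fun fe where
  "fe (Aedge a) = TP.oe (Ver x0 (y0, ya a))"
| "fe (Bedge b) = TP.oe (Hor (x0, xb b) y0)"

lemma ae_edge: "a \<in> \<Lambda>v \<Longrightarrow> Ver x0 (y0, ya a) \<in> sc_edges TP.XX"
  using ya_edge H.v0 by auto

lemma be_edge: "b \<in> \<Lambda>h \<Longrightarrow> Hor (x0, xb b) y0 \<in> sc_edges TP.XX"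
  using xb_edge I.v0 by auto

lemma pe_ae: "g \<in> carrier G \<Longrightarrow> a \<in> \<Lambda>v \<Longrightarrow> TP.oe (Ver (\<alpha> g x0) (\<beta> g y0, \<beta> g (ya a))) = fe (Aedge a)"
  using TP.oe_act[of g "Ver x0 (y0, ya a)"] ae_edge by simp

lemma pe_be: "g \<in> carrier G \<Longrightarrow> b \<in> \<Lambda>h \<Longrightarrow> TP.oe (Hor (\<alpha> g x0, \<alpha> g (xb b)) (\<beta> g y0)) = fe (Bedge b)"
  using TP.oe_act[of g "Hor (x0, xb b) y0"] be_edge by simp

text \<open>The reversed edge ends at the base vertex, and \<open>gn a\<close> moves the edge with
  the negated label onto it.\<close>

lemma fe_rev:
  assumes "e \<in> sc_edges label_complex" shows "fe (srev e) = pedge_rev ` fe e"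
proof (cases e)
  case (Aedge a)
  then have a: "a \<in> \<Lambda>v" using assms by (auto simp: label_complex_def)
  have "TP.oe (Ver x0 (ya a, y0)) = fe (Aedge (ng a))"
    using pe_ae[OF I.letter_closed[OF a] I.neg_closed[OF a]] a fix_v by (simp add: y_neg flip: ya_def)
  then show ?thesis unfolding Aedge by (simp add: TP.oe_rev)
next
  case (Bedge b)
  then have b: "b \<in> \<Lambda>h" using assms by (auto simp: label_complex_def)
  have "TP.oe (Hor (xb b, x0) y0) = fe (Bedge (ng b))"
    using pe_be[OF H.letter_closed[OF b] H.neg_closed[OF b]] b fix_h by (simp add: x_neg flip: xb_def)
  then show ?thesis unfolding Bedge by (simp add: TP.oe_rev)
qed

text \<open>An element that relates two of the chosen edges fixes their common start, the base
  vertex, and is the identity by \<open>base_free\<close>.\<close>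

lemma fe_inj: "inj_on fe (sc_edges label_complex)"
proof (rule inj_onI)
  fix e e' assume e: "e \<in> sc_edges label_complex" "e' \<in> sc_edges label_complex" "fe e = fe e'"
  have A: "a = a'" if "a \<in> \<Lambda>v" "a' \<in> \<Lambda>v" "fe (Aedge a) = fe (Aedge a')" for a a'
  proof -
    have "Ver x0 (y0, ya a') \<in> TP.oe (Ver x0 (y0, ya a))" using TP.oe_self[OF ae_edge[OF that(2)]] that(3) by simp
    then obtain g where g: "g \<in> carrier G" "x0 = \<alpha> g x0" "y0 = \<beta> g y0" "ya a' = \<beta> g (ya a)"
      by (auto simp: TP.oe_mem)
    then have "g = \<one>" using base_free by simp
    then show ?thesis using g that ya_inj ya_V I.act_one by simp
  qed
  have B: "b = b'" if "b \<in> \<Lambda>h" "b' \<in> \<Lambda>h" "fe (Bedge b) = fe (Bedge b')" for b b'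
  proof -
    have "Hor (x0, xb b') y0 \<in> TP.oe (Hor (x0, xb b) y0)" using TP.oe_self[OF be_edge[OF that(2)]] that(3) by simp
    then obtain g where g: "g \<in> carrier G" "x0 = \<alpha> g x0" "y0 = \<beta> g y0" "xb b' = \<alpha> g (xb b)"
      by (auto simp: TP.oe_mem)
    then have "g = \<one>" using base_free by simp
    then show ?thesis using g that xb_inj xb_V H.act_one by simp
  qed
  have N: "fe (Aedge a) \<noteq> fe (Bedge b)" if "a \<in> \<Lambda>v" for a b
  proof
    assume "fe (Aedge a) = fe (Bedge b)"
    then have "Ver x0 (y0, ya a) \<in> TP.oe (Hor (x0, xb b) y0)" using TP.oe_self[OF ae_edge[OF that]] by simp
    then show False by (auto simp: TP.oe_mem)
  qed
  show "e = e'"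
  proof (cases e)
    case (Aedge a)
    then have a: "a \<in> \<Lambda>v" using e by (auto simp: label_complex_def)
    show ?thesis
    proof (cases e')
      case (Aedge a')
      then show ?thesis using A[OF a, of a'] e \<open>e = _\<close> by (auto simp: label_complex_def)
    next
      case (Bedge b)
      then show ?thesis using N[OF a, of b] e(3) unfolding \<open>e = _\<close> by simp
    qed
  next
    case (Bedge b)
    then have b: "b \<in> \<Lambda>h" using e by (auto simp: label_complex_def)
    show ?thesis
    proof (cases e')
      case (Bedge b')
      then show ?thesis using B[OF b, of b'] e \<open>e = _\<close> by (auto simp: label_complex_def)
    next
      case (Aedge a)
      then have "a \<in> \<Lambda>v" using e by (auto simp: label_complex_def)
      then show ?thesis using N[of a b] e(3) unfolding Aedge \<open>e = _\<close> by simp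
    qed
  qed
qed

lemma fe_image: "fe ` sc_edges label_complex = TP.oe ` sc_edges TP.XX"
proof (intro equalityI subsetI)
  fix O' assume "O' \<in> fe ` sc_edges label_complex"
  then show "O' \<in> TP.oe ` sc_edges TP.XX"
    unfolding label_complex_def using ae_edge be_edge by auto
next
  fix O' assume "O' \<in> TP.oe ` sc_edges TP.XX"
  then obtain e where e: "e \<in> sc_edges TP.XX" "O' = TP.oe e" by blast
  from e(1) show "O' \<in> fe ` sc_edges label_complex"
  proof (cases rule: TP.edge_cases)
    case (1 x x' y)
    obtain h b where h: "h \<in> carrier G" "b \<in> \<Lambda>h" "x = \<alpha> h x0" "x' = \<alpha> h (xb b)" "y = \<beta> h y0"
      using base_edge[OF 1(2,3)] by blast
    have "O' = fe (Bedge b)" unfolding e(2) 1(1) h(3-5) by (rule pe_be[OF h(1,2)])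
    moreover have "Bedge b \<in> sc_edges label_complex" using h(2) by (simp add: label_complex_def)
    ultimately show ?thesis by (metis imageI)
  next
    case (2 x y y')
    obtain h a where h: "h \<in> carrier G" "a \<in> \<Lambda>v" "x = \<alpha> h x0" "y = \<beta> h y0" "y' = \<beta> h (ya a)"
      using base_edge'[OF 2(2,3)] by blast
    have "O' = fe (Aedge a)" unfolding e(2) 2(1) h(3-5) by (rule pe_ae[OF h(1,2)])
    moreover have "Aedge a \<in> sc_edges label_complex" using h(2) by (simp add: label_complex_def)
    ultimately show ?thesis by (metis imageI)
  qed
qed

lemma one_vertex: "TP.ve ` (V \<times> V) = {TP.ve (x0, y0)}"
proof -
  have "TP.ve z = TP.ve (x0, y0)" if z: "z \<in> V \<times> V" for z
  proof -
    obtain x y where xy: "z = (x, y)" "x \<in> V" "y \<in> V" using z by auto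
    obtain h where "h \<in> carrier G" "x = \<alpha> h x0" "y = \<beta> h y0" using base_transitive[OF xy(2,3)] by blast
    then show ?thesis using TP.ve_act[of h "(x0, y0)"] H.v0 I.v0 unfolding xy(1) by simp
  qed
  then have "TP.ve ` (V \<times> V) \<subseteq> {TP.ve (x0, y0)}" by blast
  moreover have "TP.ve (x0, y0) \<in> TP.ve ` (V \<times> V)" using H.v0 I.v0 by (intro imageI) simp
  ultimately show ?thesis by blast
qed

text \<open>The vertical edge comes first, in accordance with the tuple \<open>etup\<close> of
  labels.\<close>

definition btup where "btup a b = TP.corner' x0 (xb b) y0 (ya a)"
definition bos where "bos a b = TP.os (dihedral_class pedge_rev (btup a b))"

lemma btup_sq: "a \<in> \<Lambda>v \<Longrightarrow> b \<in> \<Lambda>h \<Longrightarrow> TP.sq_tuple (btup a b)"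
  unfolding btup_def using xb_edge ya_edge by (intro TP.sq_tupleI) auto

lemma label_edges: "Aedge a \<in> sc_edges label_complex \<longleftrightarrow> a \<in> \<Lambda>v" "Bedge b \<in> sc_edges label_complex \<longleftrightarrow> b \<in> \<Lambda>h"
  by (auto simp: label_complex_def)

lemma srev_edge: "e \<in> sc_edges label_complex \<Longrightarrow> srev e \<in> sc_edges label_complex"
  by (cases e) (auto simp: label_edges H.neg_closed I.neg_closed)

lemma etup_edges:
  assumes "a \<in> \<Lambda>v" "b \<in> \<Lambda>h" "etup a b = (e1, e2, e3, e4)" shows "{e1, e2, e3, e4} \<subseteq> sc_edges label_complex"
  using assms sig_h sig_v H.neg_closed I.neg_closed by (auto simp: etup_def label_edges)

text \<open>The two sides away from the base vertex are translates, by \<open>gn a\<close> and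
  \<open>gn b\<close>, of edges at the base vertex; \<open>gsq\<close> identifies the labels of
  these edges.\<close>

lemma map4_btup:
  assumes "a \<in> \<Lambda>v" "b \<in> \<Lambda>h" shows "map4 TP.oe (btup a b) = map4 fe (etup a b)"
proof -
  note s = gsq[OF assms]
  have m: "sig a b \<in> \<Lambda>h" "sig b a \<in> \<Lambda>v" using sig_h sig_v assms by auto
  have 2: "TP.oe (Hor (x0, xb b) (ya a)) = fe (Bedge (sig a b))"
    using pe_be[OF I.letter_closed[OF assms(1)] m(1)] s(5) fix_v[OF assms(1)] by (simp flip: ya_def)
  have "TP.oe (Ver (xb b) (y0, ya a)) = fe (Aedge (sig b a))"
    using pe_ae[OF H.letter_closed[OF assms(2)] m(2)] s(6) fix_h[OF assms(2)] by (simp flip: xb_def)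
  then have 3: "TP.oe (Ver (xb b) (ya a, y0)) = fe (srev (Aedge (sig b a)))"
    using fe_rev[of "Aedge (sig b a)"] m(2) TP.oe_rev[of "Ver (xb b) (y0, ya a)"] unfolding label_edges by simp
  have 4: "TP.oe (Hor (xb b, x0) y0) = fe (srev (Bedge b))"
    using fe_rev[of "Bedge b"] assms(2) TP.oe_rev[of "Hor (x0, xb b) y0"] unfolding label_edges by simp
  show ?thesis using 2 3 4 by (simp add: btup_def TP.corner'_def etup_def)
qed

lemma bd_bos:
  assumes "a \<in> \<Lambda>v" "b \<in> \<Lambda>h" shows "sc_bd TP.QQ (bos a b) = map4 fe ` esq a b"
proof -
  obtain e1 e2 e3 e4 where e: "etup a b = (e1, e2, e3, e4)" by (cases "etup a b")
  have "map4 fe ` esq a b = dihedral_class (image pedge_rev) (map4 fe (etup a b))"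
    unfolding esq_def e
  proof (rule map4_dihedral_on)
    fix e' assume "e' \<in> {e1, e2, e3, e4}"
    then show "fe (srev e') = pedge_rev ` fe e'" using etup_edges[OF assms e] fe_rev by blast
  qed
  then show ?thesis unfolding bos_def TP.bd_os_class[OF btup_sq[OF assms]] map4_btup[OF assms] by simp
qed

text \<open>The four label pairs of a square, one for each of its corners.\<close>

definition quad where
  "quad a b = {(a, b), (ng a, sig a b), (sig b a, ng b), (ng (sig b a), ng (sig a b))}"

lemma bos_act:
  assumes "g \<in> carrier G" "a \<in> \<Lambda>v" "b \<in> \<Lambda>h"
    "TP.corner' (\<alpha> g x0) (\<alpha> g (xb b)) (\<beta> g y0) (\<beta> g (ya a)) \<in> dihedral_class pedge_rev (btup a' b')"
  shows "bos a b = bos a' b'"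
proof -
  have "bos a b = TP.os (dihedral_class pedge_rev (TP.corner' (\<alpha> g x0) (\<alpha> g (xb b)) (\<beta> g y0) (\<beta> g (ya a))))"
    using TP.os_act[OF assms(1) btup_sq[OF assms(2,3)]] unfolding bos_def btup_def TP.pe_corner(2) by simp
  also have "\<dots> = bos a' b'" unfolding bos_def using dihedral_class_eq[OF pedge_rev_rev assms(4)] by simp
  finally show ?thesis .
qed

lemma corner'_variants:
  "TP.corner' x x' y' y \<in> dihedral_class pedge_rev (TP.corner' x x' y y')"
  "TP.corner' x' x y y' \<in> dihedral_class pedge_rev (TP.corner' x x' y y')"
  "TP.corner' x' x y' y \<in> dihedral_class pedge_rev (TP.corner' x x' y y')"
  by (simp_all add: TP.corner'_def)

text \<open>\<open>gn a\<close>, \<open>gn b\<close> and \<open>gsq a b\<close> take the base vertex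
  to the other three corners, and read from there the square shows the other three label
  pairs.\<close>

lemma quad_bos:
  assumes "a \<in> \<Lambda>v" "b \<in> \<Lambda>h" "(a', b') \<in> quad a b" shows "a' \<in> \<Lambda>v" "b' \<in> \<Lambda>h" "bos a' b' = bos a b"
proof -
  note s = gsq[OF assms(1,2)]
  have m: "sig a b \<in> \<Lambda>h" "sig b a \<in> \<Lambda>v" using sig_h sig_v assms by auto
  note n = H.neg_closed[OF assms(2)] I.neg_closed[OF assms(1)] H.neg_closed[OF m(1)] I.neg_closed[OF m(2)]
  show "a' \<in> \<Lambda>v" "b' \<in> \<Lambda>h" using assms m n by (auto simp: quad_def)
  have "bos (ng a) (sig a b) = bos a b"
    using corner'_variants(1)[of x0 "xb b" "ya a" y0] fix_v[OF assms(1)] s(5) y_neg[OF assms(1)]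
    by (intro bos_act[OF I.letter_closed[OF assms(1)] n(2) m(1)]) (simp add: btup_def flip: ya_def)
  moreover have "bos (sig b a) (ng b) = bos a b"
    using corner'_variants(2)[of "xb b" x0 y0 "ya a"] fix_h[OF assms(2)] s(6) x_neg[OF assms(2)]
    by (intro bos_act[OF H.letter_closed[OF assms(2)] m(2) n(1)]) (simp add: btup_def flip: xb_def)
  moreover have "bos (ng (sig b a)) (ng (sig a b)) = bos a b"
    using corner'_variants(3)[of "xb b" x0 "ya a" y0] s
    by (intro bos_act[OF s(1) n(4) n(3)]) (simp add: btup_def)
  ultimately show "bos a' b' = bos a b" using assms(3) by (auto simp: quad_def)
qed

text \<open>Pairs of opposite corners are distinguished by \<open>sig_not_neg\<close>, those of
  neighbouring corners by the fact that no label is its own negative.\<close>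

lemma card_quad:
  assumes "a \<in> \<Lambda>v" "b \<in> \<Lambda>h" shows "card (quad a b) = 4"
proof -
  have m: "sig a b \<in> \<Lambda>h" "sig b a \<in> \<Lambda>v" using sig_h sig_v assms by auto
  have "a \<noteq> ng (sig b a) \<or> b \<noteq> ng (sig a b)" "ng a \<noteq> sig b a \<or> sig a b \<noteq> ng b"
    using sig_not_neg[OF assms] H.neg_neg[OF m(1)] I.neg_neg[OF m(2)] by auto
  moreover have "ng a \<noteq> a" "ng b \<noteq> b" "ng (sig a b) \<noteq> sig a b" "ng (sig b a) \<noteq> sig b a"
    using H.neg_neq I.neg_neq assms m by auto
  ultimately show ?thesis unfolding quad_def by (subst card_insert_disjoint; auto)+
qed

lemma etup_quad:
  assumes "a \<in> \<Lambda>v" "b \<in> \<Lambda>h" "a' \<in> \<Lambda>v" "b' \<in> \<Lambda>h" "etup a' b' \<in> esq a b"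
  shows "(a', b') \<in> quad a b"
proof -
  have m: "sig a b \<in> \<Lambda>h" "sig b a \<in> \<Lambda>v" using sig_h sig_v assms by auto
  have "b' = ng (ng b')" using H.neg_neg assms by simp
  then show ?thesis using assms(5) H.neg_neg[OF assms(2)] I.neg_neg[OF assms(1)] H.neg_neg[OF m(1)] I.neg_neg[OF m(2)]
    unfolding esq_def etup_def quad_def by auto
qed

text \<open>Equal orbits have equal boundaries, equal label boundaries put one pair among the four
  of the other, and those four give the same orbit. So a square of the quotient is determined by its
  boundary.\<close>

lemma bos_eq_iff:
  assumes "a \<in> \<Lambda>v" "b \<in> \<Lambda>h" "a' \<in> \<Lambda>v" "b' \<in> \<Lambda>h"
  shows "bos a' b' = bos a b \<longleftrightarrow> (a', b') \<in> quad a b" "bos a' b' = bos a b \<longleftrightarrow> esq a' b' = esq a b"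
proof -
  have inj: "inj_on (map4 fe) {(e1, e2, e3, e4). {e1, e2, e3, e4} \<subseteq> sc_edges label_complex}"
    using fe_inj by (auto simp: inj_on_def)
  have sub: "esq a b \<subseteq> {(e1, e2, e3, e4). {e1, e2, e3, e4} \<subseteq> sc_edges label_complex}"
    if "a \<in> \<Lambda>v" "b \<in> \<Lambda>h" for a b
  proof -
    obtain e1 e2 e3 e4 where e: "etup a b = (e1, e2, e3, e4)" by (cases "etup a b")
    then show ?thesis using etup_edges[OF that e] srev_edge unfolding esq_def by auto
  qed
  have 1: "esq a' b' = esq a b" if "bos a' b' = bos a b"
  proof -
    have "map4 fe ` esq a' b' = map4 fe ` esq a b"
      using bd_bos[OF assms(1,2)] bd_bos[OF assms(3,4)] that by simp
    then show ?thesis using inj_on_image_eq_iff[OF inj sub[OF assms(3,4)] sub[OF assms(1,2)]] by simp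
  qed
  have 2: "(a', b') \<in> quad a b" if "esq a' b' = esq a b"
    using etup_quad[OF assms] dihedral_class_self[of "etup a' b'"] that unfolding esq_def[of a' b'] by auto
  show "bos a' b' = bos a b \<longleftrightarrow> (a', b') \<in> quad a b" "bos a' b' = bos a b \<longleftrightarrow> esq a' b' = esq a b"
    using 1 2 quad_bos(3)[OF assms(1,2)] by blast+
qed

lemma squares_bos: "TP.os ` sc_squares TP.XX = {bos a b | a b. a \<in> \<Lambda>v \<and> b \<in> \<Lambda>h}"
proof (intro equalityI subsetI)
  fix Q assume "Q \<in> TP.os ` sc_squares TP.XX"
  then obtain s where s: "s \<in> sc_squares TP.XX" "Q = TP.os s" by blast
  obtain x x' y y' where e: "(x, x') \<in> Ed" "(y, y') \<in> Ed" "s = dihedral_class pedge_rev (TP.corner x x' y y')"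
    using s(1) by (rule TP.square_cases)
  obtain h a b where h: "h \<in> carrier G" "a \<in> \<Lambda>v" "b \<in> \<Lambda>h" "x = \<alpha> h x0" "x' = \<alpha> h (xb b)" "y = \<beta> h y0" "y' = \<beta> h (ya a)"
    using base_square[OF e(1,2)] by blast
  have "Q = TP.os (dihedral_class pedge_rev (TP.corner' x x' y y'))" unfolding s(2) e(3) TP.corner'_class ..
  also have "\<dots> = bos a b"
    using TP.os_act[OF h(1) btup_sq[OF h(2,3)]] unfolding bos_def btup_def TP.pe_corner(2) h(4-7) .
  finally show "Q \<in> {bos a b | a b. a \<in> \<Lambda>v \<and> b \<in> \<Lambda>h}" using h by blast
next
  fix Q assume "Q \<in> {bos a b | a b. a \<in> \<Lambda>v \<and> b \<in> \<Lambda>h}"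
  then show "Q \<in> TP.os ` sc_squares TP.XX" unfolding bos_def using TP.tuple_square btup_sq by blast
qed

definition fs where
  "fs s = (THE Q. \<exists>a\<in>\<Lambda>v. \<exists>b\<in>\<Lambda>h. s = esq a b \<and> Q = bos a b)"

lemma fs: "a \<in> \<Lambda>v \<Longrightarrow> b \<in> \<Lambda>h \<Longrightarrow> fs (esq a b) = bos a b"
  unfolding fs_def by (rule the_equality) (use bos_eq_iff(2) in blast)+

lemma square_count:
  assumes "Q \<in> sc_squares TP.QQ"
  shows "card {(a, b). a \<in> \<Lambda>v \<and> b \<in> \<Lambda>h \<and> fs (esq a b) = Q} = 4"
proof -
  obtain a b where ab: "a \<in> \<Lambda>v" "b \<in> \<Lambda>h" "Q = bos a b" using assms squares_bos by auto
  have "{(a', b'). a' \<in> \<Lambda>v \<and> b' \<in> \<Lambda>h \<and> fs (esq a' b') = Q} = quad a b"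
  proof -
    have "a' \<in> \<Lambda>v \<and> b' \<in> \<Lambda>h \<and> fs (esq a' b') = Q \<longleftrightarrow> (a', b') \<in> quad a b" for a' b'
      unfolding ab(3) using fs[of a' b'] bos_eq_iff(1)[OF ab(1,2), of a' b'] quad_bos(1,2)[OF ab(1,2), of a' b'] by metis
    then show ?thesis by auto
  qed
  then show ?thesis using card_quad[OF ab(1,2)] by simp
qed

lemma finite_QQ: "finite_complex TP.QQ"
proof -
  have "sc_edges TP.QQ = fe ` sc_edges label_complex" by (simp add: fe_image)
  moreover have "finite (sc_edges label_complex)" using finite_labels by (simp add: label_complex_def)
  moreover have "sc_squares TP.QQ = (\<lambda>(a, b). bos a b) ` (\<Lambda>v \<times> \<Lambda>h)" unfolding TP.QQ_simps squares_bos by auto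
  ultimately show ?thesis unfolding finite_complex_def using finite_labels one_vertex by simp
qed

theorem label_complex_iso: "complex_iso label_complex TP.QQ (\<lambda>_. TP.ve (x0, y0)) fe fs"
  unfolding complex_iso_def
proof (intro conjI ballI)
  show "bij_betw (\<lambda>_. TP.ve (x0, y0)) (sc_verts label_complex) (sc_verts TP.QQ)"
    using one_vertex by (simp add: label_complex_def bij_betw_def)
  show "bij_betw fe (sc_edges label_complex) (sc_edges TP.QQ)"
    using fe_inj fe_image by (simp add: bij_betw_def)
  show "bij_betw fs (sc_squares label_complex) (sc_squares TP.QQ)"
    unfolding bij_betw_def
  proof
    show "inj_on fs (sc_squares label_complex)"
      unfolding label_complex_def using fs bos_eq_iff(2) by (auto simp: inj_on_def)
    show "fs ` sc_squares label_complex = sc_squares TP.QQ"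
      unfolding TP.QQ_simps squares_bos label_complex_def using fs by (auto simp: image_iff) metis+
  qed
next
  fix e assume e: "e \<in> sc_edges label_complex"
  show "sc_rev TP.QQ (fe e) = fe (sc_rev label_complex e)"
    using fe_rev[OF e] by (simp add: label_complex_def)
  have ve: "TP.ve z = TP.ve (x0, y0)" if "z \<in> V \<times> V" for z using one_vertex that by blast
  obtain d where d: "d \<in> sc_edges TP.XX" "fe e = TP.oe d" using e fe_image by blast
  show "sc_src TP.QQ (fe e) = TP.ve (x0, y0)" "sc_tgt TP.QQ (fe e) = TP.ve (x0, y0)"
    unfolding TP.QQ_simps d(2) TP.oe_rev TP.oe_src
    using ve TP.src_vert[OF d(1)] TP.src_vert[OF TP.rev_edge[OF d(1)]] by simp_all
next
  fix s assume "s \<in> sc_squares label_complex"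
  then obtain a b where ab: "a \<in> \<Lambda>v" "b \<in> \<Lambda>h" "s = esq a b" by (auto simp: label_complex_def)
  then show "sc_bd TP.QQ (fs s) = map4 fe ` sc_bd label_complex s"
    using fs bd_bos by (simp add: label_complex_def)
qed

end

section \<open>The places \<open>\<tau>\<close> and \<open>\<infinity>\<close>\<close>

context bt_representation
begin

text \<open>At \<open>\<infinity>\<close> the image of \<open>F\<close> has a pole; the factor \<open>u\<close> rescales it so that it preserves the
  standard lattice.\<close>

lemma bt_placeI:
  assumes \<iota>_const: "\<And>a. \<iota> (rf_const a) = fls_const a" and \<iota>_mult: "\<And>y z. \<iota> (y * z) = \<iota> y * \<iota> z"
    and t: "\<iota> rf_t = \<kappa> * s" and \<kappa>u: "\<kappa> * u = 1" and f_eq: "u * u * \<iota> (rf_t * (rf_t - 1)) = f"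
    and s: "intg s" "fls_nth s 0 \<noteq> 0" and f: "intg f" "fls_nth f 0 \<noteq> 0"
    and crit: "s\<^sup>2 * fls_const (c\<^sup>2) + fls_const c * f * fls_const n0 = fls_X * \<nu>"
    and \<nu>: "intg \<nu>" "fls_nth \<nu> 0 \<noteq> 0" and n0: "n0 \<noteq> 0"
    and \<Sigma>: "\<Sigma> \<subseteq> carrier (PD c)" "gen c ` norm_set c n0 \<subseteq> \<Sigma>"
  shows "bt_place p k c \<iota> \<rho> n0 (\<rho> qZ) (mat u ** \<rho> qF) s f \<nu> \<kappa> \<Sigma>"
proof -
  have scale: "(mat z ** M) $ i $ j = z * M $ i $ j" for z and M :: "'a fls^2^2" and i j
    using exhaust_2[of i] exhaust_2[of j] by (auto simp: matrix_matrix_mult_def mat_def sum_2)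
  have neg1: "\<iota> (- 1) = - 1"
  proof -
    have "\<iota> (rf_const (- 1)) = fls_const (- 1)" by (rule \<iota>_const)
    then show ?thesis by (simp add: rf_const_simps fls_const_uminus)
  qed
  have ZZ: "\<rho> qZ ** \<rho> qZ = mat (fls_const c)"
  proof -
    have "\<rho> qZ ** \<rho> qZ = \<rho> (qscalar (rf_const c))" unfolding \<rho>_mult[symmetric] by (simp add: D_mult)
    then show ?thesis by (simp add: \<rho>_scalar \<iota>_const)
  qed
  have FF: "\<rho> qF ** \<rho> qF = mat (\<iota> (rf_t * (rf_t - 1)))"
  proof -
    have "\<rho> qF ** \<rho> qF = \<rho> (qscalar (rf_t * (rf_t - 1)))" unfolding \<rho>_mult[symmetric] by (simp add: D_mult)
    then show ?thesis by (simp add: \<rho>_scalar)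
  qed
  have ZF: "\<rho> qZ ** \<rho> qF = \<rho> (Quat 0 0 0 1)" unfolding \<rho>_mult[symmetric] by (simp add: D_mult)
  have "\<rho> qF ** \<rho> qZ = \<rho> (qscalar (- 1) \<otimes>\<^bsub>D_alg c\<^esub> Quat 0 0 0 1)" unfolding \<rho>_mult[symmetric] by (simp add: D_mult)
  also have "\<dots> = mat (- 1) ** (\<rho> qZ ** \<rho> qF)" unfolding \<rho>_mult \<rho>_scalar neg1 ZF ..
  finally have FZ: "\<rho> qF ** \<rho> qZ = - (\<rho> qZ ** \<rho> qF)" by (simp add: vec_eq_iff scale)
  have com: "M ** (mat z ** N) = mat z ** (M ** N)" for z and M N :: "'a fls^2^2"
  proof -
    have "(M ** (mat z ** N)) $ i $ j = z * (M ** N) $ i $ j" for i j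
      by (simp add: matrix_matrix_mult_def[of M] scale sum_2) (simp add: algebra_simps)
    then show ?thesis by (simp add: vec_eq_iff scale)
  qed
  have mm: "mat z ** (mat z' ** N) = mat (z * z') ** N" for z z' and N :: "'a fls^2^2"
    by (simp add: vec_eq_iff scale)
  interpret LP: local_place c n0 "\<rho> qZ" "mat u ** \<rho> qF" s f \<nu>
  proof
    show "(2::'a) \<noteq> 0" by (rule Q.two)
    show "c \<noteq> 0" "\<not> (\<exists>x. c = x\<^sup>2)" by (rule Q.c0 Q.c_nonsquare)+
    have "(mat u ** \<rho> qF) ** (mat u ** \<rho> qF) = mat (u * u) ** (\<rho> qF ** \<rho> qF)"
      unfolding com[of "mat u ** \<rho> qF"] mm[symmetric] by (simp add: matrix_mul_assoc)
    also have "\<dots> = mat f" unfolding FF f_eq[symmetric] by (simp add: vec_eq_iff scale) (simp add: mat_def)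
    finally show "(mat u ** \<rho> qF) ** (mat u ** \<rho> qF) = mat f" .
    have "(mat u ** \<rho> qF) ** \<rho> qZ = mat u ** (\<rho> qF ** \<rho> qZ)" by (simp add: matrix_mul_assoc)
    also have "\<dots> = - (\<rho> qZ ** (mat u ** \<rho> qF))" unfolding FZ com[of "\<rho> qZ"] by (simp add: vec_eq_iff scale)
    finally show "\<rho> qZ ** (mat u ** \<rho> qF) = - ((mat u ** \<rho> qF) ** \<rho> qZ)" by simp
  qed (use ZZ s f crit \<nu> in auto)
  have el: "\<rho> (Q.el x y) = mat \<kappa> ** LP.op x y" for x y
  proof -
    have "Q.el x y = (qscalar (rf_const c * rf_t) \<oplus>\<^bsub>D_alg c\<^esub> (qscalar (rf_const (- (c * y))) \<otimes>\<^bsub>D_alg c\<^esub> qF))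
        \<oplus>\<^bsub>D_alg c\<^esub> (qscalar (rf_const (- x)) \<otimes>\<^bsub>D_alg c\<^esub> (qZ \<otimes>\<^bsub>D_alg c\<^esub> qF))"
      by (simp add: Q.el_def D_mult rf_const_simps)
    then have "\<rho> (Q.el x y) = mat (fls_const c * (\<kappa> * s)) + mat (fls_const (- (c * y))) ** \<rho> qF
        + mat (fls_const (- x)) ** (\<rho> qZ ** \<rho> qF)"
      by (simp only: \<rho>_add \<rho>_mult \<rho>_scalar \<iota>_mult \<iota>_const t)
    also have "\<dots> = mat \<kappa> ** LP.op x y"
    proof -
      \<comment> \<open>Since \<open>\<kappa> u = 1\<close>, the outer factor undoes the scaling of
        \<open>F\<close>.\<close>
      have e: "\<kappa> * (z * (u * w)) = z * w" for z w using \<kappa>u by (metis mult.assoc mult.commute mult_1)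
      show ?thesis unfolding LP.op_def com[of "\<rho> qZ"]
        by (simp add: vec_eq_iff scale right_diff_distrib distrib_left e fls_const_uminus) (simp add: mat_def mult_ac)
    qed
    finally show ?thesis .
  qed
  show ?thesis
  proof
    show "\<kappa> \<noteq> 0" using \<kappa>u by auto
  qed (use el n0 \<Sigma> in auto)
qed

end

lemma eval_at_nonzero:
  assumes "transcendental s" "z \<noteq> 0" shows "eval_at s z \<noteq> 0"
proof
  assume "eval_at s z = 0"
  then have "eval_at s (z * inverse z) = 0" using eval_at_hom(2)[OF assms(1)] by simp
  then show False using assms(2) eval_at_hom(5)[OF assms(1)] by simp
qed

lemma eval_at_t_t1:
  assumes "transcendental (s :: 'a::field fls)" shows "eval_at s (rf_t * (rf_t - 1)) = s * (s - 1)"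
proof -
  have "eval_at s (rf_t - 1) + eval_at s 1 = eval_at s rf_t"
    using eval_at_hom(1)[OF assms, of "rf_t - 1" 1] by simp
  then have "eval_at s (rf_t - 1) = s - 1" using eval_at_hom(4,5)[OF assms] by (simp add: eq_diff_eq)
  then show ?thesis using eval_at_hom(2,4)[OF assms] by simp
qed

lemma act_edge_pair_act: "act_edge \<rho> \<rho>' g e = pair_act (bt_act \<rho> g) (bt_act \<rho>' g) e"
  by (cases e rule: pedge_rev.cases) simp_all

lemma bt_product_tree_product: "bt_product = tree_product bt_verts bt_edges"
  by (simp add: bt_product_def tree_product_def)

lemma sedge_rev_label_rev: "sedge_rev c = label_rev (\<lambda>l. \<ominus>\<^bsub>D_alg c\<^esub> l)"
proof
  show "sedge_rev c e = label_rev (\<lambda>l. \<ominus>\<^bsub>D_alg c\<^esub> l) e" for e by (cases e) simp_all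
qed

text \<open>The condition \<open>crit\<close> at the place \<open>\<tau>\<close>, with
  \<open>T\<close> for \<open>\<tau>\<close>, \<open>N\<close> for the label norm and
  \<open>M\<close> for \<open>c^2 / (1 - \<tau>)\<close>. Multiplication by \<open>1 - T\<close>
  clears the denominators.\<close>

lemma crit_tau:
  fixes C N M T X :: "'b::idom"
  assumes "1 - T \<noteq> 0" "N * (1 - T) = C * T" "M * (1 - T) = C * C"
  shows "(T + X)\<^sup>2 * (C * C) + C * ((T + X) * (T + X - 1)) * N = X * ((T + X) * M)"
proof -
  have "((T + X)\<^sup>2 * (C * C) + C * ((T + X) * (T + X - 1)) * N) * (1 - T)
      = (T + X)\<^sup>2 * (C * C) * (1 - T) + C * ((T + X) * (T + X - 1)) * (N * (1 - T))"
    by (simp add: algebra_simps)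
  also have "\<dots> = X * ((T + X) * (C * C))"
    unfolding assms(2) by (simp add: power2_eq_square algebra_simps)
  also have "\<dots> = X * ((T + X) * M) * (1 - T)" unfolding assms(3)[symmetric] by (simp add: mult_ac)
  finally show ?thesis using assms(1) by simp
qed

context quaternion
begin

lemma bt_place_tau:
  assumes \<tau>: "\<tau> \<noteq> 0" "\<tau> \<noteq> 1" and spl: "splitting (emb_tau \<tau>) (D_alg c) \<rho>"
    and \<Sigma>: "\<Sigma> \<subseteq> carrier (PD c)" "gen c ` norm_set c (c * \<tau> / (1 - \<tau>)) \<subseteq> \<Sigma>"
  shows "\<exists>B s f \<nu> \<kappa>. bt_place p k c (emb_tau \<tau>) \<rho> (c * \<tau> / (1 - \<tau>)) (\<rho> qZ) B s f \<nu> \<kappa> \<Sigma>"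
proof -
  let ?s = "fls_const \<tau> + fls_X"
  note tr = transcendental_tau[of \<tau>]
  note h = eval_at_hom[OF tr]
  interpret R: bt_representation p k c "emb_tau \<tau>" \<rho>
    by unfold_locales (use spl h(5) eval_at_nonzero[OF tr] in \<open>simp_all add: emb_tau_def\<close>)
  have m1: "fls_const (c * \<tau> / (1 - \<tau>)) * (1 - fls_const \<tau>) = fls_const c * fls_const \<tau>"
    and m2: "fls_const (c\<^sup>2 / (1 - \<tau>)) * (1 - fls_const \<tau>) = fls_const c * fls_const c"
  proof -
    have "1 - fls_const \<tau> = fls_const (1 - \<tau>)" by (simp flip: fls_minus_const)
    then show "fls_const (c * \<tau> / (1 - \<tau>)) * (1 - fls_const \<tau>) = fls_const c * fls_const \<tau>"
      "fls_const (c\<^sup>2 / (1 - \<tau>)) * (1 - fls_const \<tau>) = fls_const c * fls_const c"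
      using \<tau> by (simp_all add: power2_eq_square)
  qed
  have "1 - fls_const \<tau> \<noteq> 0" using \<tau>(2) by (metis fls_const_eq_1_iff right_minus_eq)
  moreover have "fls_const (c\<^sup>2) = fls_const c * fls_const c" by (simp add: power2_eq_square)
  ultimately have crit: "?s\<^sup>2 * fls_const (c\<^sup>2) + fls_const c * (?s * (?s - 1)) * fls_const (c * \<tau> / (1 - \<tau>))
      = fls_X * (?s * fls_const (c\<^sup>2 / (1 - \<tau>)))"
    using crit_tau[OF _ m1 m2, of fls_X] by simp
  have i: "intg ?s" "intg (?s - 1)" by simp_all
  \<comment> \<open>At \<open>\<tau>\<close> nothing has to be rescaled: \<open>t\<close> and
    \<open>t (t - 1)\<close> are units because \<open>\<tau>\<close> is neither 0 nor 1.\<close>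
  have "bt_place p k c (emb_tau \<tau>) \<rho> (c * \<tau> / (1 - \<tau>)) (\<rho> qZ) (mat 1 ** \<rho> qF) ?s (?s * (?s - 1))
      (?s * fls_const (c\<^sup>2 / (1 - \<tau>))) 1 \<Sigma>"
  proof (rule R.bt_placeI[OF _ _ _ _ _ _ _ _ _ crit])
    show "fls_nth ?s 0 \<noteq> 0" using \<tau> by simp
    show "fls_nth (?s * (?s - 1)) 0 \<noteq> 0" unfolding r0_mult[OF i] using \<tau> by simp
    show "fls_nth (?s * fls_const (c\<^sup>2 / (1 - \<tau>))) 0 \<noteq> 0" using r0_mult[OF i(1) intg_const(1)] \<tau> c0 by simp
    show "c * \<tau> / (1 - \<tau>) \<noteq> 0" using \<tau> c0 by simp
  qed (use h eval_at_t_t1[OF tr] \<Sigma> in \<open>simp_all add: emb_tau_def\<close>)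
  then show ?thesis by blast
qed

lemma bt_place_inf:
  assumes spl: "splitting emb_inf (D_alg c) \<rho>"
    and \<Sigma>: "\<Sigma> \<subseteq> carrier (PD c)" "gen c ` norm_set c (- c) \<subseteq> \<Sigma>"
  shows "\<exists>B s f \<nu> \<kappa>. bt_place p k c emb_inf \<rho> (- c) (\<rho> qZ) B s f \<nu> \<kappa> \<Sigma>"
proof -
  note tr = transcendental_inf[where ?'a = 'a]
  note h = eval_at_hom[OF tr]
  interpret R: bt_representation p k c emb_inf \<rho>
    by unfold_locales (use spl h(5) eval_at_nonzero[OF tr] in \<open>simp_all add: emb_inf_def\<close>)
  have X: "fls_X_inv * fls_X = (1 :: 'a fls)" by (simp add: fls_X_inv_times_conv_shift)
  have crit: "1\<^sup>2 * fls_const (c\<^sup>2) + fls_const c * (1 - fls_X) * fls_const (- c) = fls_X * fls_const (c\<^sup>2)"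
    by (simp add: fls_const_uminus power2_eq_square algebra_simps)
  have "fls_X * fls_X * (fls_X_inv * (fls_X_inv - 1)) = (fls_X_inv * fls_X) * (fls_X_inv * fls_X) - (fls_X_inv * fls_X) * (fls_X :: 'a fls)"
    by (simp only: right_diff_distrib mult_1_right mult_ac)
  then have f: "fls_X * fls_X * (fls_X_inv * (fls_X_inv - 1)) = 1 - (fls_X :: 'a fls)" unfolding X by simp
  \<comment> \<open>At infinity \<open>t\<close> is the inverse of the uniformizer. Scaling
    \<open>F\<close> by the uniformizer turns its square into the unit \<open>1 - fls_X\<close>, and
    \<open>\<kappa>\<close> takes over the pole of \<open>t\<close>.\<close>
  have "bt_place p k c emb_inf \<rho> (- c) (\<rho> qZ) (mat fls_X ** \<rho> qF) 1 (1 - fls_X) (fls_const (c\<^sup>2)) fls_X_inv \<Sigma>"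
    by (rule R.bt_placeI[OF _ _ _ _ _ _ _ _ _ crit])
      (use h eval_at_t_t1[OF tr] \<Sigma> X f c0 in \<open>simp_all add: emb_inf_def\<close>)
  then show ?thesis by blast
qed

end

theorem corollary31:
  fixes p k :: nat and c \<tau> :: "'a::{field, finite}"
    and \<rho> \<rho>' :: "'a ratfun quat \<Rightarrow> 'a fls^2^2"
  assumes "prime p" and "odd p" and "CARD('a) = p ^ k"
    and "c \<noteq> 0" and "\<not> (\<exists>x. c = x\<^sup>2)"
    and "\<tau> \<noteq> 0" and "\<tau> \<noteq> 1"
    and "splitting (emb_tau \<tau>) (D_alg c) \<rho>"
    and "splitting emb_inf (D_alg c) \<rho>'"
  defines "G \<equiv> carrier (Gamma_tau c \<tau>)"
    and "S \<equiv> S_Gamma c \<tau> \<rho> \<rho>'"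
  shows "acts_without_inversion G (act_edge \<rho> \<rho>') bt_product
    \<and> square_complex S \<and> finite_complex S
    \<and> classifying_space (Gamma_tau c \<tau>) (realization S)
    \<and> (\<exists>v fv fe fs.
         v \<in> sc_verts bt_product
       \<and> complex_iso (explicit_complex c \<tau>) S fv fe fs
       \<and> (\<forall>\<xi>\<in>V_labels c. \<exists>e\<in>sc_edges bt_product.
            is_Ver e \<and> sc_src bt_product e = v
            \<and> sc_tgt bt_product e = act_vert \<rho> \<rho>' (gen c \<xi>) v
            \<and> fe (Aedge \<xi>) = orbit (act_edge \<rho> \<rho>') G e)
       \<and> (\<forall>\<eta>\<in>H_labels c \<tau>. \<exists>e\<in>sc_edges bt_product.
            is_Hor e \<and> sc_src bt_product e = v
            \<and> sc_tgt bt_product e = act_vert \<rho> \<rho>' (gen c \<eta>) v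
            \<and> fe (Bedge \<eta>) = orbit (act_edge \<rho> \<rho>') G e)
       \<and> (\<forall>s\<in>sc_squares S.
            card {(\<xi>, \<eta>). \<xi> \<in> V_labels c \<and> \<eta> \<in> H_labels c \<tau>
                   \<and> fs (explicit_square c \<xi> \<eta>) = s} = 4))"
proof -
  interpret Q: quaternion p k c by unfold_locales (use assms in auto)
  define nh where "nh = c * \<tau> / (1 - \<tau>)"
  define \<Sigma> where "\<Sigma> = gen c ` (V_labels c \<union> H_labels c \<tau>)"
  have lab: "V_labels c = norm_set c (- c)" "H_labels c \<tau> = norm_set c nh"
    by (simp_all add: V_labels_def H_labels_def nh_def)
  have n: "nh \<noteq> 0" "- c \<noteq> 0" "nh \<noteq> - c"
  proof -
    show "nh \<noteq> 0" "- c \<noteq> 0" using assms by (simp_all add: nh_def)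
    show "nh \<noteq> - c"
    proof
      assume "nh = - c"
      then have "c * \<tau> = - c * (1 - \<tau>)" using assms(7) by (simp add: nh_def divide_eq_eq)
      then show False using assms(4) by (simp add: algebra_simps)
    qed
  qed
  have \<Sigma>: "\<Sigma> \<subseteq> carrier (PD c)" "gen c ` norm_set c (- c) \<subseteq> \<Sigma>" "gen c ` norm_set c nh \<subseteq> \<Sigma>"
    unfolding \<Sigma>_def lab using Q.gen_closed n by auto
  have \<Gamma>: "Gamma_tau c \<tau> = subgroup_generated (PD c) \<Sigma>" by (simp add: Gamma_tau_def \<Sigma>_def)
  obtain B s f \<nu> \<kappa> where "bt_place p k c (emb_tau \<tau>) \<rho> nh (\<rho> qZ) B s f \<nu> \<kappa> \<Sigma>"
    using Q.bt_place_tau[OF assms(6-8) \<Sigma>(1)] \<Sigma>(3) unfolding nh_def by blast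
  then interpret PH: bt_place p k c "emb_tau \<tau>" \<rho> nh "\<rho> qZ" B s f \<nu> \<kappa> \<Sigma> .
  obtain B' s' f' \<nu>' \<kappa>' where "bt_place p k c emb_inf \<rho>' (- c) (\<rho>' qZ) B' s' f' \<nu>' \<kappa>' \<Sigma>"
    using Q.bt_place_inf[OF assms(9) \<Sigma>(1,2)] by blast
  then interpret PV: bt_place p k c emb_inf \<rho>' "- c" "\<rho>' qZ" B' s' f' \<nu>' \<kappa>' \<Sigma> .
  interpret L: lattice_pair "subgroup_generated (PD c) \<Sigma>" "bt_act \<rho>" "bt_act \<rho>'" bt_verts bt_edges
    "norm_set c nh" "norm_set c (- c)" "gen c" "\<lambda>l. \<ominus>\<^bsub>D_alg c\<^esub> l" PH.C0 PV.C0 "sigma c"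
  proof
    fix a b assume ab: "a \<in> norm_set c (- c)" "b \<in> norm_set c nh"
    show "sigma c a b \<in> norm_set c nh" "sigma c b a \<in> norm_set c (- c)" using Q.sigma_norm ab n by metis+
    show "gen c a \<otimes>\<^bsub>subgroup_generated (PD c) \<Sigma>\<^esub> gen c (sigma c a b) =
        gen c b \<otimes>\<^bsub>subgroup_generated (PD c) \<Sigma>\<^esub> gen c (sigma c b a)"
      using Q.gen_relation[OF ab] n by simp
    show "\<not> (sigma c a b = \<ominus>\<^bsub>D_alg c\<^esub> b \<and> sigma c b a = \<ominus>\<^bsub>D_alg c\<^esub> a)" using Q.sigma_not_neg[OF ab] n by simp
  next
    show "bt_act \<rho>' (gen c b) PV.C0 = PV.C0" if "b \<in> norm_set c nh" for b using PV.gen_fix[OF that] n by simp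
    show "bt_act \<rho> (gen c a) PH.C0 = PH.C0" if "a \<in> norm_set c (- c)" for a using PH.gen_fix[OF that] n by simp
    show "carrier (subgroup_generated (PD c) \<Sigma>) \<subseteq>
        generate (subgroup_generated (PD c) \<Sigma>) (gen c ` (norm_set c (- c) \<union> norm_set c nh))"
    proof -
      \<comment> \<open>The generators lie in the subgroup that they generate, so generating once
        more inside it reaches all of it.\<close>
      have "carrier (subgroup_generated (PD c) \<Sigma>) = carrier (subgroup_generated (subgroup_generated (PD c) \<Sigma>) \<Sigma>)"
        by (simp only: Q.P.subgroup_generated2)
      also have "\<dots> \<subseteq> generate (subgroup_generated (PD c) \<Sigma>) \<Sigma>"
        unfolding carrier_subgroup_generated[of "subgroup_generated (PD c) \<Sigma>"] by (rule group.mono_generate[OF Q.P.group_subgroup_generated]) simp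
      finally show ?thesis unfolding \<Sigma>_def lab .
    qed
    show "finite (norm_set c nh)" "finite (norm_set c (- c))" by (rule Q.finite_norm_set)+
  qed
  have act: "act_edge \<rho> \<rho>' = (\<lambda>g. pair_act (bt_act \<rho> g) (bt_act \<rho>' g))"
    "act_vert \<rho> \<rho>' = (\<lambda>g. map_prod (bt_act \<rho> g) (bt_act \<rho>' g))"
    by (intro ext act_edge_pair_act) (intro ext, simp add: act_vert_def)
  have S: "S = L.TP.QQ"
    unfolding S_def S_Gamma_def L.TP.QQ_def act bt_product_tree_product \<Gamma> ..
  have sq: "explicit_square c \<xi> \<eta> = L.esq \<xi> \<eta>" for \<xi> \<eta>
    by (simp only: explicit_square_def L.esq_def L.etup_def sedge_rev_label_rev)
  have X: "explicit_complex c \<tau> = L.label_complex"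
    by (simp only: explicit_complex_def L.label_complex_def sq lab sedge_rev_label_rev)
  have Gc: "G = carrier (subgroup_generated (PD c) \<Sigma>)" unfolding G_def \<Gamma> ..
  let ?v = "(PH.C0, PV.C0)"
  have A: "\<exists>e\<in>sc_edges bt_product. is_Ver e \<and> sc_src bt_product e = ?v
      \<and> sc_tgt bt_product e = act_vert \<rho> \<rho>' (gen c \<xi>) ?v \<and> L.fe (Aedge \<xi>) = orbit (act_edge \<rho> \<rho>') G e"
    if "\<xi> \<in> V_labels c" for \<xi>
    unfolding bt_product_tree_product act Gc
    by (rule bexI[OF _ L.ae_edge[of \<xi>]]) (use that in \<open>simp_all add: lab L.fix_v L.ya_def\<close>)
  have B: "\<exists>e\<in>sc_edges bt_product. is_Hor e \<and> sc_src bt_product e = ?v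
      \<and> sc_tgt bt_product e = act_vert \<rho> \<rho>' (gen c \<eta>) ?v \<and> L.fe (Bedge \<eta>) = orbit (act_edge \<rho> \<rho>') G e"
    if "\<eta> \<in> H_labels c \<tau>" for \<eta>
    unfolding bt_product_tree_product act Gc
    by (rule bexI[OF _ L.be_edge[of \<eta>]]) (use that in \<open>simp_all add: lab L.fix_h L.xb_def\<close>)
  show ?thesis
  proof (intro conjI exI[of _ ?v] exI[of _ L.fe] exI[of _ L.fs] exI[of _ "\<lambda>_. L.TP.ve ?v"] ballI)
    show "acts_without_inversion G (act_edge \<rho> \<rho>') bt_product"
      unfolding act bt_product_tree_product Gc by (rule L.no_inversion)
    show "square_complex S" unfolding S by (rule L.TP.square_complex_QQ)
    show "finite_complex S" unfolding S by (rule L.finite_QQ)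
    show "classifying_space (Gamma_tau c \<tau>) (realization S)"
      unfolding S \<Gamma> by (rule L.TP.classifying_space_realization[OF L.finite_QQ])
    show "?v \<in> sc_verts bt_product" using PH.C0 PV.C0 by (simp add: bt_product_def)
    show "complex_iso (explicit_complex c \<tau>) S (\<lambda>_. L.TP.ve ?v) L.fe L.fs"
      unfolding X S by (rule L.label_complex_iso)
  next
    fix s assume "s \<in> sc_squares S"
    then show "card {(\<xi>, \<eta>). \<xi> \<in> V_labels c \<and> \<eta> \<in> H_labels c \<tau> \<and> L.fs (explicit_square c \<xi> \<eta>) = s} = 4"
      unfolding S lab sq by (rule L.square_count)
  qed (erule A | erule B)+
qed

end
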